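(* Let $R=k[x_1,\ldots,x_e]/I$ be a graded ring with $\deg x_i=d_i\geq 1$, where $k$ is a field and $I$ is a homogeneous ideal. Suppose $R$ is a complete intersection with $\operatorname{reg}k=\infty$. Then for any $n\geq0$, each nonzero direct summand of the graded $R$-module $\Omega^nk$ has infinite regularity.
   Context: $k$ is a field, $k[x_1,\ldots,x_e]$ is the polynomial ring graded by $\deg x_i=d_i\geq1$, $I$ is a (proper) homogeneous ideal, $R=k[x_1,\ldots,x_e]/I$, $\mathfrak{m}$ is the maximal homogeneous ideal of $R$, and $k=R/\mathfrak{m}$ as a graded $R$-module. $\Omega^nk$ denotes the $n$-th syzygy of $k$ in a minimal graded free resolution over $R$ (with $\Omega^0k=k$). Direct summands are taken as graded $R$-modules. For a finitely generated graded $R$-module $M$, $\beta_{i,j}(M)=\operatorname{rank}_k\operatorname{Ext}_R^{i,j}(M,k)$, where $i$ is the homological degree and $j$ the internal degree, normalized so that $\beta_{i,j}(M)$ is the number of basis elements of internal degree $j$ in the $i$-th module of a minimal graded free resolution of $M$ over $R$. The Castelnuovo-Mumford regularity of $M$ is $\operatorname{reg}M=\sup\{j-i\mid\beta_{i,j}(M)\neq0\}$. *)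

theory Defs
  imports
    "HOL-Algebra.Algebra"
    "HOL-Library.Poly_Mapping"
    "HOL-Library.Function_Algebras"
    "HOL-Library.Extended_Real"
begin

section \<open>Weighted polynomial rings and their graded quotients\<close>

text \<open>
  A polynomial is a finitely supported map from monomials (exponent vectors) to coefficients.
  The carrier consists of the polynomials in the variables with index below \<open>e\<close>.
\<close>

type_synonym 'k mpoly = "(nat \<Rightarrow>\<^sub>0 nat) \<Rightarrow>\<^sub>0 'k"

definition mpoly_ring :: "nat \<Rightarrow> 'k::field mpoly ring" where
  "mpoly_ring e =
    \<lparr>carrier = {p. \<forall>m\<in>Poly_Mapping.keys p. Poly_Mapping.keys m \<subseteq> {..<e}},
     monoid.mult = (*), monoid.one = 1, ring.zero = 0, ring.add = (+)\<rparr>"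

definition monom_deg :: "(nat \<Rightarrow> nat) \<Rightarrow> (nat \<Rightarrow>\<^sub>0 nat) \<Rightarrow> int" where
  "monom_deg w m = (\<Sum>i\<in>Poly_Mapping.keys m. int (w i) * int (Poly_Mapping.lookup m i))"

definition homogeneous :: "(nat \<Rightarrow> nat) \<Rightarrow> int \<Rightarrow> 'k::field mpoly \<Rightarrow> bool" where
  "homogeneous w j p \<longleftrightarrow> (\<forall>m\<in>Poly_Mapping.keys p. monom_deg w m = j)"

definition homogeneous_ideal :: "nat \<Rightarrow> (nat \<Rightarrow> nat) \<Rightarrow> 'k::field mpoly set \<Rightarrow> bool" where
  "homogeneous_ideal e w I \<longleftrightarrow>
    ideal I (mpoly_ring e) \<and> I = Idl\<^bsub>mpoly_ring e\<^esub> {p \<in> I. \<exists>j. homogeneous w j p}"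

record 'a graded_ring = "'a ring" +
  rpart :: "int \<Rightarrow> 'a set"

definition graded_quotient ::
  "nat \<Rightarrow> (nat \<Rightarrow> nat) \<Rightarrow> 'k::field mpoly set \<Rightarrow> 'k mpoly set graded_ring" where
  "graded_quotient e w I =
    (let P = mpoly_ring e; Q = P Quot I in
     \<lparr>carrier = carrier Q, monoid.mult = monoid.mult Q, monoid.one = monoid.one Q,
      ring.zero = ring.zero Q, ring.add = ring.add Q,
      rpart = (\<lambda>j. {I +>\<^bsub>P\<^esub> p | p. p \<in> carrier P \<and> homogeneous w j p})\<rparr>)"

definition irrelevant_ideal :: "('a, 'x) graded_ring_scheme \<Rightarrow> 'a set" where
  "irrelevant_ideal R = Idl\<^bsub>R\<^esub> (\<Union>j\<in>{0<..}. rpart R j)"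

definition regular_sequence :: "('a, 'x) ring_scheme \<Rightarrow> 'a list \<Rightarrow> bool" where
  "regular_sequence P fs \<longleftrightarrow>
    set fs \<subseteq> carrier P \<and>
    (\<forall>i<length fs. \<forall>g\<in>carrier P.
       fs ! i \<otimes>\<^bsub>P\<^esub> g \<in> Idl\<^bsub>P\<^esub> (set (take i fs)) \<longrightarrow> g \<in> Idl\<^bsub>P\<^esub> (set (take i fs))) \<and>
    Idl\<^bsub>P\<^esub> (set fs) \<noteq> carrier P"

definition complete_intersection :: "nat \<Rightarrow> (nat \<Rightarrow> nat) \<Rightarrow> 'k::field mpoly set \<Rightarrow> bool" where
  "complete_intersection e w I \<longleftrightarrow>
    (\<exists>fs. (\<forall>f\<in>set fs. \<exists>j. homogeneous w j f) \<and> regular_sequence (mpoly_ring e) fs \<and>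
          I = Idl\<^bsub>mpoly_ring e\<^esub> (set fs))"


section \<open>Graded modules\<close>

record ('a, 'b) gmodule = "('a, 'b) module" +
  mpart :: "int \<Rightarrow> 'b set"

locale graded_module = Module.module R M
  for R :: "('a, 'x) graded_ring_scheme" (structure)
    and M :: "('a, 'b, 'y) gmodule_scheme" (structure) +
  assumes mpart_subgroup: "subgroup (mpart M j) (add_monoid M)"
    and smult_mpart: "\<lbrakk>r \<in> rpart R i; x \<in> mpart M j\<rbrakk> \<Longrightarrow> r \<odot>\<^bsub>M\<^esub> x \<in> mpart M (i + j)"
    and direct_sum: "x \<in> carrier M \<Longrightarrow>
      \<exists>!f. (\<forall>j. f j \<in> mpart M j) \<and> finite {j. f j \<noteq> \<zero>\<^bsub>M\<^esub>} \<and>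
           x = (\<Oplus>\<^bsub>M\<^esub>j\<in>{j. f j \<noteq> \<zero>\<^bsub>M\<^esub>}. f j)"

text \<open>Homomorphisms of internal degree 0; values outside the carrier are unconstrained.\<close>

definition graded_hom ::
  "('a, 'x) graded_ring_scheme \<Rightarrow> ('a, 'b, 'y) gmodule_scheme \<Rightarrow> ('a, 'c, 'z) gmodule_scheme
    \<Rightarrow> ('b \<Rightarrow> 'c) set" where
  "graded_hom R M N =
    {f \<in> carrier M \<rightarrow> carrier N.
      (\<forall>x\<in>carrier M. \<forall>y\<in>carrier M. f (x \<oplus>\<^bsub>M\<^esub> y) = f x \<oplus>\<^bsub>N\<^esub> f y) \<and>
      (\<forall>r\<in>carrier R. \<forall>x\<in>carrier M. f (r \<odot>\<^bsub>M\<^esub> x) = r \<odot>\<^bsub>N\<^esub> f x) \<and>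
      (\<forall>j. \<forall>x\<in>mpart M j. f x \<in> mpart N j)}"

definition graded_iso ::
  "('a, 'x) graded_ring_scheme \<Rightarrow> ('a, 'b, 'y) gmodule_scheme \<Rightarrow> ('a, 'c, 'z) gmodule_scheme
    \<Rightarrow> bool" where
  "graded_iso R M N \<longleftrightarrow>
    (\<exists>f\<in>graded_hom R M N. bij_betw f (carrier M) (carrier N) \<and> (\<forall>j. f ` mpart M j = mpart N j))"

definition restrict_gmodule ::
  "('a, 'b, 'y) gmodule_scheme \<Rightarrow> 'b set \<Rightarrow> ('a, 'b, 'y) gmodule_scheme" where
  "restrict_gmodule M N = M\<lparr>carrier := N, mpart := (\<lambda>j. mpart M j \<inter> N)\<rparr>"

definition graded_submodule ::
  "('a, 'x) graded_ring_scheme \<Rightarrow> ('a, 'b, 'y) gmodule_scheme \<Rightarrow> 'b set \<Rightarrow> bool" where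
  "graded_submodule R M N \<longleftrightarrow> submodule N R M \<and> graded_module R (restrict_gmodule M N)"

definition graded_direct_summand ::
  "('a, 'x) graded_ring_scheme \<Rightarrow> ('a, 'b, 'y) gmodule_scheme \<Rightarrow> 'b set \<Rightarrow> bool" where
  "graded_direct_summand R M N \<longleftrightarrow>
    graded_submodule R M N \<and>
    (\<exists>N'. graded_submodule R M N' \<and> N \<inter> N' = {\<zero>\<^bsub>M\<^esub>} \<and> N <+>\<^bsub>M\<^esub> N' = carrier M)"

text \<open>The twist \<open>M(s)\<close> with \<open>M(s)\<^sub>j = M\<^bsub>s+j\<^esub>\<close>.\<close>

definition gshift :: "('a, 'b, 'y) gmodule_scheme \<Rightarrow> int \<Rightarrow> ('a, 'b, 'y) gmodule_scheme" where
  "gshift M s = M\<lparr>mpart := (\<lambda>j. mpart M (s + j))\<rparr>"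

text \<open>
  The residue field \<open>k = R/\<mm>\<close> of a quotient \<open>R\<close> by a proper homogeneous ideal, as a graded module
  concentrated in degree 0. Since such an ideal contains only polynomials without constant term,
  all representatives of a residue class \<open>r\<close> have the same constant term, and this is the
  image of \<open>r\<close> under \<open>R \<rightarrow> R/\<mm> = k\<close>.
\<close>

definition augmentation :: "'k::field mpoly set \<Rightarrow> 'k" where
  "augmentation r = (THE c. \<exists>p\<in>r. Poly_Mapping.lookup p 0 = c)"

definition residue_module :: "('k::field mpoly set, 'k) gmodule" where
  "residue_module =
    \<lparr>carrier = UNIV, monoid.mult = (*), monoid.one = 1, ring.zero = 0, ring.add = (+),
     smult = (\<lambda>r c. augmentation r * c),
     mpart = (\<lambda>j. if j = 0 then UNIV else {0})\<rparr>"


section \<open>Minimal graded free resolutions and syzygies\<close>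

text \<open>
  The graded free module \<open>R(-a\<^sub>0) \<oplus> \<dots> \<oplus> R(-a\<^bsub>r-1\<^esub>)\<close> for a list of degrees \<open>a\<close>:
  the \<open>l\<close>-th basis element has internal degree \<open>a ! l\<close>. Multiplication and unit of the record
  are irrelevant for modules.
\<close>

definition free_gmodule ::
  "('a, 'x) graded_ring_scheme \<Rightarrow> int list \<Rightarrow> ('a, nat \<Rightarrow> 'a) gmodule" where
  "free_gmodule R a =
    (let C = {v. (\<forall>l<length a. v l \<in> carrier R) \<and> (\<forall>l\<ge>length a. v l = \<zero>\<^bsub>R\<^esub>)} in
     \<lparr>carrier = C, monoid.mult = undefined, monoid.one = undefined,
      ring.zero = (\<lambda>l. \<zero>\<^bsub>R\<^esub>), ring.add = (\<lambda>u v l. u l \<oplus>\<^bsub>R\<^esub> v l),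
      smult = (\<lambda>r v l. r \<otimes>\<^bsub>R\<^esub> v l),
      mpart = (\<lambda>j. {v \<in> C. \<forall>l<length a. v l \<in> rpart R (j - a ! l)})\<rparr>)"

text \<open>
  A complex of finitely generated graded free modules \<open>F\<^sub>i\<close> with basis degrees \<open>a i\<close>,
  differentials \<open>d i : F\<^bsub>i+1\<^esub> \<rightarrow> F\<^sub>i\<close> and augmentation \<open>\<epsilon> : F\<^sub>0 \<rightarrow> M\<close>.
  Finite ranks suffice: over a Noetherian ring every finitely generated module has such a
  resolution.
\<close>

definition graded_free_resolution ::
  "('a, 'x) graded_ring_scheme \<Rightarrow> ('a, 'b, 'y) gmodule_scheme \<Rightarrow> (nat \<Rightarrow> int list)
    \<Rightarrow> (nat \<Rightarrow> (nat \<Rightarrow> 'a) \<Rightarrow> (nat \<Rightarrow> 'a)) \<Rightarrow> ((nat \<Rightarrow> 'a) \<Rightarrow> 'b) \<Rightarrow> bool" where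
  "graded_free_resolution R M a d \<epsilon> \<longleftrightarrow>
    (let F = (\<lambda>i. free_gmodule R (a i)) in
     \<epsilon> \<in> graded_hom R (F 0) M \<and>
     (\<forall>i. d i \<in> graded_hom R (F (Suc i)) (F i)) \<and>
     \<epsilon> ` carrier (F 0) = carrier M \<and>
     d 0 ` carrier (F 1) = {x \<in> carrier (F 0). \<epsilon> x = \<zero>\<^bsub>M\<^esub>} \<and>
     (\<forall>i. d (Suc i) ` carrier (F (Suc (Suc i))) =
          {x \<in> carrier (F (Suc i)). d i x = \<zero>\<^bsub>F i\<^esub>}))"

text \<open>Minimality \<open>d(F\<^bsub>i+1\<^esub>) \<subseteq> \<mm> F\<^sub>i\<close> is expressed in coordinates.\<close>

definition minimal_resolution ::
  "('a, 'x) graded_ring_scheme \<Rightarrow> ('a, 'b, 'y) gmodule_scheme \<Rightarrow> (nat \<Rightarrow> int list)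
    \<Rightarrow> (nat \<Rightarrow> (nat \<Rightarrow> 'a) \<Rightarrow> (nat \<Rightarrow> 'a)) \<Rightarrow> ((nat \<Rightarrow> 'a) \<Rightarrow> 'b) \<Rightarrow> bool" where
  "minimal_resolution R M a d \<epsilon> \<longleftrightarrow>
    graded_free_resolution R M a d \<epsilon> \<and>
    (\<forall>i. \<forall>x\<in>carrier (free_gmodule R (a (Suc i))).
       \<forall>l<length (a i). d i x l \<in> irrelevant_ideal R)"

text \<open>
  \<open>is_syzygy R M n W\<close>: the graded module \<open>W\<close> is (a copy of) the \<open>n\<close>-th syzygy of \<open>M\<close>. Syzygies are
  defined only up to isomorphism, so every graded module isomorphic to the image of
  \<open>F\<^sub>n \<rightarrow> F\<^bsub>n-1\<^esub>\<close> in a minimal graded free resolution (to \<open>M\<close> itself if \<open>n = 0\<close>) is admitted.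
\<close>

fun is_syzygy ::
  "('a, 'x) graded_ring_scheme \<Rightarrow> ('a, 'b, 'y) gmodule_scheme \<Rightarrow> nat
    \<Rightarrow> ('a, 'c, 'z) gmodule_scheme \<Rightarrow> bool" where
  "is_syzygy R M 0 W \<longleftrightarrow> graded_module R W \<and> graded_iso R M W"
| "is_syzygy R M (Suc n) W \<longleftrightarrow> graded_module R W \<and>
    (\<exists>a d \<epsilon>. minimal_resolution R M a d \<epsilon> \<and>
      graded_iso R
        (restrict_gmodule (free_gmodule R (a n)) (d n ` carrier (free_gmodule R (a (Suc n))))) W)"


section \<open>Ext into the residue field, Betti numbers and regularity\<close>

text \<open>
  Degree \<open>j\<close> cochains on a graded free module: homomorphisms \<open>F \<rightarrow> k(-j)\<close>, which vanish on all
  homogeneous elements of degree other than \<open>j\<close>. The grading is such that dual basis elements have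
  the same internal degree as the basis elements. Cochains are set to zero off the carrier
  so that they form a \<open>k\<close>-vector space of functions.
\<close>

definition cochains ::
  "('k::field mpoly set, 'x) graded_ring_scheme \<Rightarrow> int list \<Rightarrow> int
    \<Rightarrow> ((nat \<Rightarrow> 'k mpoly set) \<Rightarrow> 'k) set" where
  "cochains R a j =
    {\<phi> \<in> graded_hom R (free_gmodule R a) (gshift residue_module (- j)).
      \<forall>x. x \<notin> carrier (free_gmodule R a) \<longrightarrow> \<phi> x = 0}"

definition cocycles ::
  "('k::field mpoly set, 'x) graded_ring_scheme \<Rightarrow> (nat \<Rightarrow> int list)
    \<Rightarrow> (nat \<Rightarrow> (nat \<Rightarrow> 'k mpoly set) \<Rightarrow> (nat \<Rightarrow> 'k mpoly set)) \<Rightarrow> nat \<Rightarrow> int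
    \<Rightarrow> ((nat \<Rightarrow> 'k mpoly set) \<Rightarrow> 'k) set" where
  "cocycles R a d i j =
    {\<phi> \<in> cochains R (a i) j. \<forall>x\<in>carrier (free_gmodule R (a (Suc i))). \<phi> (d i x) = 0}"

fun coboundaries ::
  "('k::field mpoly set, 'x) graded_ring_scheme \<Rightarrow> (nat \<Rightarrow> int list)
    \<Rightarrow> (nat \<Rightarrow> (nat \<Rightarrow> 'k mpoly set) \<Rightarrow> (nat \<Rightarrow> 'k mpoly set)) \<Rightarrow> nat \<Rightarrow> int
    \<Rightarrow> ((nat \<Rightarrow> 'k mpoly set) \<Rightarrow> 'k) set" where
  "coboundaries R a d 0 j = {0}"
| "coboundaries R a d (Suc i) j =
    (\<lambda>\<psi> x. if x \<in> carrier (free_gmodule R (a (Suc i))) then \<psi> (d i x) else 0) `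
      cochains R (a i) j"

abbreviation fun_dim :: "('b \<Rightarrow> 'k::field) set \<Rightarrow> nat" where
  "fun_dim \<equiv> vector_space.dim (\<lambda>(c::'k) \<phi> x. c * \<phi> x)"

text \<open>
  \<open>rank\<^sub>k Ext\<^sub>R\<^bsup>i,j\<^esup>(M, k)\<close>, computed from a minimal graded free resolution. All spaces involved are
  finite-dimensional, and the rank does not depend on the resolution. Meaningful for
  finitely generated \<open>M\<close>.
\<close>

definition betti ::
  "('k::field mpoly set, 'x) graded_ring_scheme \<Rightarrow> ('k mpoly set, 'b, 'y) gmodule_scheme
    \<Rightarrow> nat \<Rightarrow> int \<Rightarrow> nat" where
  "betti R M i j =
    (let (a, d, \<epsilon>) = (SOME (a, d, \<epsilon>). minimal_resolution R M a d \<epsilon>)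
     in fun_dim (cocycles R a d i j) - fun_dim (coboundaries R a d i j))"

definition regularity ::
  "('k::field mpoly set, 'x) graded_ring_scheme \<Rightarrow> ('k mpoly set, 'b, 'y) gmodule_scheme
    \<Rightarrow> ereal" where
  "regularity R M = Sup {ereal (real_of_int (j - int i)) | i j. betti R M i j \<noteq> 0}"

end

theory Submission
  imports Defs
begin

text \<open>
  Over \<open>R = k[x] / (f_1, \<dots>, f_c)\<close>, Tate's complex, the Koszul complex of the variables with divided power
  variables \<open>y_j\<close> adjoined to kill the classes of the equations \<open>f_j\<close>, resolves \<open>k\<close>. After a change of the
  generators \<open>f_j\<close> there are two cases.

  If the linear parts of the equations of degree \<open>> 2\<close> are linearly independent, then functionals dual to them
  give homotopies that remove the corresponding \<open>y_j\<close> from the homology of the Tate complex tensored with \<open>k\<close>.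
  The remaining generators have bounded regularity, so \<open>reg k\<close> is finite.

  Otherwise some equation \<open>f_j\<close> of degree \<open>d > 2\<close> can be chosen without linear part. Its Eisenbud operator
  acts on the Tate complex as \<open>\<partial>/\<partial>y_j\<close>, which has multiplication by \<open>y_j\<close> as a section that commutes with the
  differential modulo the maximal ideal. A summand of a syzygy of \<open>k\<close> has its minimal resolution as a retract, up to
  homotopy, of a truncation of the Tate complex, so the Eisenbud operator is surjective on its Betti numbers: a
  generator of homological degree \<open>i\<close> and internal degree \<open>j\<close> forces one of degrees \<open>i + 2\<close>
  and \<open>j + d\<close>. Since \<open>d > 2\<close>, the regularity is infinite.
\<close>

text \<open>Modules over R are handled through maps of free modules over the polynomial ring, with
  equality replaced by congruence modulo the ideal. Eisenbud operators require this: a lifted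
  differential squares not to zero but to a combination of the equations, here
  \<open>dX (dX z)\<close>, the sum of the \<open>f j \<star> del j z\<close>. On the resolution of
  a summand no operator is built. The square of its lifted differential is compared with that of
  \<open>dX\<close> along a chain map, and coefficients of the equations are compared modulo the
  maximal ideal \<open>mm\<close>; this is legitimate because a regular sequence is a basis of its
  ideal modulo \<open>mm\<close> times the ideal.

  The obstacle is that equations may have linear parts: the Tate complex is then not minimal, and
  its comparison maps with a minimal resolution are inverse modulo \<open>mm\<close> in one order
  only. As an equation of degree d has only variables of weight d in its linear part, the linear
  algebra of these parts splits by degree.

  So that the base ring is a type, polynomials keep infinitely many variables; those of index at
  least \<open>e\<close> are put into the ideal.\<close>

abbreviation lkp :: "('a \<Rightarrow>\<^sub>0 'b::zero) \<Rightarrow> 'a \<Rightarrow> 'b" where "lkp \<equiv> Poly_Mapping.lookup"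
abbreviation mkeys :: "('a \<Rightarrow>\<^sub>0 'b::zero) \<Rightarrow> 'a set" where "mkeys \<equiv> Poly_Mapping.keys"
abbreviation sing :: "'a \<Rightarrow> 'b::zero \<Rightarrow> ('a \<Rightarrow>\<^sub>0 'b)" where "sing \<equiv> Poly_Mapping.single"

section \<open>Homogeneous components and restriction of variables\<close>

lemma poly_mapping_add_induct [case_names zero single add]:
  fixes p :: "'a \<Rightarrow>\<^sub>0 'b::comm_monoid_add"
  assumes "P 0" and "\<And>m c. P (sing m c)" and "\<And>p q. P p \<Longrightarrow> P q \<Longrightarrow> P (p + q)"
  shows "P p"
proof -
  have *: "P (\<Sum>m\<in>A. sing m (lkp p m))" if "finite A" for A
    using that by (induction A) (auto intro: assms)
  have "(\<Sum>m\<in>mkeys p. sing m (lkp p m)) = p"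
  proof (rule poly_mapping_eqI)
    fix k
    have "lkp (\<Sum>m\<in>mkeys p. sing m (lkp p m)) k = (\<Sum>m\<in>mkeys p. lkp (sing m (lkp p m)) k)"
      by (simp add: lookup_sum)
    also have "\<dots> = (\<Sum>m\<in>mkeys p. if m = k then lkp p k else 0)"
      by (rule sum.cong) (auto simp: lookup_single)
    also have "\<dots> = lkp p k" by (simp add: in_keys_iff)
    finally show "lkp (\<Sum>m\<in>mkeys p. sing m (lkp p m)) k = lkp p k" .
  qed
  with *[of "mkeys p"] show ?thesis by simp
qed

definition pfilter :: "('a \<Rightarrow> bool) \<Rightarrow> ('a \<Rightarrow>\<^sub>0 'b) \<Rightarrow> ('a \<Rightarrow>\<^sub>0 'b::comm_ring_1)" where
  "pfilter Q p = Poly_Mapping.mapp (\<lambda>m c. c when Q m) p"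

lemma lookup_pfilter: "lkp (pfilter Q p) m = (if Q m then lkp p m else 0)"
  by (auto simp: pfilter_def lookup_mapp in_keys_iff when_def)

lemma pfilter_zero [simp]: "pfilter Q 0 = 0"
  and pfilter_add: "pfilter Q (p + q) = pfilter Q p + pfilter Q q"
  and pfilter_diff: "pfilter Q (p - q) = pfilter Q p - pfilter Q q"
  and pfilter_uminus: "pfilter Q (- p) = - pfilter Q p"
  by (auto intro!: poly_mapping_eqI simp: lookup_pfilter lookup_add lookup_minus)

lemma pfilter_pfilter: "pfilter Q (pfilter Q' p) = pfilter (\<lambda>m. Q m \<and> Q' m) p"
  by (auto intro!: poly_mapping_eqI simp: lookup_pfilter)

lemma pfilter_single: "pfilter Q (sing m c) = (if Q m then sing m c else 0)"
  by (auto intro!: poly_mapping_eqI simp: lookup_pfilter lookup_single when_def)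

lemma pfilter_sum: "pfilter Q (sum f A) = (\<Sum>x\<in>A. pfilter Q (f x))"
  by (induction A rule: infinite_finite_induct) (auto simp: pfilter_add)

lemma pfilter_id_iff: "pfilter Q p = p \<longleftrightarrow> (\<forall>m\<in>mkeys p. Q m)"
  by (auto simp: poly_mapping_eq_iff fun_eq_iff lookup_pfilter in_keys_iff)

lemma pfilter_eq_0_iff: "pfilter Q p = 0 \<longleftrightarrow> (\<forall>m\<in>mkeys p. \<not> Q m)"
  by (auto simp: poly_mapping_eq_iff fun_eq_iff lookup_pfilter in_keys_iff)

text \<open>Substitution of 0 for the variables outside \<open>V\<close>. Written as a selection of
  monomials it is visibly idempotent and commutes with \<open>comp\<close>, while
  \<open>rho_mult\<close> recovers that it is a ring homomorphism. For \<open>V = {..<e}\<close> it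
  projects onto the carrier of \<open>mpoly_ring e\<close>.\<close>

definition rho :: "nat set \<Rightarrow> 'k::field mpoly \<Rightarrow> 'k mpoly" where
  "rho V = pfilter (\<lambda>m. mkeys m \<subseteq> V)"

definition comp :: "(nat \<Rightarrow> nat) \<Rightarrow> int \<Rightarrow> 'k::field mpoly \<Rightarrow> 'k mpoly" where
  "comp w j = pfilter (\<lambda>m. monom_deg w m = j)"

lemma rho_simps: "rho V 0 = 0" "rho V (p + q) = rho V p + rho V q" "rho V (p - q) = rho V p - rho V q"
  "rho V (- p) = - rho V p" "rho V (sum f A) = (\<Sum>x\<in>A. rho V (f x))"
  by (simp_all add: rho_def pfilter_add pfilter_diff pfilter_uminus pfilter_sum)

lemma comp_simps: "comp w j 0 = 0" "comp w j (p + q) = comp w j p + comp w j q"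
  "comp w j (p - q) = comp w j p - comp w j q"
  "comp w j (- p) = - comp w j p" "comp w j (sum f A) = (\<Sum>x\<in>A. comp w j (f x))"
  by (simp_all add: comp_def pfilter_add pfilter_diff pfilter_uminus pfilter_sum)

lemma keys_plus_nat: "mkeys (m + m' :: 'a \<Rightarrow>\<^sub>0 nat) = mkeys m \<union> mkeys m'"
  by (auto simp: in_keys_iff lookup_add)

lemma monom_deg_superset:
  assumes "finite A" "mkeys m \<subseteq> A"
  shows "monom_deg w m = (\<Sum>i\<in>A. int (w i) * int (lkp m i))"
  unfolding monom_deg_def using assms by (intro sum.mono_neutral_left) (auto simp: in_keys_iff)

lemma monom_deg_add: "monom_deg w (m + m') = monom_deg w m + monom_deg w m'"
proof -
  let ?A = "mkeys m \<union> mkeys m'"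
  have "monom_deg w x = (\<Sum>i\<in>?A. int (w i) * int (lkp x i))" if "mkeys x \<subseteq> ?A" for x
    by (rule monom_deg_superset) (use that in auto)
  from this[of m] this[of m'] this[of "m + m'"] show ?thesis
    by (simp add: keys_plus_nat lookup_add distrib_left sum.distrib)
qed

lemma monom_deg_0 [simp]: "monom_deg w 0 = 0"
  by (simp add: monom_deg_def)

lemma monom_deg_single: "monom_deg w (sing i c) = int (w i) * int c"
  by (simp add: monom_deg_def)

lemma lookup_le_monom_deg:
  assumes "\<And>i. w i \<ge> 1"
  shows "int (lkp m i) \<le> monom_deg w m"
proof (cases "i \<in> mkeys m")
  case True
  have "int (lkp m i) \<le> int (w i) * int (lkp m i)"
    using assms[of i] by (metis Suc_le_eq mult_le_cancel_right1 nat_le_linear of_nat_0_le_iff of_nat_1 of_nat_le_iff One_nat_def not_less)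
  moreover have "int (w i) * int (lkp m i) \<le> monom_deg w m"
    unfolding monom_deg_def by (rule member_le_sum[OF True]) auto
  ultimately show ?thesis by linarith
qed (auto simp: in_keys_iff monom_deg_def intro!: sum_nonneg)

lemma monom_deg_eq_0_iff:
  assumes "\<And>i. w i \<ge> 1"
  shows "monom_deg w m = 0 \<longleftrightarrow> m = 0"
proof
  assume "monom_deg w m = 0"
  then have "lkp m i = 0" for i using lookup_le_monom_deg[of w m i] assms by simp
  then show "m = 0" by (intro poly_mapping_eqI) simp
qed simp

lemma rho_mult: "rho V (p * q) = rho V p * rho V (q :: 'k::field mpoly)"
proof (induction p rule: poly_mapping_add_induct)
  case (single m c)
  show ?case
  proof (induction q rule: poly_mapping_add_induct)
    case (single m' c')
    show ?case by (auto simp: mult_single rho_def pfilter_single keys_plus_nat)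
  qed (auto simp: rho_simps algebra_simps)
qed (auto simp: rho_simps algebra_simps)

lemma rho_one [simp]: "rho V 1 = (1 :: 'k::field mpoly)"
  by (simp add: rho_def pfilter_single flip: single_one)

lemma rho_sing0: "rho V (sing 0 c) = sing 0 (c :: 'k::field)"
  by (simp add: rho_def pfilter_single)

lemma rho_rho: "rho V (rho V' p) = rho (V \<inter> V') p"
  by (simp add: rho_def pfilter_pfilter)

lemma rho_comp: "rho V (comp w j p) = comp w j (rho V p)"
  by (simp add: rho_def comp_def pfilter_pfilter conj_commute)

lemma comp_comp: "comp w i (comp w j p) = (if i = j then comp w j p else 0)"
  by (auto simp: comp_def pfilter_pfilter pfilter_eq_0_iff intro!: arg_cong2[where f = pfilter])

lemma comp_mult:
  assumes "comp w i p = p"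
  shows "comp w (i + j) (p * q) = p * comp w j (q :: 'k::field mpoly)"
proof -
  have *: "comp w (i + j) (comp w i p * q) = comp w i p * comp w j q" for p
  proof (induction p rule: poly_mapping_add_induct)
    case (single m c)
    show ?case
    proof (induction q rule: poly_mapping_add_induct)
      case (single m' c')
      show ?case by (auto simp: mult_single comp_def pfilter_single monom_deg_add)
    qed (auto simp: comp_simps algebra_simps)
  qed (auto simp: comp_simps algebra_simps)
  from *[of p] assms show ?thesis by simp
qed

lemma comp_mult': "comp w i p = p \<Longrightarrow> comp w j (q * p) = comp w (j - i) q * (p :: 'k::field mpoly)"
  using comp_mult[of w i p "j - i" q] by (simp add: mult.commute)

lemma hom_mult: "comp w i p = p \<Longrightarrow> comp w j q = q \<Longrightarrow> comp w (i + j) (p * q) = p * (q :: 'k::field mpoly)"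
  by (simp add: comp_mult)

lemma comp_id_iff: "comp w j p = p \<longleftrightarrow> homogeneous w j p"
  by (simp add: comp_def pfilter_id_iff homogeneous_def)

lemma sum_comp:
  assumes "finite S" "monom_deg w ` mkeys p \<subseteq> S"
  shows "(\<Sum>j\<in>S. comp w j p) = p"
proof (rule poly_mapping_eqI)
  fix m
  have "lkp (\<Sum>j\<in>S. comp w j p) m = (\<Sum>j\<in>S. if j = monom_deg w m then lkp p m else 0)"
    unfolding lookup_sum by (rule sum.cong) (auto simp: comp_def lookup_pfilter)
  also have "\<dots> = lkp p m" using assms by (auto simp: in_keys_iff image_subset_iff)
  finally show "lkp (\<Sum>j\<in>S. comp w j p) m = lkp p m" .
qed

lemma rho_empty: "rho {} p = sing 0 (lkp p 0)"
  by (auto intro!: poly_mapping_eqI simp: rho_def lookup_pfilter lookup_single when_def)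

lemma lookup_rho_0 [simp]: "lkp (rho V p) 0 = lkp p 0"
  by (simp add: rho_def lookup_pfilter)

text \<open>The constant term is \<open>rho {}\<close>, hence multiplicative.\<close>

lemma lookup_mult_0: "lkp (p * q) 0 = lkp p 0 * lkp (q :: 'k::field mpoly) 0"
proof -
  have "sing 0 (lkp (p * q) 0) = rho {} (p * q)" by (simp add: rho_empty)
  also have "\<dots> = sing 0 (lkp p 0 * lkp q 0)" by (simp add: rho_mult rho_empty mult_single)
  finally show ?thesis by (metis lookup_single_eq)
qed

lemma lookup_comp_0: "lkp (comp w j p) 0 = (if j = 0 then lkp p 0 else 0)"
  by (auto simp: comp_def lookup_pfilter)

lemma comp_0:
  assumes "\<And>i. w i \<ge> 1"
  shows "comp w 0 p = sing 0 (lkp p 0)"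
  using assms by (auto intro!: poly_mapping_eqI simp: comp_def lookup_pfilter monom_deg_eq_0_iff lookup_single when_def)

lemma comp_sing0: "comp w 0 (sing 0 c) = sing 0 (c :: 'k::field)"
  by (simp add: comp_def pfilter_single)

section \<open>Polynomials without constant term, and expansion along the variables\<close>

definition mm :: "'k::field mpoly set" where
  "mm = {p. lkp p 0 = 0}"

definition xv :: "nat \<Rightarrow> 'k::field mpoly" where
  "xv i = sing (sing i 1) 1"

lemma rho_xv: "rho V (xv i) = (if i \<in> V then xv i else 0)"
  by (simp add: rho_def xv_def pfilter_single)

lemma comp_xv: "comp w (int (w i)) (xv i) = (xv i :: 'k::field mpoly)"
  by (simp add: comp_def xv_def pfilter_single monom_deg_single)

lemma xv_mm: "xv i \<in> mm"
proof -
  have "sing i (1::nat) \<noteq> 0" by (metis lookup_single_eq lookup_zero zero_neq_one)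
  then show ?thesis by (simp add: mm_def xv_def lookup_single when_def)
qed

lemma rho_remove: "\<exists>p'. rho V p - rho (V - {i}) p = xv i * (p' :: 'k::field mpoly)"
proof (induction p rule: poly_mapping_add_induct)
  case zero
  show ?case by (rule exI[of _ 0]) (simp add: rho_simps)
next
  case (single m c)
  show ?case
  proof (cases "mkeys m \<subseteq> V \<and> i \<in> mkeys m")
    case True
    define m' where "m' = m - sing i 1"
    have "sing i 1 + m' = m"
    proof (rule poly_mapping_eqI)
      fix k show "lkp (sing i 1 + m') k = lkp m k"
        using True by (auto simp: m'_def lookup_add lookup_minus lookup_single when_def in_keys_iff)
    qed
    then have "rho V (sing m c) - rho (V - {i}) (sing m c) = xv i * sing m' c"
      using True by (auto simp: rho_def pfilter_single xv_def mult_single)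
    then show ?thesis by blast
  next
    case False
    then have "rho V (sing m c) - rho (V - {i}) (sing m c) = xv i * 0"
      by (auto simp: rho_def pfilter_single)
    then show ?thesis by blast
  qed
next
  case (add p q)
  then obtain p' q' where "rho V p - rho (V - {i}) p = xv i * p'" "rho V q - rho (V - {i}) q = xv i * q'"
    by blast
  then have "rho V (p + q) - rho (V - {i}) (p + q) = xv i * (p' + q')"
    by (simp add: rho_simps algebra_simps)
  then show ?case by blast
qed

text \<open>The variables below \<open>r\<close> are removed one at a time. For \<open>r = e\<close>
  this writes a polynomial without constant term as a combination of the variables, the origin of
  the Tate coefficients \<open>a j i\<close>; smaller \<open>r\<close> serve the Koszul
  induction.\<close>

lemma rho_decompose:
  assumes "r \<le> e"
  shows "\<exists>p'. rho {..<e} p = rho {r..<e} p + (\<Sum>i<r. xv i * (p' i :: 'k::field mpoly))"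
  using assms
proof (induction r)
  case 0
  then show ?case by (simp add: lessThan_atLeast0)
next
  case (Suc r)
  then obtain p' where p': "rho {..<e} p = rho {r..<e} p + (\<Sum>i<r. xv i * p' i)" by auto
  obtain p'' where p'': "rho {r..<e} p - rho ({r..<e} - {r}) p = xv r * p''" using rho_remove by blast
  have "{r..<e} - {r} = {Suc r..<e}" using Suc.prems by auto
  then have "rho {..<e} p = rho {Suc r..<e} p + (\<Sum>i<Suc r. xv i * (p'(r := p'')) i)"
    using p' p'' by (simp add: algebra_simps)
  then show ?case by blast
qed

lemma mult_xv_eq_0: "xv i * p = (0 :: 'k::field mpoly) \<Longrightarrow> p = 0"
proof -
  assume a: "xv i * p = 0"
  have "xv i \<noteq> (0 :: 'k mpoly)" unfolding xv_def
    by (metis lookup_single_eq lookup_zero zero_neq_one)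
  with a show ?thesis by simp
qed

section \<open>Finite generation of homogeneous ideals and modules\<close>

text \<open>A decreasing sequence of naturals stabilises at its least value, so either case of the
  monotone subsequence theorem yields a nondecreasing one.\<close>

lemma monotone_subsequence_nat:
  fixes s :: "nat \<Rightarrow> nat"
  shows "\<exists>g :: nat \<Rightarrow> nat. strict_mono g \<and> mono (\<lambda>n. s (g n))"
proof -
  obtain h :: "nat \<Rightarrow> nat" where h: "strict_mono h" "monoseq (\<lambda>n. s (h n))" using seq_monosub by blast
  show ?thesis
  proof (cases "incseq (\<lambda>n. s (h n))")
    case True with h show ?thesis by blast
  next
    case False
    then have dec: "decseq (\<lambda>n. s (h n))" using h(2) by (simp add: monoseq_iff)
    define v where "v = (LEAST x. x \<in> range (\<lambda>n. s (h n)))"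
    have "v \<in> range (\<lambda>n. s (h n))" unfolding v_def by (rule LeastI) auto
    then obtain n0 where n0: "v = s (h n0)" by auto
    have le: "v \<le> s (h n)" for n unfolding v_def by (rule Least_le) auto
    have "s (h (n0 + n)) = v" for n
      using le[of "n0 + n"] decseqD[OF dec, of n0 "n0 + n"] n0 by simp
    then have "mono (\<lambda>n. s (h (n0 + n)))" by (simp add: mono_def)
    moreover have "strict_mono (\<lambda>n. h (n0 + n))" using h(1) by (simp add: strict_mono_def)
    ultimately show ?thesis by blast
  qed
qed

lemma dickson_sequence:
  fixes s :: "nat \<Rightarrow> nat \<Rightarrow> nat"
  shows "\<exists>g :: nat \<Rightarrow> nat. strict_mono g \<and> (\<forall>v<e. mono (\<lambda>n. s (g n) v))"
proof (induction e)
  case 0 show ?case by (rule exI[of _ id]) (simp add: strict_mono_def)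
next
  case (Suc e)
  then obtain g :: "nat \<Rightarrow> nat" where g: "strict_mono g" "\<forall>v<e. mono (\<lambda>n. s (g n) v)" by blast
  obtain h :: "nat \<Rightarrow> nat" where h: "strict_mono h" "mono (\<lambda>n. s (g (h n)) e)"
    using monotone_subsequence_nat[of "\<lambda>n. s (g n) e"] by blast
  have "strict_mono (\<lambda>n. g (h n))" using g(1) h(1) by (simp add: strict_mono_def)
  moreover have "mono (\<lambda>n. s (g (h n)) v)" if "v < Suc e" for v
  proof (cases "v = e")
    case False
    with that g(2) have "mono (\<lambda>n. s (g n) v)" by auto
    then show ?thesis using strict_mono_mono[OF h(1)] by (simp add: mono_def)
  qed (use h in simp)
  ultimately show ?case by blast
qed

text \<open>The minimal elements for divisibility are finitely many: a sequence of distinct ones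
  would, by \<open>dickson_sequence\<close>, contain two comparable ones. Later \<open>T\<close> is
  a set of leading monomials.\<close>

lemma dickson:
  fixes T :: "(nat \<Rightarrow>\<^sub>0 nat) set"
  assumes T: "\<And>m. m \<in> T \<Longrightarrow> mkeys m \<subseteq> {..<e}"
  shows "\<exists>T0. finite T0 \<and> T0 \<subseteq> T \<and> (\<forall>m\<in>T. \<exists>m0\<in>T0. \<exists>t. m = m0 + t)"
proof -
  have diff: "\<exists>t. m = m0 + t" if "\<And>i. lkp m0 i \<le> lkp m i" for m m0 :: "nat \<Rightarrow>\<^sub>0 nat"
    by (rule exI[of _ "m - m0"]) (use that in \<open>auto intro!: poly_mapping_eqI simp: lookup_add lookup_minus\<close>)
  define T0 where "T0 = {m \<in> T. \<forall>m'\<in>T. (\<forall>i. lkp m' i \<le> lkp m i) \<longrightarrow> m' = m}"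
  have "finite T0"
  proof (rule ccontr)
    assume "infinite T0"
    then obtain s :: "nat \<Rightarrow> _" where s: "inj s" "range s \<subseteq> T0"
      using infinite_countable_subset by blast
    obtain g :: "nat \<Rightarrow> nat" where g: "strict_mono g" "\<forall>v<e. mono (\<lambda>n. lkp (s (g n)) v)"
      using dickson_sequence[of e "\<lambda>n. lkp (s n)"] by auto
    have "lkp (s (g 0)) i \<le> lkp (s (g 1)) i" for i
    proof (cases "i < e")
      case True then show ?thesis using g(2) by (auto simp: mono_def)
    next
      case False
      moreover have "mkeys (s (g 0)) \<subseteq> {..<e}" using s(2) T unfolding T0_def by blast
      ultimately have "lkp (s (g 0)) i = 0" by (auto simp: in_keys_iff)
      then show ?thesis by simp
    qed
    moreover have "s (g 0) \<in> T0" "s (g 1) \<in> T0" using s(2) by auto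
    ultimately have "s (g 0) = s (g 1)" unfolding T0_def by blast
    then have "g 0 = g 1" using s(1) by (simp add: inj_eq)
    then show False using g(1) by (simp add: strict_mono_eq)
  qed
  moreover have "\<exists>m0\<in>T0. \<exists>t. m = m0 + t" if "m \<in> T" for m
    using that
  proof (induction "nat (monom_deg (\<lambda>_. 1) m)" arbitrary: m rule: less_induct)
    case less
    show ?case
    proof (cases "m \<in> T0")
      case True then show ?thesis by (intro bexI[of _ m] exI[of _ 0]) auto
    next
      case False
      then obtain m' where m': "m' \<in> T" "\<forall>i. lkp m' i \<le> lkp m i" "m' \<noteq> m"
        using less.prems by (auto simp: T0_def)
      obtain t where t: "m = m' + t" using diff m'(2) by blast
      then have "t \<noteq> 0" using m'(3) by auto
      then have "monom_deg (\<lambda>_. 1) t \<noteq> 0" by (simp add: monom_deg_eq_0_iff)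
      moreover have "monom_deg (\<lambda>_. 1) t \<ge> 0" "monom_deg (\<lambda>_. 1) m' \<ge> 0"
        by (auto simp: monom_deg_def sum_nonneg)
      ultimately have "nat (monom_deg (\<lambda>_. 1) m') < nat (monom_deg (\<lambda>_. 1) m)"
        using t by (simp add: monom_deg_add)
      then obtain m0 t' where "m0 \<in> T0" "m' = m0 + t'" using less.hyps m'(1) by blast
      then show ?thesis using t by (metis add.assoc)
    qed
  qed
  ultimately show ?thesis unfolding T0_def by blast
qed

lemma finite_monomials_of_degree:
  assumes "\<And>i. w i \<ge> 1"
  shows "finite {m. mkeys m \<subseteq> {..<e} \<and> monom_deg w m = j}"
proof -
  let ?S = "{m. mkeys m \<subseteq> {..<e} \<and> monom_deg w m = j}"
  have "finite {f :: nat \<Rightarrow> nat. \<forall>x. (x \<in> {..<e} \<longrightarrow> f x \<in> {..nat j}) \<and> (x \<notin> {..<e} \<longrightarrow> f x = 0)}"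
    by (rule finite_set_of_finite_funs) auto
  moreover have "lkp ` ?S \<subseteq> {f :: nat \<Rightarrow> nat. \<forall>x. (x \<in> {..<e} \<longrightarrow> f x \<in> {..nat j}) \<and> (x \<notin> {..<e} \<longrightarrow> f x = 0)}"
  proof (clarify, intro conjI impI)
    fix m x assume m: "mkeys m \<subseteq> {..<e}" and j: "j = monom_deg w m"
    show "lkp m x \<in> {..nat (monom_deg w m)}" using lookup_le_monom_deg[of w m x] assms by simp
    assume "x \<notin> {..<e}" then show "lkp m x = 0" using m by (auto simp: in_keys_iff)
  qed
  ultimately have "finite (lkp ` ?S)" by (rule finite_subset[rotated])
  then show ?thesis
    by (rule finite_imageD) (rule inj_onI, rule poly_mapping_eqI, simp)
qed

text \<open>Hilbert's basis theorem by leading monomials \<open>Max (mkeys p)\<close>: by Dickson's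
  lemma the leading monomials of finitely many homogeneous members divide all others, and division
  by these members terminates. The result speaks of \<open>rho {..<e} p\<close> since members of
  \<open>L\<close> may involve further variables.\<close>

lemma homogeneous_ideal_finite_basis:
  fixes L :: "'k::field mpoly set"
  assumes w: "\<And>i. w i \<ge> 1"
    and L0: "0 \<in> L" and Ladd: "\<And>p q. p \<in> L \<Longrightarrow> q \<in> L \<Longrightarrow> p + q \<in> L"
    and Lmult: "\<And>r p. p \<in> L \<Longrightarrow> r * p \<in> L"
    and Lcomp: "\<And>j p. p \<in> L \<Longrightarrow> comp w j p \<in> L"
    and Lrho: "\<And>p. p \<in> L \<Longrightarrow> rho {..<e} p \<in> L"
  shows "\<exists>G. finite G \<and> G \<subseteq> L \<and> (\<forall>g\<in>G. \<exists>j. comp w j g = g) \<and>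
    (\<forall>p\<in>L. \<exists>c. rho {..<e} p = (\<Sum>g\<in>G. c g * g))"
proof -
  define T where "T = {Max (mkeys p) | p. p \<in> L \<and> p \<noteq> 0 \<and> rho {..<e} p = p \<and> (\<exists>j. comp w j p = p)}"
  have T: "mkeys m \<subseteq> {..<e}" if m: "m \<in> T" for m
  proof -
    from m obtain p :: "'k mpoly" where p: "m = Max (mkeys p)" "p \<noteq> 0" "rho {..<e} p = p"
      unfolding T_def by blast
    from p(1,2) have "m \<in> mkeys p" by (metis Max_in finite_keys keys_eq_empty)
    with p(3) show ?thesis by (auto simp: rho_def pfilter_id_iff)
  qed
  obtain T0 where T0: "finite T0" "T0 \<subseteq> T" "\<forall>m\<in>T. \<exists>m0\<in>T0. \<exists>t. m = m0 + t"
    using dickson[of T e] T by blast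
  have "\<forall>m\<in>T0. \<exists>p. m = Max (mkeys p) \<and> p \<in> L \<and> p \<noteq> 0 \<and> rho {..<e} p = p \<and> (\<exists>j. comp w j p = p)"
    using T0(2) by (auto simp: T_def)
  then obtain h where h: "\<And>m. m \<in> T0 \<Longrightarrow> m = Max (mkeys (h m)) \<and> h m \<in> L \<and> h m \<noteq> 0 \<and>
      rho {..<e} (h m) = h m \<and> (\<exists>j. comp w j (h m) = h m)"
    by metis
  define G where "G = h ` T0"
  have finG: "finite G" using T0 by (simp add: G_def)
  have zero: "\<exists>c. 0 = (\<Sum>g\<in>G. c g * g)" by (rule exI[of _ "\<lambda>_. 0"]) simp
  have hom: "\<exists>c. p = (\<Sum>g\<in>G. c g * g)" if "p \<in> L" "rho {..<e} p = p" "comp w j p = p" for p j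
    using that
  \<comment> \<open>Reduction stays in degree \<open>j\<close>, where positive weights leave
    finitely many monomials; counting those up to the leading one avoids any appeal to
    well-foundedness of the order on monomials.\<close>
  proof (induction "card {m. mkeys m \<subseteq> {..<e} \<and> monom_deg w m = j \<and> m \<le> Max (mkeys p)}"
      arbitrary: p rule: less_induct)
    case less
    show ?case
    proof (cases "p = 0")
      case True then show ?thesis using zero by simp
    next
      case False
      define m where "m = Max (mkeys p)"
      have mp: "m \<in> mkeys p" unfolding m_def using False by (metis Max_in finite_keys keys_eq_empty)
      have mT: "m \<in> T" unfolding T_def m_def using less.prems False by blast
      then obtain m0 t where m0: "m0 \<in> T0" "m = m0 + t" using T0(3) by blast
      define g where "g = h m0"
      have g: "m0 = Max (mkeys g)" "g \<in> L" "g \<noteq> 0" "rho {..<e} g = g" "\<exists>j. comp w j g = g"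
        using h[OF m0(1)] unfolding g_def by blast+
      have m0g: "m0 \<in> mkeys g" unfolding g(1) using g(3) by (metis Max_in finite_keys keys_eq_empty)
      obtain i where i: "comp w i g = g" using g(5) by blast
      have im0: "monom_deg w m0 = i" using i m0g by (auto simp: comp_def pfilter_id_iff)
      have jm: "monom_deg w m = j" using less.prems(3) mp by (auto simp: comp_def pfilter_id_iff)
      \<comment> \<open>The scalar is chosen so that the multiple \<open>s * g\<close> has the same
        leading term as \<open>p\<close>.\<close>
      define cc where "cc = lkp p m / lkp g m0"
      define s where "s = sing t cc"
      have s: "comp w (monom_deg w t) s = s" by (simp add: s_def comp_def pfilter_single)
      have ksg: "\<exists>k\<in>mkeys g. m' = t + k" if "m' \<in> mkeys (s * g)" for m'
        using that keys_mult[of s g] by (auto simp: s_def split: if_splits)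
      have lsg: "lkp (s * g) (t + k) = cc * lkp g k" for k
      proof (induction g rule: poly_mapping_add_induct)
        case (single m' c') show ?case by (auto simp: s_def mult_single lookup_single when_def)
      qed (auto simp: lookup_add algebra_simps)
      define p' where "p' = p - s * g"
      have p'L: "p' \<in> L" unfolding p'_def
        using Ladd[OF less.prems(1) Lmult[OF g(2), of "- s"]] by simp
      have "mkeys t \<subseteq> {..<e}" using T[OF mT] m0(2) by (auto simp: keys_plus_nat)
      then have rs: "rho {..<e} s = s" by (simp add: s_def rho_def pfilter_single)
      have rp': "rho {..<e} p' = p'" using less.prems(2) g(4) rs by (simp add: p'_def rho_simps rho_mult)
      have "j = monom_deg w t + i" using jm m0(2) im0 by (simp add: monom_deg_add)
      then have cp': "comp w j p' = p'" using less.prems(3) hom_mult[OF s i] by (simp add: p'_def comp_simps)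
      have lm: "lkp p' m = 0"
        using lsg[of m0] m0(2) m0g by (simp add: p'_def lookup_minus add.commute in_keys_iff cc_def)
      have km: "m' < m" if "m' \<in> mkeys p'" for m'
      proof -
        have "m' \<in> mkeys p \<or> m' \<in> mkeys (s * g)"
          using that by (auto simp: p'_def in_keys_iff lookup_minus)
        then have "m' \<le> m"
        proof
          assume "m' \<in> mkeys p" then show ?thesis by (simp add: m_def)
        next
          assume "m' \<in> mkeys (s * g)"
          then obtain k where k: "k \<in> mkeys g" "m' = t + k" using ksg by blast
          then have "k \<le> m0" using g(1) by simp
          then show ?thesis using k(2) m0(2) by (simp add: add.commute add_left_mono)
        qed
        moreover have "m' \<noteq> m" using that lm by (auto simp: in_keys_iff)
        ultimately show ?thesis by simp
      qed
      have "\<exists>c. p' = (\<Sum>g\<in>G. c g * g)"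
      proof (cases "p' = 0")
        case True then show ?thesis using zero by simp
      next
        case False
        have lt: "Max (mkeys p') < m" using False km by (metis Max_in finite_keys keys_eq_empty)
        have "{m. mkeys m \<subseteq> {..<e} \<and> monom_deg w m = j \<and> m \<le> Max (mkeys p')}
            \<subset> {m. mkeys m \<subseteq> {..<e} \<and> monom_deg w m = j \<and> m \<le> Max (mkeys p)}" (is "?A \<subset> ?B")
        proof (rule psubsetI)
          show "?A \<subseteq> ?B" using lt by (auto simp: m_def)
          have "m \<in> ?B" "m \<notin> ?A" using jm T[OF mT] lt by (auto simp: m_def)
          then show "?A \<noteq> ?B" by blast
        qed
        moreover have "finite ?B"
          by (rule finite_subset[OF _ finite_monomials_of_degree[of w e j, OF w]]) auto
        ultimately have "card ?A < card ?B" by (rule psubset_card_mono[rotated])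
        then show ?thesis using less.hyps[of p'] p'L rp' cp' by blast
      qed
      then obtain c where c: "p' = (\<Sum>g\<in>G. c g * g)" by blast
      have gG: "g \<in> G" using m0(1) by (simp add: G_def g_def)
      have "p = (\<Sum>x\<in>G. c x * x) + s * g" using c by (simp add: p'_def algebra_simps)
      also have "\<dots> = (\<Sum>x\<in>G. (c x + (if x = g then s else 0)) * x)"
        using gG finG by (simp add: distrib_right sum.distrib if_distrib[of "\<lambda>y. y * _"] cong: if_cong)
      finally show ?thesis by (intro exI[of _ "\<lambda>x. c x + (if x = g then s else 0)"])
    qed
  qed
  have "\<exists>c. rho {..<e} p = (\<Sum>g\<in>G. c g * g)" if p: "p \<in> L" for p
  proof -
    let ?p = "rho {..<e} p" let ?S = "monom_deg w ` mkeys ?p"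
    have "\<forall>j. \<exists>c. comp w j ?p = (\<Sum>g\<in>G. c g * g)"
      by (intro allI hom) (auto intro: Lcomp Lrho p simp: rho_comp rho_rho comp_comp)
    then obtain c where c: "\<And>j. comp w j ?p = (\<Sum>g\<in>G. c j g * g)" by metis
    have "?p = (\<Sum>j\<in>?S. comp w j ?p)" by (simp add: sum_comp)
    also have "\<dots> = (\<Sum>g\<in>G. (\<Sum>j\<in>?S. c j g) * g)"
      by (simp add: c sum_distrib_right sum.swap[of _ G])
    finally show ?thesis by (intro exI[of _ "\<lambda>g. \<Sum>j\<in>?S. c j g"])
  qed
  then show ?thesis using finG h by (intro exI[of _ G]) (auto simp: G_def)
qed

section \<open>Graded linear maps between free modules\<close>

text \<open>
  Elements of free modules over the quotient of the polynomial ring by an ideal \<open>J\<close> are represented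
  by vectors of polynomials, and equality by having a difference with entries in \<open>J\<close>. So
  \<^const>\<open>plus\<close> and the other operations on vectors are honest type-class operations.
\<close>

definition smv :: "'a::times \<Rightarrow> ('i \<Rightarrow> 'a) \<Rightarrow> 'i \<Rightarrow> 'a" (infixr \<open>\<star>\<close> 75) where
  "p \<star> v = (\<lambda>i. p * v i)"

definition VV :: "'i set \<Rightarrow> ('i \<Rightarrow> 'a::zero) set" where
  "VV B = {v. \<forall>i. i \<notin> B \<longrightarrow> v i = 0}"

definition EV :: "'a set \<Rightarrow> ('i \<Rightarrow> 'a) set" where
  "EV K = {v. \<forall>i. v i \<in> K}"

definition ev :: "'i \<Rightarrow> 'i \<Rightarrow> 'a::zero_neq_one" where
  "ev b = (\<lambda>i. if i = b then 1 else 0)"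

definition lin :: "(('i \<Rightarrow> 'a::comm_ring_1) \<Rightarrow> 'j \<Rightarrow> 'a) \<Rightarrow> bool" where
  "lin L \<longleftrightarrow> (\<forall>u v. L (u + v) = L u + L v) \<and> (\<forall>p v. L (p \<star> v) = p \<star> L v)"

lemma smv_apply: "(p \<star> v) i = p * v i" by (simp add: smv_def)

declare plus_fun_apply [simp del] minus_apply [simp del] uminus_apply [simp del]
lemmas vec_apply = plus_fun_apply minus_apply uminus_apply smv_apply
lemma ev_apply: "ev b i = (if i = b then 1 else 0)" by (simp add: ev_def)
lemma smv_simps: "p \<star> (u + v) = p \<star> u + p \<star> (v :: 'i \<Rightarrow> 'a::comm_ring_1)"
  "(p + q) \<star> v = p \<star> v + q \<star> v" "p \<star> q \<star> v = (p * q) \<star> v" "0 \<star> v = 0" "1 \<star> v = v" "p \<star> 0 = (0 :: 'i \<Rightarrow> 'a)"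
  "p \<star> (u - v) = p \<star> u - p \<star> v" "(- p) \<star> v = - (p \<star> v)" "p \<star> (- v) = - (p \<star> v)" "(p - q) \<star> v = p \<star> v - q \<star> v"
  by (simp_all add: fun_eq_iff vec_apply algebra_simps)

lemma sum_fun_apply: "(sum f A) i = (\<Sum>x\<in>A. f x i)"
  by (induction A rule: infinite_finite_induct) (auto simp: vec_apply)

lemma smv_sum: "p \<star> (\<Sum>x\<in>A. f x) = (\<Sum>x\<in>A. p \<star> (f x :: 'i \<Rightarrow> 'a::comm_ring_1))"
  by (simp add: fun_eq_iff sum_fun_apply vec_apply sum_distrib_left)

lemma lin_add: "lin L \<Longrightarrow> L (u + v) = L u + L v" and lin_smv: "lin L \<Longrightarrow> L (p \<star> v) = p \<star> L v"
  by (simp_all add: lin_def)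

lemma lin_0: "lin L \<Longrightarrow> L 0 = 0"
  using lin_smv[of L 0 0] by (simp add: smv_simps)

lemma lin_uminus: "lin L \<Longrightarrow> L (- v) = - L v"
  using lin_smv[of L "-1" v] by (simp add: smv_simps)

lemma lin_diff: "lin L \<Longrightarrow> L (u - v) = L u - L v"
  using lin_add[of L u "- v"] lin_uminus[of L v] by simp

lemma lin_sum: "lin L \<Longrightarrow> L (sum f A) = (\<Sum>x\<in>A. L (f x))"
  by (induction A rule: infinite_finite_induct) (auto simp: lin_0 lin_add)

lemma lin_compose: "lin L \<Longrightarrow> lin L' \<Longrightarrow> lin (\<lambda>v. L (L' v))"
  by (simp add: lin_def)

lemma lin_minus: "lin L \<Longrightarrow> lin L' \<Longrightarrow> lin (\<lambda>v. L v - L' v)"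
  by (auto simp: lin_def smv_simps)

lemma VV_0 [simp]: "0 \<in> VV B" by (simp add: VV_def)
lemma VV_add: "u \<in> VV B \<Longrightarrow> v \<in> VV B \<Longrightarrow> u + v \<in> VV (B :: 'i set)" for u v :: "'i \<Rightarrow> 'a::comm_ring_1" by (simp add: VV_def vec_apply)
lemma VV_diff: "u \<in> VV B \<Longrightarrow> v \<in> VV B \<Longrightarrow> u - v \<in> VV B" for u v :: "'i \<Rightarrow> 'a::comm_ring_1" by (simp add: VV_def vec_apply)
lemma VV_smv: "v \<in> VV B \<Longrightarrow> p \<star> v \<in> VV B" for v :: "'i \<Rightarrow> 'a::comm_ring_1" by (simp add: VV_def smv_apply)
lemma VV_sum: "(\<And>x. x \<in> A \<Longrightarrow> f x \<in> VV B) \<Longrightarrow> sum f A \<in> VV B" for f :: "'x \<Rightarrow> 'i \<Rightarrow> 'a::comm_ring_1"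
  by (induction A rule: infinite_finite_induct) (auto simp: VV_add)
lemma VV_ev: "b \<in> B \<Longrightarrow> ev b \<in> VV B" by (auto simp: VV_def ev_def)

lemma VV_expand:
  assumes "finite B" "v \<in> VV B"
  shows "v = (\<Sum>b\<in>B. v b \<star> (ev b :: 'i \<Rightarrow> 'a::comm_ring_1))"
proof
  fix i
  have "(\<Sum>b\<in>B. v b \<star> (ev b :: 'i \<Rightarrow> 'a)) i = (\<Sum>b\<in>B. if b = i then v i else 0)"
    unfolding sum_fun_apply by (rule sum.cong) (auto simp: ev_def smv_apply)
  also have "\<dots> = v i" using assms by (auto simp: VV_def)
  finally show "v i = (\<Sum>b\<in>B. v b \<star> (ev b :: 'i \<Rightarrow> 'a)) i" by simp
qed

lemma lin_expand: "finite B \<Longrightarrow> v \<in> VV B \<Longrightarrow> lin L \<Longrightarrow> L v = (\<Sum>b\<in>B. v b \<star> L (ev b))"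
  by (subst VV_expand[of B v]) (simp_all only: lin_sum lin_smv)

lemma VV_induct [consumes 2, case_names zero base add]:
  fixes v :: "'i \<Rightarrow> 'a::comm_ring_1"
  assumes "finite B" "v \<in> VV B" "P 0" "\<And>p b. b \<in> B \<Longrightarrow> P (p \<star> ev b)"
    "\<And>u v. u \<in> VV B \<Longrightarrow> v \<in> VV B \<Longrightarrow> P u \<Longrightarrow> P v \<Longrightarrow> P (u + v)"
  shows "P v"
proof -
  have "P (\<Sum>b\<in>A. v b \<star> ev b)" if "finite A" "A \<subseteq> B" for A
    using that
  proof (induction A)
    case (insert x F)
    have "(\<Sum>b\<in>F. v b \<star> (ev b :: 'i \<Rightarrow> 'a)) \<in> VV B"
      by (rule VV_sum) (use insert in \<open>auto intro: VV_smv VV_ev\<close>)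
    moreover have "v x \<star> (ev x :: 'i \<Rightarrow> 'a) \<in> VV B" using insert.prems by (intro VV_smv VV_ev) simp
    moreover have "P (v x \<star> ev x)" using insert.prems by (intro assms(4)) simp
    moreover have "P (\<Sum>b\<in>F. v b \<star> ev b)" using insert by simp
    ultimately have "P (v x \<star> ev x + (\<Sum>b\<in>F. v b \<star> ev b))" by (intro assms(5))
    with insert.hyps show ?case by simp
  qed (simp add: assms)
  from this[of B] assms(1,2) VV_expand[of B v] show ?thesis by simp
qed

text \<open>\<open>T\<close> is a set closed under addition that contains the products of the two
  coefficient sets, so the bound also applies to products of ideals such as
  \<open>TT\<close>.\<close>

lemma EV_lin:
  assumes "finite B" "v \<in> VV B" "lin L" "\<And>b. b \<in> B \<Longrightarrow> L (ev b) \<in> EV K1" "v \<in> EV K2"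
    and T: "0 \<in> T" "\<And>x y. x \<in> T \<Longrightarrow> y \<in> T \<Longrightarrow> x + y \<in> T" "\<And>x y. x \<in> K2 \<Longrightarrow> y \<in> K1 \<Longrightarrow> x * y \<in> T"
  shows "L v \<in> EV T"
proof -
  have "(\<Sum>b\<in>A. v b * L (ev b) i) \<in> T" if "A \<subseteq> B" for A i
    using finite_subset[OF that assms(1)] that
    by (induction A) (use assms in \<open>auto simp: EV_def\<close>)
  then show ?thesis
    using lin_expand[OF assms(1-3)] by (auto simp: EV_def sum_fun_apply vec_apply)
qed

section \<open>Homogeneous ideals, graded submodules and graded maps\<close>

definition hideal :: "(nat \<Rightarrow> nat) \<Rightarrow> 'k::field mpoly set \<Rightarrow> bool" where
  "hideal w K \<longleftrightarrow> 0 \<in> K \<and> (\<forall>p\<in>K. \<forall>q\<in>K. p + q \<in> K) \<and> (\<forall>r. \<forall>p\<in>K. r * p \<in> K) \<and> (\<forall>j. \<forall>p\<in>K. comp w j p \<in> K)"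

lemma hidealD: assumes "hideal w K"
  shows "0 \<in> K" "p \<in> K \<Longrightarrow> q \<in> K \<Longrightarrow> p + q \<in> K" "p \<in> K \<Longrightarrow> r * p \<in> K" "p \<in> K \<Longrightarrow> p * r \<in> K"
    "p \<in> K \<Longrightarrow> comp w j p \<in> K" "p \<in> K \<Longrightarrow> - p \<in> K" "p \<in> K \<Longrightarrow> q \<in> K \<Longrightarrow> p - q \<in> K"
proof -
  have mult: "r * p \<in> K" if "p \<in> K" for r p using assms that by (simp add: hideal_def)
  show "0 \<in> K" "p \<in> K \<Longrightarrow> q \<in> K \<Longrightarrow> p + q \<in> K" "p \<in> K \<Longrightarrow> r * p \<in> K" "p \<in> K \<Longrightarrow> comp w j p \<in> K"
    using assms by (simp_all add: hideal_def)
  show "p \<in> K \<Longrightarrow> p * r \<in> K" using mult[of p r] by (simp add: mult.commute)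
  show *: "p \<in> K \<Longrightarrow> - p \<in> K" for p using mult[of p "-1"] by simp
  have "p + (- q) \<in> K" if "p \<in> K" "q \<in> K" using assms *[of q] that unfolding hideal_def by blast
  then show "p \<in> K \<Longrightarrow> q \<in> K \<Longrightarrow> p - q \<in> K" by simp
qed

lemma hideal_mm: "hideal w (mm :: 'k::field mpoly set)"
  by (auto simp: hideal_def mm_def lookup_add lookup_mult_0 lookup_comp_0)

definition vcomp :: "(nat \<Rightarrow> nat) \<Rightarrow> ('i \<Rightarrow> int) \<Rightarrow> int \<Rightarrow> ('i \<Rightarrow> 'k::field mpoly) \<Rightarrow> 'i \<Rightarrow> 'k mpoly" where
  "vcomp w g j v = (\<lambda>i. comp w (j - g i) (v i))"

lemma vcomp_simps: "vcomp w g j 0 = 0" "vcomp w g j (u + v) = vcomp w g j u + vcomp w g j v"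
  "vcomp w g j (u - v) = vcomp w g j u - vcomp w g j v"
  "vcomp w g j (sum f A) = (\<Sum>x\<in>A. vcomp w g j (f x))"
  by (auto simp: vcomp_def fun_eq_iff comp_simps sum_fun_apply vec_apply)

lemma vcomp_smv: "vcomp w g i v = v \<Longrightarrow> vcomp w g j (p \<star> v) = comp w (j - i) p \<star> v"
proof
  fix x assume v: "vcomp w g i v = v"
  then have "comp w (i - g x) (v x) = v x" by (metis vcomp_def)
  from comp_mult'[OF this, of "j - g x" p] show "vcomp w g j (p \<star> v) x = (comp w (j - i) p \<star> v) x"
    by (simp add: vcomp_def smv_apply)
qed

lemma vcomp_vcomp: "vcomp w g i (vcomp w g j v) = (if i = j then vcomp w g j v else 0)"
  by (auto simp: vcomp_def comp_comp fun_eq_iff)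

lemma vcomp_ev: "vcomp w g (g b) (ev b) = (ev b :: 'i \<Rightarrow> 'k::field mpoly)"
proof -
  have "comp w 0 (1 :: 'k mpoly) = 1" using comp_sing0[of w "1 :: 'k"] by simp
  then show ?thesis by (auto simp: vcomp_def ev_def fun_eq_iff comp_simps)
qed

lemma VV_vcomp: "v \<in> VV B \<Longrightarrow> vcomp w g j v \<in> VV B"
  by (auto simp: VV_def vcomp_def comp_simps)

text \<open>Stated for all large enough \<open>S\<close>: comparing two of them shows that the
  components outside are 0.\<close>

lemma sum_vcomp: 
  assumes "finite B" "v \<in> VV B"
  shows "\<exists>S0. finite S0 \<and> (\<forall>S. finite S \<longrightarrow> S0 \<subseteq> S \<longrightarrow> (\<Sum>j\<in>S. vcomp w g j v) = v)"
proof (intro exI conjI allI impI)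
  let ?S = "\<Union>b\<in>B. (\<lambda>j. j + g b) ` monom_deg w ` mkeys (v b)"
  show "finite ?S" using assms by auto
  fix S assume S: "finite S" "?S \<subseteq> S"
  show "(\<Sum>j\<in>S. vcomp w g j v) = v"
  proof
    fix b
    show "(\<Sum>j\<in>S. vcomp w g j v) b = v b"
    proof (cases "b \<in> B")
      case True
      have "(\<Sum>j\<in>S. vcomp w g j v) b = (\<Sum>j\<in>S. comp w (j - g b) (v b))"
        by (simp add: sum_fun_apply vcomp_def)
      also have "\<dots> = (\<Sum>j\<in>(\<lambda>j. j - g b) ` S. comp w j (v b))"
        by (subst sum.reindex) (auto simp: inj_on_def)
      also have "\<dots> = v b"
      proof (rule sum_comp)
        show "monom_deg w ` mkeys (v b) \<subseteq> (\<lambda>j. j - g b) ` S"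
        proof (rule image_subsetI)
          fix m assume "m \<in> mkeys (v b)"
          then have "monom_deg w m + g b \<in> S" using True by (intro subsetD[OF S(2)]) blast
          then show "monom_deg w m \<in> (\<lambda>j. j - g b) ` S" by (rule rev_image_eqI) simp
        qed
      qed (use S in simp)
      finally show ?thesis .
    qed (use assms in \<open>auto simp: VV_def sum_fun_apply vcomp_def comp_simps\<close>)
  qed
qed

definition submod :: "(nat \<Rightarrow> nat) \<Rightarrow> ('i \<Rightarrow> int) \<Rightarrow> ('i \<Rightarrow> 'k::field mpoly) set \<Rightarrow> bool" where
  "submod w g K \<longleftrightarrow> 0 \<in> K \<and> (\<forall>u\<in>K. \<forall>v\<in>K. u + v \<in> K) \<and> (\<forall>p. \<forall>u\<in>K. p \<star> u \<in> K) \<and> (\<forall>j. \<forall>u\<in>K. vcomp w g j u \<in> K)"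

lemma submodD: assumes "submod w g K"
  shows "0 \<in> K" "u \<in> K \<Longrightarrow> v \<in> K \<Longrightarrow> u + v \<in> K" "u \<in> K \<Longrightarrow> p \<star> u \<in> K"
    "u \<in> K \<Longrightarrow> vcomp w g j u \<in> K" "u \<in> K \<Longrightarrow> - u \<in> K" "u \<in> K \<Longrightarrow> v \<in> K \<Longrightarrow> u - v \<in> K"
proof -
  show "0 \<in> K" "u \<in> K \<Longrightarrow> v \<in> K \<Longrightarrow> u + v \<in> K" "u \<in> K \<Longrightarrow> p \<star> u \<in> K" "u \<in> K \<Longrightarrow> vcomp w g j u \<in> K"
    using assms by (simp_all add: submod_def)
  have "(- 1) \<star> u \<in> K" if "u \<in> K" for u using assms that unfolding submod_def by blast
  then show *: "u \<in> K \<Longrightarrow> - u \<in> K" for u by (simp add: smv_simps)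
  have "u + (- v) \<in> K" if "u \<in> K" "v \<in> K" using assms *[of v] that unfolding submod_def by blast
  then show "u \<in> K \<Longrightarrow> v \<in> K \<Longrightarrow> u - v \<in> K" by simp
qed

lemma submod_sum: "submod w g K \<Longrightarrow> (\<And>x. x \<in> A \<Longrightarrow> f x \<in> K) \<Longrightarrow> sum f A \<in> K"
  by (induction A rule: infinite_finite_induct) (auto simp: submodD)

lemma submod_EV: "hideal w K \<Longrightarrow> submod w g (EV K)"
  by (auto simp: submod_def EV_def hidealD vcomp_def vec_apply)

lemma submod_VV: "submod w g (VV B)"
  by (auto simp: submod_def VV_vcomp VV_add VV_smv)

lemma submod_Int: "submod w g K \<Longrightarrow> submod w g K' \<Longrightarrow> submod w g (K \<inter> K')"
  by (simp add: submod_def)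

text \<open>Linear over the polynomial ring, so that \<open>lmap_EV\<close> applies to every
  homogeneous ideal and one and the same map descends modulo \<open>J\<close> and modulo
  \<open>mm\<close>. Outside \<open>VV B\<close> it is constrained by linearity alone.\<close>

definition lmap :: "(nat \<Rightarrow> nat) \<Rightarrow> 'i set \<Rightarrow> ('i \<Rightarrow> int) \<Rightarrow> 'j set \<Rightarrow> ('j \<Rightarrow> int) \<Rightarrow>
    (('i \<Rightarrow> 'k::field mpoly) \<Rightarrow> 'j \<Rightarrow> 'k mpoly) \<Rightarrow> bool" where
  "lmap w B g B' g' L \<longleftrightarrow> lin L \<and> (\<forall>v\<in>VV B. L v \<in> VV B') \<and>
    (\<forall>v\<in>VV B. \<forall>j. L (vcomp w g j v) = vcomp w g' j (L v))"

lemma lmapD: assumes "lmap w B g B' g' L"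
  shows "lin L" "\<And>v. v \<in> VV B \<Longrightarrow> L v \<in> VV B'" "\<And>v j. v \<in> VV B \<Longrightarrow> L (vcomp w g j v) = vcomp w g' j (L v)"
  using assms by (auto simp: lmap_def)

lemma lmap_compose: "lmap w B g B' g' L \<Longrightarrow> lmap w B' g' B'' g'' L' \<Longrightarrow> lmap w B g B'' g'' (\<lambda>v. L' (L v))"
  by (auto simp: lmap_def lin_compose)

lemma lmap_id: "lmap w B g B g (\<lambda>v. v)"
  by (auto simp: lmap_def lin_def)

lemma lmap_minus: "lmap w B g B' g' L \<Longrightarrow> lmap w B g B' g' L' \<Longrightarrow> lmap w B g B' g' (\<lambda>v. L v - L' v)"
  by (auto simp: lmap_def lin_minus VV_diff vcomp_simps)

lemma lmap_EV:
  assumes "finite B" "lmap w B g B' g' L" "hideal w K" "v \<in> VV B" "v \<in> EV K"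
  shows "L v \<in> EV K"
  by (rule EV_lin[of B v L UNIV K]) (use assms in \<open>auto simp: EV_def lmapD hidealD\<close>)

lemma lmap_of_basis:
  assumes "finite B" "\<And>b. b \<in> B \<Longrightarrow> t b \<in> VV B'" "\<And>b. b \<in> B \<Longrightarrow> vcomp w g' (g b) (t b) = t b"
  shows "lmap w B g B' g' (\<lambda>v. \<Sum>b\<in>B. v b \<star> t b)" (is "lmap _ _ _ _ _ ?L")
    and "b \<in> B \<Longrightarrow> (\<Sum>b'\<in>B. ev b b' \<star> t b') = t b"
proof -
  have "lin ?L" by (simp add: lin_def smv_simps sum.distrib smv_sum vec_apply)
  moreover have "?L v \<in> VV B'" for v by (intro VV_sum VV_smv assms)
  moreover have "?L (vcomp w g j v) = vcomp w g' j (?L v)" for v j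
    unfolding vcomp_simps by (rule sum.cong) (simp_all add: vcomp_smv[OF assms(3)], simp add: vcomp_def)
  ultimately show "lmap w B g B' g' ?L" by (simp add: lmap_def)
  assume "b \<in> B"
  have "(\<Sum>b'\<in>B. ev b b' \<star> t b') = (\<Sum>b'\<in>B. if b' = b then t b else 0)"
    by (rule sum.cong) (auto simp: ev_def smv_simps)
  then show "(\<Sum>b'\<in>B. ev b b' \<star> t b') = t b" using \<open>b \<in> B\<close> assms(1) by simp
qed

text \<open>Free modules are graded projective: a preimage is chosen for each basis element, and its
  component in the degree of that element is still a preimage because \<open>psi\<close>,
  \<open>E\<close> and \<open>K\<close> are graded.\<close>

lemma lmap_lift:
  assumes "finite B" and psi: "lmap w B g B0 g0 psi" and E: "lmap w B' g' B0 g0 E" and K: "submod w g0 K"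
    and ex: "\<And>v. v \<in> VV B \<Longrightarrow> \<exists>u\<in>VV B'. psi v - E u \<in> K"
  shows "\<exists>L. lmap w B g B' g' L \<and> (\<forall>v\<in>VV B. psi v - E (L v) \<in> K)"
proof -
  have "\<exists>t. t \<in> VV B' \<and> vcomp w g' (g b) t = t \<and> psi (ev b) - E t \<in> K" if b: "b \<in> B" for b
  proof -
    obtain u where u: "u \<in> VV B'" "psi (ev b) - E u \<in> K" using ex[OF VV_ev[OF b]] by blast
    have "psi (ev b) - E (vcomp w g' (g b) u) = vcomp w g0 (g b) (psi (ev b) - E u)"
      using lmapD(3)[OF psi VV_ev[OF b], of "g b"] lmapD(3)[OF E u(1), of "g b"]
      by (simp add: vcomp_ev vcomp_simps)
    then have "psi (ev b) - E (vcomp w g' (g b) u) \<in> K" using submodD(4)[OF K u(2)] by simp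
    then show ?thesis using VV_vcomp[OF u(1)] by (intro exI[of _ "vcomp w g' (g b) u"]) (simp add: vcomp_vcomp)
  qed
  then obtain t where t: "\<And>b. b \<in> B \<Longrightarrow> t b \<in> VV B'" "\<And>b. b \<in> B \<Longrightarrow> vcomp w g' (g b) (t b) = t b"
    "\<And>b. b \<in> B \<Longrightarrow> psi (ev b) - E (t b) \<in> K" by metis
  define L where "L = (\<lambda>v. \<Sum>b\<in>B. v b \<star> t b)"
  have L: "lmap w B g B' g' L" unfolding L_def by (rule lmap_of_basis) (use assms t in auto)
  have "psi v - E (L v) \<in> K" if v: "v \<in> VV B" for v
  proof -
    have "psi v - E (L v) = (\<Sum>b\<in>B. v b \<star> (psi (ev b) - E (t b)))"
      unfolding L_def using lin_expand[OF assms(1) v lmapD(1)[OF psi]]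
      by (simp only: lin_sum[OF lmapD(1)[OF E]] lin_smv[OF lmapD(1)[OF E]] smv_simps sum_subtractf)
    also have "\<dots> \<in> K" by (intro submod_sum[OF K] submodD(3)[OF K] t)
    finally show ?thesis .
  qed
  with L show ?thesis by blast
qed

section \<open>Exact complexes of free modules and comparison maps\<close>

locale hquot =
  fixes w :: "nat \<Rightarrow> nat" and J :: "'k::field mpoly set"
  assumes w: "\<And>i. w i \<ge> 1" and J: "hideal w J" and Jmm: "J \<subseteq> mm"
begin

text \<open>
  A complex \<open>\<dots> \<rightarrow> F\<^sub>1 \<rightarrow> F\<^sub>0 \<rightarrow> F\<^bsub>-1\<^esub>\<close> that is exact at all \<open>F\<^sub>i\<close> with \<open>i \<ge> 0\<close>; level \<open>Suc i\<close> stands for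
  \<open>F\<^sub>i\<close>. All \<open>F\<^sub>i\<close> are free modulo \<open>J\<close>, but level 0 is free modulo \<open>Z\<close>: this allows both \<open>F\<^bsub>-1\<^esub> = k\<close>
  (\<open>Z = mm\<close>) and \<open>F\<^bsub>-1\<^esub>\<close> a free module containing the resolved module (\<open>Z = J\<close>).
\<close>

definition zl :: "'k mpoly set \<Rightarrow> nat \<Rightarrow> 'k mpoly set" where
  "zl Z i = (if i = 0 then Z else J)"

definition pres :: "'k mpoly set \<Rightarrow> (nat \<Rightarrow> 'i set) \<Rightarrow> (nat \<Rightarrow> 'i \<Rightarrow> int) \<Rightarrow>
    (nat \<Rightarrow> ('i \<Rightarrow> 'k mpoly) \<Rightarrow> 'i \<Rightarrow> 'k mpoly) \<Rightarrow> bool" where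
  "pres Z B g D \<longleftrightarrow> hideal w Z \<and> J \<subseteq> Z \<and> (\<forall>i. finite (B i)) \<and>
    (\<forall>i. lmap w (B (Suc i)) (g (Suc i)) (B i) (g i) (D i)) \<and>
    (\<forall>i. \<forall>v\<in>VV (B (Suc i)). D i v \<in> EV (zl Z i) \<longleftrightarrow> (\<exists>u\<in>VV (B (Suc (Suc i))). v - D (Suc i) u \<in> EV J))"

text \<open>\<open>D 0\<close> is exempt, being the augmentation; the condition starts with the map
  from F_1 to F_0.\<close>

definition minim where
  "minim B D \<longleftrightarrow> (\<forall>i. \<forall>v\<in>VV (B (Suc (Suc i))). D (Suc i) v \<in> EV mm)"

lemma presD: assumes "pres Z B g D"
  shows "hideal w Z" "J \<subseteq> Z" "finite (B i)" "lmap w (B (Suc i)) (g (Suc i)) (B i) (g i) (D i)"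
    "lin (D i)" "v \<in> VV (B (Suc i)) \<Longrightarrow> D i v \<in> VV (B i)"
    "v \<in> VV (B (Suc i)) \<Longrightarrow> D i v \<in> EV (zl Z i) \<Longrightarrow> \<exists>u\<in>VV (B (Suc (Suc i))). v - D (Suc i) u \<in> EV J"
  using assms unfolding pres_def by (blast dest: lmapD(1,2))+

lemma pres_DD:
  assumes "pres Z B g D" "u \<in> VV (B (Suc (Suc i)))"
  shows "D i (D (Suc i) u) \<in> EV (zl Z i)"
proof -
  have "D (Suc i) u - D (Suc i) u \<in> EV J" using hidealD(1)[OF J] by (simp add: EV_def)
  then show ?thesis using assms presD(6)[OF assms] unfolding pres_def by blast
qed

lemma submod_J: "submod w g (EV J)" by (rule submod_EV[OF J])

lemma pres_shift:
  assumes "pres Z B g D"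
  shows "pres (zl Z n) (\<lambda>i. B (n + i)) (\<lambda>i. g (n + i)) (\<lambda>i. D (n + i))"
proof -
  have "hideal w (zl Z n)" "J \<subseteq> zl Z n" using presD[OF assms] J by (auto simp: zl_def)
  moreover have "zl (zl Z n) i = zl Z (n + i)" for i by (simp add: zl_def)
  ultimately show ?thesis using assms unfolding pres_def by simp
qed

text \<open>The comparison theorem. The start is prescribed on F_0, under the condition that
  boundaries go to cycles; this treats inclusions, projections and identifications of
  \<open>k\<close> alike.\<close>

lemma lift_chain:
  fixes BC :: "nat \<Rightarrow> 'i set" and BD :: "nat \<Rightarrow> 'j set"
  assumes C: "pres ZC BC gC DC" and D: "pres ZD BD gD DD"
    and f0: "lmap w (BC 1) (gC 1) (BD 1) (gD 1) f0"
    and compat: "\<And>v :: 'i \<Rightarrow> 'k mpoly. v \<in> VV (BC 2) \<Longrightarrow> DD 0 (f0 (DC 1 v)) \<in> EV ZD"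
  shows "\<exists>f. f 0 = f0 \<and> (\<forall>i. lmap w (BC (Suc i)) (gC (Suc i)) (BD (Suc i)) (gD (Suc i)) (f i)) \<and>
    (\<forall>i. \<forall>v\<in>VV (BC (Suc (Suc i))). DD (Suc i) (f (Suc i) v) - f i (DC (Suc i) v) \<in> EV J)"
proof -
  \<comment> \<open>The second clause, that \<open>h\<close> carries boundaries to cycles, is what
    makes the next lift possible.\<close>
  define P where "P i h \<longleftrightarrow> lmap w (BC (Suc i)) (gC (Suc i)) (BD (Suc i)) (gD (Suc i)) h \<and>
    (\<forall>v\<in>VV (BC (Suc (Suc i))). DD i (h (DC (Suc i) v)) \<in> EV (zl ZD i)) \<and> (i = 0 \<longrightarrow> h = f0)" for i h
  define Q where "Q i h h' \<longleftrightarrow> (\<forall>v\<in>VV (BC (Suc (Suc i))). DD (Suc i) (h' v) - h (DC (Suc i) v) \<in> EV J)" for i h h'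
  have "\<exists>f. \<forall>n. P n (f n) \<and> Q n (f n) (f (Suc n))"
  proof (rule dependent_nat_choice)
    show "\<exists>h. P 0 h" using f0 compat by (auto simp: P_def zl_def numeral_2_eq_2)
  next
    fix h i assume h: "P i h"
    then have hl: "lmap w (BC (Suc i)) (gC (Suc i)) (BD (Suc i)) (gD (Suc i)) h" by (simp add: P_def)
    note c = presD[OF C] note d = presD[OF D]
    have "\<exists>L. lmap w (BC (Suc (Suc i))) (gC (Suc (Suc i))) (BD (Suc (Suc i))) (gD (Suc (Suc i))) L \<and>
      (\<forall>v\<in>VV (BC (Suc (Suc i))). h (DC (Suc i) v) - DD (Suc i) (L v) \<in> EV J)"
    proof (rule lmap_lift[OF _ lmap_compose[OF c(4) hl] d(4) submod_J])
      fix v :: "'i \<Rightarrow> 'k mpoly" assume v: "v \<in> VV (BC (Suc (Suc i)))"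
      then have "h (DC (Suc i) v) \<in> VV (BD (Suc i))" using c(6) hl by (auto simp: lmapD)
      moreover have "DD i (h (DC (Suc i) v)) \<in> EV (zl ZD i)" using h v by (simp add: P_def)
      ultimately show "\<exists>u\<in>VV (BD (Suc (Suc i))). h (DC (Suc i) v) - DD (Suc i) u \<in> EV J"
        using d(7) by blast
    qed (rule c(3))
    then obtain L where L: "lmap w (BC (Suc (Suc i))) (gC (Suc (Suc i))) (BD (Suc (Suc i))) (gD (Suc (Suc i))) L"
      "\<And>v. v \<in> VV (BC (Suc (Suc i))) \<Longrightarrow> h (DC (Suc i) v) - DD (Suc i) (L v) \<in> EV J" by blast
    have "Q i h L" using submodD(5)[OF submod_J L(2)] by (auto simp: Q_def)
    moreover have "DD (Suc i) (L (DC (Suc (Suc i)) v)) \<in> EV J" if v: "v \<in> VV (BC (Suc (Suc (Suc i))))" for v :: "'i \<Rightarrow> 'k mpoly"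
    proof -
      let ?x = "DC (Suc (Suc i)) v"
      have x: "?x \<in> VV (BC (Suc (Suc i)))" using c(6) v by simp
      have "DC (Suc i) ?x \<in> EV J" using pres_DD[OF C v] by (simp add: zl_def)
      then have "h (DC (Suc i) ?x) \<in> EV J" using lmap_EV[OF _ hl J] c(3) c(6)[OF x] by blast
      from submodD(6)[OF submod_J this L(2)[OF x]] show ?thesis by simp
    qed
    ultimately show "\<exists>h'. P (Suc i) h' \<and> Q i h h'" using L(1) by (auto simp: P_def zl_def)
  qed
  then obtain f where "\<And>n. P n (f n) \<and> Q n (f n) (f (Suc n))" by blast
  then show ?thesis by (intro exI[of _ f]) (auto simp: P_def Q_def)
qed

text \<open>The endomorphism is homotopic to the identity, and on a minimal complex both homotopy
  terms \<open>D h\<close> and \<open>h D\<close> vanish modulo \<open>mm\<close>.\<close>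

lemma chain_endo_id_mod_mm:
  fixes B :: "nat \<Rightarrow> 'i set" and v :: "'i \<Rightarrow> 'k mpoly"
  assumes C: "pres Z B g D" and min: "minim B D"
    and f: "\<And>i. lmap w (B (Suc i)) (g (Suc i)) (B (Suc i)) (g (Suc i)) (f i)"
    and chain: "\<And>i v. v \<in> VV (B (Suc (Suc i))) \<Longrightarrow> D (Suc i) (f (Suc i) v) - f i (D (Suc i) v) \<in> EV J"
    and id0: "\<And>v. v \<in> VV (B 1) \<Longrightarrow> D 0 (f 0 v) - D 0 v \<in> EV Z"
    and v: "v \<in> VV (B (Suc i))"
  shows "f i v - v \<in> EV mm"
proof -
  note c = presD[OF C]
  note J6 = submodD(6)[OF submod_J] note J2 = submodD(2)[OF submod_J]
  have JE: "x \<in> EV J \<Longrightarrow> x \<in> EV mm" for x :: "'i \<Rightarrow> 'k mpoly" using Jmm by (auto simp: EV_def)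
  have mmS: "submod w g0 (EV mm)" for g0 :: "'i \<Rightarrow> int" by (rule submod_EV[OF hideal_mm])
  \<comment> \<open>Modulo \<open>J\<close>, \<open>f i - id - D h\<close> agrees with the previous
    homotopy composed with \<open>D\<close>, which is congruent to 0 on boundaries. This consequence
    suffices to continue, so the previous homotopy is not carried along.\<close>
  define P where "P i h \<longleftrightarrow> lmap w (B (Suc i)) (g (Suc i)) (B (Suc (Suc i))) (g (Suc (Suc i))) h \<and>
    (\<forall>v\<in>VV (B (Suc (Suc i))). f i (D (Suc i) v) - D (Suc i) v - D (Suc i) (h (D (Suc i) v)) \<in> EV J) \<and>
    (\<forall>v\<in>VV (B (Suc i)). f i v - v \<in> EV mm)" for i h
  have "\<exists>h. P i h" for i
  proof (induction i)
    case 0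
    have "\<exists>h. lmap w (B (Suc 0)) (g (Suc 0)) (B (Suc (Suc 0))) (g (Suc (Suc 0))) h \<and>
      (\<forall>v\<in>VV (B (Suc 0)). (f 0 v - v) - D (Suc 0) (h v) \<in> EV J)"
    proof (rule lmap_lift[OF _ lmap_minus[OF f lmap_id] c(4) submod_J])
      fix v :: "'i \<Rightarrow> 'k mpoly" assume v: "v \<in> VV (B (Suc 0))"
      then have fv: "f 0 v - v \<in> VV (B (Suc 0))" using lmapD(2)[OF f] by (auto intro: VV_diff)
      have "D 0 (f 0 v - v) \<in> EV (zl Z 0)" using id0 v c(5) by (simp add: lin_diff zl_def)
      then show "\<exists>u\<in>VV (B (Suc (Suc 0))). (f 0 v - v) - D (Suc 0) u \<in> EV J" by (rule c(7)[OF fv])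
    qed (rule c(3))
    then obtain h where h: "lmap w (B (Suc 0)) (g (Suc 0)) (B (Suc (Suc 0))) (g (Suc (Suc 0))) h"
      "\<And>v. v \<in> VV (B (Suc 0)) \<Longrightarrow> (f 0 v - v) - D (Suc 0) (h v) \<in> EV J" by blast
    have "f 0 v - v \<in> EV mm" if v: "v \<in> VV (B (Suc 0))" for v :: "'i \<Rightarrow> 'k mpoly"
    proof -
      have "D (Suc 0) (h v) \<in> EV mm" using min lmapD(2)[OF h(1) v] by (simp add: minim_def)
      from submodD(2)[OF mmS JE[OF h(2)[OF v]] this] show ?thesis by simp
    qed
    then have "P 0 h" using h c(6) by (simp add: P_def)
    then show ?case by blast
  next
    case (Suc i)
    then obtain h where h: "lmap w (B (Suc i)) (g (Suc i)) (B (Suc (Suc i))) (g (Suc (Suc i))) h"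
      "\<And>v. v \<in> VV (B (Suc (Suc i))) \<Longrightarrow> f i (D (Suc i) v) - D (Suc i) v - D (Suc i) (h (D (Suc i) v)) \<in> EV J"
      by (auto simp: P_def)
    let ?psi = "\<lambda>v. (f (Suc i) v - v) - h (D (Suc i) v)"
    have "\<exists>h'. lmap w (B (Suc (Suc i))) (g (Suc (Suc i))) (B (Suc (Suc (Suc i)))) (g (Suc (Suc (Suc i)))) h' \<and>
      (\<forall>v\<in>VV (B (Suc (Suc i))). ?psi v - D (Suc (Suc i)) (h' v) \<in> EV J)"
    proof (rule lmap_lift[OF _ lmap_minus[OF lmap_minus[OF f lmap_id] lmap_compose[OF c(4) h(1)]] c(4) submod_J])
      fix v :: "'i \<Rightarrow> 'k mpoly" assume v: "v \<in> VV (B (Suc (Suc i)))"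
      have pv: "?psi v \<in> VV (B (Suc (Suc i)))"
        using v lmapD(2)[OF f] lmapD(2)[OF h(1)] c(6) by (auto intro!: VV_diff)
      have "D (Suc i) (?psi v) = (D (Suc i) (f (Suc i) v) - f i (D (Suc i) v)) +
          (f i (D (Suc i) v) - D (Suc i) v - D (Suc i) (h (D (Suc i) v)))"
        using c(5) by (simp add: lin_diff)
      also have "\<dots> \<in> EV J" by (intro J2 chain h(2) v)
      finally have "D (Suc i) (?psi v) \<in> EV (zl Z (Suc i))" by (simp add: zl_def)
      then show "\<exists>u\<in>VV (B (Suc (Suc (Suc i)))). ?psi v - D (Suc (Suc i)) u \<in> EV J" by (rule c(7)[OF pv])
    qed (rule c(3))
    then obtain h' where h': "lmap w (B (Suc (Suc i))) (g (Suc (Suc i))) (B (Suc (Suc (Suc i)))) (g (Suc (Suc (Suc i)))) h'"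
      "\<And>v. v \<in> VV (B (Suc (Suc i))) \<Longrightarrow> ?psi v - D (Suc (Suc i)) (h' v) \<in> EV J" by blast
    have 1: "f (Suc i) v - v \<in> EV mm" if v: "v \<in> VV (B (Suc (Suc i)))" for v :: "'i \<Rightarrow> 'k mpoly"
    proof -
      have "D (Suc (Suc i)) (h' v) \<in> EV mm" using min lmapD(2)[OF h'(1) v] by (simp add: minim_def)
      then have a: "?psi v \<in> EV mm" using submodD(2)[OF mmS JE[OF h'(2)[OF v]]] by fastforce
      have "D (Suc i) v \<in> EV mm" using min v by (simp add: minim_def)
      then have "h (D (Suc i) v) \<in> EV mm" using lmap_EV[OF _ h(1) hideal_mm] c(3) c(6)[OF v] by blast
      from submodD(2)[OF mmS a this] show ?thesis by simp
    qed
    have 2: "f (Suc i) (D (Suc (Suc i)) v) - D (Suc (Suc i)) v - D (Suc (Suc i)) (h' (D (Suc (Suc i)) v)) \<in> EV J"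
      if v: "v \<in> VV (B (Suc (Suc (Suc i))))" for v :: "'i \<Rightarrow> 'k mpoly"
    proof -
      let ?x = "D (Suc (Suc i)) v"
      have x: "?x \<in> VV (B (Suc (Suc i)))" using c(6) v by simp
      have "D (Suc i) ?x \<in> EV J" using pres_DD[OF C v] by (simp add: zl_def)
      then have "h (D (Suc i) ?x) \<in> EV J" using lmap_EV[OF _ h(1) J] c(3) c(6)[OF x] by blast
      from J2[OF h'(2)[OF x] this] show ?thesis by (simp add: algebra_simps)
    qed
    have "P (Suc i) h'" using h'(1) 1 2 by (simp add: P_def)
    then show ?case by blast
  qed
  with v show ?thesis by (auto simp: P_def)
qed

end

section \<open>Minimal generators and minimal resolutions\<close>

text \<open>Generated by the variables of index at least \<open>e\<close>. An ideal containing it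
  has the same quotient as its trace on the polynomials in the first \<open>e\<close>
  variables.\<close>

definition kr :: "nat \<Rightarrow> 'k::field mpoly set" where
  "kr e = {p. rho {..<e} p = 0}"

lemma hideal_kr: "hideal w (kr e)"
  by (auto simp: hideal_def kr_def rho_simps rho_mult rho_comp comp_simps)

lemma rho_diff_kr: "rho {..<e} p - p \<in> kr e" "p - rho {..<e} p \<in> kr e"
  by (simp_all add: kr_def rho_simps rho_rho)

definition lcomb :: "('i \<Rightarrow> 'a::comm_ring_1) set \<Rightarrow> ('i \<Rightarrow> 'a) \<Rightarrow> bool" where
  "lcomb G v \<longleftrightarrow> (\<exists>c. v = (\<Sum>y\<in>G. c y \<star> y))"

lemma lcomb_0: "lcomb G 0"
  unfolding lcomb_def by (rule exI[of _ "\<lambda>_. 0"]) (simp add: smv_simps)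

lemma lcomb_add: "lcomb G u \<Longrightarrow> lcomb G v \<Longrightarrow> lcomb G (u + v)"
proof -
  assume "lcomb G u" "lcomb G v"
  then obtain c d where "u = (\<Sum>y\<in>G. c y \<star> y)" "v = (\<Sum>y\<in>G. d y \<star> y)" by (auto simp: lcomb_def)
  then have "u + v = (\<Sum>y\<in>G. (c y + d y) \<star> y)" by (simp add: smv_simps sum.distrib)
  then show ?thesis unfolding lcomb_def by (intro exI[of _ "\<lambda>y. c y + d y"])
qed

lemma lcomb_smv: "lcomb G u \<Longrightarrow> lcomb G (p \<star> u)"
proof -
  assume "lcomb G u"
  then obtain c where "u = (\<Sum>y\<in>G. c y \<star> y)" by (auto simp: lcomb_def)
  then have "p \<star> u = (\<Sum>y\<in>G. (p * c y) \<star> y)" by (simp add: smv_simps smv_sum)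
  then show ?thesis unfolding lcomb_def by (intro exI[of _ "\<lambda>y. p * c y"])
qed

lemma lcomb_base: "finite G \<Longrightarrow> y \<in> G \<Longrightarrow> lcomb G y"
proof -
  assume G: "finite G" "y \<in> G"
  have "(\<Sum>z\<in>G. (if z = y then 1 else 0) \<star> z) = (\<Sum>z\<in>G. if z = y then y else 0)"
    by (rule sum.cong) (auto simp: smv_simps)
  also have "\<dots> = y" using G by simp
  finally show ?thesis unfolding lcomb_def by (intro exI[of _ "\<lambda>z. if z = y then 1 else 0"]) simp
qed

lemma lcomb_sum: "(\<And>x. x \<in> A \<Longrightarrow> lcomb G (f x)) \<Longrightarrow> lcomb G (sum f A)"
  by (induction A rule: infinite_finite_induct) (auto simp: lcomb_0 lcomb_add)

lemma lcomb_trans: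
  assumes "\<And>y. y \<in> G \<Longrightarrow> lcomb G' y" "lcomb G u"
  shows "lcomb G' u"
proof -
  obtain c where "u = (\<Sum>y\<in>G. c y \<star> y)" using assms(2) by (auto simp: lcomb_def)
  then show ?thesis using assms(1) by (simp add: lcomb_sum lcomb_smv)
qed

lemma lcomb_mono: "finite G' \<Longrightarrow> G \<subseteq> G' \<Longrightarrow> lcomb G u \<Longrightarrow> lcomb G' u"
  using lcomb_trans[of G G'] lcomb_base[of G'] by blast

text \<open>Induction on the rank: the coordinates at a new basis index \<open>b\<close> form a
  homogeneous ideal, whose generators lift to homogeneous vectors; what they leave over lies in
  \<open>K \<inter> VV B\<close>.\<close>

lemma graded_submodule_finite_basis:
  fixes K :: "('i \<Rightarrow> 'k::field mpoly) set"
  assumes w: "\<And>i. w i \<ge> 1" and "finite B" and K: "submod w g K" "K \<subseteq> VV B" "EV (kr e) \<inter> VV B \<subseteq> K"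
  shows "\<exists>G. finite G \<and> G \<subseteq> K \<and> (\<forall>y\<in>G. \<exists>j. vcomp w g j y = y) \<and>
    (\<forall>v\<in>K. \<exists>u. lcomb G u \<and> v - u \<in> EV (kr e))"
  using assms(2-)
proof (induction B arbitrary: K rule: finite_induct)
  case empty
  then show ?case
    by (intro exI[of _ "{}"]) (auto simp: lcomb_def VV_def EV_def hidealD(1)[OF hideal_kr])
next
  case (insert b B)
  note K = insert.prems
  note kr = hidealD[OF hideal_kr[of w e]]
  define L where "L = (\<lambda>v. v b) ` K"
  have "\<exists>G. finite G \<and> G \<subseteq> L \<and> (\<forall>g\<in>G. \<exists>j. comp w j g = g) \<and>
    (\<forall>p\<in>L. \<exists>c. rho {..<e} p = (\<Sum>g\<in>G. c g * g))"
  proof (rule homogeneous_ideal_finite_basis[OF w])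
    show "0 \<in> L" unfolding L_def using submodD(1)[OF K(1)] by (rule rev_image_eqI) simp
    show "p + q \<in> L" if "p \<in> L" "q \<in> L" for p q
    proof -
      from that obtain u v where uv: "u \<in> K" "v \<in> K" "p = u b" "q = v b" by (auto simp: L_def)
      then have "p + q = (u + v) b" by (simp add: vec_apply)
      then show ?thesis unfolding L_def using submodD(2)[OF K(1) uv(1,2)] by blast
    qed
    show "r * p \<in> L" if "p \<in> L" for r p
    proof -
      from that obtain u where uv: "u \<in> K" "p = u b" by (auto simp: L_def)
      then have "r * p = (r \<star> u) b" by (simp add: vec_apply)
      then show ?thesis unfolding L_def using submodD(3)[OF K(1) uv(1)] by blast
    qed
    show "comp w j p \<in> L" if "p \<in> L" for j p
    proof -
      from that obtain u where uv: "u \<in> K" "p = u b" by (auto simp: L_def)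
      then have "comp w j p = (vcomp w g (j + g b) u) b" by (simp add: vcomp_def)
      then show ?thesis unfolding L_def using submodD(4)[OF K(1) uv(1)] by blast
    qed
    show "rho {..<e} p \<in> L" if "p \<in> L" for p
    proof -
      from that obtain u where uv: "u \<in> K" "p = u b" by (auto simp: L_def)
      let ?d = "(rho {..<e} p - p) \<star> ev b :: 'i \<Rightarrow> 'k mpoly"
      have "?d \<in> EV (kr e) \<inter> VV (insert b B)"
        using rho_diff_kr(1)[of e p] by (auto simp: EV_def vec_apply ev_apply kr(1) intro: VV_smv VV_ev)
      then have "u + ?d \<in> K" using K(3) uv(1) by (intro submodD(2)[OF K(1)]) auto
      moreover have "rho {..<e} p = (u + ?d) b" using uv(2) by (simp add: vec_apply ev_apply)
      ultimately show ?thesis unfolding L_def by blast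
    qed
  qed
  then obtain G0 where G0: "finite G0" "G0 \<subseteq> L" "\<forall>g\<in>G0. \<exists>j. comp w j g = g"
    "\<forall>p\<in>L. \<exists>c. rho {..<e} p = (\<Sum>g\<in>G0. c g * g)" by blast
  have "\<exists>y. y \<in> K \<and> y b = l \<and> (\<exists>j. vcomp w g j y = y)" if l: "l \<in> G0" for l
  proof -
    obtain v where v: "v \<in> K" "v b = l" using G0(2) l by (auto simp: L_def)
    obtain j where j: "comp w j l = l" using G0(3) l by blast
    show ?thesis
      using submodD(4)[OF K(1) v(1), of "j + g b"] v(2) j
      by (intro exI[of _ "vcomp w g (j + g b) v"])
        (auto simp: vcomp_vcomp intro!: exI[of _ "j + g b"], simp add: vcomp_def)
  qed
  then obtain y where y: "\<And>l. l \<in> G0 \<Longrightarrow> y l \<in> K" "\<And>l. l \<in> G0 \<Longrightarrow> y l b = l"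
    "\<And>l. l \<in> G0 \<Longrightarrow> \<exists>j. vcomp w g j (y l) = y l" by metis
  have "submod w g (K \<inter> VV B)" by (rule submod_Int[OF K(1) submod_VV])
  moreover have "EV (kr e) \<inter> VV B \<subseteq> K \<inter> VV B" using K(3) by (auto simp: VV_def)
  ultimately obtain G1 where G1: "finite G1" "G1 \<subseteq> K \<inter> VV B" "\<forall>y\<in>G1. \<exists>j. vcomp w g j y = y"
    "\<forall>v\<in>K \<inter> VV B. \<exists>u. lcomb G1 u \<and> v - u \<in> EV (kr e)" using insert.IH[of "K \<inter> VV B"] by auto
  let ?G = "y ` G0 \<union> G1"
  have "\<exists>u. lcomb ?G u \<and> v - u \<in> EV (kr e)" if v: "v \<in> K" for v
  proof -
    have "v b \<in> L" using v by (auto simp: L_def)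
    then obtain c where c: "rho {..<e} (v b) = (\<Sum>l\<in>G0. c l * l)" using G0(4) by blast
    let ?u0 = "\<Sum>l\<in>G0. c l \<star> y l"
    have u0: "lcomb ?G ?u0" using G0(1) G1(1) by (intro lcomb_sum lcomb_smv lcomb_base) auto
    have u0K: "?u0 \<in> K" by (intro submod_sum[OF K(1)] submodD(3)[OF K(1)] y)
    have "?u0 b = (\<Sum>l\<in>G0. c l * l)" unfolding sum_fun_apply by (rule sum.cong) (auto simp: vec_apply y)
    then have u0b: "(v - ?u0) b \<in> kr e" using c rho_diff_kr(2)[of "v b" e] by (simp add: vec_apply)
    \<comment> \<open>The coordinate at \<open>b\<close> is cancelled only modulo
      \<open>kr e\<close>; \<open>?d\<close> removes the remainder so that the rest lies exactly in
      \<open>VV B\<close>.\<close>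
    let ?d = "(v - ?u0) b \<star> ev b :: 'i \<Rightarrow> 'k mpoly"
    have d: "?d \<in> EV (kr e)" "?d \<in> VV (insert b B)"
      using u0b by (auto simp: EV_def vec_apply ev_apply kr(1) intro: VV_smv VV_ev)
    define v' where "v' = v - ?u0 - ?d"
    have "v' \<in> K" unfolding v'_def using d K(3) by (intro submodD(6)[OF K(1)] v u0K) auto
    moreover have "v' \<in> VV B"
      using \<open>v' \<in> K\<close> K(2) unfolding v'_def by (auto simp: VV_def vec_apply ev_apply)
    ultimately obtain u1 where u1: "lcomb G1 u1" "v' - u1 \<in> EV (kr e)" using G1(4) by blast
    have "lcomb ?G (?u0 + u1)" using lcomb_mono[OF _ _ u1(1), of ?G] G0(1) G1(1) u0 by (intro lcomb_add) auto
    moreover have "v - (?u0 + u1) = (v' - u1) + ?d" by (simp add: v'_def algebra_simps)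
    then have "v - (?u0 + u1) \<in> EV (kr e)"
      using submodD(2)[OF submod_EV[OF hideal_kr] u1(2) d(1)] by (simp only:)
    ultimately show ?thesis by blast
  qed
  then show ?case using G0 G1 y by (intro exI[of _ ?G]) blast
qed

text \<open>Graded Nakayama: in a generating set of least cardinality, a relation with a coefficient
  outside \<open>mm\<close> would make a generator redundant, since the constant term of that
  coefficient is a unit.\<close>

lemma minimal_generators:
  fixes K :: "('i \<Rightarrow> 'k::field mpoly) set"
  assumes w: "\<And>i. w i \<ge> 1" and "finite B" and K: "submod w g K" "K \<subseteq> VV B"
    and Z: "hideal w Z" "kr e \<subseteq> Z" "EV Z \<inter> VV B \<subseteq> K"
  shows "\<exists>G dg. finite G \<and> G \<subseteq> K \<and> (\<forall>y\<in>G. vcomp w g (dg y) y = y) \<and>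
    (\<forall>v\<in>K. \<exists>u. lcomb G u \<and> v - u \<in> EV Z) \<and>
    (\<forall>c. (\<Sum>y\<in>G. c y \<star> y) \<in> EV Z \<longrightarrow> (\<forall>y\<in>G. c y \<in> mm))"
proof -
  define P where "P G \<longleftrightarrow> finite G \<and> G \<subseteq> K \<and> (\<forall>y\<in>G. \<exists>j. vcomp w g j y = y) \<and>
    (\<forall>v\<in>K. \<exists>u. lcomb G u \<and> v - u \<in> EV Z)" for G
  have EVZ: "submod w g (EV Z :: ('i \<Rightarrow> 'k mpoly) set)" by (rule submod_EV[OF Z(1)])
  have "EV (kr e) \<inter> VV B \<subseteq> K" using Z(2,3) by (auto simp: EV_def)
  from graded_submodule_finite_basis[OF w assms(2) K this] obtain G' where
    "finite G' \<and> G' \<subseteq> K \<and> (\<forall>y\<in>G'. \<exists>j. vcomp w g j y = y) \<and>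
      (\<forall>v\<in>K. \<exists>u. lcomb G' u \<and> v - u \<in> EV (kr e))" by (elim exE)
  moreover have "EV (kr e) \<subseteq> (EV Z :: ('i \<Rightarrow> 'k mpoly) set)" using Z(2) by (auto simp: EV_def)
  ultimately have "P G'" unfolding P_def by blast
  then obtain G where G: "P G" and least: "\<And>G'. P G' \<Longrightarrow> card G \<le> card G'"
    using ex_has_least_nat[of P G' card] by blast
  from G have G': "finite G" "G \<subseteq> K" "\<And>v. v \<in> K \<Longrightarrow> \<exists>u. lcomb G u \<and> v - u \<in> EV Z" by (auto simp: P_def)
  from G obtain dg where dg: "\<And>y. y \<in> G \<Longrightarrow> vcomp w g (dg y) y = y" unfolding P_def by metis
  have "c y0 \<in> mm" if c: "(\<Sum>y\<in>G. c y \<star> y) \<in> EV Z" and y0: "y0 \<in> G" for c y0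
  proof (rule ccontr)
    assume nc: "c y0 \<notin> mm"
    define k where "k = lkp (c y0) 0"
    have k: "k \<noteq> 0" using nc by (simp add: k_def mm_def)
    \<comment> \<open>The part of the relation in the degree of \<open>y0\<close>, rescaled: there
      the coefficient of \<open>y0\<close> has degree 0, hence is a constant, and becomes 1.\<close>
    define c' where "c' y = sing 0 (1 / k) * comp w (dg y0 - dg y) (c y)" for y
    have "vcomp w g (dg y0) (\<Sum>y\<in>G. c y \<star> y) \<in> EV Z" by (rule submodD(4)[OF EVZ c])
    also have "vcomp w g (dg y0) (\<Sum>y\<in>G. c y \<star> y) = (\<Sum>y\<in>G. comp w (dg y0 - dg y) (c y) \<star> y)"
      unfolding vcomp_simps by (rule sum.cong) (auto simp: vcomp_smv[OF dg])
    finally have "sing 0 (1 / k) \<star> (\<Sum>y\<in>G. comp w (dg y0 - dg y) (c y) \<star> y) \<in> EV Z" by (rule submodD(3)[OF EVZ])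
    then have c'Z: "(\<Sum>y\<in>G. c' y \<star> y) \<in> EV Z" by (simp add: smv_sum smv_simps c'_def)
    have "c' y0 = 1" using k by (simp add: c'_def comp_0[OF w] k_def[symmetric] mult_single)
    then have "(\<Sum>y\<in>G. c' y \<star> y) = y0 + (\<Sum>y\<in>G - {y0}. c' y \<star> y)"
      using sum.remove[OF G'(1) y0, of "\<lambda>y. c' y \<star> y"] by (simp add: smv_simps)
    with c'Z have red: "y0 - - (\<Sum>y\<in>G - {y0}. c' y \<star> y) \<in> EV Z" by simp
    let ?G = "G - {y0}"
    have lc: "lcomb ?G (- (\<Sum>y\<in>G - {y0}. c' y \<star> y))"
    proof -
      have "lcomb ?G (\<Sum>y\<in>?G. c' y \<star> y)" using G'(1) by (intro lcomb_sum lcomb_smv lcomb_base) auto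
      from lcomb_smv[OF this, of "-1"] show ?thesis by (simp add: smv_simps)
    qed
    have "\<exists>u. lcomb ?G u \<and> v - u \<in> EV Z" if v: "v \<in> K" for v
    proof -
      obtain u where u: "lcomb G u" "v - u \<in> EV Z" using G'(3)[OF v] by blast
      then obtain d where d: "u = (\<Sum>y\<in>G. d y \<star> y)" by (auto simp: lcomb_def)
      let ?u = "(\<Sum>y\<in>?G. d y \<star> y) + d y0 \<star> - (\<Sum>y\<in>G - {y0}. c' y \<star> y)"
      have "lcomb ?G ?u" using G'(1) by (intro lcomb_add lcomb_smv[OF lc] lcomb_sum lcomb_smv lcomb_base) auto
      moreover have "v - ?u = (v - u) + d y0 \<star> (y0 - - (\<Sum>y\<in>G - {y0}. c' y \<star> y))"
        using d sum.remove[OF G'(1) y0, of "\<lambda>y. d y \<star> y"] by (simp add: smv_simps)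
      then have "v - ?u \<in> EV Z"
        using submodD(2)[OF EVZ u(2) submodD(3)[OF EVZ red], of "d y0"] by (simp only:)
      ultimately show ?thesis by blast
    qed
    then have "P ?G" using G unfolding P_def by auto
    from least[OF this] show False using y0 G'(1) by (metis card_Diff1_less not_less)
  qed
  then have "\<forall>c. (\<Sum>y\<in>G. c y \<star> y) \<in> EV Z \<longrightarrow> (\<forall>y\<in>G. c y \<in> mm)" by blast
  with G' dg show ?thesis by (intro exI[of _ G] exI[of _ dg] conjI) auto
qed

context hquot
begin

lemma free_cover:
  fixes K :: "('i \<Rightarrow> 'k mpoly) set"
  assumes "finite B" and K: "submod w g K" "K \<subseteq> VV B"
    and Z: "hideal w Z" "kr e \<subseteq> Z" "EV Z \<inter> VV B \<subseteq> K"
  shows "\<exists>a L. lmap w {..<length a} (nth a) B g L \<and> (\<forall>v\<in>VV {..<length a}. L v \<in> K) \<and>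
    (\<forall>v\<in>K. \<exists>u\<in>VV {..<length a}. v - L u \<in> EV Z) \<and>
    (\<forall>u\<in>VV {..<length a}. L u \<in> EV Z \<longrightarrow> u \<in> EV mm)"
proof -
  from minimal_generators[OF w assms] obtain G dg where
    G0: "finite G \<and> G \<subseteq> K \<and> (\<forall>y\<in>G. vcomp w g (dg y) y = y) \<and>
      (\<forall>v\<in>K. \<exists>u. lcomb G u \<and> v - u \<in> EV Z) \<and>
      (\<forall>c. (\<Sum>y\<in>G. c y \<star> y) \<in> EV Z \<longrightarrow> (\<forall>y\<in>G. c y \<in> mm))"
    by (elim exE)
  then have G: "finite G" "G \<subseteq> K" "\<And>y. y \<in> G \<Longrightarrow> vcomp w g (dg y) y = y"
    "\<And>v. v \<in> K \<Longrightarrow> \<exists>u. lcomb G u \<and> v - u \<in> EV Z"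
    by simp_all
  have Gmm: "c y \<in> mm" if "(\<Sum>y\<in>G. c y \<star> y) \<in> EV Z" "y \<in> G" for c y using G0 that by blast
  obtain ys where ys: "set ys = G" "distinct ys" using finite_distinct_list[OF G(1)] by blast
  define a where "a = map dg ys"
  let ?S = "{..<length a}"
  have bij: "bij_betw (nth ys) ?S G" using bij_betw_nth[OF ys(2)] ys(1) by (simp add: a_def)
  define L where "L = (\<lambda>v :: nat \<Rightarrow> 'k mpoly. \<Sum>l\<in>?S. v l \<star> ys ! l)"
  have ysG: "ys ! l \<in> G" if "l \<in> ?S" for l using that ys(1) by (auto simp: a_def)
  have L: "lmap w ?S (nth a) B g L"
    unfolding L_def
  proof (rule lmap_of_basis)
    fix l assume "l \<in> ?S"
    then show "ys ! l \<in> VV B" "vcomp w g (a ! l) (ys ! l) = ys ! l"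
      using ysG[of l] G K(2) by (auto simp: a_def)
  qed simp
  have LG: "L v = (\<Sum>y\<in>G. v (the_inv_into ?S (nth ys) y) \<star> y)" for v
    unfolding L_def using bij
    by (subst sum.reindex_bij_betw[OF bij, symmetric])
      (auto intro!: sum.cong simp: the_inv_into_f_f bij_betw_def)
  have "L v \<in> K" for v unfolding L_def using ysG G(2) by (intro submod_sum[OF K(1)] submodD(3)[OF K(1)]) auto
  moreover have "\<exists>u\<in>VV ?S. v - L u \<in> EV Z" if v: "v \<in> K" for v
  proof -
    obtain c where c: "v - (\<Sum>y\<in>G. c y \<star> y) \<in> EV Z" using G(4)[OF v] by (auto simp: lcomb_def)
    let ?u = "\<lambda>l. if l \<in> ?S then c (ys ! l) else 0"
    have "L ?u = (\<Sum>l\<in>?S. c (ys ! l) \<star> ys ! l)" unfolding L_def by (rule sum.cong) auto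
    also have "\<dots> = (\<Sum>y\<in>G. c y \<star> y)" by (rule sum.reindex_bij_betw[OF bij])
    finally have "v - L ?u \<in> EV Z" using c by simp
    moreover have "?u \<in> VV ?S" by (simp add: VV_def)
    ultimately show ?thesis by blast
  qed
  moreover have "u \<in> EV mm" if u: "u \<in> VV ?S" "L u \<in> EV Z" for u
  proof -
    have "u l \<in> mm" if l: "l \<in> ?S" for l
      using Gmm[OF u(2)[unfolded LG] ysG[OF l]] bij l by (simp add: the_inv_into_f_f bij_betw_def)
    then have "u l \<in> mm" for l using u(1) hidealD(1)[OF hideal_mm] by (cases "l \<in> ?S") (auto simp: VV_def)
    then show ?thesis by (simp add: EV_def)
  qed
  ultimately show ?thesis using L by blast
qed

definition lvl :: "'x \<Rightarrow> (nat \<Rightarrow> 'x) \<Rightarrow> nat \<Rightarrow> 'x" where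
  "lvl x f i = (case i of 0 \<Rightarrow> x | Suc i \<Rightarrow> f i)"

lemma lvl_simps [simp]: "lvl x f 0 = x" "lvl x f (Suc i) = f i"
  by (simp_all add: lvl_def)

text \<open>Minimal free covers are taken of \<open>K\<close> and then of each successive kernel.
  Minimality of one cover puts its kernel into \<open>EV mm\<close>, and this is minimality of the
  next differential.\<close>

lemma minimal_pres_exists:
  fixes K :: "(nat \<Rightarrow> 'k mpoly) set"
  assumes B: "finite B" and K: "submod w g K" "K \<subseteq> VV B"
    and Z: "hideal w Z" "J \<subseteq> Z" "EV Z \<inter> VV B \<subseteq> K" and e: "kr e \<subseteq> J"
  shows "\<exists>a D. pres Z (lvl B (\<lambda>i. {..<length (a i)})) (lvl g (\<lambda>i. nth (a i))) D \<and>
    minim (lvl B (\<lambda>i. {..<length (a i)})) D \<and>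
    (\<forall>v\<in>VV {..<length (a 0)}. D 0 v \<in> K) \<and> (\<forall>v\<in>K. \<exists>u\<in>VV {..<length (a 0)}. v - D 0 u \<in> EV Z) \<and>
    (\<forall>u\<in>VV {..<length (a 0)}. D 0 u \<in> EV Z \<longrightarrow> u \<in> EV mm)"
proof -
  let ?S = "\<lambda>a :: int list. {..<length a}"
  define ker where "ker Z s = {u \<in> VV (?S (fst s)). snd s u \<in> EV Z}"
    for Z :: "'k mpoly set" and s :: "int list \<times> ((nat \<Rightarrow> 'k mpoly) \<Rightarrow> nat \<Rightarrow> 'k mpoly)"
  define cover where "cover K B g Z s \<longleftrightarrow> lmap w (?S (fst s)) (nth (fst s)) B g (snd s) \<and>
      (\<forall>v\<in>VV (?S (fst s)). snd s v \<in> K) \<and> (\<forall>v\<in>K. \<exists>u\<in>VV (?S (fst s)). v - snd s u \<in> EV Z) \<and>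
      ker Z s \<subseteq> EV mm" for K B g Z and s :: "int list \<times> ((nat \<Rightarrow> 'k mpoly) \<Rightarrow> nat \<Rightarrow> 'k mpoly)"
  have cover_ex: "\<exists>s. cover K B g Z s"
    if h: "finite B" "submod w g K" "K \<subseteq> VV B" "hideal w Z" "J \<subseteq> Z" "EV Z \<inter> VV B \<subseteq> K" for K :: "(nat \<Rightarrow> 'k mpoly) set" and B g Z
  proof -
    obtain a L where aL: "lmap w {..<length a} (nth a) B g L" "\<forall>v\<in>VV {..<length a}. L v \<in> K"
      "\<forall>v\<in>K. \<exists>u\<in>VV {..<length a}. v - L u \<in> EV Z" "\<forall>u\<in>VV {..<length a}. L u \<in> EV Z \<longrightarrow> u \<in> EV mm"
      using free_cover[OF h(1-4) order_trans[OF e h(5)] h(6)] by blast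
    then have "cover K B g Z (a, L)" by (auto simp: cover_def ker_def)
    then show ?thesis by blast
  qed
  \<comment> \<open>The target of the map varies along the construction and is therefore quantified
    away; the clause for \<open>i = 0\<close> pins down the initial cover of
    \<open>K\<close>.\<close>
  define P where "P i s \<longleftrightarrow> (\<exists>B g. lmap w (?S (fst s)) (nth (fst s)) B g (snd s)) \<and> (i = 0 \<longrightarrow> cover K B g Z s) \<and>
    ker (zl Z i) s \<subseteq> EV mm" for i s
  define Q where "Q i s s' \<longleftrightarrow> cover (ker (zl Z i) s) (?S (fst s)) (nth (fst s)) J s'" for i s s'
  have zl: "hideal w (zl Z i)" "J \<subseteq> zl Z i" for i using Z J by (auto simp: zl_def)
  have "\<exists>s. \<forall>n. P n (s n) \<and> Q n (s n) (s (Suc n))"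
  proof (rule dependent_nat_choice)
    show "\<exists>s. P 0 s" using cover_ex[OF B K Z] by (auto simp: P_def cover_def zl_def)
  next
    fix s i assume s: "P i s"
    then obtain B0 g0 where s0: "lmap w (?S (fst s)) (nth (fst s)) B0 g0 (snd s)" by (auto simp: P_def)
    have EVs: "submod w g0 (EV (zl Z i))" by (rule submod_EV[OF zl(1)])
    have "submod w (nth (fst s)) (ker (zl Z i) s)"
      using submodD(1-4)[OF EVs] lmapD(3)[OF s0]
      unfolding submod_def ker_def
      by (auto simp: lin_0[OF lmapD(1)[OF s0]] lin_add[OF lmapD(1)[OF s0]] lin_smv[OF lmapD(1)[OF s0]]
          intro: VV_add VV_smv VV_vcomp)
    moreover have "EV J \<inter> VV (?S (fst s)) \<subseteq> ker (zl Z i) s"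
      using lmap_EV[OF _ s0 J] zl(2) by (auto simp: ker_def EV_def)
    ultimately obtain s' where s': "Q i s s'"
      unfolding Q_def using cover_ex[of "?S (fst s)" "nth (fst s)" "ker (zl Z i) s" J] J by (auto simp: ker_def)
    then have "P (Suc i) s'" by (auto simp: P_def Q_def cover_def zl_def)
    with s' show "\<exists>s'. P (Suc i) s' \<and> Q i s s'" by blast
  qed
  then obtain s where P: "\<And>i. P i (s i)" and Q: "\<And>i. Q i (s i) (s (Suc i))" by blast
  define a where "a i = fst (s i)" for i
  define D where "D i = snd (s i)" for i
  let ?B = "lvl B (\<lambda>i. ?S (a i))" and ?g = "lvl g (\<lambda>i. nth (a i))"
  have c0: "cover K B g Z (s 0)" using P[of 0] by (simp add: P_def)
  have l: "lmap w (?B (Suc i)) (?g (Suc i)) (?B i) (?g i) (D i)" for i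
    using c0 Q by (cases i) (auto simp: cover_def a_def D_def Q_def)
  have ex: "D i v \<in> EV (zl Z i) \<longleftrightarrow> (\<exists>u\<in>VV (?S (a (Suc i))). v - D (Suc i) u \<in> EV J)"
    if v: "v \<in> VV (?S (a i))" for i and v :: "nat \<Rightarrow> 'k mpoly"
  proof
    assume "D i v \<in> EV (zl Z i)"
    then have "v \<in> ker (zl Z i) (s i)" using v by (simp add: ker_def a_def D_def)
    then show "\<exists>u\<in>VV (?S (a (Suc i))). v - D (Suc i) u \<in> EV J"
      using Q[of i] by (auto simp: Q_def cover_def a_def D_def)
  next
    assume "\<exists>u\<in>VV (?S (a (Suc i))). v - D (Suc i) u \<in> EV J"
    then obtain u where u: "u \<in> VV (?S (a (Suc i)))" "v - D (Suc i) u \<in> EV J" by blast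
    have Du: "D (Suc i) u \<in> ker (zl Z i) (s i)" using Q[of i] u(1) by (auto simp: Q_def cover_def a_def D_def)
    then have "v - D (Suc i) u \<in> VV (?S (a i))" using v by (auto simp: ker_def a_def intro: VV_diff)
    then have "D i (v - D (Suc i) u) \<in> EV J" using lmap_EV[OF _ l[of i] J _ u(2)] by simp
    then have "D i (v - D (Suc i) u) \<in> EV (zl Z i)" using zl(2) by (auto simp: EV_def)
    moreover have "D i (D (Suc i) u) \<in> EV (zl Z i)" using Du by (simp add: ker_def D_def)
    ultimately have "D i (v - D (Suc i) u) + D i (D (Suc i) u) \<in> EV (zl Z i)"
      by (rule submodD(2)[OF submod_EV[OF zl(1)]])
    then show "D i v \<in> EV (zl Z i)" using lin_add[OF lmapD(1)[OF l[of i]], symmetric] by simp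
  qed
  have "finite (?B i)" for i using B by (cases i) auto
  then have "pres Z ?B ?g D" unfolding pres_def using Z l ex by simp
  moreover have "minim ?B D"
    unfolding minim_def
  proof (intro allI ballI)
    fix i and v :: "nat \<Rightarrow> 'k mpoly" assume v: "v \<in> VV (?B (Suc (Suc i)))"
    then have "D (Suc i) v \<in> ker (zl Z i) (s i)" using Q[of i] by (auto simp: Q_def cover_def a_def D_def)
    then show "D (Suc i) v \<in> EV mm" using P[of i] by (auto simp: P_def)
  qed
  ultimately show ?thesis using c0
    by (intro exI[of _ a] exI[of _ D]) (auto simp: cover_def a_def D_def ker_def)
qed

end

section \<open>The Tate complex\<close>

type_synonym 'k tvec = "nat set \<times> (nat \<Rightarrow> nat) \<Rightarrow> 'k mpoly"

text \<open>
  The index \<open>(A, b)\<close> stands for the basis element \<open>x\<^sub>A y\<^bsup>(b)\<^esup>\<close>, a product of exterior and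
  divided-power variables. \<open>lam i\<close> and \<open>iota i\<close> are left multiplication and contraction by \<open>x\<^sub>i\<close>,
  \<open>del j\<close> is the derivative by \<open>y\<^sub>j\<close>, and \<open>sig j\<close> raises the divided power of \<open>y\<^sub>j\<close> by one.
\<close>

definition sg :: "nat \<Rightarrow> nat set \<Rightarrow> 'a::comm_ring_1" where
  "sg i A = (if even (card {a \<in> A. a < i}) then 1 else -1)"

definition iota :: "nat \<Rightarrow> 'k::field tvec \<Rightarrow> 'k tvec" where
  "iota i z = (\<lambda>(A, b). if i \<in> A then 0 else sg i A * z (insert i A, b))"

definition lam :: "nat \<Rightarrow> 'k::field tvec \<Rightarrow> 'k tvec" where
  "lam i z = (\<lambda>(A, b). if i \<in> A then sg i A * z (A - {i}, b) else 0)"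

definition del :: "nat \<Rightarrow> 'k::field tvec \<Rightarrow> 'k tvec" where
  "del j z = (\<lambda>(A, b). z (A, b(j := Suc (b j))))"

definition sig :: "nat \<Rightarrow> 'k::field tvec \<Rightarrow> 'k tvec" where
  "sig j z = (\<lambda>(A, b). if b j = 0 then 0 else z (A, b(j := b j - 1)))"

definition e0 :: "nat \<Rightarrow> 'k::field tvec \<Rightarrow> 'k tvec" where
  "e0 j z = (\<lambda>(A, b). if b j = 0 then z (A, b) else 0)"

lemmas tate_defs = iota_def lam_def del_def sig_def e0_def

lemma sg_square [simp]: "sg i A * sg i A = 1" "sg i A * (sg i A * p) = p"
  by (simp_all add: sg_def)

lemma sg_self: "sg i (insert i A) = sg i A" "sg i (A - {i}) = sg i A"
proof -
  have "{a \<in> insert i A. a < i} = {a \<in> A. a < i}" "{a \<in> A - {i}. a < i} = {a \<in> A. a < i}" by auto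
  then show "sg i (insert i A) = sg i A" "sg i (A - {i}) = sg i A" by (simp_all add: sg_def)
qed

lemma sg_insert:
  assumes "k \<notin> A" "k \<noteq> i"
  shows "sg i (insert k A) = (if k < i then - sg i A else sg i A)"
proof -
  have "{a \<in> insert k A. a < i} = (if k < i then insert k {a \<in> A. a < i} else {a \<in> A. a < i})" by auto
  moreover have "finite {a \<in> A. a < i}" by (rule finite_subset[of _ "{..<i}"]) auto
  ultimately show ?thesis using assms by (simp add: sg_def)
qed

lemma sg_remove:
  assumes "k \<in> A" "k \<noteq> i"
  shows "(sg i (A - {k}) :: 'a::comm_ring_1) = (if k < i then - sg i A else sg i A)"
proof -
  have "insert k (A - {k}) = A" using assms(1) by auto
  then have "(sg i A :: 'a) = (if k < i then - sg i (A - {k}) else sg i (A - {k}))"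
    using sg_insert[of k "A - {k}" i, where 'a = 'a] assms(2) by simp
  then show ?thesis by simp
qed

lemma iota_iota: "iota i (iota i z) = 0"
  by (auto simp: tate_defs fun_eq_iff)

lemma lam_lam: "lam i (lam i z) = 0"
  by (auto simp: tate_defs fun_eq_iff)

lemma iota_anti: "iota i (iota k z) + iota k (iota i z) = 0"
proof (cases "i = k")
  case False
  then show ?thesis
    by (auto simp: tate_defs fun_eq_iff vec_apply sg_insert insert_commute)
qed (simp add: iota_iota)

lemma lam_anti: "lam i (lam k z) + lam k (lam i z) = 0"
proof (cases "i = k")
  case False
  then show ?thesis
    by (auto simp: tate_defs fun_eq_iff vec_apply sg_remove Diff_insert2[symmetric] insert_commute)
qed (simp add: lam_lam)

lemma iota_lam: "iota i (lam k z) + lam k (iota i z) = (if i = k then z else 0)"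
proof (cases "i = k")
  case True
  then show ?thesis
    by (auto simp: tate_defs fun_eq_iff vec_apply sg_self insert_absorb)
next
  case False
  then have "insert i (A - {k}) = insert i A - {k}" for A by auto
  with False show ?thesis
    by (auto simp: tate_defs fun_eq_iff vec_apply sg_insert sg_remove)
qed

lemma lin_tate: "lin (iota i)" "lin (lam i)" "lin (del j)" "lin (sig j)" "lin (e0 j)"
  by (auto simp: lin_def tate_defs fun_eq_iff vec_apply algebra_simps)

lemma tate_commute:
  "del j (iota i z) = iota i (del j z)" "del j (lam i z) = lam i (del j z)"
  "sig j (iota i z) = iota i (sig j z)" "sig j (lam i z) = lam i (sig j z)"
  "e0 j (iota i z) = iota i (e0 j z)" "e0 j (lam i z) = lam i (e0 j z)"
  by (auto simp: tate_defs fun_eq_iff)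

lemma del_commute: "del j (del k z) = del k (del j z)"
  by (cases "j = k") (auto simp: tate_defs fun_eq_iff fun_upd_twist)

text \<open>\<open>sig j\<close> shifts divided powers without the integer factor of multiplication
  by \<open>y_j\<close>, so it is a section of \<open>del j\<close> in every characteristic. In the
  other order, the part \<open>e0 j\<close> free of \<open>y_j\<close> gets lost.\<close>

lemma del_sig: "del j (sig j z) = z"
  by (auto simp: tate_defs fun_eq_iff)

lemma sig_del: "sig j (del j z) = z - e0 j z"
  by (auto simp: tate_defs fun_eq_iff vec_apply)

lemma del_sig_neq: "j \<noteq> k \<Longrightarrow> del j (sig k z) = sig k (del j z)"
  by (auto simp: tate_defs fun_eq_iff fun_upd_twist)

lemma EV_tate:
  assumes "hideal w K" "z \<in> EV K"
  shows "iota i z \<in> EV K" "lam i z \<in> EV K" "del j z \<in> EV K" "sig j z \<in> EV K" "e0 j z \<in> EV K"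
  using assms by (auto simp: EV_def tate_defs hidealD split: prod.splits)

lemma sum_anticommuting_square:
  fixes r :: nat
  assumes lin: "\<And>i. lin (T i)" and sq: "\<And>i z. T i (T i z) = 0"
    and anti: "\<And>i k z. T i (T k z) + T k (T i z) = (0 :: 'i \<Rightarrow> 'a::comm_ring_1)"
  shows "(\<Sum>i<r. p i \<star> T i (\<Sum>i<r. p i \<star> T i z)) = 0"
proof (induction r)
  case (Suc r)
  have "(\<Sum>i<r. p i \<star> T i (p r \<star> T r z)) + p r \<star> T r (\<Sum>i<r. p i \<star> T i z) =
      p r \<star> (\<Sum>i<r. p i \<star> (T i (T r z) + T r (T i z)))"
    by (simp add: lin_sum[OF lin] lin_smv[OF lin] smv_simps smv_sum sum.distrib mult.commute)
  also have "\<dots> = 0" by (simp add: anti smv_simps)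
  finally have 1: "(\<Sum>i<r. p i \<star> T i (p r \<star> T r z)) + p r \<star> T r (\<Sum>i<r. p i \<star> T i z) = 0" .
  have "(\<Sum>i<Suc r. p i \<star> T i (\<Sum>i<Suc r. p i \<star> T i z)) =
      (\<Sum>i<r. p i \<star> T i (\<Sum>i<r. p i \<star> T i z)) +
      ((\<Sum>i<r. p i \<star> T i (p r \<star> T r z)) + p r \<star> T r (\<Sum>i<r. p i \<star> T i z)) + p r \<star> T r (p r \<star> T r z)"
    by (simp add: lin_add[OF lin] smv_simps sum.distrib)
  then show ?case using Suc 1 by (simp add: lin_smv[OF lin] sq smv_simps)
qed simp

text \<open>The value \<open>q = 1\<close> covers contraction against exterior multiplication,
  \<open>q = 0\<close> two exterior multiplications.\<close>

lemma sum_cross: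
  fixes z :: "'i \<Rightarrow> 'a::comm_ring_1" and r :: nat
  assumes lin: "\<And>i. lin (T i)" "\<And>i. lin (U i)"
    and anti: "\<And>i k. T i (U k z) + U k (T i z) = (if i = k then q \<star> z else 0)"
  shows "(\<Sum>i<r. p i \<star> T i (\<Sum>k<r. p' k \<star> U k z)) + (\<Sum>k<r. p' k \<star> U k (\<Sum>i<r. p i \<star> T i z)) =
    (\<Sum>i<r. p i * p' i * q) \<star> z"
proof -
  have smv_sum_left: "(\<Sum>i<r. s i) \<star> z = (\<Sum>i<r. s i \<star> z)" for s and r :: nat
    by (induction r) (simp_all add: smv_simps)
  have "(\<Sum>k<r. p' k \<star> U k (\<Sum>i<r. p i \<star> T i z)) = (\<Sum>i<r. \<Sum>k<r. (p i * p' k) \<star> U k (T i z))"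
    by (subst sum.swap) (simp add: lin_sum[OF lin(2)] lin_smv[OF lin(2)] smv_sum smv_simps mult.commute)
  moreover have "(\<Sum>i<r. p i \<star> T i (\<Sum>k<r. p' k \<star> U k z)) = (\<Sum>i<r. \<Sum>k<r. (p i * p' k) \<star> T i (U k z))"
    by (simp add: lin_sum[OF lin(1)] lin_smv[OF lin(1)] smv_sum smv_simps)
  ultimately have "(\<Sum>i<r. p i \<star> T i (\<Sum>k<r. p' k \<star> U k z)) + (\<Sum>k<r. p' k \<star> U k (\<Sum>i<r. p i \<star> T i z)) =
      (\<Sum>i<r. \<Sum>k<r. (p i * p' k) \<star> (T i (U k z) + U k (T i z)))"
    by (simp add: smv_simps sum.distrib)
  also have "\<dots> = (\<Sum>i<r. \<Sum>k<r. if k = i then (p i * p' i * q) \<star> z else 0)"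
    by (intro sum.cong refl) (auto simp: anti smv_simps)
  also have "\<dots> = (\<Sum>i<r. p i * p' i * q) \<star> z" by (simp add: smv_sum_left)
  finally show ?thesis .
qed

text \<open>The coefficients \<open>a j i\<close> are the coordinates of a Koszul chain with
  boundary \<open>f j\<close>. In \<open>regular\<close> the \<open>t j\<close> range over all
  polynomials; applying \<open>rho {..<e}\<close> brings them into the first \<open>e\<close>
  variables.\<close>

locale tate =
  fixes e c :: nat and w :: "nat \<Rightarrow> nat" and f :: "nat \<Rightarrow> 'k::field mpoly"
    and a :: "nat \<Rightarrow> nat \<Rightarrow> 'k mpoly" and dg :: "nat \<Rightarrow> int"
  assumes w: "\<And>i. w i \<ge> 1"
    and f_rho: "\<And>j. j < c \<Longrightarrow> rho {..<e} (f j) = f j"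
    and f_a: "\<And>j. j < c \<Longrightarrow> f j = (\<Sum>i<e. xv i * a j i)"
    and a_hom: "\<And>j i. j < c \<Longrightarrow> i < e \<Longrightarrow> comp w (dg j - int (w i)) (a j i) = a j i"
    and regular: "\<And>s p t. s < c \<Longrightarrow> rho {..<e} (f s * p) = (\<Sum>j<s. f j * t j) \<Longrightarrow>
      \<exists>t. rho {..<e} p = (\<Sum>j<s. f j * t j)"
begin

text \<open>The ideal of the first \<open>s\<close> equations together with \<open>kr e\<close>. All
  \<open>s\<close> are considered, since exactness is proved by adding one equation at a
  time.\<close>

definition JJ :: "nat \<Rightarrow> 'k mpoly set" where
  "JJ s = {p. \<exists>t. rho {..<e} p = (\<Sum>j<s. f j * t j)}"

lemma f_hom: assumes "j < c" shows "comp w (dg j) (f j) = f j"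
proof -
  have "comp w (dg j) (xv i * a j i) = xv i * a j i" if "i < e" for i
    using hom_mult[OF comp_xv a_hom[OF assms that], of i] by simp
  then show ?thesis using f_a[OF assms] by (simp add: comp_simps)
qed

lemma mm_simps: "(0 :: 'k mpoly) \<in> mm" "p \<in> mm \<Longrightarrow> q \<in> mm \<Longrightarrow> p + q \<in> (mm :: 'k mpoly set)"
  "p \<in> mm \<Longrightarrow> r * p \<in> (mm :: 'k mpoly set)" "p \<in> mm \<Longrightarrow> p * r \<in> (mm :: 'k mpoly set)"
  using hidealD[OF hideal_mm] by auto

lemma sum_mm: "(\<And>x. x \<in> A \<Longrightarrow> g x \<in> mm) \<Longrightarrow> sum g A \<in> (mm :: 'k mpoly set)"
  by (induction A rule: infinite_finite_induct) (auto simp: mm_simps)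

lemma f_mm: "j < c \<Longrightarrow> f j \<in> mm"
  by (simp add: f_a sum_mm mm_simps xv_mm)

lemma hideal_JJ: assumes "s \<le> c" shows "hideal w (JJ s)"
proof -
  have "0 \<in> JJ s" unfolding JJ_def by (auto simp: rho_simps intro!: exI[of _ "\<lambda>_. 0"])
  moreover have "p + q \<in> JJ s" if pq: "p \<in> JJ s" "q \<in> JJ s" for p q
  proof -
    obtain t t' where "rho {..<e} p = (\<Sum>j<s. f j * t j)" "rho {..<e} q = (\<Sum>j<s. f j * t' j)"
      using pq by (auto simp: JJ_def)
    then have "rho {..<e} (p + q) = (\<Sum>j<s. f j * (t j + t' j))"
      by (simp add: rho_simps distrib_left sum.distrib)
    then show ?thesis by (auto simp: JJ_def)
  qed
  moreover have "r * p \<in> JJ s" if p: "p \<in> JJ s" for p r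
  proof -
    obtain t where "rho {..<e} p = (\<Sum>j<s. f j * t j)" using p by (auto simp: JJ_def)
    then have "rho {..<e} (r * p) = (\<Sum>j<s. f j * (rho {..<e} r * t j))"
      by (simp add: rho_mult sum_distrib_left mult.left_commute)
    then show ?thesis unfolding JJ_def by (intro CollectI exI[of _ "\<lambda>j. rho {..<e} r * t j"])
  qed
  moreover have "comp w i p \<in> JJ s" if p: "p \<in> JJ s" for p i
  proof -
    obtain t where t: "rho {..<e} p = (\<Sum>j<s. f j * t j)" using p by (auto simp: JJ_def)
    have "comp w i (f j * t j) = f j * comp w (i - dg j) (t j)" if "j < s" for j
      using comp_mult[OF f_hom, of j "i - dg j" "t j"] that assms by simp
    then have "rho {..<e} (comp w i p) = (\<Sum>j<s. f j * comp w (i - dg j) (t j))"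
      by (simp add: rho_comp t comp_simps)
    then show ?thesis unfolding JJ_def by (intro CollectI exI[of _ "\<lambda>j. comp w (i - dg j) (t j)"])
  qed
  ultimately show ?thesis unfolding hideal_def by blast
qed

lemma JJ_0: "JJ 0 = kr e"
  by (simp add: JJ_def kr_def)

lemma JJ_Suc: "p \<in> JJ (Suc s) \<Longrightarrow> \<exists>t. p - f s * t \<in> JJ s" if "s < c"
proof -
  assume "p \<in> JJ (Suc s)"
  then obtain t where t: "rho {..<e} p = (\<Sum>j<Suc s. f j * t j)" unfolding JJ_def by blast
  have "rho {..<e} p = rho {..<e} (rho {..<e} p)" by (simp only: rho_rho Int_absorb)
  also have "\<dots> = (\<Sum>j<s. f j * rho {..<e} (t j)) + f s * rho {..<e} (t s)"
    unfolding t using f_rho that by (simp add: rho_simps rho_mult)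
  finally have "rho {..<e} (p - f s * t s) = (\<Sum>j<s. f j * rho {..<e} (t j))"
    using f_rho[OF that] by (simp add: rho_simps rho_mult)
  then show ?thesis unfolding JJ_def by (intro exI[of _ "t s"] CollectI exI[of _ "\<lambda>j. rho {..<e} (t j)"])
qed

lemma JJ_mono: "s \<le> s' \<Longrightarrow> JJ s \<subseteq> JJ s'"
proof (rule subsetI)
  fix p assume s: "s \<le> s'" "p \<in> JJ s"
  then obtain t where t: "rho {..<e} p = (\<Sum>j<s. f j * t j)" by (auto simp: JJ_def)
  have "(\<Sum>j<s. f j * t j) = (\<Sum>j<s'. f j * (if j < s then t j else 0))"
    using s(1) by (intro sum.mono_neutral_cong_left) auto
  then show "p \<in> JJ s'" using t unfolding JJ_def by (intro CollectI exI[of _ "\<lambda>j. if j < s then t j else 0"]) simp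
qed

lemma f_JJ: assumes "s < c" shows "f s * p \<in> JJ (Suc s)"
proof -
  have "rho {..<e} (f s * p) = (\<Sum>j<Suc s. f j * (if j = s then rho {..<e} p else 0))"
    using f_rho[OF assms] by (simp add: rho_mult)
  then show ?thesis unfolding JJ_def
    by (intro CollectI exI[of _ "\<lambda>j. if j = s then rho {..<e} p else 0"])
qed

lemma f_JJ': "j < s \<Longrightarrow> s \<le> c \<Longrightarrow> f j * p \<in> JJ s"
  using f_JJ[of j p] JJ_mono[of "Suc j" s] by auto

lemma JJ_mm: assumes "s \<le> c" shows "JJ s \<subseteq> mm"
proof
  fix p assume "p \<in> JJ s"
  then obtain t where t: "rho {..<e} p = (\<Sum>j<s. f j * t j)" by (auto simp: JJ_def)
  have "(\<Sum>j<s. f j * t j) \<in> mm" using assms by (intro sum_mm mm_simps f_mm) auto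
  then have "rho {..<e} p \<in> mm" using t by simp
  then show "p \<in> mm" by (simp add: mm_def)
qed

lemma JJ_regular: "s < c \<Longrightarrow> f s * p \<in> JJ s \<Longrightarrow> p \<in> JJ s"
  using regular[of s p] by (auto simp: JJ_def)

definition delta :: "'k tvec \<Rightarrow> 'k tvec" where
  "delta z = (\<Sum>i<e. xv i \<star> iota i z)"

text \<open>Multiplication by the Koszul chain with boundary \<open>f j\<close>; in the Tate complex
  this chain is the differential of \<open>y_j\<close>.\<close>

definition ss :: "nat \<Rightarrow> 'k tvec \<Rightarrow> 'k tvec" where
  "ss j z = (\<Sum>i<e. a j i \<star> lam i z)"

definition dX :: "'k tvec \<Rightarrow> 'k tvec" where
  "dX z = delta z + (\<Sum>j<c. ss j (del j z))"

lemma lin_delta: "lin delta" and lin_ss: "lin (ss j)"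
  by (auto simp: lin_def delta_def ss_def lin_add[OF lin_tate(1)] lin_add[OF lin_tate(2)]
      lin_smv[OF lin_tate(1)] lin_smv[OF lin_tate(2)] smv_simps sum.distrib smv_sum mult.commute)

lemma lin_dX: "lin dX"
  unfolding lin_def dX_def
  by (simp add: lin_add[OF lin_delta] lin_smv[OF lin_delta] lin_add[OF lin_ss] lin_smv[OF lin_ss]
      lin_add[OF lin_tate(3)] lin_smv[OF lin_tate(3)] smv_simps sum.distrib smv_sum algebra_simps)

lemma delta_delta: "delta (delta z) = 0"
  unfolding delta_def by (rule sum_anticommuting_square) (auto simp: lin_tate iota_iota iota_anti)

lemma ss_ss: "ss j (ss j z) = 0"
  unfolding ss_def by (rule sum_anticommuting_square) (auto simp: lin_tate lam_lam lam_anti)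

lemma ss_anti: "ss j (ss k z) + ss k (ss j z) = 0"
  unfolding ss_def
  by (subst sum_cross[where q = 0]) (auto simp: lin_tate lam_anti smv_simps)

lemma delta_ss: "j < c \<Longrightarrow> delta (ss j z) + ss j (delta z) = f j \<star> z"
  unfolding ss_def delta_def
  by (subst sum_cross[where q = 1]) (auto simp: lin_tate iota_lam smv_simps f_a)

lemma delta_lam: "i < e \<Longrightarrow> delta (lam i z) + lam i (delta z) = xv i \<star> z"
proof -
  assume i: "i < e"
  have "delta (lam i z) + lam i (delta z) = (\<Sum>k<e. xv k \<star> (iota k (lam i z) + lam i (iota k z)))"
    by (simp add: delta_def lin_sum[OF lin_tate(2)] lin_smv[OF lin_tate(2)] smv_simps sum.distrib)
  also have "\<dots> = (\<Sum>k<e. if k = i then xv i \<star> z else 0)"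
    by (rule sum.cong) (auto simp: iota_lam smv_simps)
  finally show ?thesis using i by simp
qed

lemma iota_delta: "iota i (delta z) = - delta (iota i z)"
proof -
  have "delta (iota i z) + iota i (delta z) = (\<Sum>k<e. xv k \<star> (iota k (iota i z) + iota i (iota k z)))"
    by (simp add: delta_def lin_sum[OF lin_tate(1)] lin_smv[OF lin_tate(1)] smv_simps sum.distrib)
  then show ?thesis by (simp add: iota_anti smv_simps eq_neg_iff_add_eq_0 add.commute)
qed

lemma ss_lam: "ss j (lam i z) = - lam i (ss j z)"
proof -
  have "ss j (lam i z) + lam i (ss j z) = (\<Sum>k<e. a j k \<star> (lam k (lam i z) + lam i (lam k z)))"
    by (simp add: ss_def lin_sum[OF lin_tate(2)] lin_smv[OF lin_tate(2)] smv_simps sum.distrib)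
  then show ?thesis by (simp add: lam_anti smv_simps eq_neg_iff_add_eq_0 add.commute)
qed

lemma ss_commute: "del k (ss j z) = ss j (del k z)" "sig k (ss j z) = ss j (sig k z)" "e0 k (ss j z) = ss j (e0 k z)"
  "del k (delta z) = delta (del k z)" "sig k (delta z) = delta (sig k z)" "e0 k (delta z) = delta (e0 k z)"
  by (simp_all add: ss_def delta_def lin_sum[OF lin_tate(3)] lin_smv[OF lin_tate(3)] lin_sum[OF lin_tate(4)]
      lin_smv[OF lin_tate(4)] lin_sum[OF lin_tate(5)] lin_smv[OF lin_tate(5)] tate_commute)

text \<open>The Koszul part squares to zero and so does the sum of the anticommuting
  \<open>ss j\<close>; the cross terms leave \<open>f j\<close>. Modulo the equations
  \<open>dX\<close> is thus a differential, and over the polynomial ring it exhibits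
  \<open>del j\<close> as the Eisenbud operator of \<open>f j\<close>.\<close>

lemma dX_dX: "dX (dX z) = (\<Sum>j<c. f j \<star> del j z)"
proof -
  let ?T = "\<lambda>j z. ss j (del j z)"
  have "(\<Sum>j<c. 1 \<star> ?T j (\<Sum>j<c. 1 \<star> ?T j z)) = 0"
  proof (rule sum_anticommuting_square)
    show "lin (?T j)" for j by (rule lin_compose[OF lin_ss lin_tate(3)])
    show "?T j (?T j z) = 0" for j z by (simp add: ss_commute ss_ss)
    show "?T j (?T k z) + ?T k (?T j z) = 0" for j k z
      using ss_anti[of j k "del j (del k z)"] by (simp add: ss_commute del_commute[of k j])
  qed
  then have "(\<Sum>j<c. ?T j (\<Sum>j<c. ?T j z)) = 0" by (simp only: smv_simps)
  then have "dX (dX z) = (\<Sum>j<c. delta (ss j (del j z)) + ss j (delta (del j z)))"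
    by (simp add: dX_def lin_add[OF lin_delta] lin_sum[OF lin_delta] delta_delta
        lin_add[OF lin_tate(3)] lin_add[OF lin_ss] sum.distrib ss_commute)
  also have "\<dots> = (\<Sum>j<c. f j \<star> del j z)" by (rule sum.cong) (auto simp: delta_ss)
  finally show ?thesis .
qed

lemma dX_del: "del k (dX z) = dX (del k z)"
  by (simp add: dX_def lin_add[OF lin_tate(3)] lin_sum[OF lin_tate(3)] ss_commute del_commute[of k])

text \<open>The differential lowers a divided power of \<open>y_k\<close> by one and multiplies by
  \<open>ss k\<close>. The shift commutes with this except on the part free of \<open>y_k\<close>,
  where raising creates a new term. Its coefficients are multiples of the \<open>a k i\<close>, so
  it vanishes modulo \<open>mm\<close> when \<open>f k\<close> has no linear part.\<close>

lemma dX_sig: assumes "k < c" shows "dX (sig k z) = sig k (dX z) + ss k (e0 k z)"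
proof -
  have "ss j (del j (sig k z)) = sig k (ss j (del j z)) + (if j = k then ss k (e0 k z) else 0)" for j
  proof (cases "j = k")
    case True
    have "sig k (ss k (del k z)) = ss k (z - e0 k z)" by (simp add: ss_commute sig_del)
    then show ?thesis using True by (simp add: del_sig lin_diff[OF lin_ss])
  qed (simp add: del_sig_neq ss_commute)
  then show ?thesis using assms
    by (simp add: dX_def ss_commute lin_add[OF lin_tate(4)] lin_sum[OF lin_tate(4)] sum.distrib)
qed

lemma dX_lam: "i < e \<Longrightarrow> dX (lam i z) = xv i \<star> z - lam i (dX z)"
proof -
  assume i: "i < e"
  have "dX (lam i z) + lam i (dX z) = delta (lam i z) + lam i (delta z) +
      (\<Sum>j<c. ss j (lam i (del j z)) + lam i (ss j (del j z)))"
    by (simp add: dX_def tate_commute lin_add[OF lin_tate(2)] lin_sum[OF lin_tate(2)] sum.distrib)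
  also have "\<dots> = xv i \<star> z" using i by (simp add: delta_lam ss_lam)
  finally show ?thesis by (simp add: eq_diff_eq)
qed

lemma dX_ss: "k < c \<Longrightarrow> dX (ss k z) = f k \<star> z - ss k (dX z)"
proof -
  assume k: "k < c"
  have "dX (ss k z) + ss k (dX z) = delta (ss k z) + ss k (delta z) +
      (\<Sum>j<c. ss j (ss k (del j z)) + ss k (ss j (del j z)))"
    by (simp add: dX_def ss_commute lin_add[OF lin_ss] lin_sum[OF lin_ss] sum.distrib)
  also have "\<dots> = f k \<star> z" using k by (simp add: delta_ss ss_anti)
  finally show ?thesis by (simp add: eq_diff_eq)
qed

lemma EV_ss: "hideal w K \<Longrightarrow> z \<in> EV K \<Longrightarrow> ss j z \<in> EV K"
  unfolding ss_def
  by (intro submod_sum[OF submod_EV] submodD(3)[OF submod_EV] EV_tate(2)) auto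

lemma EV_dX: "hideal w K \<Longrightarrow> z \<in> EV K \<Longrightarrow> dX z \<in> EV K"
  unfolding dX_def delta_def
  by (intro submodD(2)[OF submod_EV] submod_sum[OF submod_EV] submodD(3)[OF submod_EV] EV_tate EV_ss) auto

text \<open>Exterior variables have homological degree 1, divided power variables degree 2. With the
  first \<open>s\<close> of the latter this is the Koszul complex for \<open>s = 0\<close> and the
  Tate complex of the first \<open>s\<close> equations in general.\<close>

definition Bs :: "nat \<Rightarrow> nat \<Rightarrow> (nat set \<times> (nat \<Rightarrow> nat)) set" where
  "Bs s n = {(A, b). A \<subseteq> {..<e} \<and> (\<forall>j\<ge>s. b j = 0) \<and> card A + 2 * (\<Sum>j<s. b j) = n}"

lemma Bs_finite_A: "(A, b) \<in> Bs s n \<Longrightarrow> finite A"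
  by (auto simp: Bs_def intro: finite_subset)

lemma finite_Bs: "finite (Bs s n)"
proof -
  let ?F = "{b :: nat \<Rightarrow> nat. \<forall>x. (x \<in> {..<s} \<longrightarrow> b x \<in> {..n}) \<and> (x \<notin> {..<s} \<longrightarrow> b x = 0)}"
  have "finite ?F" by (rule finite_set_of_finite_funs) auto
  moreover have "Bs s n \<subseteq> Pow {..<e} \<times> ?F"
  proof (clarify, intro conjI)
    fix A b assume Ab: "(A, b) \<in> Bs s n"
    then show "A \<in> Pow {..<e}" by (auto simp: Bs_def)
    have "b x \<le> n" if "x < s" for x
    proof -
      have "b x \<le> (\<Sum>j<s. b j)" using that by (intro member_le_sum) auto
      then show ?thesis using Ab by (auto simp: Bs_def)
    qed
    then show "b \<in> ?F" using Ab by (auto simp: Bs_def)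
  qed
  ultimately show ?thesis by (meson finite_Pow_iff finite_SigmaI finite_lessThan finite_subset)
qed

lemma sum_upd: assumes "j < (s :: nat)" shows "(\<Sum>i<s. (b(j := x)) i) + b j = (\<Sum>i<s. b i) + (x :: nat)"
proof -
  have "(\<Sum>i<s. (b(j := x)) i) = x + (\<Sum>i\<in>{..<s} - {j}. b i)"
    using assms by (subst sum.remove[of _ j]) (auto intro: sum.cong)
  moreover have "(\<Sum>i<s. b i) = b j + (\<Sum>i\<in>{..<s} - {j}. b i)" using assms by (subst sum.remove[of _ j]) auto
  ultimately show ?thesis by simp
qed

lemma Bs_insert: "i \<notin> A \<Longrightarrow> i < e \<Longrightarrow> (insert i A, b) \<in> Bs s (Suc n) \<longleftrightarrow> (A, b) \<in> Bs s n"
proof (cases "A \<subseteq> {..<e}")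
  case True
  then have "finite A" by (rule finite_subset) simp
  then show "i \<notin> A \<Longrightarrow> i < e \<Longrightarrow> ?thesis" by (auto simp: Bs_def)
qed (auto simp: Bs_def)

lemma Bs_upd: "(A, b(j := Suc (b j))) \<in> Bs s n \<longleftrightarrow> j < s \<and> (\<exists>m. n = m + 2 \<and> (A, b) \<in> Bs s m)"
proof (cases "j < s")
  case True
  then show ?thesis using sum_upd[OF True, of b "Suc (b j)"] by (auto simp: Bs_def)
qed (auto simp: Bs_def intro!: exI[of _ j])

lemma VV_iota: "z \<in> VV (Bs s (Suc n)) \<Longrightarrow> i < e \<Longrightarrow> iota i z \<in> VV (Bs s n)"
  unfolding VV_def iota_def using Bs_insert by auto

lemma iota_VV_0: "z \<in> VV (Bs s 0) \<Longrightarrow> iota i z = 0"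
proof
  fix x assume z: "z \<in> VV (Bs s 0)"
  have "(insert i A, b) \<notin> Bs s 0" for A b
  proof
    assume *: "(insert i A, b) \<in> Bs s 0"
    then have "finite (insert i A)" by (rule Bs_finite_A)
    with * show False by (auto simp: Bs_def)
  qed
  with z show "iota i z x = 0 x" by (cases x) (auto simp: VV_def iota_def)
qed

lemma VV_lam: "z \<in> VV (Bs s n) \<Longrightarrow> i < e \<Longrightarrow> lam i z \<in> VV (Bs s (Suc n))"
proof -
  assume z: "z \<in> VV (Bs s n)" and i: "i < e"
  have "(A - {i}, b) \<notin> Bs s n" if "(A, b) \<notin> Bs s (Suc n)" "i \<in> A" for A b
    using that i Bs_insert[of i "A - {i}" b s n] by (auto simp: insert_absorb)
  with z show ?thesis by (auto simp: VV_def lam_def)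
qed

lemma VV_del: "z \<in> VV (Bs s (n + 2)) \<Longrightarrow> del j z \<in> VV (Bs s n)"
  by (auto simp: VV_def del_def Bs_upd)

lemma VV_del_low: "z \<in> VV (Bs s n) \<Longrightarrow> n < 2 \<or> s \<le> j \<Longrightarrow> del j z = 0"
  by (auto simp: VV_def del_def Bs_upd fun_eq_iff)

lemma VV_sig: "z \<in> VV (Bs s n) \<Longrightarrow> j < s \<Longrightarrow> sig j z \<in> VV (Bs s (n + 2))"
proof -
  assume z: "z \<in> VV (Bs s n)" and j: "j < s"
  have "(A, b(j := b j - 1)) \<notin> Bs s n" if "(A, b) \<notin> Bs s (n + 2)" "b j \<noteq> 0" for A b
    using that j Bs_upd[of A "b(j := b j - 1)" j s "n + 2"] by auto
  with z show ?thesis by (auto simp: VV_def sig_def)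
qed

lemma VV_e0: "z \<in> VV (Bs s n) \<Longrightarrow> e0 j z \<in> VV (Bs s n)"
  by (auto simp: VV_def e0_def)

lemma VV_e0_Suc: "z \<in> VV (Bs (Suc s) n) \<Longrightarrow> e0 s z \<in> VV (Bs s n)"
proof -
  have "(A, b) \<in> Bs s n" if "(A, b) \<in> Bs (Suc s) n" "b s = 0" for A b
    using that by (auto simp: Bs_def) (metis Suc_leI le_neq_implies_less)
  then show "z \<in> VV (Bs (Suc s) n) \<Longrightarrow> ?thesis" by (auto simp: VV_def e0_def)
qed

lemma VV_Bs_mono: "z \<in> VV (Bs s n) \<Longrightarrow> s \<le> s' \<Longrightarrow> z \<in> VV (Bs s' n)"
proof -
  assume z: "z \<in> VV (Bs s n)" and s: "s \<le> s'"
  have "Bs s n \<subseteq> Bs s' n"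
  proof (clarify)
    fix A b assume Ab: "(A, b) \<in> Bs s n"
    then have "(\<Sum>j<s. b j) = (\<Sum>j<s'. b j)" using s by (intro sum.mono_neutral_left) (auto simp: Bs_def)
    then show "(A, b) \<in> Bs s' n" using Ab s by (auto simp: Bs_def)
  qed
  with z show ?thesis by (auto simp: VV_def)
qed

lemma VV_ss: "z \<in> VV (Bs s n) \<Longrightarrow> ss j z \<in> VV (Bs s (Suc n))"
  unfolding ss_def by (intro VV_sum VV_smv VV_lam) auto

lemma VV_dX: assumes z: "z \<in> VV (Bs s (Suc n))" shows "dX z \<in> VV (Bs s n)"
proof -
  have "ss j (del j z) \<in> VV (Bs s n)" for j
  proof (cases n)
    case 0
    then show ?thesis using VV_del_low[OF z, of j] lin_0[OF lin_ss] by simp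
  next
    case (Suc m)
    then show ?thesis using VV_ss[OF VV_del[of z s m j]] z by simp
  qed
  moreover have "delta z \<in> VV (Bs s n)" unfolding delta_def using z by (intro VV_sum VV_smv VV_iota) auto
  ultimately show ?thesis unfolding dX_def by (intro VV_add VV_sum)
qed

lemma dX_VV_0: "z \<in> VV (Bs s 0) \<Longrightarrow> dX z = 0"
  by (simp add: dX_def delta_def iota_VV_0 VV_del_low lin_0[OF lin_ss] smv_simps)

definition gX :: "nat set \<times> (nat \<Rightarrow> nat) \<Rightarrow> int" where
  "gX = (\<lambda>(A, b). (\<Sum>i\<in>A. int (w i)) + (\<Sum>j<c. int (b j) * dg j))"

lemma gX_insert: "finite A \<Longrightarrow> i \<notin> A \<Longrightarrow> gX (insert i A, b) = int (w i) + gX (A, b)"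
  by (simp add: gX_def)

lemma gX_upd: assumes "j < c" shows "gX (A, b(j := Suc (b j))) = gX (A, b) + dg j"
proof -
  have "(\<Sum>i<c. int ((b(j := Suc (b j))) i) * dg i) = int (Suc (b j)) * dg j + (\<Sum>i\<in>{..<c} - {j}. int (b i) * dg i)"
    using assms by (subst sum.remove[of _ j]) (auto intro: sum.cong)
  moreover have "(\<Sum>i<c. int (b i) * dg i) = int (b j) * dg j + (\<Sum>i\<in>{..<c} - {j}. int (b i) * dg i)"
    using assms by (subst sum.remove[of _ j]) auto
  ultimately show ?thesis by (simp add: gX_def algebra_simps)
qed

lemma comp_sg: "comp w j (sg i A * p) = sg i A * comp w j p"
  by (simp add: sg_def comp_simps)

lemma lmap_dX: "lmap w (Bs s (Suc n)) gX (Bs s n) gX dX"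
  unfolding lmap_def
proof (intro conjI ballI allI lin_dX VV_dX)
  fix z :: "'k tvec" and j assume z: "z \<in> VV (Bs s (Suc n))"
  show "dX (vcomp w gX j z) = vcomp w gX j (dX z)"
  proof
    fix x :: "nat set \<times> (nat \<Rightarrow> nat)"
    obtain A b where x: "x = (A, b)" by fastforce
    show "dX (vcomp w gX j z) x = vcomp w gX j (dX z) x"
    \<comment> \<open>Sums over an infinite \<open>A\<close> are 0 by convention, so
      \<open>gX_insert\<close> fails there; but such indices lie outside every
      \<open>Bs s n\<close>, and both sides are 0.\<close>
    proof (cases "finite A")
      case True
      have 1: "xv i * iota i (vcomp w gX j z) (A, b) = comp w (j - gX (A, b)) (xv i * iota i z (A, b))" if "i < e" for i
      proof (cases "i \<in> A")
        case False
        have "int (w i) + (j - gX (insert i A, b)) = j - gX (A, b)" using gX_insert[OF True False, of b] by simp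
        with comp_mult[OF comp_xv, of w i "j - gX (insert i A, b)" "sg i A * z (insert i A, b)"] False show ?thesis
          by (simp add: iota_def vcomp_def comp_sg)
      qed (simp add: iota_def comp_simps)
      have 2: "a k i * lam i (del k (vcomp w gX j z)) (A, b) = comp w (j - gX (A, b)) (a k i * lam i (del k z) (A, b))"
        if "k < c" "i < e" for i k
      proof (cases "i \<in> A")
        case i: True
        have g: "gX (A, b) = int (w i) + gX (A - {i}, b)"
          using gX_insert[of "A - {i}" i b] True i by (simp add: insert_absorb)
        show ?thesis
        proof -
          let ?b = "b(k := Suc (b k))"
          have "dg k - int (w i) + (j - gX (A - {i}, ?b)) = j - gX (A, b)"
            using gX_upd[OF that(1), of "A - {i}" b] g by simp
          with comp_mult[OF a_hom[OF that], of "j - gX (A - {i}, ?b)" "sg i A * z (A - {i}, ?b)"] i show ?thesis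
            by (simp add: lam_def del_def vcomp_def comp_sg)
        qed
      qed (simp add: lam_def comp_simps)
      show ?thesis unfolding x
        by (simp add: dX_def delta_def ss_def vec_apply sum_fun_apply 1 2 comp_simps vcomp_def[of w gX j "_ + _"])
    next
      case False
      then have "x \<notin> Bs s n" using Bs_finite_A x by blast
      then have "dX z x = 0" "dX (vcomp w gX j z) x = 0"
        using VV_dX[OF z] VV_dX[OF VV_vcomp[OF z, of w gX j]] unfolding VV_def by blast+
      then show ?thesis by (simp add: vcomp_def[of w gX j "dX z"] comp_simps)
    qed
  qed
qed


section \<open>Exactness of the Tate complex\<close>

abbreviation ev0 :: "'k tvec" where "ev0 \<equiv> ev ({}, \<lambda>_. 0)"

text \<open>The Koszul complex on the first \<open>r\<close> variables. Its differential can still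
  be \<open>dX\<close>: contractions by later variables and all \<open>del j\<close> vanish on
  it.\<close>

definition Ks :: "nat \<Rightarrow> nat \<Rightarrow> (nat set \<times> (nat \<Rightarrow> nat)) set" where
  "Ks r n = {(A, b). A \<subseteq> {..<r} \<and> b = (\<lambda>_. 0) \<and> card A = n}"

lemma Ks_Bs: "Ks e n = Bs 0 n"
  by (auto simp: Ks_def Bs_def)

lemma Bs_0: "Bs s 0 = {({}, \<lambda>_. 0)}"
proof -
  have "A = {} \<and> b = (\<lambda>_. 0)" if Ab: "(A, b) \<in> Bs s 0" for A b
  proof
    show "A = {}" using Ab Bs_finite_A[OF Ab] by (auto simp: Bs_def)
    show "b = (\<lambda>_. 0)"
    proof
      fix j show "b j = 0" using Ab by (cases "j < s") (auto simp: Bs_def)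
    qed
  qed
  then show ?thesis by (auto simp: Bs_def)
qed

lemma VV_Ks_mono: "z \<in> VV (Ks r n) \<Longrightarrow> r \<le> r' \<Longrightarrow> z \<in> VV (Ks r' n)"
proof -
  assume "z \<in> VV (Ks r n)" "r \<le> r'"
  moreover from this have "Ks r n \<subseteq> Ks r' n" by (auto simp: Ks_def)
  ultimately show ?thesis by (auto simp: VV_def)
qed

lemma VV_Ks_Bs: "z \<in> VV (Ks r n) \<Longrightarrow> r \<le> e \<Longrightarrow> z \<in> VV (Bs s n)"
  using VV_Ks_mono[of z r n e] VV_Bs_mono[of z 0 n s] by (simp add: Ks_Bs)

lemma VV_Ks_iota: "z \<in> VV (Ks (Suc r) (Suc n)) \<Longrightarrow> iota r z \<in> VV (Ks r n)"
proof -
  assume z: "z \<in> VV (Ks (Suc r) (Suc n))"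
  have "(insert r A, b) \<notin> Ks (Suc r) (Suc n)" if "(A, b) \<notin> Ks r n" "r \<notin> A" for A b
  proof
    assume *: "(insert r A, b) \<in> Ks (Suc r) (Suc n)"
    then have "insert r A \<subseteq> {..<Suc r}" by (simp add: Ks_def)
    then have "A \<subseteq> {..<r}" using that(2) by (metis insert_subset lessThan_Suc subset_insert)
    moreover from this have "finite A" by (rule finite_subset) simp
    ultimately show False using * that by (simp add: Ks_def)
  qed
  with z show ?thesis by (auto simp: VV_def iota_def)
qed

lemma VV_Ks_lam: "z \<in> VV (Ks r n) \<Longrightarrow> i < r' \<Longrightarrow> r \<le> r' \<Longrightarrow> lam i z \<in> VV (Ks r' (Suc n))"
proof -
  assume z: "z \<in> VV (Ks r n)" and r: "i < r'" "r \<le> r'"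
  have "(A - {i}, b) \<notin> Ks r n" if A: "(A, b) \<notin> Ks r' (Suc n)" "i \<in> A" for A b
  proof
    assume *: "(A - {i}, b) \<in> Ks r n"
    then have sub: "A - {i} \<subseteq> {..<r}" by (simp add: Ks_def)
    then have "finite (A - {i})" by (rule finite_subset) simp
    then have "card A = Suc n" using * A(2) by (simp add: Ks_def card_Diff_singleton) (metis card_gt_0_iff empty_iff Suc_pred finite_insert insert_Diff)
    moreover have "A \<subseteq> {..<r'}" using sub r by (auto simp: subset_iff)
    ultimately show False using A * by (simp add: Ks_def)
  qed
  with z show ?thesis by (auto simp: VV_def lam_def)
qed

lemma VV_Ks_decompose: "z \<in> VV (Ks (Suc r) n) \<Longrightarrow> z - lam r (iota r z) \<in> VV (Ks r n)"
proof -
  assume z: "z \<in> VV (Ks (Suc r) n)"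
  have "(z - lam r (iota r z)) (A, b) = 0" if A: "(A, b) \<notin> Ks r n" for A b
  proof (cases "r \<in> A")
    case True
    then show ?thesis by (simp add: lam_def iota_def vec_apply sg_self insert_absorb)
  next
    case False
    then have "(A, b) \<notin> Ks (Suc r) n"
      using A by (auto simp: Ks_def lessThan_Suc)
    then show ?thesis using z False by (simp add: lam_def vec_apply VV_def)
  qed
  then show ?thesis by (auto simp: VV_def)
qed

lemma del_Ks: "z \<in> VV (Ks r n) \<Longrightarrow> r \<le> e \<Longrightarrow> del j z = 0"
  using VV_del_low[of z 0 n j] VV_Ks_Bs[of z r n 0] by simp

lemma dX_Ks: "z \<in> VV (Ks r n) \<Longrightarrow> r \<le> e \<Longrightarrow> dX z = delta z"
  by (simp add: dX_def del_Ks lin_0[OF lin_ss])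

lemma dX_dX_Ks: "z \<in> VV (Ks r n) \<Longrightarrow> r \<le> e \<Longrightarrow> dX (dX z) = 0"
  by (simp add: dX_dX del_Ks smv_simps)

lemma ev0_Ks: "ev0 \<in> VV (Ks r 0)"
  by (rule VV_ev) (simp add: Ks_def)

lemma VV_0_eq: "z \<in> VV (Bs s 0) \<Longrightarrow> z = z ({}, \<lambda>_. 0) \<star> ev0"
  using VV_expand[OF finite_Bs, of z s 0] by (simp add: Bs_0)

lemma dX_ev0: "dX ev0 = 0"
  using dX_VV_0[OF VV_Ks_Bs[OF ev0_Ks[of 0]]] by simp

lemma dX_scalar:
  assumes "z \<in> VV (Bs s 1)"
  shows "dX z ({}, \<lambda>_. 0) = (\<Sum>i<e. xv i * z ({i}, \<lambda>_. 0))"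
proof -
  have "dX z = delta z" using VV_del_low[OF assms] by (simp add: dX_def lin_0[OF lin_ss])
  then show ?thesis by (simp add: delta_def sum_fun_apply vec_apply iota_def sg_def)
qed

lemma dX_scalar_mm: "z \<in> VV (Bs s 1) \<Longrightarrow> dX z ({}, \<lambda>_. 0) \<in> mm"
  by (simp add: dX_scalar sum_mm mm_simps xv_mm)

lemma scalar_boundary:
  assumes r: "r \<le> e" and p: "rho {r..<e} p = 0"
  shows "\<exists>u\<in>VV (Ks r 1). p \<star> ev0 - dX u \<in> EV (kr e)"
proof -
  obtain p' where p': "rho {..<e} p = rho {r..<e} p + (\<Sum>i<r. xv i * p' i)" using rho_decompose[OF r] by blast
  let ?u = "\<Sum>i<r. p' i \<star> lam i ev0"
  have "?u \<in> VV (Ks r 1)" using VV_Ks_lam[OF ev0_Ks[of 0]] by (intro VV_sum VV_smv) simp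
  moreover have "dX ?u = (\<Sum>i<r. (xv i * p' i) \<star> ev0)"
    using r by (simp add: lin_sum[OF lin_dX] lin_smv[OF lin_dX] dX_lam dX_ev0 lin_0[OF lin_tate(2)] smv_simps mult.commute)
  then have "dX ?u = rho {..<e} p \<star> ev0"
    using p p' by (simp add: fun_eq_iff sum_fun_apply vec_apply sum_distrib_right)
  then have "p \<star> ev0 - dX ?u = (p - rho {..<e} p) \<star> ev0" by (simp add: smv_simps)
  then have "p \<star> ev0 - dX ?u \<in> EV (kr e)"
    using rho_diff_kr(2)[of p e] hidealD(1)[OF hideal_kr, of e] by (auto simp: EV_def vec_apply ev_apply)
  ultimately show ?thesis by blast
qed

text \<open>Induction on the number of variables. The part \<open>v\<close> of \<open>z\<close> that
  multiplies the last exterior variable is a cycle, hence a boundary; in degree 0 this rests on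
  regularity of the variable modulo the earlier ones. Correcting \<open>z\<close> by a boundary then
  removes the last exterior variable.\<close>

lemma koszul_exact:
  assumes "r \<le> e" "z \<in> VV (Ks r (Suc n))" "dX z \<in> EV (kr e)"
  shows "\<exists>u\<in>VV (Ks r (Suc (Suc n))). z - dX u \<in> EV (kr e)"
  using assms
proof (induction r arbitrary: z n)
  case 0
  then have "z = 0" by (auto simp: VV_def Ks_def fun_eq_iff)
  then have "z - dX 0 = 0" by (simp only: lin_0[OF lin_dX] diff_self)
  then have "z - dX 0 \<in> EV (kr e)" using submodD(1)[OF submod_EV[OF hideal_kr]] by (simp only:)
  then show ?case using VV_0 by blast
next
  case (Suc r)
  note S = submod_EV[OF hideal_kr[of w e], where g = "\<lambda>_. 0"]
  have r: "r < e" "r \<le> e" using Suc.prems(1) by auto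
  define v where "v = iota r z"
  define u where "u = z - lam r v"
  have v: "v \<in> VV (Ks r n)" unfolding v_def by (rule VV_Ks_iota[OF Suc.prems(2)])
  have u: "u \<in> VV (Ks r (Suc n))" unfolding u_def v_def by (rule VV_Ks_decompose[OF Suc.prems(2)])
  have "dX v = - iota r (dX z)"
    using dX_Ks[OF Suc.prems(2,1)] dX_Ks[OF v r(2)] by (simp add: v_def iota_delta)
  then have dv: "dX v \<in> EV (kr e)"
    using submodD(5)[OF S EV_tate(1)[OF hideal_kr Suc.prems(3)]] by simp
  have "\<exists>x\<in>VV (Ks r (Suc n)). v - dX x \<in> EV (kr e)"
  proof (cases n)
    case (Suc m)
    then show ?thesis using Suc.IH[OF r(2), of v m] v dv by simp
  next
    case 0
    \<comment> \<open>In degree 0 being a cycle says nothing about \<open>v\<close>. Instead the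
      scalar coordinate of \<open>dX z\<close> puts \<open>xv r * p\<close> into the ideal of the
      earlier variables, up to \<open>kr e\<close>, and \<open>rho {r..<e}\<close> detects
      this.\<close>
    define p where "p = v ({}, \<lambda>_. 0)"
    have vp: "v = p \<star> ev0" using VV_0_eq[OF VV_Ks_Bs[OF v[unfolded 0] r(2)]] by (simp add: p_def)
    have "dX z = dX u + (xv r \<star> v - lam r (dX v))"
      using dX_lam[OF r(1), of v] lin_add[OF lin_dX, of u "lam r v"] by (simp add: u_def)
    then have "dX u ({}, \<lambda>_. 0) + xv r * p = dX z ({}, \<lambda>_. 0)"
      by (simp add: vec_apply p_def) (simp add: lam_def)
    then have 1: "dX u ({}, \<lambda>_. 0) + xv r * p \<in> kr e" using Suc.prems(3) by (simp add: EV_def)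
    have 2: "dX u ({}, \<lambda>_. 0) = (\<Sum>i<e. xv i * u ({i}, \<lambda>_. 0))"
      using dX_scalar[of u 0] VV_Ks_Bs[OF u r(2), of 0] 0 by simp
    have 3: "rho {r..<e} q = 0" if "q \<in> kr e" for q :: "'k mpoly"
    proof -
      have "{r..<e} \<inter> {..<e} = {r..<e}" by auto
      then have "rho {r..<e} q = rho {r..<e} (rho {..<e} q)" by (simp add: rho_rho)
      also have "\<dots> = 0" using that by (simp add: kr_def rho_simps)
      finally show ?thesis .
    qed
    have "(\<Sum>i<e. rho {r..<e} (xv i * u ({i}, \<lambda>_. 0))) + rho {r..<e} (xv r * p) = 0"
      using 3[OF 1[unfolded 2]] by (simp add: rho_simps)
    moreover have "rho {r..<e} (xv i * u ({i}, \<lambda>_. 0)) = 0" for i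
    proof (cases "i < r")
      case False
      then have "({i}, \<lambda>_. 0) \<notin> Ks r (Suc n)" by (simp add: Ks_def)
      then show ?thesis using u by (simp add: VV_def rho_simps)
    qed (simp add: rho_mult rho_xv)
    ultimately have "rho {r..<e} (xv r * p) = 0" by (simp only: sum.neutral_const add_0)
    then have "xv r * rho {r..<e} p = 0" using r by (simp add: rho_mult rho_xv)
    then have "rho {r..<e} p = 0" by (rule mult_xv_eq_0)
    then show ?thesis using scalar_boundary[OF r(2)] 0 vp by simp
  qed
  then obtain x where x: "x \<in> VV (Ks r (Suc n))" "v - dX x \<in> EV (kr e)" by blast
  \<comment> \<open>Up to the congruence of \<open>v\<close> with \<open>dX x\<close>, this is
    \<open>z\<close> plus the boundary of \<open>lam r x\<close>; it is free of the exterior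
    variable of index \<open>r\<close>.\<close>
  define z' where "z' = u + xv r \<star> x"
  have z': "z' \<in> VV (Ks r (Suc n))" unfolding z'_def by (intro VV_add VV_smv u x)
  have eq: "z' = z + dX (lam r x) - lam r (v - dX x)"
    using dX_lam[OF r(1), of x] by (simp add: z'_def u_def lin_diff[OF lin_tate(2)])
  have lx: "lam r x \<in> VV (Ks (Suc r) (Suc (Suc n)))" using VV_Ks_lam[OF x(1), of r "Suc r"] by simp
  have lE: "lam r (v - dX x) \<in> EV (kr e)" by (rule EV_tate(2)[OF hideal_kr x(2)])
  have "dX z' = dX z - dX (lam r (v - dX x))"
    unfolding eq lin_diff[OF lin_dX] lin_add[OF lin_dX] using dX_dX_Ks[OF lx Suc.prems(1)] by simp
  then have "dX z' \<in> EV (kr e)" using submodD(6)[OF S Suc.prems(3) EV_dX[OF hideal_kr lE]] by simp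
  then obtain u' where u': "u' \<in> VV (Ks r (Suc (Suc n)))" "z' - dX u' \<in> EV (kr e)"
    using Suc.IH[OF r(2) z'] by blast
  have "z - dX (u' - lam r x) = (z' - dX u') + lam r (v - dX x)"
    by (simp add: eq lin_diff[OF lin_dX])
  then have "z - dX (u' - lam r x) \<in> EV (kr e)" using submodD(2)[OF S u'(2) lE] by (simp only:)
  moreover have "u' - lam r x \<in> VV (Ks (Suc r) (Suc (Suc n)))"
    using VV_Ks_mono[OF u'(1), of "Suc r"] lx by (intro VV_diff) auto
  ultimately show ?case by blast
qed

end

section \<open>Adjoining divided power variables one at a time\<close>

context tate
begin

sublocale hquot w "JJ c"
proof
  show "1 \<le> w i" for i by (rule w)
  show "hideal w (JJ c)" "JJ c \<subseteq> mm" by (rule hideal_JJ JJ_mm, simp)+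
qed

lemma EV_mono: "K \<subseteq> K' \<Longrightarrow> z \<in> EV K \<Longrightarrow> z \<in> EV K'"
  by (auto simp: EV_def)

lemma kr_JJ: "kr e \<subseteq> JJ s"
  using JJ_mono[of 0 s] by (simp add: JJ_0)

lemma scalar_mm_boundary:
  assumes "p \<in> mm"
  shows "\<exists>u\<in>VV (Bs s 1). p \<star> ev0 - dX u \<in> EV (kr e)"
proof -
  have "rho {e..<e} p = 0" using assms by (simp add: rho_empty mm_def)
  then obtain u where "u \<in> VV (Ks e 1)" "p \<star> ev0 - dX u \<in> EV (kr e)" using scalar_boundary[of e p] by blast
  then show ?thesis using VV_Ks_Bs[of u e 1 s] by auto
qed

lemma dX_dX_JJ:
  assumes "z \<in> VV (Bs s n)" "s \<le> c"
  shows "dX (dX z) \<in> EV (JJ s)"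
proof -
  have "f j \<star> del j z \<in> EV (JJ s)" if "j < c" for j
  proof (cases "j < s")
    case True
    then show ?thesis using f_JJ'[OF True assms(2)] by (simp add: EV_def vec_apply)
  next
    case False
    then have "f j \<star> del j z = 0" using VV_del_low[OF assms(1), of j] by (simp add: smv_simps)
    then show ?thesis using submodD(1)[OF submod_EV[OF hideal_JJ[OF assms(2)]]] by (simp only:)
  qed
  then show ?thesis unfolding dX_dX
    by (intro submod_sum[OF submod_EV[OF hideal_JJ[OF assms(2)], where g = "\<lambda>_. 0"]]) simp
qed

lemma EV_JJ_Suc:
  assumes "s < c" "z \<in> EV (JJ (Suc s))" "z \<in> VV B"
  shows "\<exists>v\<in>VV B. z - f s \<star> v \<in> EV (JJ s)"
proof -
  have "\<forall>x. \<exists>t. z x - f s * t \<in> JJ s" using JJ_Suc[OF assms(1)] assms(2) by (auto simp: EV_def)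
  then obtain t where t: "\<And>x. z x - f s * t x \<in> JJ s" by metis
  have "0 \<in> JJ s" using hidealD(1)[OF hideal_JJ[of s]] assms(1) by simp
  then have "z - f s \<star> (\<lambda>x. if x \<in> B then t x else 0) \<in> EV (JJ s)"
    using t assms(3) by (simp add: EV_def vec_apply VV_def)
  moreover have "(\<lambda>x. if x \<in> B then t x else 0) \<in> VV B" by (simp add: VV_def)
  ultimately show ?thesis by blast
qed

lemma EV_f_JJ: "s < c \<Longrightarrow> f s \<star> v \<in> EV (JJ (Suc s))"
  using f_JJ by (simp add: EV_def vec_apply)

text \<open>Modulo \<open>JJ s\<close> the complex is exact in positive degrees; reducing further by
  the regular element \<open>f s\<close> creates positive homology only in degree 1, spanned by
  \<open>ss s ev0\<close>. Indeed \<open>dX z\<close> is \<open>f s\<close> times some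
  \<open>v\<close>, which is a cycle by regularity, and a primitive of \<open>v\<close>, up to a
  constant \<open>k\<close> in degree 0, serves to correct \<open>z\<close>.\<close>

lemma homology_mod_next:
  assumes s: "s < c" and IH: "\<And>n z. z \<in> VV (Bs s (Suc n)) \<Longrightarrow> dX z \<in> EV (JJ s) \<Longrightarrow>
      \<exists>u\<in>VV (Bs s (Suc (Suc n))). z - dX u \<in> EV (JJ s)"
    and z: "z \<in> VV (Bs s (Suc m))" "dX z \<in> EV (JJ (Suc s))"
  shows "\<exists>u\<in>VV (Bs s (Suc (Suc m))). \<exists>k. (m = 0 \<or> k = 0) \<and> z - dX u - sing 0 k \<star> ss s ev0 \<in> EV (JJ (Suc s))"
proof -
  note S = submod_EV[OF hideal_JJ, of s "\<lambda>_. 0", OF less_imp_le[OF s]]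
  note S' = submod_EV[OF hideal_JJ, of "Suc s" "\<lambda>_. 0", OF Suc_leI[OF s]]
  obtain v where v: "v \<in> VV (Bs s m)" "dX z - f s \<star> v \<in> EV (JJ s)"
    using EV_JJ_Suc[OF s z(2) VV_dX[OF z(1)]] by blast
  have "\<exists>x\<in>VV (Bs s (Suc m)). \<exists>k. (m = 0 \<or> k = 0) \<and> v - dX x - sing 0 k \<star> ev0 \<in> EV (JJ s)"
  proof (cases m)
    case 0
    define p where "p = v ({}, \<lambda>_. 0)"
    have vp: "v = p \<star> ev0" using VV_0_eq[OF v(1)[unfolded 0]] by (simp add: p_def)
    have "p - sing 0 (lkp p 0) \<in> mm" by (simp add: mm_def lookup_minus)
    then obtain x where x: "x \<in> VV (Bs s 1)" "(p - sing 0 (lkp p 0)) \<star> ev0 - dX x \<in> EV (kr e)"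
      using scalar_mm_boundary by blast
    have "v - dX x - sing 0 (lkp p 0) \<star> ev0 = (p - sing 0 (lkp p 0)) \<star> ev0 - dX x"
      by (simp add: vp smv_simps)
    then have "v - dX x - sing 0 (lkp p 0) \<star> ev0 \<in> EV (JJ s)"
      using EV_mono[OF kr_JJ x(2)] by (simp only:)
    then show ?thesis using x(1) 0 by auto
  next
    case (Suc m')
    have "f s \<star> dX v = dX (dX z) - dX (dX z - f s \<star> v)"
      by (simp add: lin_diff[OF lin_dX] lin_smv[OF lin_dX])
    also have "\<dots> \<in> EV (JJ s)"
      using s by (intro submodD(6)[OF S] dX_dX_JJ[OF z(1)] EV_dX[OF hideal_JJ] v(2)) auto
    finally have "dX v \<in> EV (JJ s)" using JJ_regular[OF s] by (simp add: EV_def vec_apply)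
    then obtain x where "x \<in> VV (Bs s (Suc m))" "v - dX x \<in> EV (JJ s)" using IH[of v m'] v(1) Suc by auto
    then show ?thesis by (intro bexI[of _ x] exI[of _ 0]) (auto simp: smv_simps)
  qed
  then obtain x k where x: "x \<in> VV (Bs s (Suc m))" "m = 0 \<or> k = 0" "v - dX x - sing 0 k \<star> ev0 \<in> EV (JJ s)"
    by blast
  define y where "y = z - sing 0 k \<star> ss s ev0 - f s \<star> x"
  have "sing 0 k \<star> ss s ev0 \<in> VV (Bs s (Suc m))"
    using x(2)
  proof
    assume "m = 0"
    then show ?thesis using VV_ss[OF VV_Ks_Bs[OF ev0_Ks[of 0], of s], of s] by (intro VV_smv) simp
  qed (simp add: smv_simps)
  then have y: "y \<in> VV (Bs s (Suc m))" unfolding y_def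
    using VV_diff[OF VV_diff[OF z(1)] VV_smv[OF x(1)]] by blast
  have "dX y = (dX z - f s \<star> v) + f s \<star> (v - dX x - sing 0 k \<star> ev0)"
    unfolding y_def using dX_ss[OF s, of ev0]
    by (simp add: lin_diff[OF lin_dX] lin_smv[OF lin_dX] dX_ev0 lin_0[OF lin_ss] smv_simps mult.commute)
  also have "\<dots> \<in> EV (JJ s)" by (intro submodD(2)[OF S] submodD(3)[OF S] v(2) x(3))
  finally obtain u where u: "u \<in> VV (Bs s (Suc (Suc m)))" "y - dX u \<in> EV (JJ s)" using IH[OF y] by blast
  have "z - dX u - sing 0 k \<star> ss s ev0 = (y - dX u) + f s \<star> x" by (simp add: y_def)
  also have "\<dots> \<in> EV (JJ (Suc s))"
    by (intro submodD(2)[OF S'] EV_f_JJ[OF s] EV_mono[OF JJ_mono u(2)]) simp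
  finally show ?thesis using u(1) x(2) by blast
qed

lemma del_pow: "(del j ^^ M) (dX z) = dX ((del j ^^ M) z)" "lin (del j ^^ M)" "(del j ^^ M) ((sig j ^^ M) z) = z"
  "z \<in> VV (Bs s (n + 2 * M)) \<Longrightarrow> (del j ^^ M) z \<in> VV (Bs s n)"
  "hideal w K \<Longrightarrow> z \<in> EV K \<Longrightarrow> (del j ^^ M) z \<in> EV K"
proof -
  show "(del j ^^ M) (dX z) = dX ((del j ^^ M) z)" by (induction M) (auto simp: dX_del)
  show "lin (del j ^^ M)"
  proof (induction M)
    case (Suc M)
    from lin_compose[OF lin_tate(3) this] show ?case by (simp add: o_def)
  qed (simp add: lin_def)
  show "(del j ^^ M) ((sig j ^^ M) z) = z"
    by (induction M arbitrary: z) (auto simp: funpow_swap1 del_sig simp flip: funpow.simps(2), simp add: funpow_swap1 del_sig)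
  show "z \<in> VV (Bs s (n + 2 * M)) \<Longrightarrow> (del j ^^ M) z \<in> VV (Bs s n)"
  proof (induction M arbitrary: n)
    case (Suc M)
    then show ?case using VV_del[OF Suc.IH[of "n + 2"], of j] by (simp add: add.commute add.left_commute)
  qed simp
  show "hideal w K \<Longrightarrow> z \<in> EV K \<Longrightarrow> (del j ^^ M) z \<in> EV K"
    by (induction M) (auto intro: EV_tate)
qed

lemma del_pow_low:
  assumes z: "z \<in> VV (Bs s n)" and n: "n < 2 * M"
  shows "(del j ^^ M) z = 0"
proof (rule ext)
  fix x :: "nat set \<times> (nat \<Rightarrow> nat)"
  obtain A b where x: "x = (A, b)" by fastforce
  have "(del j ^^ k) z (A, b) = z (A, b(j := b j + k))" for k and b :: "nat \<Rightarrow> nat"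
    by (induction k arbitrary: b) (auto simp: del_def)
  moreover have "(A, b(j := b j + M)) \<notin> Bs s n"
  proof
    assume *: "(A, b(j := b j + M)) \<in> Bs s n"
    show False
    proof (cases "j < s")
      case True
      then have "(b(j := b j + M)) j \<le> (\<Sum>i<s. (b(j := b j + M)) i)" by (intro member_le_sum) auto
      then show False using * n by (simp add: Bs_def)
    next
      case False
      then have "(b(j := b j + M)) j = 0" using * unfolding Bs_def by (auto simp del: fun_upd_apply)
      then show False using n by simp
    qed
  qed
  ultimately show "(del j ^^ M) z x = 0 x" using z by (simp add: x VV_def)
qed

lemma sig_pow: "z \<in> VV (Bs s n) \<Longrightarrow> j < s \<Longrightarrow> (sig j ^^ M) z \<in> VV (Bs s (n + 2 * M))"
  "hideal w K \<Longrightarrow> z \<in> EV K \<Longrightarrow> (sig j ^^ M) z \<in> EV K"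
proof -
  show "z \<in> VV (Bs s n) \<Longrightarrow> j < s \<Longrightarrow> (sig j ^^ M) z \<in> VV (Bs s (n + 2 * M))"
  proof (induction M)
    case (Suc M)
    then show ?case using VV_sig[of "(sig j ^^ M) z" s "n + 2 * M" j] by simp
  qed simp
  show "hideal w K \<Longrightarrow> z \<in> EV K \<Longrightarrow> (sig j ^^ M) z \<in> EV K"
    by (induction M) (auto intro: EV_tate)
qed

text \<open>If \<open>k\<close> times the class were a boundary, applying \<open>dX\<close> and
  cancelling \<open>f s\<close> would express \<open>k\<close> modulo \<open>JJ s\<close> as the
  scalar of a boundary; both lie in \<open>mm\<close>.\<close>

lemma ss_ev0_not_boundary:
  assumes s: "s < c" and y: "y \<in> VV (Bs s 2)" "dX y + sing 0 k \<star> ss s ev0 \<in> EV (JJ (Suc s))"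
  shows "k = 0"
proof -
  note S = submod_EV[OF hideal_JJ, of s "\<lambda>_. 0", OF less_imp_le[OF s]]
  let ?z = "dX y + sing 0 k \<star> ss s ev0"
  have "?z \<in> VV (Bs s 1)"
    using VV_dX[of y s 1] y(1) VV_ss[OF VV_Ks_Bs[OF ev0_Ks[of 0], of s]]
    by (intro VV_add VV_smv) (auto simp: numeral_2_eq_2)
  then obtain t where t: "t \<in> VV (Bs s 1)" "?z - f s \<star> t \<in> EV (JJ s)" using EV_JJ_Suc[OF s y(2)] by blast
  have "f s \<star> (sing 0 k \<star> ev0 - dX t) = dX (?z - f s \<star> t) - dX (dX y)"
    using dX_ss[OF s, of ev0]
    by (simp add: lin_diff[OF lin_dX] lin_add[OF lin_dX] lin_smv[OF lin_dX] dX_ev0 lin_0[OF lin_ss] smv_simps mult.commute)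
  also have "\<dots> \<in> EV (JJ s)"
    using s by (intro submodD(6)[OF S] dX_dX_JJ[OF y(1)] EV_dX[OF hideal_JJ] t(2)) auto
  finally have "(sing 0 k \<star> ev0 - dX t) ({}, \<lambda>_. 0) \<in> JJ s" using JJ_regular[OF s] by (simp add: EV_def vec_apply)
  then have "sing 0 k - dX t ({}, \<lambda>_. 0) \<in> mm" using JJ_mm[of s] s by (auto simp: vec_apply ev_apply)
  from mm_simps(2)[OF this dX_scalar_mm[OF t(1)]] show "k = 0" by (simp add: mm_def)
qed

text \<open>The new variable \<open>y_s\<close> kills the class of \<open>ss s ev0\<close>. The
  highest power of \<open>y_s\<close> in a cycle is lowered step by step: its coefficient is a cycle
  free of \<open>y_s\<close>, to which \<open>homology_mod_next\<close> applies.\<close>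

lemma tate_exact:
  assumes "s \<le> c" "z \<in> VV (Bs s (Suc n))" "dX z \<in> EV (JJ s)"
  shows "\<exists>u\<in>VV (Bs s (Suc (Suc n))). z - dX u \<in> EV (JJ s)"
  using assms
proof (induction s arbitrary: n z)
  case 0
  then show ?case using koszul_exact[of e z n] by (simp add: JJ_0 flip: Ks_Bs)
next
  case (Suc s)
  have s: "s < c" using Suc.prems(1) by simp
  have IH: "\<And>n z. z \<in> VV (Bs s (Suc n)) \<Longrightarrow> dX z \<in> EV (JJ s) \<Longrightarrow>
      \<exists>u\<in>VV (Bs s (Suc (Suc n))). z - dX u \<in> EV (JJ s)" using Suc.IH s by simp
  note S' = submod_EV[OF hideal_JJ, of "Suc s" "\<lambda>_. 0", OF Suc_leI[OF s]]
  have J': "hideal w (JJ (Suc s))" by (rule hideal_JJ) (use s in simp)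
  \<comment> \<open>\<open>M\<close> is a strict upper bound for the powers of \<open>y_s\<close>
    that occur in \<open>z\<close>.\<close>
  have claim: "\<exists>u\<in>VV (Bs (Suc s) (Suc (Suc n))). z - dX u \<in> EV (JJ (Suc s))"
    if "(del s ^^ M) z = 0" "z \<in> VV (Bs (Suc s) (Suc n))" "dX z \<in> EV (JJ (Suc s))" for M and z :: "'k tvec"
    using that
  proof (induction M arbitrary: z)
    case 0
    then have "z = 0" by (simp only: funpow_0)
    then have "z - dX 0 = 0" by (simp only: lin_0[OF lin_dX] diff_self)
    then have "z - dX 0 \<in> EV (JJ (Suc s))" using submodD(1)[OF S'] by (simp only:)
    then show ?case using VV_0 by blast
  next
    case (Suc M)
    define u where "u = (del s ^^ M) z"
    show ?case
    proof (cases "2 * M \<le> Suc n")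
      case False
      then have "u = 0" unfolding u_def using del_pow_low[OF Suc.prems(2)] by simp
      then show ?thesis using Suc.IH[of z] Suc.prems(2,3) by (simp add: u_def)
    next
      case True
      then obtain m where m: "Suc n = m + 2 * M" using le_Suc_ex[of "2 * M" "Suc n"] by (auto simp: add.commute)
      have uS: "u \<in> VV (Bs (Suc s) m)" unfolding u_def using del_pow(4)[of z "Suc s" m M s] Suc.prems(2) m by simp
      have du0: "del s u = 0" using Suc.prems(1) by (simp only: u_def funpow.simps o_apply)
      then have "u - e0 s u = 0" using sig_del[of s u, symmetric] by (simp only: lin_0[OF lin_tate(4)])
      then have eu: "e0 s u = u" by (simp only: right_minus_eq)
      have u: "u \<in> VV (Bs s m)" using VV_e0_Suc[OF uS] eu by simp
      have dXu: "dX u \<in> EV (JJ (Suc s))"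
        unfolding u_def using del_pow(5)[OF J' Suc.prems(3), where j = s and M = M] by (simp add: del_pow(1))
      \<comment> \<open>A chain whose boundary has, modulo the ideal, the same coefficient
        \<open>u\<close> at the \<open>M\<close>-th divided power of \<open>y_s\<close>; it may
        itself contain one higher power.\<close>
      have "\<exists>Y\<in>VV (Bs (Suc s) (Suc (Suc n))). u - dX ((del s ^^ M) Y) \<in> EV (JJ (Suc s))"
      proof (cases m)
        case (Suc m')
        obtain x k where x: "x \<in> VV (Bs s (Suc m))" "m' = 0 \<or> k = 0"
          "u - dX x - sing 0 k \<star> ss s ev0 \<in> EV (JJ (Suc s))"
          using homology_mod_next[OF s IH, of u m'] u dXu Suc by auto
        \<comment> \<open>The summand with \<open>sig s ev0\<close>, that is \<open>y_s\<close>, has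
          boundary \<open>ss s ev0\<close> and so accounts for the exceptional class.\<close>
        let ?Y = "(sig s ^^ M) (x + sing 0 k \<star> sig s ev0)"
        have "sing 0 k \<star> sig s ev0 \<in> VV (Bs (Suc s) (Suc m))"
          using x(2)
        proof
          assume "m' = 0"
          then show ?thesis using Suc VV_sig[OF VV_Ks_Bs[OF ev0_Ks[of 0], of "Suc s"], of s]
            by (intro VV_smv) (simp add: numeral_2_eq_2)
        qed (simp add: smv_simps)
        then have "x + sing 0 k \<star> sig s ev0 \<in> VV (Bs (Suc s) (Suc m))"
          using VV_Bs_mono[OF x(1), of "Suc s"] by (intro VV_add) auto
        then have "?Y \<in> VV (Bs (Suc s) (Suc (Suc n)))" using sig_pow(1)[of _ "Suc s" "Suc m" s M] m by simp
        moreover have "e0 s ev0 = (ev0 :: 'k tvec)" by (auto simp: e0_def ev_def fun_eq_iff)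
        then have "dX ((del s ^^ M) ?Y) = dX x + sing 0 k \<star> ss s ev0"
          using dX_sig[OF s, of ev0]
          by (simp add: del_pow(3) lin_add[OF lin_dX] lin_smv[OF lin_dX] dX_ev0 lin_0[OF lin_tate(4)])
        then have "u - dX ((del s ^^ M) ?Y) = u - dX x - sing 0 k \<star> ss s ev0" by simp
        then have "u - dX ((del s ^^ M) ?Y) \<in> EV (JJ (Suc s))" using x(3) by (simp only:)
        ultimately show ?thesis by blast
      next
        case 0
        \<comment> \<open>For \<open>u\<close> of degree 0 the cycle condition is void. The
          coefficient \<open>z'\<close> one power lower equals \<open>y + sig s u\<close>; its
          differential turns the constant term \<open>k\<close> of \<open>u\<close> into
          \<open>k\<close> times the exceptional class, which is thereby a boundary, so
          \<open>k = 0\<close>.\<close>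
        then obtain M' where M': "M = Suc M'" using m by (cases M) auto
        define p where "p = u ({}, \<lambda>_. 0)"
        define k where "k = lkp p 0"
        have up: "u = p \<star> ev0" using VV_0_eq[OF u[unfolded 0]] by (simp add: p_def)
        have "p - sing 0 k \<in> mm" by (simp add: mm_def lookup_minus k_def)
        then obtain x where x: "x \<in> VV (Bs s 1)" "(p - sing 0 k) \<star> ev0 - dX x \<in> EV (kr e)"
          using scalar_mm_boundary by blast
        have x': "u - sing 0 k \<star> ev0 - dX x \<in> EV (JJ (Suc s))"
          using EV_mono[OF kr_JJ x(2)] by (simp add: up smv_simps)
        define z' where "z' = (del s ^^ M') z"
        have z': "z' \<in> VV (Bs (Suc s) 2)" unfolding z'_def
          using del_pow(4)[of z "Suc s" 2 M' s] Suc.prems(2) m M' 0 by simp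
        have uz': "u = del s z'" by (simp add: u_def z'_def M')
        define y where "y = e0 s z'"
        have y: "y \<in> VV (Bs s 2)" unfolding y_def by (rule VV_e0_Suc[OF z'])
        have "z' = y + sig s u" using sig_del[of s z'] by (simp add: y_def uz')
        then have "dX z' = dX y + ss s u"
          using dX_sig[OF s, of u] dX_VV_0[OF u[unfolded 0]] eu
          by (simp add: lin_add[OF lin_dX] lin_0[OF lin_tate(4)])
        moreover have "dX z' \<in> EV (JJ (Suc s))"
          unfolding z'_def using del_pow(5)[OF J' Suc.prems(3), where j = s and M = M'] by (simp add: del_pow(1))
        ultimately have 1: "dX y + ss s u \<in> EV (JJ (Suc s))" by simp
        have 2: "ss s (u - sing 0 k \<star> ev0 - dX x) \<in> EV (JJ (Suc s))" by (rule EV_ss[OF J' x'])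
        have "dX (y - ss s x) + sing 0 k \<star> ss s ev0 =
            (dX y + ss s u) - ss s (u - sing 0 k \<star> ev0 - dX x) - f s \<star> x"
          using dX_ss[OF s, of x] by (simp add: lin_diff[OF lin_dX] lin_diff[OF lin_ss] lin_smv[OF lin_ss])
        also have "\<dots> \<in> EV (JJ (Suc s))" by (intro submodD(6)[OF S'] 1 2 EV_f_JJ s)
        finally have "dX (y - ss s x) + sing 0 k \<star> ss s ev0 \<in> EV (JJ (Suc s))" .
        moreover have "y - ss s x \<in> VV (Bs s 2)"
          using VV_ss[OF x(1), of s] y by (intro VV_diff) (auto simp: numeral_2_eq_2)
        ultimately have "k = 0" using ss_ev0_not_boundary[OF s] by blast
        then have "u - dX x \<in> EV (JJ (Suc s))" using x' by (simp add: smv_simps)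
        moreover have "(sig s ^^ M) x \<in> VV (Bs (Suc s) (Suc (Suc n)))"
          using sig_pow(1)[OF VV_Bs_mono[OF x(1), of "Suc s"], of s M] m 0 by simp
        ultimately show ?thesis by (intro bexI[of _ "(sig s ^^ M) x"]) (simp_all add: del_pow(3))
      qed
      then obtain Y where Y: "Y \<in> VV (Bs (Suc s) (Suc (Suc n)))" "u - dX ((del s ^^ M) Y) \<in> EV (JJ (Suc s))" by blast
      \<comment> \<open>The boundary of \<open>Y\<close> matches \<open>u\<close> only up to
        \<open>r\<close>, which has entries in the ideal. Subtracting the lift of \<open>r\<close>
        makes the coefficient vanish exactly, as the induction hypothesis requires.\<close>
      define r where "r = u - dX ((del s ^^ M) Y)"
      define z1 where "z1 = z - dX Y - (sig s ^^ M) r"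
      have rE: "(sig s ^^ M) r \<in> EV (JJ (Suc s))" using sig_pow(2)[OF J'] Y(2) by (simp add: r_def)
      have "r \<in> VV (Bs (Suc s) m)"
        unfolding r_def using Y(1) m VV_Bs_mono[OF u, of "Suc s"] del_pow(4)[of Y "Suc s" "Suc m" M s]
        by (intro VV_diff VV_dX) auto
      then have "(sig s ^^ M) r \<in> VV (Bs (Suc s) (Suc n))" using sig_pow(1)[of r "Suc s" m s M] m by simp
      then have z1: "z1 \<in> VV (Bs (Suc s) (Suc n))"
        unfolding z1_def using Suc.prems(2) VV_dX[OF Y(1)] by (intro VV_diff) auto
      have "(del s ^^ M) z1 = 0"
        unfolding z1_def by (simp add: lin_diff[OF del_pow(2)] del_pow(1,3) r_def u_def)
      moreover have "dX z1 \<in> EV (JJ (Suc s))"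
        unfolding z1_def lin_diff[OF lin_dX] using s
        by (intro submodD(6)[OF S'] Suc.prems(3) dX_dX_JJ[OF Y(1)] EV_dX[OF J' rE]) auto
      ultimately obtain u' where u': "u' \<in> VV (Bs (Suc s) (Suc (Suc n)))" "z1 - dX u' \<in> EV (JJ (Suc s))"
        using Suc.IH[OF _ z1] by blast
      have "z - dX (u' + Y) = (z1 - dX u') + (sig s ^^ M) r"
        by (simp add: z1_def lin_add[OF lin_dX])
      also have "\<dots> \<in> EV (JJ (Suc s))" by (rule submodD(2)[OF S' u'(2) rE])
      finally show ?thesis using VV_add[OF u'(1) Y(1)] by blast
    qed
  qed
  have "(del s ^^ Suc (Suc n)) z = 0" by (rule del_pow_low[OF Suc.prems(2)]) simp
  then show ?case using claim Suc.prems by blast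
qed

text \<open>Level 0 is \<open>k\<close>, realised as the rank one module in degree 0 modulo
  \<open>mm\<close>, with the identity as augmentation.\<close>

definition BX :: "nat \<Rightarrow> (nat set \<times> (nat \<Rightarrow> nat)) set" where
  "BX = lvl (Bs c 0) (Bs c)"

definition DX :: "nat \<Rightarrow> 'k tvec \<Rightarrow> 'k tvec" where
  "DX = lvl (\<lambda>z. z) (\<lambda>_. dX)"

lemma tate_pres: "pres mm BX (\<lambda>_. gX) DX"
  unfolding pres_def
proof (intro conjI allI ballI)
  show "hideal w (mm :: 'k mpoly set)" by (rule hideal_mm)
  show "JJ c \<subseteq> mm" by (rule JJ_mm) simp
  show "finite (BX i)" for i by (cases i) (auto simp: BX_def finite_Bs)
  show "lmap w (BX (Suc i)) gX (BX i) gX (DX i)" for i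
    by (cases i) (auto simp: BX_def DX_def lmap_dX lmap_id)
  fix i and v :: "'k tvec" assume "v \<in> VV (BX (Suc i))"
  then have v: "v \<in> VV (Bs c i)" by (simp add: BX_def)
  note S = submod_EV[OF hideal_JJ, of c "\<lambda>_. 0", OF order_refl]
  show "DX i v \<in> EV (zl mm i) \<longleftrightarrow> (\<exists>u\<in>VV (BX (Suc (Suc i))). v - DX (Suc i) u \<in> EV (JJ c))"
  proof (cases i)
    case 0
    define p where "p = v ({}, \<lambda>_. 0)"
    have vp: "v = p \<star> ev0" using VV_0_eq[OF v[unfolded 0]] by (simp add: p_def)
    have "v \<in> EV mm \<longleftrightarrow> p \<in> mm" unfolding vp by (auto simp: EV_def vec_apply ev_apply mm_simps)
    moreover have "p \<in> mm \<longleftrightarrow> (\<exists>u\<in>VV (Bs c 1). v - dX u \<in> EV (JJ c))"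
    proof
      assume "p \<in> mm"
      then show "\<exists>u\<in>VV (Bs c 1). v - dX u \<in> EV (JJ c)"
        unfolding vp using scalar_mm_boundary[of p c] EV_mono[OF kr_JJ] by blast
    next
      assume "\<exists>u\<in>VV (Bs c 1). v - dX u \<in> EV (JJ c)"
      then obtain u where u: "u \<in> VV (Bs c 1)" "v - dX u \<in> EV (JJ c)" by blast
      have "p - dX u ({}, \<lambda>_. 0) \<in> mm" using u(2) JJ_mm[of c] by (auto simp: EV_def p_def vec_apply)
      from mm_simps(2)[OF this dX_scalar_mm[OF u(1)]] show "p \<in> mm" by simp
    qed
    ultimately show ?thesis using 0 by (simp add: BX_def DX_def zl_def)
  next
    case (Suc n)
    have "dX v \<in> EV (JJ c)" if u: "u \<in> VV (Bs c (Suc (Suc n)))" "v - dX u \<in> EV (JJ c)" for u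
    proof -
      have "dX v = dX (v - dX u) + dX (dX u)" by (simp add: lin_diff[OF lin_dX])
      also have "\<dots> \<in> EV (JJ c)"
        by (intro submodD(2)[OF S] EV_dX[OF hideal_JJ] dX_dX_JJ[OF u(1)] u(2)) auto
      finally show ?thesis .
    qed
    then show ?thesis using Suc tate_exact[of c v n] v by (auto simp: BX_def DX_def zl_def)
  qed
qed

end

section \<open>Summands of syzygies of the residue field\<close>

context hquot
begin

text \<open>
  \<open>K\<close> is a direct summand, with complement \<open>K'\<close>, of the image of \<open>F\<^sub>n \<rightarrow> F\<^bsub>n-1\<^esub>\<close>
  (both modulo \<open>Z\<close>), and \<open>G\<close> is a minimal resolution of \<open>K\<close>.
\<close>

definition resolves_summand where
  "resolves_summand Z B g B1 D1 K K' BG gG DG \<longleftrightarrow>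
    pres Z BG gG DG \<and> minim BG DG \<and> BG 0 = B \<and> gG 0 = g \<and>
    submod w g K \<and> submod w g K' \<and> EV Z \<inter> VV B \<subseteq> K' \<and>
    (\<forall>u\<in>VV (BG 1). DG 0 u \<in> K) \<and> (\<forall>v\<in>K. \<exists>u\<in>VV (BG 1). v - DG 0 u \<in> EV Z) \<and>
    (\<forall>v\<in>K. v \<in> VV B \<and> (\<exists>u\<in>VV B1. v - D1 u \<in> EV Z)) \<and>
    (\<forall>u\<in>VV B1. \<exists>y\<in>K. D1 u - y \<in> K') \<and> (\<forall>y\<in>K \<inter> K'. y \<in> EV Z)"

text \<open>The inclusion of \<open>K\<close> and the projection along \<open>K'\<close> lift to
  chain maps between the resolution of \<open>K\<close> and the truncation of \<open>F\<close>.
  Their composite lifts the identity of \<open>K\<close>, so by minimality it is the identity modulo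
  \<open>mm\<close>.\<close>

lemma summand_maps:
  fixes BF BG :: "nat \<Rightarrow> 'i set"
  assumes F: "pres Z BF gF DF"
    and G: "resolves_summand (zl Z n) (BF n) (gF n) B1 D1 K K' BG gG DG" "B1 = BF (Suc n)" "D1 = DF n"
  shows "\<exists>inc prj. (\<forall>i. lmap w (BG (Suc i)) (gG (Suc i)) (BF (Suc (n + i))) (gF (Suc (n + i))) (inc i)) \<and>
    (\<forall>i. lmap w (BF (Suc (n + i))) (gF (Suc (n + i))) (BG (Suc i)) (gG (Suc i)) (prj i)) \<and>
    (\<forall>i. \<forall>v\<in>VV (BF (Suc (Suc (n + i)))). DG (Suc i) (prj (Suc i) v) - prj i (DF (Suc (n + i)) v) \<in> EV J) \<and>
    (\<forall>i. \<forall>v\<in>VV (BG (Suc i)). prj i (inc i v) - v \<in> EV mm)"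
proof -
  let ?Z = "zl Z n"
  note G = G(1)[unfolded G(2,3) resolves_summand_def]
  have Gp: "pres ?Z BG gG DG" and Gm: "minim BG DG" and G0: "BG 0 = BF n" "gG 0 = gF n"
    and K: "submod w (gF n) K" and K': "submod w (gF n) K'" "EV ?Z \<inter> VV (BF n) \<subseteq> K'"
    and GK: "\<And>u. u \<in> VV (BG 1) \<Longrightarrow> DG 0 u \<in> K" "\<And>v. v \<in> K \<Longrightarrow> \<exists>u\<in>VV (BG 1). v - DG 0 u \<in> EV ?Z"
    and KF: "\<And>v. v \<in> K \<Longrightarrow> v \<in> VV (BF n)" "\<And>v. v \<in> K \<Longrightarrow> \<exists>u\<in>VV (BF (Suc n)). v - DF n u \<in> EV ?Z"
    and FK: "\<And>u. u \<in> VV (BF (Suc n)) \<Longrightarrow> \<exists>y\<in>K. DF n u - y \<in> K'"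
    and int: "\<And>y. y \<in> K \<Longrightarrow> y \<in> K' \<Longrightarrow> y \<in> EV ?Z"
    using G by blast+
  note Fs = pres_shift[OF F, of n]
  note c = presD[OF Gp] and d = presD[OF F]
  note SZ = submod_EV[OF c(1), of "gF n"]
  have DG0: "lmap w (BG (Suc 0)) (gG (Suc 0)) (BF n) (gF n) (DG 0)" using c(4)[of 0] G0 by simp
  have "\<exists>L. lmap w (BG (Suc 0)) (gG (Suc 0)) (BF (Suc n)) (gF (Suc n)) L \<and>
      (\<forall>v\<in>VV (BG (Suc 0)). DG 0 v - DF n (L v) \<in> EV ?Z)"
    by (rule lmap_lift[OF c(3) DG0 d(4) SZ]) (use GK(1) KF(2) in simp)
  then obtain i0 where i0: "lmap w (BG (Suc 0)) (gG (Suc 0)) (BF (Suc n)) (gF (Suc n)) i0"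
    "\<And>v. v \<in> VV (BG (Suc 0)) \<Longrightarrow> DG 0 v - DF n (i0 v) \<in> EV ?Z" by blast
  have inK': "x \<in> K'" if "x \<in> EV ?Z" "x \<in> VV (BF n)" for x using K'(2) that by blast
  \<comment> \<open>The projection along \<open>K'\<close> is never defined as a map; a lift of it
    is any map that agrees with \<open>DF n\<close> modulo \<open>K'\<close>.\<close>
  have "\<exists>L. lmap w (BF (Suc n)) (gF (Suc n)) (BG (Suc 0)) (gG (Suc 0)) L \<and>
      (\<forall>v\<in>VV (BF (Suc n)). DF n v - DG 0 (L v) \<in> K')"
  proof (rule lmap_lift[OF d(3) d(4) DG0 K'(1)])
    fix v :: "'i \<Rightarrow> 'k mpoly" assume v: "v \<in> VV (BF (Suc n))"
    obtain y where y: "y \<in> K" "DF n v - y \<in> K'" using FK[OF v] by blast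
    obtain u where u: "u \<in> VV (BG 1)" "y - DG 0 u \<in> EV ?Z" using GK(2)[OF y(1)] by blast
    have "y - DG 0 u \<in> K'" using lmapD(2)[OF DG0] u KF(1)[OF y(1)] by (intro inK' VV_diff) auto
    from submodD(2)[OF K'(1) y(2) this] have "DF n v - DG 0 u \<in> K'" by simp
    then show "\<exists>u\<in>VV (BG (Suc 0)). DF n v - DG 0 u \<in> K'" using u(1) by auto
  qed
  then obtain p0 where p0: "lmap w (BF (Suc n)) (gF (Suc n)) (BG (Suc 0)) (gG (Suc 0)) p0"
    "\<And>v. v \<in> VV (BF (Suc n)) \<Longrightarrow> DF n v - DG 0 (p0 v) \<in> K'" by blast
  have "\<exists>f. f 0 = i0 \<and> (\<forall>i. lmap w (BG (Suc i)) (gG (Suc i)) (BF (n + Suc i)) (gF (n + Suc i)) (f i)) \<and>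
    (\<forall>i. \<forall>v\<in>VV (BG (Suc (Suc i))). DF (n + Suc i) (f (Suc i) v) - f i (DG (Suc i) v) \<in> EV J)"
  proof (rule lift_chain[OF Gp Fs])
    fix v :: "'i \<Rightarrow> 'k mpoly" assume v: "v \<in> VV (BG 2)"
    then have v': "DG 1 v \<in> VV (BG (Suc 0))" using c(6)[of v "Suc 0"] by (simp add: numeral_2_eq_2)
    have 1: "DG 0 (DG 1 v) \<in> EV ?Z" using pres_DD[OF Gp, of v 0] v by (simp add: zl_def numeral_2_eq_2)
    from submodD(6)[OF SZ 1 i0(2)[OF v']] show "DF (n + 0) (i0 (DG 1 v)) \<in> EV ?Z" by simp
  qed (use i0(1) in simp)
  then obtain inc where inc: "inc 0 = i0"
    "\<And>i. lmap w (BG (Suc i)) (gG (Suc i)) (BF (Suc (n + i))) (gF (Suc (n + i))) (inc i)"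
    "\<And>i v. v \<in> VV (BG (Suc (Suc i))) \<Longrightarrow> DF (Suc (n + i)) (inc (Suc i) v) - inc i (DG (Suc i) v) \<in> EV J"
    by auto
  have "\<exists>f. f 0 = p0 \<and> (\<forall>i. lmap w (BF (n + Suc i)) (gF (n + Suc i)) (BG (Suc i)) (gG (Suc i)) (f i)) \<and>
    (\<forall>i. \<forall>v\<in>VV (BF (n + Suc (Suc i))). DG (Suc i) (f (Suc i) v) - f i (DF (n + Suc i) v) \<in> EV J)"
  proof (rule lift_chain[OF Fs Gp])
    fix v :: "'i \<Rightarrow> 'k mpoly" assume "v \<in> VV (BF (n + 2))"
    then have v: "v \<in> VV (BF (Suc (Suc n)))" by simp
    then have v': "DF (Suc n) v \<in> VV (BF (Suc n))" by (rule d(6))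
    have 1: "DF n (DF (Suc n) v) \<in> EV ?Z" using pres_DD[OF F v] by simp
    then have "DF n (DF (Suc n) v) \<in> K'" using d(6)[OF v'] by (intro inK')
    from submodD(6)[OF K'(1) this p0(2)[OF v']] have "DG 0 (p0 (DF (Suc n) v)) \<in> K'" by simp
    \<comment> \<open>Lying in \<open>K\<close> and in \<open>K'\<close> together means being zero
      modulo the modulus of level \<open>n\<close>.\<close>
    moreover have "DG 0 (p0 (DF (Suc n) v)) \<in> K" using lmapD(2)[OF p0(1) v'] by (intro GK(1)) simp
    ultimately show "DG 0 (p0 (DF (n + 1) v)) \<in> EV ?Z" using int by simp
  qed (use p0(1) in simp)
  then obtain prj where prj: "prj 0 = p0"
    "\<And>i. lmap w (BF (Suc (n + i))) (gF (Suc (n + i))) (BG (Suc i)) (gG (Suc i)) (prj i)"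
    "\<And>i v. v \<in> VV (BF (Suc (Suc (n + i)))) \<Longrightarrow> DG (Suc i) (prj (Suc i) v) - prj i (DF (Suc (n + i)) v) \<in> EV J"
    by auto
  have "prj i (inc i v) - v \<in> EV mm" if v: "v \<in> VV (BG (Suc i))" for i and v :: "'i \<Rightarrow> 'k mpoly"
  proof (rule chain_endo_id_mod_mm[OF Gp Gm _ _ _ v, where f = "\<lambda>i v. prj i (inc i v)"])
    show "lmap w (BG (Suc i)) (gG (Suc i)) (BG (Suc i)) (gG (Suc i)) (\<lambda>v. prj i (inc i v))" for i
      by (rule lmap_compose[OF inc(2) prj(2)])
    fix i and v :: "'i \<Rightarrow> 'k mpoly" assume v: "v \<in> VV (BG (Suc (Suc i)))"
    let ?x = "DF (Suc (n + i)) (inc (Suc i) v) - inc i (DG (Suc i) v)"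
    have iv: "inc (Suc i) v \<in> VV (BF (Suc (Suc (n + i))))" using lmapD(2)[OF inc(2) v] by simp
    have "?x \<in> VV (BF (Suc (n + i)))" using c(6)[OF v] iv by (intro VV_diff d(6) lmapD(2)[OF inc(2)])
    then have "prj i ?x \<in> EV J" using lmap_EV[OF d(3) prj(2) J _ inc(3)[OF v]] by simp
    from submodD(2)[OF submod_J this prj(3)[OF iv]]
    show "DG (Suc i) (prj (Suc i) (inc (Suc i) v)) - prj i (inc i (DG (Suc i) v)) \<in> EV J"
      by (simp add: lin_diff[OF lmapD(1)[OF prj(2)]])
  next
    fix v :: "'i \<Rightarrow> 'k mpoly" assume "v \<in> VV (BG 1)"
    then have v: "v \<in> VV (BG (Suc 0))" by simp
    have iv: "i0 v \<in> VV (BF (Suc n))" by (rule lmapD(2)[OF i0(1) v])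
    let ?x = "DG 0 (p0 (i0 v)) - DG 0 v"
    have pK: "DG 0 (p0 (i0 v)) \<in> K" using lmapD(2)[OF p0(1) iv] by (intro GK(1)) simp
    have vK: "DG 0 v \<in> K" using v by (intro GK(1)) simp
    have "DG 0 v - DF n (i0 v) \<in> K'"
      using lmapD(2)[OF DG0 v] d(6)[OF iv] i0(2)[OF v] by (intro inK' VV_diff)
    from submodD(5)[OF K'(1) submodD(2)[OF K'(1) this p0(2)[OF iv]]] have "?x \<in> K'" by simp
    moreover have "?x \<in> K" by (rule submodD(6)[OF K pK vK])
    ultimately show "DG 0 (prj 0 (inc 0 v)) - DG 0 v \<in> EV ?Z" using int inc(1) prj(1) by simp
  qed
  then show ?thesis using inc(2) prj(2,3) by blast
qed

end

section \<open>Comparison of the Tate complex with minimal resolutions\<close>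

context tate
begin

text \<open>The Tate complex and \<open>F\<close> both resolve \<open>k\<close>, and the truncated
  \<open>F\<close> has the resolution of the summand as a retract modulo \<open>mm\<close>;
  \<open>al\<close> and \<open>be\<close> are the composites. Minimality gives
  \<open>be (al v) = v\<close> modulo \<open>mm\<close>, whereas the other order is not controlled,
  as the Tate complex need not be minimal.\<close>

lemma tate_comparison:
  fixes BF BG :: "nat \<Rightarrow> nat set"
  assumes F: "pres mm BF gF DF" "minim BF DF" "BF 0 = {0}" "gF 0 = (\<lambda>_. 0)"
    "\<And>v. v \<in> VV (BF 0) \<Longrightarrow> \<exists>u\<in>VV (BF 1). v - DF 0 u \<in> EV mm"
    and G: "resolves_summand (zl mm n) (BF n) (gF n) (BF (Suc n)) (DF n) K K' BG gG DG"
  shows "\<exists>al be. (\<forall>i. lmap w (BG (Suc i)) (gG (Suc i)) (Bs c (n + i)) gX (al i)) \<and>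
    (\<forall>i. lmap w (Bs c (n + i)) gX (BG (Suc i)) (gG (Suc i)) (be i)) \<and>
    (\<forall>i. \<forall>v\<in>VV (Bs c (Suc (n + i))). DG (Suc i) (be (Suc i) v) - be i (dX v) \<in> EV (JJ c)) \<and>
    (\<forall>i. \<forall>v\<in>VV (BG (Suc i)). dX (al i v) \<in> EV mm \<and> be i (al i v) - v \<in> EV mm)"
proof -
  let ?J = "JJ c"
  have J: "hideal w ?J" and Jmm: "?J \<subseteq> mm" by (auto intro: hideal_JJ subsetD[OF JJ_mm])
  note d = presD[OF F(1)]
  have mmS: "submod w g0 (EV mm)" for g0 :: "'x \<Rightarrow> int" by (rule submod_EV[OF hideal_mm])
  \<comment> \<open>\<open>tF\<close> and \<open>tX\<close> identify the two rank one models of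
    \<open>k\<close>, whose basis indices are \<open>0\<close> and
    \<open>({}, \<lambda>_. 0)\<close>.\<close>
  define tF where "tF v = v 0 \<star> ev0" for v :: "nat \<Rightarrow> 'k mpoly"
  define tX where "tX z = z ({}, \<lambda>_. 0) \<star> (ev 0 :: nat \<Rightarrow> 'k mpoly)" for z :: "'k tvec"
  have ev0V: "ev0 \<in> VV (Bs c 0)" using VV_Ks_Bs[OF ev0_Ks[of 0]] by simp
  have gX0: "gX ({}, \<lambda>_. 0) = 0" by (simp add: gX_def)
  have tF: "lmap w (BF 0) (gF 0) (Bs c 0) gX tF"
    unfolding lmap_def
  proof (intro conjI ballI allI)
    show "lin tF" by (simp add: lin_def tF_def vec_apply smv_simps)
    show "tF v \<in> VV (Bs c 0)" for v unfolding tF_def by (rule VV_smv[OF ev0V])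
    show "tF (vcomp w (gF 0) j v) = vcomp w gX j (tF v)" for v j
    proof
      fix x show "tF (vcomp w (gF 0) j v) x = vcomp w gX j (tF v) x"
        by (cases "x = ({}, \<lambda>_. 0)") (simp_all add: tF_def vcomp_def F(4) vec_apply ev_apply gX0 comp_simps)
    qed
  qed
  have tX: "lmap w (Bs c 0) gX (BF 0) (gF 0) tX"
    unfolding lmap_def
  proof (intro conjI ballI allI)
    show "lin tX" by (simp add: lin_def tX_def vec_apply smv_simps)
    show "tX v \<in> VV (BF 0)" for v unfolding tX_def F(3) by (rule VV_smv, rule VV_ev) simp
    show "tX (vcomp w gX j v) = vcomp w (gF 0) j (tX v)" for v j
      by (auto simp: tX_def vcomp_def F(4) fun_eq_iff vec_apply ev_apply gX0 comp_simps)
  qed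
  have tXF: "tX (tF v) = v" if "v \<in> VV (BF 0)" for v
    using that F(3) by (auto simp: tX_def tF_def VV_def fun_eq_iff vec_apply ev_apply)
  have BX: "BX 0 = Bs c 0" "BX 1 = Bs c 0" "BX 2 = Bs c 1" "BX (Suc i) = Bs c i" "DX 0 = (\<lambda>z. z)" "DX (Suc i) = dX" for i
    by (simp_all add: BX_def DX_def numeral_2_eq_2)
  have u0: "lmap w (BF 1) (gF 1) (Bs c 0) gX (\<lambda>v. tF (DF 0 v))"
    using lmap_compose[OF d(4)[of 0] tF] by simp
  have "\<exists>u. u 0 = (\<lambda>v. tF (DF 0 v)) \<and> (\<forall>i. lmap w (BF (Suc i)) (gF (Suc i)) (BX (Suc i)) gX (u i)) \<and>
    (\<forall>i. \<forall>v\<in>VV (BF (Suc (Suc i))). DX (Suc i) (u (Suc i) v) - u i (DF (Suc i) v) \<in> EV ?J)"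
  proof (rule lift_chain[OF F(1) tate_pres])
    show "lmap w (BF 1) (gF 1) (BX 1) gX (\<lambda>v. tF (DF 0 v))" using u0 BX by simp
    fix v :: "nat \<Rightarrow> 'k mpoly" assume "v \<in> VV (BF 2)"
    then have "DF 0 (DF 1 v) \<in> EV mm" using pres_DD[OF F(1), of v 0] by (simp add: zl_def numeral_2_eq_2)
    then show "DX 0 (tF (DF 0 (DF 1 v))) \<in> EV mm" by (auto simp: BX tF_def EV_def vec_apply ev_apply mm_simps)
  qed
  then obtain u where u: "u 0 = (\<lambda>v. tF (DF 0 v))" "\<And>i. lmap w (BF (Suc i)) (gF (Suc i)) (Bs c i) gX (u i)"
    "\<And>i v. v \<in> VV (BF (Suc (Suc i))) \<Longrightarrow> dX (u (Suc i) v) - u i (DF (Suc i) v) \<in> EV ?J"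
    by (auto simp: BX)
  have "\<exists>L. lmap w (Bs c 0) gX (BF (Suc 0)) (gF (Suc 0)) L \<and> (\<forall>v\<in>VV (Bs c 0). tX v - DF 0 (L v) \<in> EV mm)"
  proof (rule lmap_lift[OF finite_Bs tX d(4) mmS])
    show "\<exists>u\<in>VV (BF (Suc 0)). tX v - DF 0 u \<in> EV mm" if "v \<in> VV (Bs c 0)" for v :: "'k tvec"
      using F(5)[OF lmapD(2)[OF tX that]] by simp
  qed
  then obtain v0 where v0: "lmap w (Bs c 0) gX (BF (Suc 0)) (gF (Suc 0)) v0"
    "\<And>v. v \<in> VV (Bs c 0) \<Longrightarrow> tX v - DF 0 (v0 v) \<in> EV mm" by blast
  have "\<exists>v. v 0 = v0 \<and> (\<forall>i. lmap w (BX (Suc i)) gX (BF (Suc i)) (gF (Suc i)) (v i)) \<and>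
    (\<forall>i. \<forall>x\<in>VV (BX (Suc (Suc i))). DF (Suc i) (v (Suc i) x) - v i (DX (Suc i) x) \<in> EV ?J)"
  proof (rule lift_chain[OF tate_pres F(1)])
    show "lmap w (BX 1) gX (BF 1) (gF 1) v0" using v0 BX by simp
    fix x :: "'k tvec" assume "x \<in> VV (BX 2)"
    then have x: "x \<in> VV (Bs c 1)" by (simp add: BX)
    then have x': "dX x \<in> VV (Bs c 0)" using VV_dX[of x c 0] by simp
    have "tX (dX x) \<in> EV mm" using dX_scalar_mm[OF x] by (auto simp: tX_def EV_def vec_apply ev_apply mm_simps)
    from submodD(6)[OF mmS this v0(2)[OF x']] show "DF 0 (v0 (DX 1 x)) \<in> EV mm" using BX(6)[of 0] by simp
  qed
  then obtain v where v: "v 0 = v0" "\<And>i. lmap w (Bs c i) gX (BF (Suc i)) (gF (Suc i)) (v i)"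
    "\<And>i x. x \<in> VV (Bs c (Suc i)) \<Longrightarrow> DF (Suc i) (v (Suc i) x) - v i (dX x) \<in> EV ?J"
    by (auto simp: BX)
  have vu: "v i (u i x) - x \<in> EV mm" if x: "x \<in> VV (BF (Suc i))" for i and x :: "nat \<Rightarrow> 'k mpoly"
  proof (rule chain_endo_id_mod_mm[OF F(1,2) _ _ _ x, where f = "\<lambda>i x. v i (u i x)"])
    show "lmap w (BF (Suc i)) (gF (Suc i)) (BF (Suc i)) (gF (Suc i)) (\<lambda>x. v i (u i x))" for i
      by (rule lmap_compose[OF u(2) v(2)])
    fix i and x :: "nat \<Rightarrow> 'k mpoly" assume x: "x \<in> VV (BF (Suc (Suc i)))"
    let ?y = "dX (u (Suc i) x) - u i (DF (Suc i) x)"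
    have ux: "u (Suc i) x \<in> VV (Bs c (Suc i))" by (rule lmapD(2)[OF u(2) x])
    have "?y \<in> VV (Bs c i)" by (intro VV_diff VV_dX ux lmapD(2)[OF u(2)] d(6) x)
    then have "v i ?y \<in> EV ?J" using lmap_EV[OF finite_Bs v(2) J _ u(3)[OF x]] by simp
    from submodD(2)[OF submod_J this v(3)[OF ux]]
    show "DF (Suc i) (v (Suc i) (u (Suc i) x)) - v i (u i (DF (Suc i) x)) \<in> EV ?J"
      by (simp add: lin_diff[OF lmapD(1)[OF v(2)]])
  next
    fix x :: "nat \<Rightarrow> 'k mpoly" assume x: "x \<in> VV (BF 1)"
    then have x0: "DF 0 x \<in> VV (BF 0)" using d(6)[of x 0] by simp
    have "tX (tF (DF 0 x)) - DF 0 (v0 (tF (DF 0 x))) \<in> EV mm" by (rule v0(2)[OF lmapD(2)[OF tF x0]])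
    from submodD(5)[OF mmS this] show "DF 0 (v 0 (u 0 x)) - DF 0 x \<in> EV mm" using tXF[OF x0] u(1) v(1) by simp
  qed
  have "\<exists>inc prj. (\<forall>i. lmap w (BG (Suc i)) (gG (Suc i)) (BF (Suc (n + i))) (gF (Suc (n + i))) (inc i)) \<and>
    (\<forall>i. lmap w (BF (Suc (n + i))) (gF (Suc (n + i))) (BG (Suc i)) (gG (Suc i)) (prj i)) \<and>
    (\<forall>i. \<forall>v\<in>VV (BF (Suc (Suc (n + i)))). DG (Suc i) (prj (Suc i) v) - prj i (DF (Suc (n + i)) v) \<in> EV ?J) \<and>
    (\<forall>i. \<forall>v\<in>VV (BG (Suc i)). prj i (inc i v) - v \<in> EV mm)"
    by (rule summand_maps[OF F(1) G refl refl])
  then obtain inc prj where inc: "\<And>i. lmap w (BG (Suc i)) (gG (Suc i)) (BF (Suc (n + i))) (gF (Suc (n + i))) (inc i)"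
    and prj: "\<And>i. lmap w (BF (Suc (n + i))) (gF (Suc (n + i))) (BG (Suc i)) (gG (Suc i)) (prj i)"
    "\<And>i v. v \<in> VV (BF (Suc (Suc (n + i)))) \<Longrightarrow> DG (Suc i) (prj (Suc i) v) - prj i (DF (Suc (n + i)) v) \<in> EV ?J"
    and pi: "\<And>i v. v \<in> VV (BG (Suc i)) \<Longrightarrow> prj i (inc i v) - v \<in> EV mm"
    by blast
  define al where "al i x = u (n + i) (inc i x)" for i x
  define be where "be i x = prj i (v (n + i) x)" for i x
  have al: "lmap w (BG (Suc i)) (gG (Suc i)) (Bs c (n + i)) gX (al i)" for i
    unfolding al_def[abs_def] by (rule lmap_compose[OF inc u(2)])
  have be: "lmap w (Bs c (n + i)) gX (BG (Suc i)) (gG (Suc i)) (be i)" for i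
    unfolding be_def[abs_def] by (rule lmap_compose[OF v(2) prj(1)])
  have chain: "DG (Suc i) (be (Suc i) x) - be i (dX x) \<in> EV ?J" if x: "x \<in> VV (Bs c (Suc (n + i)))" for i x
  proof -
    let ?y = "DF (Suc (n + i)) (v (Suc (n + i)) x) - v (n + i) (dX x)"
    have vx: "v (Suc (n + i)) x \<in> VV (BF (Suc (Suc (n + i))))" by (rule lmapD(2)[OF v(2) x])
    have "?y \<in> VV (BF (Suc (n + i)))" by (intro VV_diff d(6) vx lmapD(2)[OF v(2)] VV_dX x)
    then have "prj i ?y \<in> EV ?J" using lmap_EV[OF d(3) prj(1) J _ v(3)[OF x]] by simp
    from submodD(2)[OF submod_J this prj(2)[OF vx]] show ?thesis
      by (simp add: be_def lin_diff[OF lmapD(1)[OF prj(1)]])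
  qed
  have "dX (al i x) \<in> EV mm \<and> be i (al i x) - x \<in> EV mm" if x: "x \<in> VV (BG (Suc i))" for i x
  proof
    have ix: "inc i x \<in> VV (BF (Suc (n + i)))" by (rule lmapD(2)[OF inc x])
    \<comment> \<open>Minimality of \<open>F\<close> is transported by the chain map
      \<open>u\<close>, so values of \<open>al\<close> are cycles modulo \<open>mm\<close> even
      where the Tate complex is not minimal.\<close>
    show "dX (al i x) \<in> EV mm"
    proof (cases "n + i")
      case 0
      then have "dX (al i x) = 0" using dX_VV_0 lmapD(2)[OF al x] by metis
      then show ?thesis using submodD(1)[OF mmS] by (simp only:)
    next
      case (Suc m)
      have "DF (Suc m) (inc i x) \<in> EV mm" using F(2) ix Suc by (simp add: minim_def)
      moreover have "DF (Suc m) (inc i x) \<in> VV (BF (Suc m))" using d(6)[of "inc i x" "Suc m"] ix Suc by simp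
      ultimately have 1: "u m (DF (Suc m) (inc i x)) \<in> EV mm" using lmap_EV[OF d(3) u(2) hideal_mm] by blast
      have "dX (u (Suc m) (inc i x)) - u m (DF (Suc m) (inc i x)) \<in> EV ?J" using u(3)[of "inc i x" m] ix Suc by simp
      then have "dX (u (Suc m) (inc i x)) - u m (DF (Suc m) (inc i x)) \<in> EV mm" by (rule EV_mono[OF Jmm])
      from submodD(2)[OF mmS this 1] show ?thesis using Suc by (simp add: al_def)
    qed
    have ux: "u (n + i) (inc i x) \<in> VV (Bs c (n + i))" by (rule lmapD(2)[OF u(2) ix])
    let ?y = "v (n + i) (u (n + i) (inc i x)) - inc i x"
    have "?y \<in> VV (BF (Suc (n + i)))" by (intro VV_diff lmapD(2)[OF v(2)] ux ix)
    then have "prj i ?y \<in> EV mm" using lmap_EV[OF d(3) prj(1) hideal_mm _ vu[OF ix]] by simp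
    from submodD(2)[OF mmS this pi[OF x]] show "be i (al i x) - x \<in> EV mm"
      by (simp add: al_def be_def lin_diff[OF lmapD(1)[OF prj(1)]])
  qed
  with al be chain show ?thesis by blast
qed

text \<open>The last coefficient lies in the ideal of the earlier equations by regularity.
  Substituting its expression gives a shorter relation, whose coefficients differ from the old ones
  by multiples of the last equation, which are in \<open>mm\<close>.\<close>

lemma koszul_relation:
  assumes "s \<le> c" "rho {..<e} (\<Sum>j<s. f j * q j) = 0" "j < s"
  shows "q j \<in> mm"
  using assms
proof (induction s arbitrary: q j)
  case (Suc s)
  have s: "s < c" using Suc.prems(1) by simp
  have "rho {..<e} (f s * q s) = (\<Sum>j<s. f j * (- rho {..<e} (q j)))"
    using Suc.prems(2) f_rho s
    by (simp add: rho_simps rho_mult sum_negf eq_neg_iff_add_eq_0 add.commute)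
  then have "f s * q s \<in> JJ s" unfolding JJ_def by (intro CollectI exI[of _ "\<lambda>j. - rho {..<e} (q j)"])
  then have qs: "q s \<in> JJ s" by (rule JJ_regular[OF s])
  then obtain t where t: "rho {..<e} (q s) = (\<Sum>j<s. f j * t j)" by (auto simp: JJ_def)
  have "rho {..<e} (q s) = rho {..<e} (rho {..<e} (q s))" by (simp only: rho_rho Int_absorb)
  also have "\<dots> = (\<Sum>j<s. f j * rho {..<e} (t j))" using f_rho s by (simp add: t rho_simps rho_mult)
  finally have t': "f s * rho {..<e} (q s) = (\<Sum>j<s. f j * (f s * rho {..<e} (t j)))"
    by (simp add: sum_distrib_left mult.left_commute)
  have "rho {..<e} (\<Sum>j<s. f j * (q j + f s * t j)) = rho {..<e} (\<Sum>j<Suc s. f j * q j)"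
    using f_rho s by (simp add: rho_simps rho_mult distrib_left sum.distrib t')
  then have IH: "j < s \<Longrightarrow> q j + f s * t j \<in> mm" for j using Suc.IH[of "\<lambda>j. q j + f s * t j"] Suc.prems s by simp
  show ?case
  proof (cases "j < s")
    case True
    have "(q j + f s * t j) - f s * t j \<in> mm"
      by (rule hidealD(7)[OF hideal_mm IH[OF True] mm_simps(4)[OF f_mm[OF s]]])
    then show ?thesis by simp
  next
    case False
    then have "j = s" using Suc.prems(3) by simp
    then show ?thesis using qs JJ_mm[of s] s by auto
  qed
qed simp

text \<open>The product of \<open>mm\<close> with the ideal of the equations, plus
  \<open>kr e\<close>. Modulo \<open>JJ c\<close> the equations become invisible; modulo
  \<open>TT\<close> their coefficients are still determined modulo \<open>mm\<close>.\<close>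

definition TT :: "'k mpoly set" where
  "TT = {p. \<exists>m. (\<forall>j<c. m j \<in> mm) \<and> rho {..<e} p = (\<Sum>j<c. f j * m j)}"

lemma TT: "0 \<in> TT" "p \<in> TT \<Longrightarrow> q \<in> TT \<Longrightarrow> p + q \<in> TT" "x \<in> mm \<Longrightarrow> y \<in> JJ c \<Longrightarrow> x * y \<in> TT"
proof -
  show "0 \<in> TT" unfolding TT_def by (auto simp: rho_simps mm_simps intro!: exI[of _ "\<lambda>_. 0"])
  show "p + q \<in> TT" if pq: "p \<in> TT" "q \<in> TT" for p q
  proof -
    obtain m m' where "\<forall>j<c. m j \<in> mm" "rho {..<e} p = (\<Sum>j<c. f j * m j)"
      "\<forall>j<c. m' j \<in> mm" "rho {..<e} q = (\<Sum>j<c. f j * m' j)" using pq unfolding TT_def by blast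
    then show ?thesis unfolding TT_def
      by (intro CollectI exI[of _ "\<lambda>j. m j + m' j"]) (auto simp: rho_simps distrib_left sum.distrib mm_simps)
  qed
  show "x * y \<in> TT" if x: "x \<in> mm" and y: "y \<in> JJ c"
  proof -
    obtain t where "rho {..<e} y = (\<Sum>j<c. f j * t j)" using y by (auto simp: JJ_def)
    moreover have "rho {..<e} x \<in> mm" using x by (simp add: mm_def)
    ultimately show ?thesis unfolding TT_def
      by (intro CollectI exI[of _ "\<lambda>j. rho {..<e} x * t j"])
        (auto simp: rho_mult sum_distrib_left mult.left_commute mm_simps)
  qed
qed

lemma TT_coeff:
  assumes "(\<Sum>j<c. f j * p j) \<in> TT" "j < c"
  shows "p j \<in> mm"
proof -
  obtain m where m: "\<forall>j<c. m j \<in> mm" "rho {..<e} (\<Sum>j<c. f j * p j) = (\<Sum>j<c. f j * m j)"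
    using assms(1) by (auto simp: TT_def)
  have "rho {..<e} (\<Sum>j<c. f j * m j) = rho {..<e} (rho {..<e} (\<Sum>j<c. f j * p j))" by (simp only: m(2))
  also have "\<dots> = rho {..<e} (\<Sum>j<c. f j * p j)" by (simp only: rho_rho Int_absorb)
  finally have "rho {..<e} (\<Sum>j<c. f j * (p j - m j)) = 0"
    by (simp only: right_diff_distrib sum_subtractf rho_simps diff_self)
  then have "p j - m j \<in> mm" using koszul_relation[of c "\<lambda>j. p j - m j" j] assms(2) by simp
  from mm_simps(2)[OF this] m(1) assms(2) show ?thesis by fastforce
qed

lemma vcomp_sig: "j < c \<Longrightarrow> vcomp w gX d z = z \<Longrightarrow> vcomp w gX (d + dg j) (sig j z) = sig j z"
proof
  fix x :: "nat set \<times> (nat \<Rightarrow> nat)" assume j: "j < c" and z: "vcomp w gX d z = z"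
  obtain A b where x: "x = (A, b)" by fastforce
  show "vcomp w gX (d + dg j) (sig j z) x = sig j z x"
  proof (cases "b j = 0")
    case False
    have "gX (A, b) = gX (A, b(j := b j - 1)) + dg j" using gX_upd[OF j, of A "b(j := b j - 1)"] False by simp
    moreover have "comp w (d - gX y) (z y) = z y" for y using z by (metis vcomp_def)
    ultimately show ?thesis using False by (simp add: x vcomp_def sig_def)
  qed (simp add: x vcomp_def sig_def comp_simps)
qed

text \<open>
  The reason for the shift is that the Eisenbud operator of \<open>f j0\<close> acts surjectively: on the Tate complex it is
  the derivative \<open>del j0\<close>, and \<open>sig j0\<close> is a section of it which is compatible with the differential modulo \<open>mm\<close>.
\<close>

lemma betti_shift:
  fixes BF BG :: "nat \<Rightarrow> nat set"
  assumes F: "pres mm BF gF DF" "minim BF DF" "BF 0 = {0}" "gF 0 = (\<lambda>_. 0)"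
    "\<And>v. v \<in> VV (BF 0) \<Longrightarrow> \<exists>u\<in>VV (BF 1). v - DF 0 u \<in> EV mm"
    and G: "resolves_summand (zl mm n) (BF n) (gF n) (BF (Suc n)) (DF n) K K' BG gG DG"
    and j0: "j0 < c" "\<And>i. i < e \<Longrightarrow> a j0 i \<in> mm"
    and b: "b \<in> BG (Suc i)"
  shows "\<exists>b'\<in>BG (Suc (Suc (Suc i))). gG (Suc (Suc (Suc i))) b' = gG (Suc i) b + dg j0"
proof (rule ccontr)
  \<comment> \<open>If the shifted degree is absent from the basis, a homogeneous vector of that
    degree has entries of nonzero degree only, all of them in \<open>mm\<close>. This will apply to
    \<open>g'\<close>.\<close>
  assume no: "\<not> ?thesis"
  have "\<exists>al be. (\<forall>i. lmap w (BG (Suc i)) (gG (Suc i)) (Bs c (n + i)) gX (al i)) \<and>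
    (\<forall>i. lmap w (Bs c (n + i)) gX (BG (Suc i)) (gG (Suc i)) (be i)) \<and>
    (\<forall>i. \<forall>v\<in>VV (Bs c (Suc (n + i))). DG (Suc i) (be (Suc i) v) - be i (dX v) \<in> EV (JJ c)) \<and>
    (\<forall>i. \<forall>v\<in>VV (BG (Suc i)). dX (al i v) \<in> EV mm \<and> be i (al i v) - v \<in> EV mm)"
    by (rule tate_comparison[OF F G])
  then obtain al be where al: "\<And>i. lmap w (BG (Suc i)) (gG (Suc i)) (Bs c (n + i)) gX (al i)"
    and be: "\<And>i. lmap w (Bs c (n + i)) gX (BG (Suc i)) (gG (Suc i)) (be i)"
    and chain: "\<And>i v. v \<in> VV (Bs c (Suc (n + i))) \<Longrightarrow> DG (Suc i) (be (Suc i) v) - be i (dX v) \<in> EV (JJ c)"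
    and dal: "\<And>i v. v \<in> VV (BG (Suc i)) \<Longrightarrow> dX (al i v) \<in> EV mm"
    and beal: "\<And>i v. v \<in> VV (BG (Suc i)) \<Longrightarrow> be i (al i v) - v \<in> EV mm"
    by blast
  have Gp: "pres (zl mm n) BG gG DG" and Gm: "minim BG DG" using G by (auto simp: resolves_summand_def)
  note d = presD[OF Gp]
  have mmS: "submod w g0 (EV mm)" for g0 :: "'x \<Rightarrow> int" by (rule submod_EV[OF hideal_mm])
  define g where "g = (ev b :: nat \<Rightarrow> 'k mpoly)"
  have g: "g \<in> VV (BG (Suc i))" unfolding g_def by (rule VV_ev[OF b])
  define x where "x = al i g"
  have x: "x \<in> VV (Bs c (n + i))" unfolding x_def by (rule lmapD(2)[OF al g])
  have vx: "vcomp w gX (gG (Suc i) b) x = x"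
    unfolding x_def lmapD(3)[OF al g, symmetric] by (simp add: g_def vcomp_ev)
  \<comment> \<open>The image \<open>x\<close> of the generator, raised by one power of the divided
    power variable of \<open>j0\<close>; it remains a cycle modulo \<open>mm\<close> since
    \<open>f j0\<close> has no linear part.\<close>
  define y where "y = sig j0 x"
  have y: "y \<in> VV (Bs c (Suc (n + Suc i)))" unfolding y_def using VV_sig[OF x j0(1)] by simp
  have vy: "vcomp w gX (gG (Suc i) b + dg j0) y = y" unfolding y_def by (rule vcomp_sig[OF j0(1) vx])
  have dy: "dX y \<in> EV mm"
    unfolding y_def dX_sig[OF j0(1)]
  proof (rule submodD(2)[OF mmS])
    show "sig j0 (dX x) \<in> EV mm" unfolding x_def by (rule EV_tate(4)[OF hideal_mm dal[OF g]])
    have "a j0 i \<star> lam i (e0 j0 x) \<in> EV mm" if "i < e" for i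
      using j0(2)[OF that] by (simp add: EV_def vec_apply mm_simps)
    then show "ss j0 (e0 j0 x) \<in> EV mm" unfolding ss_def by (intro submod_sum[OF mmS[of "\<lambda>_. 0"]]) simp
  qed
  define g' where "g' = be (Suc (Suc i)) y"
  have g': "g' \<in> VV (BG (Suc (Suc (Suc i))))" unfolding g'_def using lmapD(2)[OF be, of y "Suc (Suc i)"] y by simp
  have vg': "vcomp w (gG (Suc (Suc (Suc i)))) (gG (Suc i) b + dg j0) g' = g'"
    unfolding g'_def using lmapD(3)[OF be, of y "Suc (Suc i)" "gG (Suc i) b + dg j0"] y vy by simp
  have g'mm: "g' \<in> EV mm"
  proof -
    have "g' b' \<in> mm" for b'
    proof (cases "b' \<in> BG (Suc (Suc (Suc i)))")
      case True
      then have "gG (Suc i) b + dg j0 - gG (Suc (Suc (Suc i))) b' \<noteq> 0" using no by force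
      then have "vcomp w (gG (Suc (Suc (Suc i)))) (gG (Suc i) b + dg j0) g' b' \<in> mm"
        by (simp add: vcomp_def mm_def lookup_comp_0)
      then show ?thesis unfolding vg' .
    qed (use g' in \<open>simp add: VV_def mm_simps\<close>)
    then show ?thesis by (simp add: EV_def)
  qed
  \<comment> \<open>The failure of \<open>be\<close> to commute with the differentials over the
    polynomial ring; its values lie in the ideal.\<close>
  define r where "r i v = be i (dX v) - DG (Suc i) (be (Suc i) v)" for i v
  have rJ: "r i v \<in> EV (JJ c)" if "v \<in> VV (Bs c (Suc (n + i)))" for i v
    using submodD(5)[OF submod_J chain[OF that]] by (simp add: r_def)
  have rlin: "lin (r i)" for i
    unfolding r_def[abs_def]
    by (rule lin_minus[OF lin_compose[OF lmapD(1)[OF be] lin_dX] lin_compose[OF d(5) lmapD(1)[OF be]]])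
  have ry: "r (Suc i) y \<in> VV (BG (Suc (Suc i)))"
    unfolding r_def using y
    by (intro VV_diff lmapD(2)[OF be] d(6)) (auto intro: VV_dX lmapD(2)[OF be])
  have dyV: "dX y \<in> VV (Bs c (Suc (n + i)))" using VV_dX[OF y] by simp
  \<comment> \<open>Each of the three terms combines a factor in \<open>mm\<close> with one in the
    ideal: the square of \<open>DG\<close> on \<open>g'\<close>, \<open>DG\<close> on an error, and
    an error on \<open>dX y\<close>. Hence the sum has entries in \<open>TT\<close>.\<close>
  have "be i (dX (dX y)) = DG (Suc i) (DG (Suc (Suc i)) g') + (DG (Suc i) (r (Suc i) y) + r i (dX y))"
    by (simp add: r_def g'_def lin_diff[OF d(5)])
  moreover have "DG (Suc i) (DG (Suc (Suc i)) g') \<in> EV TT"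
    by (rule EV_lin[OF d(3) g' lin_compose[OF d(5) d(5)] _ g'mm TT])
      (use pres_DD[OF Gp VV_ev, of _ "Suc i"] in \<open>auto simp: zl_def\<close>)
  moreover have "DG (Suc i) (r (Suc i) y) \<in> EV TT"
  proof (rule EV_lin[OF d(3) ry d(5) _ rJ TT(1,2)])
    show "DG (Suc i) (ev b') \<in> EV mm" if "b' \<in> BG (Suc (Suc i))" for b'
      by (rule Gm[unfolded minim_def, rule_format, OF VV_ev[OF that]])
    show "x * y \<in> TT" if "x \<in> JJ c" "y \<in> mm" for x y using TT(3)[OF that(2,1)] by (simp add: mult.commute)
  qed (use y in simp)
  moreover have "r i (dX y) \<in> EV TT"
    by (rule EV_lin[OF finite_Bs dyV rlin rJ[OF VV_ev] dy TT])
  ultimately have "be i (dX (dX y)) \<in> EV TT" by (auto simp: EV_def vec_apply TT)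
  \<comment> \<open>The other evaluation of the square shows \<open>be i (del j y)\<close> as the
    coefficient of \<open>f j\<close>. For \<open>j0\<close> this is \<open>be i x\<close>, which is
    congruent to the basis vector \<open>g\<close> and so cannot lie in
    \<open>EV mm\<close>.\<close>
  moreover have "be i (dX (dX y)) = (\<Sum>j<c. f j \<star> be i (del j y))"
    by (simp add: dX_dX lin_sum[OF lmapD(1)[OF be]] lin_smv[OF lmapD(1)[OF be]])
  ultimately have "(\<Sum>j<c. f j * be i (del j y) l) \<in> TT" for l by (simp add: EV_def sum_fun_apply vec_apply)
  then have "be i (del j0 y) l \<in> mm" for l using TT_coeff[of "\<lambda>j. be i (del j y) l"] j0(1) by blast
  then have "be i x \<in> EV mm" by (simp add: EV_def y_def del_sig)
  from submodD(6)[OF mmS this beal[OF g, folded x_def]] have "g \<in> EV mm" by simp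
  then have "g b \<in> mm" by (simp add: EV_def)
  then show False by (simp add: g_def ev_apply mm_def)
qed


text \<open>
  If the linear parts of the equations in \<open>S\<close> have dual functionals \<open>phi\<close>, then
  \<open>ip phi j (sig j z)\<close> is a homotopy, modulo \<open>mm\<close>, from the identity to a map that vanishes on all
  multiples of \<open>y\<^sub>j\<close>.
\<close>

definition ip :: "(nat \<Rightarrow> nat \<Rightarrow> 'k) \<Rightarrow> nat \<Rightarrow> 'k tvec \<Rightarrow> 'k tvec" where
  "ip phi j z = (\<Sum>i<e. sing 0 (phi j i) \<star> iota i z)"

lemma lin_ip: "lin (ip phi j)"
  by (auto simp: lin_def ip_def lin_add[OF lin_tate(1)] lin_smv[OF lin_tate(1)] smv_simps sum.distrib
      smv_sum mult.commute)

lemma ip_commute: "del k (ip phi j z) = ip phi j (del k z)" "e0 k (ip phi j z) = ip phi j (e0 k z)"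
  by (simp_all add: ip_def lin_sum[OF lin_tate(3)] lin_smv[OF lin_tate(3)] lin_sum[OF lin_tate(5)]
      lin_smv[OF lin_tate(5)] tate_commute)

text \<open>The anticommutator is multiplication by the pairing of \<open>phi j\<close> with the
  coefficients of \<open>f k\<close>; modulo \<open>mm\<close> this is its pairing \<open>x\<close>
  with the linear part.\<close>

lemma ip_ss:
  assumes "(\<Sum>i<e. phi j i * lkp (a k i) 0) = x"
  shows "ip phi j (ss k z) + ss k (ip phi j z) - sing 0 x \<star> z \<in> EV mm"
proof -
  have "ip phi j (ss k z) + ss k (ip phi j z) = (\<Sum>i<e. sing 0 (phi j i) * a k i * 1) \<star> z"
    unfolding ip_def ss_def by (rule sum_cross) (auto simp: lin_tate iota_lam smv_simps)
  moreover have "lkp (\<Sum>i<e. sing 0 (phi j i) * a k i * 1) 0 = x"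
    using assms by (simp add: lookup_sum lookup_mult_0)
  then have "(\<Sum>i<e. sing 0 (phi j i) * a k i * 1) - sing 0 x \<in> mm" by (simp add: mm_def lookup_minus)
  then have "((\<Sum>i<e. sing 0 (phi j i) * a k i * 1) - sing 0 x) \<star> z \<in> EV mm"
    by (simp add: EV_def vec_apply mm_simps)
  ultimately show ?thesis by (simp only: smv_simps)
qed

lemma VV_ip: "z \<in> VV (Bs s (Suc n)) \<Longrightarrow> ip phi j z \<in> VV (Bs s n)"
  unfolding ip_def by (intro VV_sum VV_smv VV_iota) auto

lemma EV_ip: "z \<in> EV mm \<Longrightarrow> ip phi j z \<in> EV mm"
  unfolding ip_def
  by (intro submod_sum[OF submod_EV[OF hideal_mm, of w "\<lambda>_. 0"]]
      submodD(3)[OF submod_EV[OF hideal_mm, of w "\<lambda>_. 0"]] EV_tate(1)[OF hideal_mm]) auto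

lemma dX_mod_mm: "dX z - (\<Sum>j<c. ss j (del j z)) \<in> EV mm"
proof -
  note S = submod_EV[OF hideal_mm, of w "\<lambda>_. 0"]
  have "xv i \<star> iota i z \<in> EV mm" for i by (simp add: EV_def vec_apply mm_simps xv_mm)
  then have "delta z \<in> EV mm" unfolding delta_def by (intro submod_sum[OF S])
  then show ?thesis by (simp add: dX_def)
qed

lemma tate_homotopy:
  assumes j: "j < c" and dual: "\<And>k. k < c \<Longrightarrow> (\<Sum>i<e. phi j i * lkp (a k i) 0) = (if k = j then 1 else 0)"
    and z: "dX z \<in> EV mm"
  shows "z - dX (ip phi j (sig j z)) - ip phi j (ss j (e0 j z)) \<in> EV mm"
proof -
  note S = submod_EV[OF hideal_mm, of w "\<lambda>_. 0"]
  let ?h = "\<lambda>z. ip phi j (sig j z)"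
  let ?S = "\<lambda>z. \<Sum>k<c. ss k (del k z)"
  \<comment> \<open>For \<open>k\<close> other than \<open>j\<close> the functional pairs to 0 with
    the linear part of \<open>f k\<close>. For \<open>k = j\<close> it pairs to 1, and
    \<open>sig j\<close> fails to invert \<open>del j\<close> by the \<open>e0\<close> term.\<close>
  have "ss k (del k (?h z)) + ?h (ss k (del k z)) - (if k = j then z - ip phi j (ss j (e0 j z)) else 0) \<in> EV mm"
    if k: "k < c" for k
  proof (cases "k = j")
    case True
    have "ss j (del j (?h z)) + ?h (ss j (del j z)) - (z - ip phi j (ss j (e0 j z))) =
        ip phi j (ss j z) + ss j (ip phi j z) - sing 0 1 \<star> z"
      by (simp add: ip_commute del_sig ss_commute sig_del lin_diff[OF lin_ss] lin_diff[OF lin_ip] smv_simps)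
    then show ?thesis using ip_ss[of phi j j 1 z] dual[OF j] True by simp
  next
    case False
    then have "ss k (del k (?h z)) + ?h (ss k (del k z)) =
        ip phi j (ss k (sig j (del k z))) + ss k (ip phi j (sig j (del k z))) - sing 0 0 \<star> sig j (del k z)"
      by (simp add: ip_commute del_sig_neq ss_commute smv_simps)
    then show ?thesis using ip_ss[of phi j k 0 "sig j (del k z)"] dual[OF k] False by simp
  qed
  then have "(\<Sum>k<c. ss k (del k (?h z)) + ?h (ss k (del k z)) -
      (if k = j then z - ip phi j (ss j (e0 j z)) else 0)) \<in> EV mm" by (intro submod_sum[OF S]) simp
  then have 1: "?S (?h z) + ?h (?S z) - (z - ip phi j (ss j (e0 j z))) \<in> EV mm"
    using j by (simp add: sum.distrib sum_subtractf lin_sum[OF lin_ip] lin_sum[OF lin_tate(4)])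
  have "?S z \<in> EV mm" using submodD(6)[OF S z dX_mod_mm[of z]] by simp
  then have 2: "?h (?S z) \<in> EV mm" by (intro EV_ip EV_tate(4)[OF hideal_mm])
  have "z - dX (?h z) - ip phi j (ss j (e0 j z)) =
      ?h (?S z) - (dX (?h z) - ?S (?h z)) - (?S (?h z) + ?h (?S z) - (z - ip phi j (ss j (e0 j z))))" by simp
  also have "\<dots> \<in> EV mm" by (intro submodD(6)[OF S] 1 2 dX_mod_mm)
  finally show ?thesis .
qed

text \<open>Once the \<open>y_j\<close> with \<open>j\<close> in \<open>S\<close> are removed, each
  remaining divided power adds at most 2 to the internal degree for the 2 it adds to the homological
  one, while the exterior variable \<open>i\<close> adds \<open>w i\<close> for 1. So nothing
  survives above the sum of the \<open>w i - 1\<close>.\<close>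

lemma low_regularity:
  assumes S: "finite S" "S \<subseteq> {..<c}"
    and dual: "\<And>j k. j \<in> S \<Longrightarrow> k < c \<Longrightarrow> (\<Sum>i<e. phi j i * lkp (a k i) 0) = (if k = j then 1 else 0)"
    and small: "\<And>j. j < c \<Longrightarrow> j \<notin> S \<Longrightarrow> dg j \<le> 2"
    and z: "z \<in> VV (Bs c n)" "vcomp w gX d z = z" "dX z \<in> EV mm"
    and d: "d - int n > (\<Sum>i<e. int (w i) - 1)"
  shows "\<exists>u\<in>VV (Bs c (Suc n)). z - dX u \<in> EV mm"
proof -
  note E = submod_EV[OF hideal_mm, of w gX]
  have "\<exists>u\<in>VV (Bs c (Suc n)). \<exists>z'\<in>VV (Bs c n). z - dX u - z' \<in> EV mm \<and> (\<forall>A b. (\<exists>j\<in>S. b j \<noteq> 0) \<longrightarrow> z' (A, b) = 0)"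
    using S dual
  proof (induction S rule: finite_induct)
    case empty
    have "z - dX 0 - z = 0" by (simp add: lin_0[OF lin_dX])
    then have "z - dX 0 - z \<in> EV mm" using submodD(1)[OF E] by (simp only:)
    then show ?case using z(1) VV_0 by blast
  next
    case (insert j S)
    then have "\<exists>u\<in>VV (Bs c (Suc n)). \<exists>z'\<in>VV (Bs c n). z - dX u - z' \<in> EV mm \<and>
        (\<forall>A b. (\<exists>j\<in>S. b j \<noteq> 0) \<longrightarrow> z' (A, b) = 0)" by simp
    then obtain u z' where u: "u \<in> VV (Bs c (Suc n))" and z': "z' \<in> VV (Bs c n)" "z - dX u - z' \<in> EV mm"
      "\<forall>A b. (\<exists>j\<in>S. b j \<noteq> 0) \<longrightarrow> z' (A, b) = 0" by blast
    have j: "j < c" using insert.prems(1) by simp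
    have "dX (dX u) \<in> EV mm" using dX_dX_JJ[OF u] EV_mono[OF JJ_mm] by blast
    from submodD(6)[OF E submodD(6)[OF E z(3) this] EV_dX[OF hideal_mm z'(2)]]
    have "dX z' \<in> EV mm" by (simp add: lin_diff[OF lin_dX])
    from tate_homotopy[OF j _ this, of phi] insert.prems(2)
    have h: "z' - dX (ip phi j (sig j z')) - ip phi j (ss j (e0 j z')) \<in> EV mm" by simp
    let ?u = "u + ip phi j (sig j z')" and ?z = "ip phi j (ss j (e0 j z'))"
    have "sig j z' \<in> VV (Bs c (Suc (Suc n)))" using VV_sig[OF z'(1) j] by simp
    then have "?u \<in> VV (Bs c (Suc n))" using u by (intro VV_add VV_ip)
    moreover have "?z \<in> VV (Bs c n)" by (intro VV_ip VV_ss VV_e0 z'(1))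
    moreover have "z - dX ?u - ?z = (z - dX u - z') + (z' - dX (ip phi j (sig j z')) - ?z)"
      by (simp add: lin_add[OF lin_dX])
    then have "z - dX ?u - ?z \<in> EV mm" using submodD(2)[OF E z'(2) h] by (simp only:)
    moreover have "?z (A, b) = 0" if "i \<in> insert j S" "b i \<noteq> 0" for A b i
    proof -
      have "e0 j z' (A', b) = 0" for A' using that z'(3) by (auto simp: e0_def)
      then have "lam i (e0 j z') (A', b) = 0" for A' i by (simp add: lam_def)
      then have "ss j (e0 j z') (A', b) = 0" for A' by (simp add: ss_def sum_fun_apply vec_apply)
      then have "iota i (ss j (e0 j z')) (A', b) = 0" for A' i by (simp add: iota_def)
      then show ?thesis by (simp add: ip_def sum_fun_apply vec_apply)
    qed
    ultimately show ?case by blast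
  qed
  then obtain u z' where u: "u \<in> VV (Bs c (Suc n))" and z': "z' \<in> VV (Bs c n)" "z - dX u - z' \<in> EV mm"
    "\<And>A b j. j \<in> S \<Longrightarrow> b j \<noteq> 0 \<Longrightarrow> z' (A, b) = 0" by blast
  \<comment> \<open>The homotopies need not respect internal degrees, as \<open>phi\<close> is
    arbitrary there; so the component of degree \<open>d\<close> is taken afterwards.\<close>
  have "vcomp w gX d (z - dX u - z') \<in> EV mm" by (rule submodD(4)[OF E z'(2)])
  then have 1: "z - dX (vcomp w gX d u) - vcomp w gX d z' \<in> EV mm"
    by (simp add: vcomp_simps z(2) lmapD(3)[OF lmap_dX u])
  have "vcomp w gX d z' x \<in> mm" for x
  proof (cases "x \<in> Bs c n")
    case True
    obtain A b where x: "x = (A, b)" by fastforce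
    show ?thesis
    proof (cases "\<exists>j\<in>S. b j \<noteq> 0")
      case True
      then have "z' x = 0" using z'(3) by (auto simp: x)
      then show ?thesis by (simp add: vcomp_def comp_simps mm_simps)
    next
      case False
      have A: "A \<subseteq> {..<e}" and n: "card A + 2 * (\<Sum>j<c. b j) = n" using True by (auto simp: x Bs_def)
      have "int (b j) * dg j \<le> 2 * int (b j)" if "j < c" for j
      proof (cases "j \<in> S")
        case True then show ?thesis using False by simp
      next
        case False
        from mult_left_mono[OF small[OF that False], of "int (b j)"] show ?thesis by simp
      qed
      then have "(\<Sum>j<c. int (b j) * dg j) \<le> (\<Sum>j<c. 2 * int (b j))" by (intro sum_mono) simp
      moreover have "(\<Sum>i\<in>A. int (w i) - 1) \<le> (\<Sum>i<e. int (w i) - 1)"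
        using A w by (intro sum_mono2) (auto simp: Suc_le_eq)
      moreover have "(\<Sum>i\<in>A. int (w i) - 1) = (\<Sum>i\<in>A. int (w i)) - int (card A)" by (simp add: sum_subtractf)
      moreover have "int n = int (card A) + (\<Sum>j<c. 2 * int (b j))" using n by (simp flip: n add: sum_distrib_left)
      ultimately have "gX x \<noteq> d" using d by (simp add: x gX_def)
      then show ?thesis by (simp add: vcomp_def mm_def lookup_comp_0)
    qed
  next
    case False
    then have "z' x = 0" using z'(1) unfolding VV_def by blast
    then show ?thesis by (simp add: vcomp_def comp_simps mm_simps)
  qed
  then have "vcomp w gX d z' \<in> EV mm" by (simp add: EV_def)
  from submodD(2)[OF E 1 this] have "z - dX (vcomp w gX d u) \<in> EV mm" by simp
  then show ?thesis using VV_vcomp[OF u] by blast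
qed

text \<open>A generator above the bound would go under \<open>al\<close> to a cycle that is a
  boundary modulo \<open>mm\<close>, and \<open>be\<close> would carry this into
  \<open>EV mm\<close> by minimality of \<open>F\<close>.\<close>

lemma betti_bound:
  fixes BF :: "nat \<Rightarrow> nat set"
  assumes F: "pres mm BF gF DF" "minim BF DF" "BF 0 = {0}" "gF 0 = (\<lambda>_. 0)"
    "\<And>v. v \<in> VV (BF 0) \<Longrightarrow> \<exists>u\<in>VV (BF 1). v - DF 0 u \<in> EV mm"
    and S: "finite S" "S \<subseteq> {..<c}"
    and dual: "\<And>j k. j \<in> S \<Longrightarrow> k < c \<Longrightarrow> (\<Sum>i<e. phi j i * lkp (a k i) 0) = (if k = j then 1 else 0)"
    and small: "\<And>j. j < c \<Longrightarrow> j \<notin> S \<Longrightarrow> dg j \<le> 2"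
    and b: "b \<in> BF (Suc i)"
  shows "gF (Suc i) b - int i \<le> (\<Sum>i<e. int (w i) - 1)"
proof (rule ccontr)
  assume big: "\<not> ?thesis"
  have mmS: "submod w g0 (EV mm)" for g0 :: "'x \<Rightarrow> int" by (rule submod_EV[OF hideal_mm])
  \<comment> \<open>\<open>k\<close> as a summand of its own syzygy of order 0; the zero complement
    is represented by the vectors that vanish modulo \<open>mm\<close>.\<close>
  have "resolves_summand (zl mm 0) (BF 0) (gF 0) (BF (Suc 0)) (DF 0) (VV (BF 0)) (EV mm \<inter> VV (BF 0)) BF gF DF"
    unfolding resolves_summand_def
  proof (intro conjI ballI)
    fix u :: "nat \<Rightarrow> 'k mpoly" assume u: "u \<in> VV (BF (Suc 0))"
    have "DF 0 u - DF 0 u = 0" by simp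
    then have "DF 0 u - DF 0 u \<in> EV mm \<inter> VV (BF 0)" using submodD(1)[OF mmS] VV_0 by (simp only:) blast
    then show "\<exists>y\<in>VV (BF 0). DF 0 u - y \<in> EV mm \<inter> VV (BF 0)" using presD(6)[OF F(1) u] by blast
  qed (use F presD(6)[OF F(1), of _ 0] in \<open>auto simp: zl_def intro: submod_VV submod_Int mmS\<close>)
  from tate_comparison[OF F this]
  obtain al be where al: "\<And>i. lmap w (BF (Suc i)) (gF (Suc i)) (Bs c (0 + i)) gX (al i)"
    and be: "\<And>i. lmap w (Bs c (0 + i)) gX (BF (Suc i)) (gF (Suc i)) (be i)"
    and chain: "\<And>i v. v \<in> VV (Bs c (Suc (0 + i))) \<Longrightarrow> DF (Suc i) (be (Suc i) v) - be i (dX v) \<in> EV (JJ c)"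
    and dal: "\<And>i v. v \<in> VV (BF (Suc i)) \<Longrightarrow> dX (al i v) \<in> EV mm"
    and beal: "\<And>i v. v \<in> VV (BF (Suc i)) \<Longrightarrow> be i (al i v) - v \<in> EV mm"
    by blast
  define g where "g = (ev b :: nat \<Rightarrow> 'k mpoly)"
  have g: "g \<in> VV (BF (Suc i))" unfolding g_def by (rule VV_ev[OF b])
  define x where "x = al i g"
  have x: "x \<in> VV (Bs c i)" unfolding x_def using lmapD(2)[OF al g] by simp
  have vx: "vcomp w gX (gF (Suc i) b) x = x"
    unfolding x_def lmapD(3)[OF al g, symmetric] by (simp add: g_def vcomp_ev)
  have "\<exists>u\<in>VV (Bs c (Suc i)). x - dX u \<in> EV mm"
    by (rule low_regularity[OF S dual small x vx]) (use big dal[OF g] in \<open>auto simp: x_def\<close>)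
  then obtain u where u: "u \<in> VV (Bs c (Suc i))" "x - dX u \<in> EV mm" by blast
  have "x - dX u \<in> VV (Bs c i)" by (intro VV_diff x VV_dX u(1))
  then have 1: "be i (x - dX u) \<in> EV mm" using lmap_EV[OF finite_Bs be[of i] hideal_mm _ u(2)] by simp
  have "be (Suc i) u \<in> VV (BF (Suc (Suc i)))" using lmapD(2)[OF be[of "Suc i"]] u(1) by simp
  then have 2: "DF (Suc i) (be (Suc i) u) \<in> EV mm" using F(2) by (simp add: minim_def)
  have 3: "DF (Suc i) (be (Suc i) u) - be i (dX u) \<in> EV mm"
    using chain[of u i] u(1) by (intro EV_mono[OF JJ_mm[OF order_refl]]) simp
  have "be i x = be i (x - dX u) + (DF (Suc i) (be (Suc i) u) - (DF (Suc i) (be (Suc i) u) - be i (dX u)))"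
    by (simp add: lin_diff[OF lmapD(1)[OF be[of i]]])
  also have "\<dots> \<in> EV mm" by (intro submodD(2)[OF mmS 1] submodD(6)[OF mmS 2 3])
  finally have "be i x \<in> EV mm" .
  from submodD(6)[OF mmS this beal[OF g, folded x_def]] have "g \<in> EV mm" by simp
  then have "g b \<in> mm" by (simp add: EV_def)
  then show False by (simp add: g_def ev_apply mm_def)
qed

end

section \<open>Linear parts of the equations\<close>

text \<open>
  The vanishing combination of linear parts is triangular, so that it can replace the last equation that it
  involves.
\<close>

lemma dual_functionals_or_relation:
  fixes l :: "nat \<Rightarrow> nat \<Rightarrow> 'k::field" and dg wt :: "nat \<Rightarrow> int"
  assumes l: "\<And>j i. j < s \<Longrightarrow> i < e \<Longrightarrow> l j i \<noteq> 0 \<Longrightarrow> wt i = dg j"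
  shows "(\<exists>j0<s. dg j0 > 2 \<and> (\<exists>cc. cc j0 = 1 \<and> (\<forall>j<j0. cc j \<noteq> 0 \<longrightarrow> dg j = dg j0) \<and>
      (\<forall>i<e. (\<Sum>j<Suc j0. cc j * l j i) = 0))) \<or>
    (\<exists>phi. (\<forall>j<s. dg j > 2 \<longrightarrow> (\<forall>i<e. phi j i \<noteq> 0 \<longrightarrow> wt i = dg j)) \<and>
      (\<forall>j<s. \<forall>k<s. dg j > 2 \<longrightarrow> dg k > 2 \<longrightarrow> (\<Sum>i<e. phi j i * l k i) = (if k = j then 1 else 0)))"
  using l
proof (induction s)
  case (Suc s)
  show ?case
  proof (cases "(\<exists>j0<s. dg j0 > 2 \<and> (\<exists>cc. cc j0 = 1 \<and> (\<forall>j<j0. cc j \<noteq> 0 \<longrightarrow> dg j = dg j0) \<and>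
      (\<forall>i<e. (\<Sum>j<Suc j0. cc j * l j i) = 0)))")
    case True
    then show ?thesis using less_SucI by blast
  next
    case False
    have "(\<exists>phi. (\<forall>j<s. dg j > 2 \<longrightarrow> (\<forall>i<e. phi j i \<noteq> 0 \<longrightarrow> wt i = dg j)) \<and>
      (\<forall>j<s. \<forall>k<s. dg j > 2 \<longrightarrow> dg k > 2 \<longrightarrow> (\<Sum>i<e. phi j i * l k i) = (if k = j then 1 else 0)))"
    proof -
      note IH = Suc.IH[OF Suc.prems[OF less_SucI]]
      from IH False show ?thesis by blast
    qed
    then obtain phi where ps: "\<And>j i. j < s \<Longrightarrow> dg j > 2 \<Longrightarrow> i < e \<Longrightarrow> phi j i \<noteq> 0 \<Longrightarrow> wt i = dg j"
      and pd: "\<And>j k. j < s \<Longrightarrow> k < s \<Longrightarrow> dg j > 2 \<Longrightarrow> dg k > 2 \<Longrightarrow> (\<Sum>i<e. phi j i * l k i) = (if k = j then 1 else 0)"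
      by blast
    show ?thesis
    proof (cases "dg s > 2")
      case False
      then show ?thesis using ps pd by (intro disjI2 exI[of _ phi]) (auto simp: less_Suc_eq)
    next
      case s: True
      define Bg where "Bg = {j. j < s \<and> dg j > 2}"
      have fB: "finite Bg" by (simp add: Bg_def)
      define t where "t j = (\<Sum>i<e. phi j i * l s i)" for j
      have t: "dg j = dg s" if j: "j \<in> Bg" "t j \<noteq> 0" for j
      proof -
        obtain i where "i < e" "phi j i * l s i \<noteq> 0" using j(2) unfolding t_def by (rule sum.not_neutral_contains_not_neutral) simp
        then show ?thesis using ps[of j i] Suc.prems[of s i] j(1) by (auto simp: Bg_def)
      qed
      \<comment> \<open>What remains of \<open>l s\<close> after expansion in the earlier vectors.
        If it is zero, the expansion is a relation with coefficient 1 at \<open>s\<close>; if its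
        entry at some \<open>p\<close> is nonzero, that coordinate yields a new functional.\<close>
      define r where "r i = l s i - (\<Sum>j\<in>Bg. t j * l j i)" for i
      show ?thesis
      proof (cases "\<forall>i<e. r i = 0")
        case True
        define cc where "cc j = (if j = s then 1 else if j \<in> Bg then - t j else 0)" for j
        have "(\<Sum>j<Suc s. cc j * l j i) = r i" for i
        proof -
          have "(\<Sum>j<s. cc j * l j i) = (\<Sum>j\<in>Bg. cc j * l j i)"
            by (rule sum.mono_neutral_right) (auto simp: Bg_def cc_def)
          also have "\<dots> = - (\<Sum>j\<in>Bg. t j * l j i)"
            by (simp add: sum_negf[symmetric]) (auto intro!: sum.cong simp: Bg_def cc_def)
          finally show ?thesis by (simp add: r_def cc_def)
        qed
        moreover have "\<forall>j<s. cc j \<noteq> 0 \<longrightarrow> dg j = dg s" using t by (auto simp: cc_def split: if_splits)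
        ultimately show ?thesis using True s
          by (intro disjI1 exI[of _ s] conjI exI[of _ cc]) (auto simp: cc_def)
      next
        case False
        then obtain p where p: "p < e" "r p \<noteq> 0" by blast
        \<comment> \<open>The remainder is supported on variables of weight \<open>dg s\<close>,
          which keeps the functionals homogeneous.\<close>
        have wp: "wt p = dg s"
        proof (rule ccontr)
          assume ne: "wt p \<noteq> dg s"
          then have ls: "l s p = 0" using Suc.prems[of s p] p(1) by auto
          have "t j * l j p = 0" if "j \<in> Bg" for j
            using t[OF that] Suc.prems[of j p] p(1) ne that by (auto simp: Bg_def)
          then have "(\<Sum>j\<in>Bg. t j * l j p) = 0" by (intro sum.neutral ballI)
          then show False using p(2) ls by (simp add: r_def)
        qed
        have lp: "dg j = dg s" if "j \<in> Bg" "l j p \<noteq> 0" for j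
          using Suc.prems[of j p] that p(1) wp by (auto simp: Bg_def)
        \<comment> \<open>The coordinate functional at \<open>p\<close>, corrected to vanish on the
          earlier vectors and normalised on \<open>l s\<close>.\<close>
        define psi where "psi i = ((if i = p then 1 else 0) - (\<Sum>j\<in>Bg. l j p * phi j i)) / r p" for i
        have psi_br: "(\<Sum>i<e. psi i * l k i) = (l k p - (\<Sum>j\<in>Bg. l j p * (\<Sum>i<e. phi j i * l k i))) / r p" for k
        proof -
          have "(\<Sum>i<e. (if i = p then 1 else 0) * l k i) = (\<Sum>i<e. if i = p then l k p else 0)"
            by (rule sum.cong) auto
          also have "\<dots> = l k p" using p(1) by simp
          finally have 1: "(\<Sum>i<e. (if i = p then 1 else 0) * l k i) = l k p" .
          have "(\<Sum>i<e. (\<Sum>j\<in>Bg. l j p * phi j i) * l k i) = (\<Sum>j\<in>Bg. l j p * (\<Sum>i<e. phi j i * l k i))"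
            by (simp add: sum_distrib_left sum_distrib_right sum.swap[of _ Bg] mult.assoc)
          then show ?thesis using 1
            by (simp add: psi_def left_diff_distrib sum_subtractf flip: sum_divide_distrib)
        qed
        have psi_k: "(\<Sum>i<e. psi i * l k i) = 0" if "k \<in> Bg" for k
        proof -
          have "(\<Sum>j\<in>Bg. l j p * (\<Sum>i<e. phi j i * l k i)) = (\<Sum>j\<in>Bg. if j = k then l k p else 0)"
            using that pd by (intro sum.cong) (auto simp: Bg_def)
          then show ?thesis using that fB by (simp add: psi_br)
        qed
        have psi_s: "(\<Sum>i<e. psi i * l s i) = 1"
        proof -
          have "l s p - (\<Sum>j\<in>Bg. l j p * (\<Sum>i<e. phi j i * l s i)) = r p"
            by (simp add: r_def t_def mult.commute)
          then show ?thesis using p(2) by (simp add: psi_br)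
        qed
        have psi_w: "wt i = dg s" if i: "i < e" "psi i \<noteq> 0" for i
        proof (cases "i = p")
          case False
          then have "(\<Sum>j\<in>Bg. l j p * phi j i) \<noteq> 0" using i(2) by (auto simp: psi_def)
          then obtain j where "j \<in> Bg" "l j p * phi j i \<noteq> 0" by (rule sum.not_neutral_contains_not_neutral)
          then show ?thesis using lp[of j] ps[of j i] i(1) by (auto simp: Bg_def)
        qed (use wp in simp)
        \<comment> \<open>The old functionals are made to vanish on \<open>l s\<close> by
          subtracting multiples of the new one.\<close>
        define phi' where "phi' j i = (if j = s then psi i else phi j i - t j * psi i)" for j i
        have "wt i = dg j" if "j < Suc s" "dg j > 2" "i < e" "phi' j i \<noteq> 0" for j i
        proof (cases "j = s")
          case False
          then have j: "j \<in> Bg" using that by (simp add: Bg_def)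
          from False that(4) have "phi j i \<noteq> 0 \<or> (t j \<noteq> 0 \<and> psi i \<noteq> 0)" by (auto simp: phi'_def)
          then show ?thesis using ps[of j i] t[OF j] psi_w[OF that(3)] that j by (auto simp: Bg_def)
        qed (use that psi_w in \<open>simp add: phi'_def\<close>)
        moreover have "(\<Sum>i<e. phi' j i * l k i) = (if k = j then 1 else 0)"
          if "j < Suc s" "k < Suc s" "dg j > 2" "dg k > 2" for j k
        proof (cases "j = s")
          case True
          then show ?thesis using psi_k[of k] psi_s that by (cases "k = s") (auto simp: phi'_def Bg_def)
        next
          case False
          then have "(\<Sum>i<e. phi' j i * l k i) = (\<Sum>i<e. phi j i * l k i) - t j * (\<Sum>i<e. psi i * l k i)"
            by (simp add: phi'_def left_diff_distrib sum_subtractf sum_distrib_left mult.assoc)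
          then show ?thesis
            using psi_k[of k] psi_s pd[of j k] False that by (cases "k = s") (auto simp: Bg_def t_def)
        qed
        ultimately show ?thesis by (intro disjI2 exI[of _ phi']) blast
      qed
    qed
  qed
qed simp

section \<open>Making one equation free of linear terms\<close>

context tate
begin

lemma linear_coeff_degree: "j < c \<Longrightarrow> i < e \<Longrightarrow> lkp (a j i) 0 \<noteq> 0 \<Longrightarrow> int (w i) = dg j"
  using lookup_comp_0[of w "dg j - int (w i)" "a j i"] a_hom[of j i] by (simp split: if_splits)

text \<open>Only earlier equations of the same degree are added to \<open>f j0\<close>, so
  homogeneity persists and every initial segment generates the same ideal as before, which preserves
  regularity.\<close>

lemma tate_replace:
  assumes j0: "j0 < c" and cc: "cc j0 = 1" "\<And>j. j < j0 \<Longrightarrow> cc j \<noteq> 0 \<Longrightarrow> dg j = dg j0"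
    and zero: "\<And>i. i < e \<Longrightarrow> (\<Sum>j<Suc j0. cc j * lkp (a j i) 0) = 0"
  shows "\<exists>f' a'. tate e c w f' a' dg \<and> (\<forall>i<e. a' j0 i \<in> mm) \<and>
    (\<forall>p. (\<exists>t. p = (\<Sum>j<c. f' j * t j)) \<longleftrightarrow> (\<exists>t. p = (\<Sum>j<c. f j * t j)))"
proof -
  define f' where "f' j = (if j = j0 then (\<Sum>i<Suc j0. sing 0 (cc i) * f i) else f j)" for j
  define a' where "a' j i = (if j = j0 then (\<Sum>k<Suc j0. sing 0 (cc k) * a k i) else a j i)" for j i
  have f'0: "f' j0 = f j0 + (\<Sum>i<j0. sing 0 (cc i) * f i)" by (simp add: f'_def cc(1))
  have span: "(\<exists>t. p = (\<Sum>j<s. f' j * t j)) \<longleftrightarrow> (\<exists>t. p = (\<Sum>j<s. f j * t j))" for s p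
  proof (cases "j0 < s")
    case False
    then have "(\<Sum>j<s. f' j * t j) = (\<Sum>j<s. f j * t j)" for t by (intro sum.cong) (auto simp: f'_def)
    then show ?thesis by simp
  next
    case True
    have *: "(\<Sum>j<s. (if j < j0 then sing 0 (cc j) * u else 0) * f j) = (\<Sum>i<j0. sing 0 (cc i) * f i) * u" for u
    proof -
      have "(\<Sum>j<s. (if j < j0 then sing 0 (cc j) * u else 0) * f j) = (\<Sum>j<j0. sing 0 (cc j) * u * f j)"
        using True by (intro sum.mono_neutral_cong_right) auto
      then show ?thesis by (simp add: sum_distrib_right mult.assoc mult.commute[of u])
    qed
    have f't: "(\<Sum>j<s. f' j * t j) = (\<Sum>j<s. f j * t j) + (\<Sum>i<j0. sing 0 (cc i) * f i) * t j0" for t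
    proof -
      have "(\<Sum>j<s. f' j * t j) = f' j0 * t j0 + (\<Sum>j\<in>{..<s} - {j0}. f j * t j)"
        using True by (subst sum.remove[of _ j0]) (auto intro: sum.cong simp: f'_def)
      moreover have "(\<Sum>j<s. f j * t j) = f j0 * t j0 + (\<Sum>j\<in>{..<s} - {j0}. f j * t j)"
        using True by (subst sum.remove[of _ j0]) auto
      ultimately show ?thesis by (simp add: f'0 distrib_right)
    qed
    show ?thesis
    proof
      assume "\<exists>t. p = (\<Sum>j<s. f' j * t j)"
      then obtain t where t: "p = (\<Sum>j<s. f' j * t j)" by blast
      have "p = (\<Sum>j<s. f j * (t j + (if j < j0 then sing 0 (cc j) * t j0 else 0)))"
        unfolding t f't using *[of "t j0"] by (simp add: distrib_left sum.distrib mult.commute)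
      then show "\<exists>t. p = (\<Sum>j<s. f j * t j)"
        by (rule exI[of _ "\<lambda>j. t j + (if j < j0 then sing 0 (cc j) * t j0 else 0)"])
    next
      assume "\<exists>t. p = (\<Sum>j<s. f j * t j)"
      then obtain t where t: "p = (\<Sum>j<s. f j * t j)" by blast
      have "p = (\<Sum>j<s. f' j * (t j - (if j < j0 then sing 0 (cc j) * t j0 else 0)))"
        unfolding t f't using *[of "t j0"] by (simp add: right_diff_distrib sum_subtractf mult.commute)
      then show "\<exists>t. p = (\<Sum>j<s. f' j * t j)"
        by (rule exI[of _ "\<lambda>j. t j - (if j < j0 then sing 0 (cc j) * t j0 else 0)"])
    qed
  qed
  have "tate e c w f' a' dg"
  proof
    show "1 \<le> w i" for i by (rule w)
    fix j assume j: "j < c"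
    show "rho {..<e} (f' j) = f' j"
      using f_rho j j0 by (auto simp: f'_def rho_simps rho_mult rho_sing0)
    show "f' j = (\<Sum>i<e. xv i * a' j i)"
    proof (cases "j = j0")
      case True
      have "(\<Sum>k<Suc j0. sing 0 (cc k) * f k) = (\<Sum>k<Suc j0. sing 0 (cc k) * (\<Sum>i<e. xv i * a k i))"
        using j0 f_a by (intro sum.cong) auto
      also have "\<dots> = (\<Sum>i<e. xv i * (\<Sum>k<Suc j0. sing 0 (cc k) * a k i))"
        by (simp only: sum_distrib_left sum.swap[of _ "{..<e}"] mult.left_commute)
      finally show ?thesis using True by (simp add: f'_def a'_def)
    qed (use f_a[OF j] in \<open>simp add: f'_def a'_def\<close>)
    fix i assume i: "i < e"
    show "comp w (dg j - int (w i)) (a' j i) = a' j i"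
    proof (cases "j = j0")
      case True
      have "comp w (dg j0 - int (w i)) (sing 0 (cc k) * a k i) = sing 0 (cc k) * a k i" if k: "k < Suc j0" for k
      proof (cases "cc k = 0")
        case False
        then have "dg k = dg j0" using cc(2)[of k] k by (cases "k = j0") auto
        then show ?thesis
          using comp_mult[OF comp_sing0, of w "dg k - int (w i)" "cc k" "a k i"] a_hom[of k i] k j0 i by simp
      qed (simp add: comp_simps)
      then have "comp w (dg j0 - int (w i)) (\<Sum>k<Suc j0. sing 0 (cc k) * a k i) = (\<Sum>k<Suc j0. sing 0 (cc k) * a k i)"
        unfolding comp_simps by (intro sum.cong) auto
      then show ?thesis using True by (simp only: a'_def if_True refl simp_thms)
    qed (use a_hom[OF j i] in \<open>simp add: a'_def\<close>)
  next
    fix s p t assume s: "s < c" and eq: "rho {..<e} (f' s * p) = (\<Sum>j<s. f' j * t j)"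
    from eq have "\<exists>t. rho {..<e} (f' s * p) = (\<Sum>j<s. f j * t j)" using span[of _ s] by blast
    then obtain t where t: "rho {..<e} (f' s * p) = (\<Sum>j<s. f j * t j)" by blast
    have "\<exists>t. rho {..<e} (f s * p) = (\<Sum>j<s. f j * t j)"
    proof (cases "s = j0")
      case True
      have "rho {..<e} (f' j0 * p) = rho {..<e} (f j0 * p) + (\<Sum>j<j0. f j * (sing 0 (cc j) * rho {..<e} p))"
      proof -
        have "rho {..<e} (\<Sum>i<j0. sing 0 (cc i) * f i) = (\<Sum>i<j0. sing 0 (cc i) * f i)"
          using f_rho j0 by (simp add: rho_simps rho_mult rho_sing0)
        then have "rho {..<e} (f' j0 * p) = rho {..<e} (f j0) * rho {..<e} p + (\<Sum>i<j0. sing 0 (cc i) * f i) * rho {..<e} p"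
          by (simp only: f'0 rho_mult rho_simps distrib_right)
        then show ?thesis by (simp add: rho_mult sum_distrib_right mult.assoc mult.left_commute)
      qed
      then have "rho {..<e} (f j0 * p) = (\<Sum>j<j0. f j * (t j - sing 0 (cc j) * rho {..<e} p))"
        using t True by (simp add: right_diff_distrib sum_subtractf eq_diff_eq)
      then show ?thesis unfolding True by (rule exI[of _ "\<lambda>j. t j - sing 0 (cc j) * rho {..<e} p"])
    qed (use t in \<open>auto simp: f'_def\<close>)
    then obtain t where "rho {..<e} (f s * p) = (\<Sum>j<s. f j * t j)" by blast
    from regular[OF s this] show "\<exists>t. rho {..<e} p = (\<Sum>j<s. f' j * t j)" using span[of _ s] by blast
  qed
  moreover have "a' j0 i \<in> mm" if "i < e" for i
  proof -
    have "lkp (a' j0 i) 0 = (\<Sum>k<Suc j0. cc k * lkp (a k i) 0)"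
      by (simp only: a'_def if_True simp_thms lookup_sum lookup_mult_0 lookup_single_eq)
    then show ?thesis using zero[OF that] by (simp add: mm_def)
  qed
  ultimately show ?thesis using span[of _ c] by blast
qed

lemma tate_dichotomy:
  "(\<exists>j0<c. dg j0 > 2 \<and> (\<exists>f' a'. tate e c w f' a' dg \<and> (\<forall>i<e. a' j0 i \<in> mm) \<and>
      (\<forall>p. (\<exists>t. p = (\<Sum>j<c. f' j * t j)) \<longleftrightarrow> (\<exists>t. p = (\<Sum>j<c. f j * t j))))) \<or>
   (\<exists>phi. \<forall>j<c. \<forall>k<c. dg j > 2 \<longrightarrow> (\<Sum>i<e. phi j i * lkp (a k i) 0) = (if k = j then 1 else 0))"
  using dual_functionals_or_relation[of c e "\<lambda>j i. lkp (a j i) 0" "\<lambda>i. int (w i)" dg, OF linear_coeff_degree]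
proof
  assume "\<exists>j0<c. dg j0 > 2 \<and> (\<exists>cc. cc j0 = 1 \<and> (\<forall>j<j0. cc j \<noteq> 0 \<longrightarrow> dg j = dg j0) \<and>
      (\<forall>i<e. (\<Sum>j<Suc j0. cc j * lkp (a j i) 0) = 0))"
  then obtain j0 cc where "j0 < c" "dg j0 > 2" "cc j0 = 1" "\<forall>j<j0. cc j \<noteq> 0 \<longrightarrow> dg j = dg j0"
    "\<forall>i<e. (\<Sum>j<Suc j0. cc j * lkp (a j i) 0) = 0" by blast
  then show ?thesis using tate_replace[of j0 cc] by blast
next
  assume "\<exists>phi. (\<forall>j<c. dg j > 2 \<longrightarrow> (\<forall>i<e. phi j i \<noteq> 0 \<longrightarrow> int (w i) = dg j)) \<and>
      (\<forall>j<c. \<forall>k<c. dg j > 2 \<longrightarrow> dg k > 2 \<longrightarrow> (\<Sum>i<e. phi j i * lkp (a k i) 0) = (if k = j then 1 else 0))"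
  then obtain phi where ps: "\<forall>j<c. dg j > 2 \<longrightarrow> (\<forall>i<e. phi j i \<noteq> 0 \<longrightarrow> int (w i) = dg j)"
    and pd: "\<forall>j<c. \<forall>k<c. dg j > 2 \<longrightarrow> dg k > 2 \<longrightarrow> (\<Sum>i<e. phi j i * lkp (a k i) 0) = (if k = j then 1 else 0)"
    by blast
  have "(\<Sum>i<e. phi j i * lkp (a k i) 0) = (if k = j then 1 else 0)" if "j < c" "k < c" "dg j > 2" for j k
  proof (cases "dg k > 2")
    case False
    \<comment> \<open>\<open>phi j\<close> lives on variables of weight \<open>dg j > 2\<close>, the
      linear part of \<open>f k\<close> on those of weight \<open>dg k \<le> 2\<close>.\<close>
    have "phi j i * lkp (a k i) 0 = 0" if "i < e" for i
      using ps linear_coeff_degree[of k i] that \<open>j < c\<close> \<open>k < c\<close> \<open>dg j > 2\<close> False by force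
    then have "(\<Sum>i<e. phi j i * lkp (a k i) 0) = 0" by (intro sum.neutral) simp
    then show ?thesis using False that by auto
  qed (use pd that in simp)
  then show ?thesis by blast
qed

end

section \<open>The quotient ring\<close>

lemma carrier_mpoly_ring: "carrier (mpoly_ring e) = {p. rho {..<e} p = p}"
  by (auto simp: mpoly_ring_def rho_def pfilter_id_iff)

lemma cring_mpoly_ring: "cring (mpoly_ring e :: 'k::field mpoly ring)"
proof (rule cringI)
  show "abelian_group (mpoly_ring e :: 'k mpoly ring)"
  proof (rule abelian_groupI)
    fix x :: "'k mpoly" assume "x \<in> carrier (mpoly_ring e)"
    then have "- x \<in> carrier (mpoly_ring e)" by (simp add: carrier_mpoly_ring rho_simps)
    then show "\<exists>y\<in>carrier (mpoly_ring e). y \<oplus>\<^bsub>mpoly_ring e\<^esub> x = \<zero>\<^bsub>mpoly_ring e\<^esub>"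
      by (rule bexI[rotated]) (simp add: mpoly_ring_def)
  qed (simp_all add: carrier_mpoly_ring, simp_all add: mpoly_ring_def rho_simps algebra_simps)
  show "Group.comm_monoid (mpoly_ring e :: 'k mpoly ring)"
    by (rule comm_monoidI) (simp_all add: carrier_mpoly_ring, simp_all add: mpoly_ring_def rho_mult algebra_simps)
qed (simp add: mpoly_ring_def algebra_simps)

text \<open>The coefficients \<open>t j\<close> may involve all variables; \<open>rho {..<e}\<close>
  brings them back into the ring while it fixes the sum and the generators.\<close>

lemma genideal_mpoly_ring:
  fixes fs :: "'k::field mpoly list"
  assumes "set fs \<subseteq> carrier (mpoly_ring e)" "s \<le> length fs"
  shows "Idl\<^bsub>mpoly_ring e\<^esub> (set (take s fs)) =
    {p. rho {..<e} p = p \<and> (\<exists>t. p = (\<Sum>j<s. fs ! j * t j))}" (is "?I = ?C")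
proof -
  interpret P: cring "mpoly_ring e :: 'k mpoly ring" by (rule cring_mpoly_ring)
  have sub: "set (take s fs) \<subseteq> carrier (mpoly_ring e)" using assms(1) by (meson order_trans set_take_subset)
  have ops: "x \<oplus>\<^bsub>mpoly_ring e\<^esub> y = x + y" "x \<otimes>\<^bsub>mpoly_ring e\<^esub> y = x * y" "\<zero>\<^bsub>mpoly_ring e\<^esub> = 0" for x y :: "'k mpoly"
    by (simp_all add: mpoly_ring_def)
  have fsr: "rho {..<e} (fs ! j) = fs ! j" if "j < s" for j
    using assms that by (force simp: carrier_mpoly_ring)
  have "ideal ?C (mpoly_ring e)"
  proof (rule idealI)
    show "ring (mpoly_ring e :: 'k mpoly ring)" by (rule P.ring_axioms)
    have m: "- x \<in> ?C" if x: "x \<in> ?C" for x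
    proof -
      from x obtain t where "rho {..<e} x = x" "x = (\<Sum>j<s. fs ! j * t j)" by auto
      then show ?thesis by (auto simp: rho_simps sum_negf intro!: exI[of _ "\<lambda>j. - t j"])
    qed
    show "subgroup ?C (add_monoid (mpoly_ring e))"
    proof (rule group.subgroupI)
      show "Group.group (add_monoid (mpoly_ring e :: 'k mpoly ring))" by (rule P.a_group)
      show "?C \<subseteq> carrier (add_monoid (mpoly_ring e))" by (auto simp: carrier_mpoly_ring)
      have "0 \<in> ?C" by (auto simp: rho_simps intro!: exI[of _ "\<lambda>_. 0"])
      then show "?C \<noteq> {}" by blast
    next
      fix x assume x: "x \<in> ?C"
      have "\<ominus>\<^bsub>mpoly_ring e\<^esub> x = - x"
        using x m[OF x] by (intro P.minus_equality) (auto simp: carrier_mpoly_ring ops)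
      then show "inv\<^bsub>add_monoid (mpoly_ring e)\<^esub> x \<in> ?C" using m[OF x] by (simp add: a_inv_def)
    next
      fix x y assume "x \<in> ?C" "y \<in> ?C"
      then obtain t t' where "rho {..<e} x = x" "x = (\<Sum>j<s. fs ! j * t j)" "rho {..<e} y = y" "y = (\<Sum>j<s. fs ! j * t' j)"
        by auto
      then show "x \<otimes>\<^bsub>add_monoid (mpoly_ring e)\<^esub> y \<in> ?C"
        by (auto simp: ops rho_simps sum.distrib distrib_left intro!: exI[of _ "\<lambda>j. t j + t' j"])
    qed
    fix x y :: "'k mpoly" assume "x \<in> ?C" and y: "y \<in> carrier (mpoly_ring e)"
    then obtain t where t: "rho {..<e} x = x" "x = (\<Sum>j<s. fs ! j * t j)" by auto
    have "y * x = (\<Sum>j<s. fs ! j * (y * t j))" by (subst t(2)) (simp add: sum_distrib_left mult.left_commute)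
    moreover have "rho {..<e} (y * x) = y * x" using t(1) y by (simp add: rho_mult carrier_mpoly_ring)
    ultimately have "y * x \<in> ?C" by (intro CollectI conjI exI[of _ "\<lambda>j. y * t j"])
    then show "y \<otimes>\<^bsub>mpoly_ring e\<^esub> x \<in> ?C" "x \<otimes>\<^bsub>mpoly_ring e\<^esub> y \<in> ?C" by (simp_all add: ops mult.commute)
  qed
  moreover have "set (take s fs) \<subseteq> ?C"
  proof
    fix p assume "p \<in> set (take s fs)"
    then obtain j where j: "j < s" "p = fs ! j" using assms(2) by (auto simp: in_set_conv_nth)
    have "(\<Sum>i<s. fs ! i * (if i = j then 1 else 0)) = (\<Sum>i<s. if i = j then fs ! j else 0)"
      by (rule sum.cong) auto
    also have "\<dots> = p" using j by simp
    finally have "p = (\<Sum>i<s. fs ! i * (if i = j then 1 else 0))" by simp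
    then show "p \<in> ?C" using fsr[OF j(1)] j(2)
      by (intro CollectI conjI exI[of _ "\<lambda>i. if i = j then 1 else 0"]) simp_all
  qed
  ultimately have "?I \<subseteq> ?C" by (rule P.genideal_minimal)
  moreover have "?C \<subseteq> ?I"
  proof
    fix p assume "p \<in> ?C"
    then obtain t where t: "rho {..<e} p = p" "p = (\<Sum>j<s. fs ! j * t j)" by auto
    interpret I: ideal ?I "mpoly_ring e" by (rule P.genideal_ideal[OF sub])
    have "(\<Sum>j<i. fs ! j * rho {..<e} (t j)) \<in> ?I" if "i \<le> s" for i
      using that
    proof (induction i)
      case 0
      then show ?case using I.zero_closed by (simp add: ops)
    next
      case (Suc i)
      have "fs ! i \<in> set (take s fs)" using Suc.prems assms(2) by (auto simp: in_set_conv_nth intro!: exI[of _ i])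
      then have "fs ! i \<in> ?I" by (rule subsetD[OF P.genideal_self[OF sub]])
      then have "fs ! i \<otimes>\<^bsub>mpoly_ring e\<^esub> rho {..<e} (t i) \<in> ?I"
        by (rule I.I_r_closed) (simp add: carrier_mpoly_ring rho_rho)
      then show ?case using I.a_closed[of "\<Sum>j<i. fs ! j * rho {..<e} (t j)"] Suc by (simp add: ops)
    qed
    from this[of s] have "(\<Sum>j<s. fs ! j * rho {..<e} (t j)) \<in> ?I" by simp
    moreover have "rho {..<e} (\<Sum>j<s. fs ! j * t j) = (\<Sum>j<s. fs ! j * rho {..<e} (t j))"
      using fsr by (simp add: rho_simps rho_mult)
    ultimately show "p \<in> ?I" using t by metis
  qed
  ultimately show ?thesis by blast
qed

context hquot
begin

definition resolves_k where
  "resolves_k BF gF DF \<longleftrightarrow> pres mm BF gF DF \<and> minim BF DF \<and> BF 0 = {0 :: nat} \<and> gF 0 = (\<lambda>_. 0) \<and>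
    (\<forall>v\<in>VV (BF 0). \<exists>u\<in>VV (BF 1). v - DF 0 u \<in> EV mm)"

end

text \<open>The alternative is phrased without equations, since its first case replaces them.
  Resolutions depend on the equations only through the ideal, which the replacement leaves
  unchanged.\<close>

lemma (in tate) betti_alternative:
  "(\<exists>d>2. \<forall>n BF gF DF K K' BG gG DG i b. resolves_k BF gF DF \<longrightarrow>
      resolves_summand (zl mm n) (BF n) (gF n) (BF (Suc n)) (DF n) K K' BG gG DG \<longrightarrow> b \<in> BG (Suc i) \<longrightarrow>
      (\<exists>b'\<in>BG (Suc (Suc (Suc i))). gG (Suc (Suc (Suc i))) b' = gG (Suc i) b + d)) \<or>
   (\<exists>C. \<forall>BF gF DF i b. resolves_k BF gF DF \<longrightarrow> b \<in> BF (Suc i) \<longrightarrow> gF (Suc i) b - int i \<le> C)"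
  using tate_dichotomy
proof
  assume "\<exists>j0<c. dg j0 > 2 \<and> (\<exists>f' a'. tate e c w f' a' dg \<and> (\<forall>i<e. a' j0 i \<in> mm) \<and>
      (\<forall>p. (\<exists>t. p = (\<Sum>j<c. f' j * t j)) \<longleftrightarrow> (\<exists>t. p = (\<Sum>j<c. f j * t j))))"
  then obtain j0 f' a' where j0: "j0 < c" "dg j0 > 2" "tate e c w f' a' dg" "\<And>i. i < e \<Longrightarrow> a' j0 i \<in> mm"
    and span: "\<And>p. (\<exists>t. p = (\<Sum>j<c. f' j * t j)) \<longleftrightarrow> (\<exists>t. p = (\<Sum>j<c. f j * t j))" by blast
  interpret T: tate e c w f' a' dg by (rule j0(3))
  have JJ: "T.JJ c = JJ c" by (auto simp: JJ_def T.JJ_def span)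
  show ?thesis
  proof (intro disjI1 exI[of _ "dg j0"] conjI allI impI j0(2))
    fix n BF gF DF K K' BG gG DG i b
    assume F: "resolves_k BF gF DF"
      and G: "resolves_summand (zl mm n) (BF n) (gF n) (BF (Suc n)) (DF n) K K' BG gG DG" and b: "b \<in> BG (Suc i)"
    have F': "pres mm BF gF DF" "minim BF DF" "BF 0 = {0}" "gF 0 = (\<lambda>_. 0)"
      "\<And>v. v \<in> VV (BF 0) \<Longrightarrow> \<exists>u\<in>VV (BF 1). v - DF 0 u \<in> EV mm"
      using F by (simp_all add: resolves_k_def)
    show "\<exists>b'\<in>BG (Suc (Suc (Suc i))). gG (Suc (Suc (Suc i))) b' = gG (Suc i) b + dg j0"
      by (rule T.betti_shift[unfolded JJ, OF F' G j0(1) j0(4) b])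
  qed
next
  assume "\<exists>phi. \<forall>j<c. \<forall>k<c. dg j > 2 \<longrightarrow> (\<Sum>i<e. phi j i * lkp (a k i) 0) = (if k = j then 1 else 0)"
  then obtain phi where phi: "\<forall>j<c. \<forall>k<c. dg j > 2 \<longrightarrow> (\<Sum>i<e. phi j i * lkp (a k i) 0) = (if k = j then 1 else 0)"
    by blast
  have "gF (Suc i) b - int i \<le> (\<Sum>i<e. int (w i) - 1)" if "resolves_k BF gF DF" "b \<in> BF (Suc i)" for BF gF DF i b
    by (rule betti_bound[of BF gF DF "{j. j < c \<and> dg j > 2}" phi b i])
      (use that phi in \<open>auto simp: resolves_k_def\<close>)
  then show ?thesis by blast
qed

section \<open>Modules over the quotient ring\<close>

lemma image_eq_kernel:
  assumes "\<And>v. v \<in> A \<Longrightarrow> P (h v) \<longleftrightarrow> (\<exists>u\<in>B. h v = k (h u))" "\<And>u. u \<in> B \<Longrightarrow> k (h u) \<in> h ` A"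
  shows "k ` h ` B = {x \<in> h ` A. P x}"
proof (intro equalityI subsetI)
  fix x assume "x \<in> k ` h ` B"
  then obtain u where u: "u \<in> B" "x = k (h u)" by blast
  with assms(2) obtain v where v: "v \<in> A" "x = h v" by blast
  have "P (h v)" using assms(1)[OF v(1)] u v(2) by metis
  then show "x \<in> {x \<in> h ` A. P x}" using v by blast
next
  fix x assume "x \<in> {x \<in> h ` A. P x}"
  then obtain v where "v \<in> A" "x = h v" "P (h v)" by blast
  with assms(1)[of v] show "x \<in> k ` h ` B" by auto
qed

text \<open>The quotient seen as the image of the full polynomial ring under \<open>q\<close>, with
  kernel \<open>J\<close>; these rules take the place of calculations with cosets.\<close>

locale qring = hquot w J for w :: "nat \<Rightarrow> nat" and J :: "'k::field mpoly set" +
  fixes e :: nat and R :: "'k mpoly set graded_ring" and q :: "'k mpoly \<Rightarrow> 'k mpoly set"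
  assumes kr: "kr e \<subseteq> J"
    and q_carrier: "carrier R = range q"
    and q_add: "q p \<oplus>\<^bsub>R\<^esub> q p' = q (p + p')"
    and q_mult: "q p \<otimes>\<^bsub>R\<^esub> q p' = q (p * p')"
    and q_zero: "\<zero>\<^bsub>R\<^esub> = q 0"
    and q_eq: "q p = q p' \<longleftrightarrow> p - p' \<in> J"
    and q_part: "rpart R j = q ` {p. comp w j p = p}"
    and q_irr: "q p \<in> irrelevant_ideal R \<longleftrightarrow> p \<in> mm"
    and q_aug: "augmentation (q p) = lkp p 0"
begin

definition qv :: "('i \<Rightarrow> 'k mpoly) \<Rightarrow> 'i \<Rightarrow> 'k mpoly set" where
  "qv v = (\<lambda>i. q (v i))"

lemma qv_eq: "qv u = qv v \<longleftrightarrow> u - v \<in> EV J"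
  by (simp add: qv_def EV_def fun_eq_iff q_eq vec_apply)

abbreviation S :: "int list \<Rightarrow> nat set" where "S a \<equiv> {..<length a}"

lemma free_simps:
  "carrier (free_gmodule R a) = qv ` VV (S a)"
  "qv u \<oplus>\<^bsub>free_gmodule R a\<^esub> qv v = qv (u + v)"
  "q p \<odot>\<^bsub>free_gmodule R a\<^esub> qv v = qv (p \<star> v)"
  "\<zero>\<^bsub>free_gmodule R a\<^esub> = qv 0"
  "mpart (free_gmodule R a) j = qv ` {v \<in> VV (S a). vcomp w (nth a) j v = v}"
proof -
  let ?C = "{v. (\<forall>l<length a. v l \<in> carrier R) \<and> (\<forall>l\<ge>length a. v l = \<zero>\<^bsub>R\<^esub>)}"
  have C: "?C = qv ` VV (S a)"
  proof (intro equalityI subsetI)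
    fix x assume x: "x \<in> ?C"
    then have "\<forall>l. \<exists>p. l < length a \<longrightarrow> x l = q p" unfolding q_carrier by blast
    then obtain p where p: "\<And>l. l < length a \<Longrightarrow> x l = q (p l)" by metis
    have "x = qv (\<lambda>l. if l < length a then p l else 0)"
      using x p by (auto simp: qv_def fun_eq_iff q_zero)
    moreover have "(\<lambda>l. if l < length a then p l else 0) \<in> VV (S a)" by (simp add: VV_def)
    ultimately show "x \<in> qv ` VV (S a)" by blast
  qed (auto simp: qv_def VV_def q_carrier q_zero)
  show "carrier (free_gmodule R a) = qv ` VV (S a)" using C by (simp add: free_gmodule_def)
  show "qv u \<oplus>\<^bsub>free_gmodule R a\<^esub> qv v = qv (u + v)" "q p \<odot>\<^bsub>free_gmodule R a\<^esub> qv v = qv (p \<star> v)"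
    "\<zero>\<^bsub>free_gmodule R a\<^esub> = qv 0"
    by (simp_all add: free_gmodule_def qv_def q_add q_mult q_zero vec_apply)
  have "{v \<in> ?C. \<forall>l<length a. v l \<in> rpart R (j - a ! l)} = qv ` {v \<in> VV (S a). vcomp w (nth a) j v = v}" for j
  proof (intro equalityI subsetI)
    fix x assume x: "x \<in> {v \<in> ?C. \<forall>l<length a. v l \<in> rpart R (j - a ! l)}"
    then have "\<forall>l<length a. \<exists>p. x l = q p \<and> comp w (j - a ! l) p = p" unfolding q_part by blast
    then obtain p where p: "\<And>l. l < length a \<Longrightarrow> x l = q (p l) \<and> comp w (j - a ! l) (p l) = p l" by metis
    let ?v = "\<lambda>l. if l < length a then p l else 0"
    have "x = qv ?v" using x p by (auto simp: qv_def fun_eq_iff q_zero)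
    moreover have "?v \<in> {v \<in> VV (S a). vcomp w (nth a) j v = v}"
      using p by (auto simp: VV_def vcomp_def comp_simps fun_eq_iff)
    ultimately show "x \<in> qv ` {v \<in> VV (S a). vcomp w (nth a) j v = v}" by blast
  next
    fix x assume "x \<in> qv ` {v \<in> VV (S a). vcomp w (nth a) j v = v}"
    then obtain v where v: "x = qv v" "v \<in> VV (S a)" "vcomp w (nth a) j v = v" by blast
    have "comp w (j - a ! l) (v l) = v l" for l using v(3) by (metis vcomp_def)
    then have "x l \<in> rpart R (j - a ! l)" for l unfolding q_part v(1) qv_def by (intro imageI CollectI)
    moreover have "x \<in> ?C" unfolding C v(1) using v(2) by (rule imageI)
    ultimately show "x \<in> {v \<in> ?C. \<forall>l<length a. v l \<in> rpart R (j - a ! l)}" by simp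
  qed
  then show "mpart (free_gmodule R a) j = qv ` {v \<in> VV (S a). vcomp w (nth a) j v = v}"
    by (simp add: free_gmodule_def)
qed

text \<open>The graded module \<open>M\<close> is, via \<open>om\<close>, the subquotient \<open>K\<close> modulo \<open>EV Z\<close> of a free module.\<close>

definition presents :: "'k mpoly set \<Rightarrow> nat set \<Rightarrow> (nat \<Rightarrow> int) \<Rightarrow> (nat \<Rightarrow> 'k mpoly) set \<Rightarrow>
    ('k mpoly set, 'b, 'y) gmodule_scheme \<Rightarrow> ((nat \<Rightarrow> 'k mpoly) \<Rightarrow> 'b) \<Rightarrow> bool" where
  "presents Z B g K M om \<longleftrightarrow> submod w g K \<and> K \<subseteq> VV B \<and> finite B \<and> hideal w Z \<and> J \<subseteq> Z \<and>
    EV Z \<inter> VV B \<subseteq> K \<and> carrier M = om ` K \<and>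
    (\<forall>u\<in>K. \<forall>v\<in>K. om (u + v) = om u \<oplus>\<^bsub>M\<^esub> om v) \<and> (\<forall>p. \<forall>v\<in>K. om (p \<star> v) = q p \<odot>\<^bsub>M\<^esub> om v) \<and>
    (\<forall>v\<in>K. om v = \<zero>\<^bsub>M\<^esub> \<longleftrightarrow> v \<in> EV Z) \<and> (\<forall>j. mpart M j = om ` {v \<in> K. vcomp w g j v = v})"

lemma presentsD: assumes "presents Z B g K M om"
  shows "submod w g K" "K \<subseteq> VV B" "finite B" "hideal w Z" "J \<subseteq> Z" "EV Z \<inter> VV B \<subseteq> K" "carrier M = om ` K"
    "\<And>u v. u \<in> K \<Longrightarrow> v \<in> K \<Longrightarrow> om (u + v) = om u \<oplus>\<^bsub>M\<^esub> om v"
    "\<And>p v. v \<in> K \<Longrightarrow> om (p \<star> v) = q p \<odot>\<^bsub>M\<^esub> om v"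
    "\<And>v. v \<in> K \<Longrightarrow> om v = \<zero>\<^bsub>M\<^esub> \<longleftrightarrow> v \<in> EV Z"
    "\<And>j. mpart M j = om ` {v \<in> K. vcomp w g j v = v}"
proof -
  note * = assms[unfolded presents_def]
  show "submod w g K" "K \<subseteq> VV B" "finite B" "hideal w Z" "J \<subseteq> Z" "EV Z \<inter> VV B \<subseteq> K" "carrier M = om ` K"
    using * by simp_all
  have "\<forall>u\<in>K. \<forall>v\<in>K. om (u + v) = om u \<oplus>\<^bsub>M\<^esub> om v" "\<forall>p. \<forall>v\<in>K. om (p \<star> v) = q p \<odot>\<^bsub>M\<^esub> om v"
    "\<forall>v\<in>K. om v = \<zero>\<^bsub>M\<^esub> \<longleftrightarrow> v \<in> EV Z" "\<forall>j. mpart M j = om ` {v \<in> K. vcomp w g j v = v}"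
    using * by simp_all
  then show "\<And>u v. u \<in> K \<Longrightarrow> v \<in> K \<Longrightarrow> om (u + v) = om u \<oplus>\<^bsub>M\<^esub> om v"
    "\<And>p v. v \<in> K \<Longrightarrow> om (p \<star> v) = q p \<odot>\<^bsub>M\<^esub> om v"
    "\<And>v. v \<in> K \<Longrightarrow> om v = \<zero>\<^bsub>M\<^esub> \<longleftrightarrow> v \<in> EV Z"
    "\<And>j. mpart M j = om ` {v \<in> K. vcomp w g j v = v}" by simp_all
qed

lemma presents_eq:
  assumes P: "presents Z B g K M om" and uv: "u \<in> K" "v \<in> K"
  shows "om u = om v \<longleftrightarrow> u - v \<in> EV Z"
proof -
  note p = presentsD[OF P]
  note K = submodD[OF p(1)]
  note Z = submodD(1)[OF submod_EV[OF p(4)]]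
  have om0: "om 0 = \<zero>\<^bsub>M\<^esub>" using p(10)[OF K(1)] Z by simp
  show ?thesis
  proof
    assume eq: "om u = om v"
    have "om (u - v) = om (u + - v)" by simp
    also have "\<dots> = om v \<oplus>\<^bsub>M\<^esub> om (- v)" using p(8)[OF uv(1) K(5)[OF uv(2)]] eq by (simp only:)
    also have "\<dots> = om (v + - v)" using p(8)[OF uv(2) K(5)[OF uv(2)]] by (simp only:)
    finally have "om (u - v) = \<zero>\<^bsub>M\<^esub>" using om0 by simp
    then show "u - v \<in> EV Z" using p(10)[OF K(6)[OF uv]] by simp
  next
    assume "u - v \<in> EV Z"
    then have 0: "om (u - v) = \<zero>\<^bsub>M\<^esub>" using p(10)[OF K(6)[OF uv]] by simp
    have "om u = om ((u - v) + v)" by simp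
    also have "\<dots> = om 0 \<oplus>\<^bsub>M\<^esub> om v" using p(8)[OF K(6)[OF uv] uv(2)] 0 om0 by simp
    also have "\<dots> = om v" using p(8)[OF K(1) uv(2)] by simp
    finally show "om u = om v" .
  qed
qed

lemma presents_free: "presents J (S a) (nth a) (VV (S a)) (free_gmodule R a) qv"
  unfolding presents_def
proof (intro conjI ballI allI)
  show "qv v = \<zero>\<^bsub>free_gmodule R a\<^esub> \<longleftrightarrow> v \<in> EV J" for v :: "nat \<Rightarrow> 'k mpoly" by (simp add: free_simps qv_eq)
qed (use J in \<open>auto simp: free_simps submod_VV\<close>)

text \<open>Basis elements are homogeneous, so their images have homogeneous representatives;
  choosing these lifts a homomorphism over the quotient to a matrix of polynomials.\<close>

lemma hom_to_lmap:
  assumes P: "presents Z B g K M om" and f: "f \<in> graded_hom R (free_gmodule R a) M"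
  shows "\<exists>D. lmap w (S a) (nth a) B g D \<and> (\<forall>v\<in>VV (S a). D v \<in> K \<and> om (D v) = f (qv v))"
proof -
  note p = presentsD[OF P]
  have fadd: "f (qv u \<oplus>\<^bsub>free_gmodule R a\<^esub> qv v) = f (qv u) \<oplus>\<^bsub>M\<^esub> f (qv v)" if "u \<in> VV (S a)" "v \<in> VV (S a)" for u v
    using f that by (auto simp: graded_hom_def free_simps(1))
  have fsmul: "f (q r \<odot>\<^bsub>free_gmodule R a\<^esub> qv v) = q r \<odot>\<^bsub>M\<^esub> f (qv v)" if "v \<in> VV (S a)" for r v
    using f that by (auto simp: graded_hom_def free_simps(1) q_carrier)
  have "\<exists>t. t \<in> K \<and> vcomp w g (a ! b) t = t \<and> om t = f (qv (ev b))" if b: "b \<in> S a" for b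
  proof -
    have "qv (ev b) \<in> mpart (free_gmodule R a) (a ! b)"
      unfolding free_simps(5) using VV_ev[OF b] vcomp_ev[of w "nth a" b] by blast
    then have "f (qv (ev b)) \<in> mpart M (a ! b)" using f by (auto simp: graded_hom_def)
    then show ?thesis unfolding p(11) by auto
  qed
  then obtain t where t: "\<And>b. b \<in> S a \<Longrightarrow> t b \<in> K" "\<And>b. b \<in> S a \<Longrightarrow> vcomp w g (a ! b) (t b) = t b"
    "\<And>b. b \<in> S a \<Longrightarrow> om (t b) = f (qv (ev b))" by metis
  define D where "D = (\<lambda>v. \<Sum>b\<in>S a. v b \<star> t b)"
  have D: "lmap w (S a) (nth a) B g D" unfolding D_def
    using t p(2) by (intro lmap_of_basis) auto
  have DK: "D v \<in> K" for v unfolding D_def using t by (intro submod_sum[OF p(1)] submodD(3)[OF p(1)])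
  have Dev: "D (ev b) = t b" if "b \<in> S a" for b
    unfolding D_def by (rule lmap_of_basis(2)[where B' = B and g = "nth a" and g' = g and w = w]) (use t p(2) that in auto)
  have scal: "om (D (r \<star> v)) = f (qv (r \<star> v))" if "v \<in> VV (S a)" "om (D v) = f (qv v)" for r v
    using that fsmul[of v r] p(9)[OF DK] by (simp add: lin_smv[OF lmapD(1)[OF D]] free_simps)
  have ev: "om (D (ev b)) = f (qv (ev b))" if "b \<in> S a" for b using Dev t that by simp
  \<comment> \<open>\<open>graded_hom\<close> does not ask for 0 to be preserved, and
    \<open>M\<close> enters only through its presentation; the value at 0 is obtained from the
    scalar 0.\<close>
  have D0: "om (D 0) = f (qv 0)"
  proof -
    obtain k where k: "k \<in> K" "f (qv 0) = om k"
      using f p(7) VV_0[of "S a"] unfolding graded_hom_def free_simps(1) by blast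
    have "f (qv 0) = f (q 0 \<odot>\<^bsub>free_gmodule R a\<^esub> qv 0)" by (simp add: free_simps smv_simps)
    also have "\<dots> = om (0 \<star> k)" using fsmul[of 0 0] k p(9)[OF k(1)] by simp
    finally show ?thesis using lin_0[OF lmapD(1)[OF D]] by (simp add: smv_simps)
  qed
  have "om (D v) = f (qv v)" if v: "v \<in> VV (S a)" for v
    using finite_lessThan v
  proof (induction v rule: VV_induct)
    case (base r b)
    then show ?case by (intro scal VV_ev ev)
  next
    case (add u v)
    then show ?case using fadd[of u v] p(8)[OF DK DK] by (simp add: lin_add[OF lmapD(1)[OF D]] free_simps)
  qed (rule D0)
  with D DK show ?thesis by blast
qed

lemma lmap_to_hom:
  assumes P: "presents Z B g K M om" and D: "lmap w (S a) (nth a) B g D" "\<And>v. v \<in> VV (S a) \<Longrightarrow> D v \<in> K"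
  shows "\<exists>f. f \<in> graded_hom R (free_gmodule R a) M \<and> (\<forall>v\<in>VV (S a). f (qv v) = om (D v))"
proof -
  note p = presentsD[OF P]
  \<comment> \<open>Values are read off chosen representatives; two choices differ by
    \<open>EV J\<close>, which \<open>D\<close> maps into \<open>EV Z\<close>.\<close>
  define f where "f x = om (D (SOME v. v \<in> VV (S a) \<and> qv v = x))" for x
  have f: "f (qv v) = om (D v)" if v: "v \<in> VV (S a)" for v
  proof -
    let ?u = "SOME u. u \<in> VV (S a) \<and> qv u = qv v"
    have u: "?u \<in> VV (S a) \<and> qv ?u = qv v" by (rule someI[of _ v]) (use v in simp)
    then have "D (?u - v) \<in> EV J" using v by (intro lmap_EV[OF _ D(1) J]) (auto simp: qv_eq intro: VV_diff)
    then have "D ?u - D v \<in> EV Z" using p(5) by (auto simp: lin_diff[OF lmapD(1)[OF D(1)]] EV_def)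
    then show ?thesis using presents_eq[OF P] D(2) u v by (simp add: f_def)
  qed
  have "f \<in> graded_hom R (free_gmodule R a) M"
    unfolding graded_hom_def
  proof (intro CollectI conjI ballI allI)
    show "f \<in> carrier (free_gmodule R a) \<rightarrow> carrier M" using f D(2) p(7) by (auto simp: free_simps)
    fix x y assume "x \<in> carrier (free_gmodule R a)" "y \<in> carrier (free_gmodule R a)"
    then obtain u v where "x = qv u" "y = qv v" "u \<in> VV (S a)" "v \<in> VV (S a)" by (auto simp: free_simps)
    then show "f (x \<oplus>\<^bsub>free_gmodule R a\<^esub> y) = f x \<oplus>\<^bsub>M\<^esub> f y"
      using f[of u] f[of v] f[of "u + v"] p(8)[OF D(2) D(2)] by (simp add: free_simps VV_add lin_add[OF lmapD(1)[OF D(1)]])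
  next
    fix r x assume "r \<in> carrier R" "x \<in> carrier (free_gmodule R a)"
    then obtain s u where "r = q s" "x = qv u" "u \<in> VV (S a)" by (auto simp: free_simps q_carrier)
    then show "f (r \<odot>\<^bsub>free_gmodule R a\<^esub> x) = r \<odot>\<^bsub>M\<^esub> f x"
      using f[of u] f[of "s \<star> u"] p(9)[OF D(2)] by (simp add: free_simps VV_smv lin_smv[OF lmapD(1)[OF D(1)]])
  next
    fix j x assume "x \<in> mpart (free_gmodule R a) j"
    then obtain u where u: "x = qv u" "u \<in> VV (S a)" "vcomp w (nth a) j u = u" by (auto simp: free_simps)
    then have "vcomp w g j (D u) = D u" using lmapD(3)[OF D(1) u(2), of j] by simp
    then show "f x \<in> mpart M j" unfolding p(11) using f[OF u(2)] D(2)[OF u(2)] u(1) by auto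
  qed
  with f show ?thesis by blast
qed

lemma minimal_resolution_exists:
  assumes P: "presents Z B g K M om"
  shows "\<exists>a d \<epsilon>. minimal_resolution R M a d \<epsilon>"
proof -
  note p = presentsD[OF P]
  from minimal_pres_exists[OF p(3,1,2,4,5,6) kr] obtain a D where
    pr: "pres Z (lvl B (\<lambda>i. S (a i))) (lvl g (\<lambda>i. nth (a i))) D" and mi: "minim (lvl B (\<lambda>i. S (a i))) D"
    and D0: "\<And>v. v \<in> VV (S (a 0)) \<Longrightarrow> D 0 v \<in> K" "\<And>v. v \<in> K \<Longrightarrow> \<exists>u\<in>VV (S (a 0)). v - D 0 u \<in> EV Z" by blast
  note d = presD[OF pr]
  have "lmap w (S (a 0)) (nth (a 0)) B g (D 0)" using d(4)[of 0] by simp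
  from lmap_to_hom[OF P this D0(1)] obtain \<epsilon> where
    eps: "\<epsilon> \<in> graded_hom R (free_gmodule R (a 0)) M" "\<And>v. v \<in> VV (S (a 0)) \<Longrightarrow> \<epsilon> (qv v) = om (D 0 v)" by blast
  have "\<forall>i. \<exists>f. f \<in> graded_hom R (free_gmodule R (a (Suc i))) (free_gmodule R (a i)) \<and>
      (\<forall>v\<in>VV (S (a (Suc i))). f (qv v) = qv (D (Suc i) v))"
  proof
    fix i show "\<exists>f. f \<in> graded_hom R (free_gmodule R (a (Suc i))) (free_gmodule R (a i)) \<and>
      (\<forall>v\<in>VV (S (a (Suc i))). f (qv v) = qv (D (Suc i) v))"
      using d(4)[of "Suc i"] d(6)[of _ "Suc i"] by (intro lmap_to_hom[OF presents_free]) auto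
  qed
  then obtain df where df: "\<And>i. df i \<in> graded_hom R (free_gmodule R (a (Suc i))) (free_gmodule R (a i))"
    "\<And>i v. v \<in> VV (S (a (Suc i))) \<Longrightarrow> df i (qv v) = qv (D (Suc i) v)" by metis
  have ex: "(\<exists>u\<in>VV (S (a (Suc i))). qv v = df i (qv u)) \<longleftrightarrow> D i v \<in> EV (zl Z i)" if "v \<in> VV (S (a i))" for i v
  proof -
    have "(\<exists>u\<in>VV (S (a (Suc i))). qv v = df i (qv u)) \<longleftrightarrow> (\<exists>u\<in>VV (S (a (Suc i))). v - D (Suc i) u \<in> EV J)"
      using df(2) by (simp add: qv_eq)
    also have "\<dots> \<longleftrightarrow> D i v \<in> EV (zl Z i)" using pr that unfolding pres_def by simp
    finally show ?thesis .
  qed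
  have "graded_free_resolution R M a df \<epsilon>"
    unfolding graded_free_resolution_def Let_def
  proof (intro conjI allI df(1) eps(1))
    have "om ` D 0 ` VV (S (a 0)) = om ` K"
    proof (intro equalityI subsetI)
      fix x assume "x \<in> om ` K"
      then obtain v where v: "v \<in> K" "x = om v" by blast
      obtain u where "u \<in> VV (S (a 0))" "v - D 0 u \<in> EV Z" using D0(2)[OF v(1)] by blast
      then show "x \<in> om ` D 0 ` VV (S (a 0))" using presents_eq[OF P v(1) D0(1)] v(2) by blast
    qed (use D0(1) in blast)
    then show "\<epsilon> ` carrier (free_gmodule R (a 0)) = carrier M"
      using eps(2) by (simp add: free_simps p(7) image_image)
    have "\<epsilon> (qv v) = \<zero>\<^bsub>M\<^esub> \<longleftrightarrow> (\<exists>u\<in>VV (S (a 1)). qv v = df 0 (qv u))" if "v \<in> VV (S (a 0))" for v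
      using ex[OF that] eps(2)[OF that] p(10)[OF D0(1)[OF that]] by (simp add: zl_def)
    moreover have "df 0 (qv u) \<in> qv ` VV (S (a 0))" if "u \<in> VV (S (a 1))" for u
      using df(2)[of u 0] d(6)[of u "Suc 0"] that by auto
    ultimately have "df 0 ` qv ` VV (S (a 1)) = {x \<in> qv ` VV (S (a 0)). \<epsilon> x = \<zero>\<^bsub>M\<^esub>}"
      by (rule image_eq_kernel)
    then show "df 0 ` carrier (free_gmodule R (a 1)) = {x \<in> carrier (free_gmodule R (a 0)). \<epsilon> x = \<zero>\<^bsub>M\<^esub>}"
      by (simp only: free_simps)
    fix i
    have "df i (qv v) = qv 0 \<longleftrightarrow> (\<exists>u\<in>VV (S (a (Suc (Suc i)))). qv v = df (Suc i) (qv u))"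
      if "v \<in> VV (S (a (Suc i)))" for v
      using ex[OF that] df(2)[OF that] by (simp add: zl_def qv_eq)
    moreover have "df (Suc i) (qv u) \<in> qv ` VV (S (a (Suc i)))" if "u \<in> VV (S (a (Suc (Suc i))))" for u
      using df(2)[OF that] d(6)[of u "Suc (Suc i)"] that by auto
    ultimately have "df (Suc i) ` qv ` VV (S (a (Suc (Suc i)))) = {x \<in> qv ` VV (S (a (Suc i))). df i x = qv 0}"
      by (rule image_eq_kernel)
    then show "df (Suc i) ` carrier (free_gmodule R (a (Suc (Suc i)))) =
        {x \<in> carrier (free_gmodule R (a (Suc i))). df i x = \<zero>\<^bsub>free_gmodule R (a i)\<^esub>}"
      by (simp only: free_simps)
  qed
  moreover have "df i x l \<in> irrelevant_ideal R" if "x \<in> carrier (free_gmodule R (a (Suc i)))" for i x l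
  proof -
    obtain v where v: "x = qv v" "v \<in> VV (S (a (Suc i)))" using \<open>x \<in> _\<close> by (auto simp: free_simps)
    have "D (Suc i) v \<in> EV mm" using mi v(2) by (simp add: minim_def)
    then show ?thesis using df(2)[OF v(2)] v(1) by (simp add: qv_def q_irr EV_def)
  qed
  ultimately have "minimal_resolution R M a df \<epsilon>" by (simp add: minimal_resolution_def)
  then show ?thesis by blast
qed

text \<open>Lifts a given resolution to matrices of polynomials and keeps its basis degrees
  \<open>a i\<close>; this is how Betti numbers enter the polynomial setting.\<close>

lemma minimal_resolution_pres:
  assumes P: "presents Z B g K M om" and M: "minimal_resolution R M a d \<epsilon>"
  shows "\<exists>D. pres Z (lvl B (\<lambda>i. S (a i))) (lvl g (\<lambda>i. nth (a i))) D \<and> minim (lvl B (\<lambda>i. S (a i))) D \<and>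
    (\<forall>v\<in>VV (S (a 0)). D 0 v \<in> K \<and> om (D 0 v) = \<epsilon> (qv v)) \<and>
    (\<forall>v\<in>K. \<exists>u\<in>VV (S (a 0)). v - D 0 u \<in> EV Z) \<and>
    (\<forall>i. \<forall>v\<in>VV (S (a (Suc i))). qv (D (Suc i) v) = d i (qv v))"
proof -
  note p = presentsD[OF P]
  from M have res: "\<epsilon> \<in> graded_hom R (free_gmodule R (a 0)) M"
    "\<And>i. d i \<in> graded_hom R (free_gmodule R (a (Suc i))) (free_gmodule R (a i))"
    "\<epsilon> ` carrier (free_gmodule R (a 0)) = carrier M"
    "d 0 ` carrier (free_gmodule R (a 1)) = {x \<in> carrier (free_gmodule R (a 0)). \<epsilon> x = \<zero>\<^bsub>M\<^esub>}"
    "\<And>i. d (Suc i) ` carrier (free_gmodule R (a (Suc (Suc i)))) =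
          {x \<in> carrier (free_gmodule R (a (Suc i))). d i x = \<zero>\<^bsub>free_gmodule R (a i)\<^esub>}"
    "\<And>i x l. x \<in> carrier (free_gmodule R (a (Suc i))) \<Longrightarrow> l < length (a i) \<Longrightarrow> d i x l \<in> irrelevant_ideal R"
    by (auto simp: minimal_resolution_def graded_free_resolution_def Let_def)
  obtain D0 where D0: "lmap w (S (a 0)) (nth (a 0)) B g D0"
    "\<And>v. v \<in> VV (S (a 0)) \<Longrightarrow> D0 v \<in> K" "\<And>v. v \<in> VV (S (a 0)) \<Longrightarrow> om (D0 v) = \<epsilon> (qv v)"
    using hom_to_lmap[OF P res(1)] by blast
  have "\<forall>i. \<exists>D. lmap w (S (a (Suc i))) (nth (a (Suc i))) (S (a i)) (nth (a i)) D \<and>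
      (\<forall>v\<in>VV (S (a (Suc i))). qv (D v) = d i (qv v))"
    using hom_to_lmap[OF presents_free res(2)] by blast
  then obtain D1 where D1: "\<And>i. lmap w (S (a (Suc i))) (nth (a (Suc i))) (S (a i)) (nth (a i)) (D1 i)"
    "\<And>i v. v \<in> VV (S (a (Suc i))) \<Longrightarrow> qv (D1 i v) = d i (qv v)" by metis
  define D where "D = lvl D0 D1"
  let ?B = "lvl B (\<lambda>i. S (a i))" and ?g = "lvl g (\<lambda>i. nth (a i))"
  have l: "lmap w (?B (Suc i)) (?g (Suc i)) (?B i) (?g i) (D i)" for i
    using D0(1) D1(1) by (cases i) (auto simp: D_def)
  have ex: "D i v \<in> EV (zl Z i) \<longleftrightarrow> (\<exists>u\<in>VV (S (a (Suc i))). v - D (Suc i) u \<in> EV J)" if v: "v \<in> VV (S (a i))" for i v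
  proof -
    have "(\<exists>u\<in>VV (S (a (Suc i))). v - D (Suc i) u \<in> EV J) \<longleftrightarrow> qv v \<in> d i ` carrier (free_gmodule R (a (Suc i)))"
      using D1(2)[of _ i] by (auto simp: D_def free_simps qv_eq[symmetric])
    also have "\<dots> \<longleftrightarrow> D i v \<in> EV (zl Z i)"
    proof (cases i)
      case 0
      then show ?thesis using res(4) v D0(3)[of v, symmetric] p(10)[OF D0(2)[of v]] by (simp add: free_simps D_def zl_def)
    next
      case (Suc m)
      then show ?thesis using res(5)[of m] v D1(2)[of v m, symmetric] by (auto simp: free_simps D_def zl_def qv_eq)
    qed
    finally show ?thesis by blast
  qed
  have "finite (?B i)" for i using p(3) by (cases i) auto
  then have pr: "pres Z ?B ?g D" unfolding pres_def using p(4,5) l ex by simp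
  moreover have "minim ?B D"
    unfolding minim_def
  proof (intro allI ballI)
    fix i and v :: "nat \<Rightarrow> 'k mpoly" assume "v \<in> VV (?B (Suc (Suc i)))"
    then have v: "v \<in> VV (S (a (Suc i)))" by simp
    have "D (Suc i) v l \<in> mm" for l
    proof (cases "l < length (a i)")
      case True
      have "q (D (Suc i) v l) = d i (qv v) l" using D1(2)[OF v] by (simp add: D_def qv_def fun_eq_iff)
      then show ?thesis using res(6)[of "qv v" i l] v True by (simp add: free_simps q_irr[symmetric])
    next
      case False
      then have "D (Suc i) v l = 0" using lmapD(2)[OF l[of "Suc i"]] v by (simp add: VV_def)
      then show ?thesis by (simp add: mm_def)
    qed
    then show "D (Suc i) v \<in> EV mm" by (simp add: EV_def)
  qed
  moreover have "\<exists>u\<in>VV (S (a 0)). v - D 0 u \<in> EV Z" if v: "v \<in> K" for v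
  proof -
    have "om v \<in> \<epsilon> ` qv ` VV (S (a 0))" using res(3) p(7) v by (simp add: free_simps)
    then obtain u where "u \<in> VV (S (a 0))" "om v = om (D0 u)" using D0(3) by auto
    then show ?thesis using presents_eq[OF P v D0(2)] by (auto simp: D_def)
  qed
  ultimately show ?thesis using D0(2,3) D1(2) by (intro exI[of _ D]) (simp add: D_def)
qed

lemma presents_residue:
  "presents mm {0} (\<lambda>_. 0) (VV {0}) (residue_module :: ('k mpoly set, 'k) gmodule) (\<lambda>v. lkp (v 0) 0)"
  unfolding presents_def
proof (intro conjI ballI allI)
  have surj: "\<exists>v\<in>VV {0}. vcomp w (\<lambda>_. 0) 0 v = v \<and> lkp (v 0) 0 = c" for c :: 'k
    by (rule bexI[of _ "sing 0 c \<star> ev 0"])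
      (auto simp: vcomp_def fun_eq_iff vec_apply ev_apply comp_sing0 comp_simps intro: VV_smv VV_ev)
  have "c \<in> (\<lambda>v :: nat \<Rightarrow> 'k mpoly. lkp (v 0) 0) ` VV {0}" for c :: 'k using surj[of c] by blast
  then show "carrier (residue_module :: ('k mpoly set, 'k) gmodule) = (\<lambda>v :: nat \<Rightarrow> 'k mpoly. lkp (v 0) 0) ` VV {0}"
    by (auto simp: residue_module_def)
  show "mpart (residue_module :: ('k mpoly set, 'k) gmodule) j =
      (\<lambda>v :: nat \<Rightarrow> 'k mpoly. lkp (v 0) 0) ` {v \<in> VV {0}. vcomp w (\<lambda>_. 0) j v = v}" for j
  proof (cases "j = 0")
    case True
    have "c \<in> (\<lambda>v :: nat \<Rightarrow> 'k mpoly. lkp (v 0) 0) ` {v \<in> VV {0}. vcomp w (\<lambda>_. 0) 0 v = v}" for c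
      using surj[of c] by blast
    then show ?thesis using True by (auto simp: residue_module_def)
  next
    case False
    have "lkp (v 0) 0 = 0" if "vcomp w (\<lambda>_. 0) j v = v" for v :: "nat \<Rightarrow> 'k mpoly"
      using False lookup_comp_0[of w j "v 0"] that by (metis diff_zero vcomp_def)
    then have "(\<lambda>v :: nat \<Rightarrow> 'k mpoly. lkp (v 0) 0) ` {v \<in> VV {0}. vcomp w (\<lambda>_. 0) j v = v} \<subseteq> {0 :: 'k}" by auto
    moreover have "(0 :: 'k) \<in> (\<lambda>v :: nat \<Rightarrow> 'k mpoly. lkp (v 0) 0) ` {v \<in> VV {0}. vcomp w (\<lambda>_. 0) j v = v}"
      by (rule rev_image_eqI[of 0]) (auto simp: vcomp_simps)
    ultimately show ?thesis using False by (auto simp: residue_module_def)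
  qed
  show "lkp ((u + v) 0) 0 = lkp (u 0) 0 \<oplus>\<^bsub>residue_module :: ('k mpoly set, 'k) gmodule\<^esub> lkp (v 0) 0" for u v :: "nat \<Rightarrow> 'k mpoly"
    by (simp add: residue_module_def vec_apply lookup_add)
  show "lkp ((p \<star> v) 0) 0 = q p \<odot>\<^bsub>residue_module\<^esub> lkp (v 0) 0" for p and v :: "nat \<Rightarrow> 'k mpoly"
    by (simp add: residue_module_def vec_apply lookup_mult_0 q_aug)
  show "lkp (v 0) 0 = \<zero>\<^bsub>residue_module :: ('k mpoly set, 'k) gmodule\<^esub> \<longleftrightarrow> v \<in> EV mm" if "v \<in> VV {0}"
    for v :: "nat \<Rightarrow> 'k mpoly"
  proof -
    have 0: "v l = 0" if "l \<noteq> 0" for l using \<open>v \<in> VV {0}\<close> that by (simp add: VV_def)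
    have "v l \<in> mm" if "v 0 \<in> mm" for l using 0[of l] that by (cases "l = 0") (simp_all add: mm_def)
    then show ?thesis by (auto simp: residue_module_def EV_def) (auto simp: mm_def)
  qed
qed (use Jmm in \<open>auto simp: submod_VV hideal_mm\<close>)

lemma presents_iso:
  assumes P: "presents Z B g K M om" and W: "graded_module R W" and iso: "graded_iso R M W"
  shows "\<exists>om'. presents Z B g K W om'"
proof -
  note p = presentsD[OF P]
  interpret W: graded_module R W by (rule W)
  obtain f where f: "f \<in> graded_hom R M W" "bij_betw f (carrier M) (carrier W)" "\<And>j. f ` mpart M j = mpart W j"
    using iso by (auto simp: graded_iso_def)
  have omM: "om v \<in> carrier M" if "v \<in> K" for v using that p(7) by simp
  have add: "f (om u \<oplus>\<^bsub>M\<^esub> om v) = f (om u) \<oplus>\<^bsub>W\<^esub> f (om v)" if "u \<in> K" "v \<in> K" for u v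
    using f(1) omM that by (simp add: graded_hom_def)
  have fW: "f (om v) \<in> carrier W" if "v \<in> K" for v using f(1) omM[OF that] by (auto simp: graded_hom_def)
  have f0: "f (om 0) = \<zero>\<^bsub>W\<^esub>"
  proof -
    have "f (om 0) \<oplus>\<^bsub>W\<^esub> f (om 0) = f (om 0)"
      using add[of 0 0] p(8)[of 0 0] submodD(1)[OF p(1)] by simp
    then show ?thesis using fW[OF submodD(1)[OF p(1)]] by (metis W.M.add.r_cancel_one)
  qed
  have "presents Z B g K W (\<lambda>v. f (om v))"
    unfolding presents_def
  proof (intro conjI ballI allI p(1-6))
    show "carrier W = (\<lambda>v. f (om v)) ` K" using f(2) p(7) by (auto simp: bij_betw_def)
    show "mpart W j = (\<lambda>v. f (om v)) ` {v \<in> K. vcomp w g j v = v}" for j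
      using f(3)[of j] p(11)[of j] by (simp add: image_image)
    fix u v assume uv: "u \<in> K" "v \<in> K"
    show "f (om (u + v)) = f (om u) \<oplus>\<^bsub>W\<^esub> f (om v)" using p(8)[OF uv] add[OF uv] by simp
  next
    fix r v assume v: "v \<in> K"
    show "f (om (r \<star> v)) = q r \<odot>\<^bsub>W\<^esub> f (om v)"
      using p(9)[OF v] f(1) omM[OF v] by (simp add: graded_hom_def q_carrier)
  next
    fix v assume v: "v \<in> K"
    have "f (om v) = f (om 0) \<longleftrightarrow> om v = om 0"
      using f(2) omM v submodD(1)[OF p(1)] by (auto simp: bij_betw_def inj_on_def)
    then show "f (om v) = \<zero>\<^bsub>W\<^esub> \<longleftrightarrow> v \<in> EV Z"
      using f0 presents_eq[OF P v submodD(1)[OF p(1)]] by simp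
  qed
  then show ?thesis by blast
qed

text \<open>The point is that the preimage of \<open>N\<close> is closed under homogeneous
  components. An element of \<open>N\<close> decomposes within \<open>N\<close>, and by uniqueness
  in \<open>W\<close> this decomposition is the one induced by a representative.\<close>

lemma presents_summand:
  assumes P: "presents Z B g K W om" and W: "graded_module R W" and N: "graded_submodule R W N"
  shows "presents Z B g {v \<in> K. om v \<in> N} (restrict_gmodule W N) om"
proof -
  note p = presentsD[OF P]
  note K = submodD[OF p(1)]
  interpret W: graded_module R W by (rule W)
  let ?N = "restrict_gmodule W N"
  have gN: "graded_module R ?N" and sN: "submodule N R W" using N by (auto simp: graded_submodule_def)
  interpret N: graded_module R ?N by (rule gN)
  have simps: "carrier ?N = N" "mpart ?N = (\<lambda>j. mpart W j \<inter> N)" "x \<oplus>\<^bsub>?N\<^esub> y = x \<oplus>\<^bsub>W\<^esub> y" "r \<odot>\<^bsub>?N\<^esub> x = r \<odot>\<^bsub>W\<^esub> x"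
    "\<zero>\<^bsub>?N\<^esub> = \<zero>\<^bsub>W\<^esub>" for x y r by (simp_all add: restrict_gmodule_def)
  have NW: "N \<subseteq> carrier W" using W.submoduleE(1)[OF sN] .
  have om0: "om 0 = \<zero>\<^bsub>W\<^esub>" using p(10)[OF K(1)] submodD(1)[OF submod_EV[OF p(4)]] by simp
  have Nadd: "x \<oplus>\<^bsub>W\<^esub> y \<in> N" if "x \<in> N" "y \<in> N" for x y using N.M.add.m_closed that simps by simp
  have Nsm: "q r \<odot>\<^bsub>W\<^esub> x \<in> N" if "x \<in> N" for r x using N.smult_closed[of "q r" x] that simps by (simp add: q_carrier)
  have N0: "\<zero>\<^bsub>W\<^esub> \<in> N" using N.M.zero_closed simps by simp
  have fin: "finsum ?N h A = finsum W h A" if "finite A" "h \<in> A \<rightarrow> N" for h :: "int \<Rightarrow> _" and A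
    using that
  proof (induction A)
    case (insert x A)
    have "h \<in> A \<rightarrow> carrier ?N" "h x \<in> carrier ?N" "h \<in> A \<rightarrow> carrier W" "h x \<in> carrier W"
      using insert.prems NW simps by auto
    then show ?case using insert by (simp add: N.M.finsum_insert W.M.finsum_insert simps)
  qed (simp add: simps)
  have graded: "om (vcomp w g j v) \<in> N" if v: "v \<in> K" "om v \<in> N" for v j
  proof -
    define h where "h j = om (vcomp w g j v)" for j
    have hW: "h j \<in> carrier W" for j using K(4)[OF v(1)] p(7) by (auto simp: h_def)
    have hm: "h j \<in> mpart W j" for j unfolding p(11) h_def using K(4)[OF v(1)] by (auto simp: vcomp_vcomp)
    obtain T where T: "finite T" "\<And>T'. finite T' \<Longrightarrow> T \<subseteq> T' \<Longrightarrow> (\<Sum>j\<in>T'. vcomp w g j v) = v"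
      using sum_vcomp[of B v w g] p(2,3) v(1) by blast
    have z: "vcomp w g j v = 0" if "j \<notin> T" for j
      using T(2)[of "insert j T"] T(2)[of T] T(1) that by (auto simp: sum.insert)
    have hs: "{j. h j \<noteq> \<zero>\<^bsub>W\<^esub>} \<subseteq> T" using z om0 by (force simp: h_def)
    then have fh: "finite {j. h j \<noteq> \<zero>\<^bsub>W\<^esub>}" using T(1) by (rule finite_subset)
    have sum: "(\<Sum>j\<in>A. vcomp w g j v) \<in> K \<and> om (\<Sum>j\<in>A. vcomp w g j v) = finsum W h A" if "finite A" for A
      using that
    proof (induction A)
      case empty
      then show ?case using K(1) om0 by (simp only: sum.empty W.M.finsum_empty simp_thms)
    next
      case (insert x A)
      then show ?case
        using K(2)[OF K(4)[OF v(1), of x]] p(8)[OF K(4)[OF v(1), of x]] hW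
        by (simp add: W.M.finsum_insert h_def[symmetric])
    qed
    \<comment> \<open>\<open>direct_sum\<close> speaks of the sum over the exact support, whereas a
      component of the representative may be nonzero with zero image; this excess vanishes modulo
      \<open>Z\<close>.\<close>
    let ?H = "{j. h j \<noteq> \<zero>\<^bsub>W\<^esub>}"
    have "v - (\<Sum>j\<in>?H. vcomp w g j v) = (\<Sum>j\<in>T - ?H. vcomp w g j v)"
      using T hs by (metis (no_types, lifting) order_refl sum_diff)
    also have "\<dots> \<in> EV Z"
      using p(10)[OF K(4)[OF v(1)]] by (intro submod_sum[OF submod_EV[OF p(4), of g]]) (auto simp: h_def)
    finally have "om v = finsum W h ?H" using presents_eq[OF P v(1) conjunct1[OF sum[OF fh]]] conjunct2[OF sum[OF fh]] by simp
    then have 1: "(\<forall>j. h j \<in> mpart W j) \<and> finite ?H \<and> om v = finsum W h ?H" using hm fh by simp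
    have "om v \<in> carrier ?N" using v(2) simps by simp
    then obtain k where k: "\<And>j. k j \<in> mpart W j" "\<And>j. k j \<in> N" "finite {j. k j \<noteq> \<zero>\<^bsub>W\<^esub>}"
      "om v = finsum ?N k {j. k j \<noteq> \<zero>\<^bsub>W\<^esub>}"
      using N.direct_sum[of "om v"] unfolding simps by blast
    then have "(\<forall>j. k j \<in> mpart W j) \<and> finite {j. k j \<noteq> \<zero>\<^bsub>W\<^esub>} \<and> om v = finsum W k {j. k j \<noteq> \<zero>\<^bsub>W\<^esub>}"
      using fin[of "{j. k j \<noteq> \<zero>\<^bsub>W\<^esub>}" k] by auto
    with 1 have "h = k" using W.direct_sum[of "om v"] v(2) NW by blast
    then have "h j \<in> N" using k(2)[of j] by (simp only:)
    then show ?thesis by (simp only: h_def)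
  qed
  show ?thesis
    unfolding presents_def simps
  proof (intro conjI ballI allI p(3-5))
    show "submod w g {v \<in> K. om v \<in> N}"
      unfolding submod_def using K(1-4) graded om0 N0 p(8,9) Nadd Nsm by auto
    show "{v \<in> K. om v \<in> N} \<subseteq> VV B" using p(2) by blast
    show "EV Z \<inter> VV B \<subseteq> {v \<in> K. om v \<in> N}"
    proof
      fix v assume "v \<in> EV Z \<inter> VV B"
      then have "v \<in> K" "v \<in> EV Z" using p(6) by auto
      then show "v \<in> {v \<in> K. om v \<in> N}" using p(10)[of v] N0 by simp
    qed
    show "N = om ` {v \<in> K. om v \<in> N}" using NW p(7) by auto
    show "mpart W j \<inter> N = om ` {v \<in> {v \<in> K. om v \<in> N}. vcomp w g j v = v}" for j unfolding p(11) by auto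
  qed (use p(8-10) in auto)
qed

end

section \<open>Betti numbers as basis degrees of a minimal resolution\<close>

lemma vector_space_fun: "vector_space (\<lambda>(c :: 'k::field) (\<phi> :: 'x \<Rightarrow> 'k) x. c * \<phi> x)"
  by unfold_locales (auto simp: fun_eq_iff algebra_simps vec_apply)

abbreviation fun_span :: "('x \<Rightarrow> 'k::field) set \<Rightarrow> ('x \<Rightarrow> 'k) set" where
  "fun_span \<equiv> module.span (\<lambda>(c :: 'k) \<phi> x. c * \<phi> x)"

lemma fun_span_sum:
  fixes c :: "'i \<Rightarrow> 'k::field" and f :: "'i \<Rightarrow> 'x \<Rightarrow> 'k"
  shows "(\<And>x. x \<in> A \<Longrightarrow> f x \<in> T) \<Longrightarrow> (\<Sum>x\<in>A. (\<lambda>y. c x * f x y)) \<in> fun_span T"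
proof -
  interpret fv: vector_space "\<lambda>(c :: 'k) (\<phi> :: 'x \<Rightarrow> 'k) x. c * \<phi> x" by (rule vector_space_fun)
  show "(\<And>x. x \<in> A \<Longrightarrow> f x \<in> T) \<Longrightarrow> ?thesis"
    by (intro fv.span_sum fv.span_scale fv.span_base)
qed

lemma fun_dim_subset_0: "U \<subseteq> {0} \<Longrightarrow> fun_dim (U :: ('x \<Rightarrow> 'k::field) set) = 0"
proof -
  interpret fv: vector_space "\<lambda>(c :: 'k) (\<phi> :: 'x \<Rightarrow> 'k) x. c * \<phi> x" by (rule vector_space_fun)
  show "U \<subseteq> {0} \<Longrightarrow> ?thesis" using fv.dim_le_card[of U "{}"] by simp
qed

text \<open>An infinite-dimensional space has \<open>dim\<close> 0 as well, hence the finite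
  spanning set.\<close>

lemma fun_dim_eq_0_iff:
  fixes U :: "('x \<Rightarrow> 'k::field) set"
  assumes "finite T" "U \<subseteq> fun_span T"
  shows "fun_dim U = 0 \<longleftrightarrow> U \<subseteq> {0}"
proof -
  interpret fv: vector_space "\<lambda>(c :: 'k) (\<phi> :: 'x \<Rightarrow> 'k) x. c * \<phi> x" by (rule vector_space_fun)
  show ?thesis
  proof
    assume 0: "fun_dim U = 0"
    obtain B where B: "B \<subseteq> U" "fv.independent B" "U \<subseteq> fun_span B" "card B = fun_dim U"
      using fv.basis_exists by blast
    have "finite B" using fv.independent_span_bound[OF assms(1) B(2)] B(1) assms(2) by blast
    then have "B = {}" using B(4) 0 by simp
    then show "U \<subseteq> {0}" using B(3) by simp
  next
    assume "U \<subseteq> {0}"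
    then show "fun_dim U = 0" by (rule fun_dim_subset_0)
  qed
qed

context qring
begin

text \<open>Scalars act on \<open>k\<close> by their constant term, so a cochain sees only constant
  terms of coordinates.\<close>

lemma cochain_expand:
  assumes phi: "\<phi> \<in> cochains R a j" and v: "v \<in> VV (S a)"
  shows "\<phi> (qv v) = (\<Sum>l\<in>S a. lkp (v l) 0 * \<phi> (qv (ev l)))"
  using finite_lessThan v
proof (induction v rule: VV_induct)
  have h: "\<phi> (x \<oplus>\<^bsub>free_gmodule R a\<^esub> y) = \<phi> x + \<phi> y" "\<phi> (q r \<odot>\<^bsub>free_gmodule R a\<^esub> x) = lkp r 0 * \<phi> x"
    if "x \<in> carrier (free_gmodule R a)" "y \<in> carrier (free_gmodule R a)" for x y r
    using phi that by (auto simp: cochains_def graded_hom_def gshift_def residue_module_def q_aug q_carrier)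
  {
    case zero
    have "\<phi> (qv 0) = \<phi> (q 0 \<odot>\<^bsub>free_gmodule R a\<^esub> qv 0)" by (simp add: free_simps smv_simps)
    also have "\<dots> = 0" using h(2)[of "qv 0" "qv 0" 0] by (simp add: free_simps)
    also have "\<dots> = (\<Sum>l\<in>S a. lkp ((0 :: nat \<Rightarrow> 'k mpoly) l) 0 * \<phi> (qv (ev l)))" by simp
    finally show ?case .
  next
    case (base p b)
    have "(ev b :: nat \<Rightarrow> 'k mpoly) \<in> VV (S a)" by (rule VV_ev[OF base])
    then have "\<phi> (qv (p \<star> ev b)) = lkp p 0 * \<phi> (qv (ev b))"
      using h(2)[of "qv (ev b)" "qv (ev b)" p] by (simp add: free_simps)
    also have "\<dots> = (\<Sum>l\<in>S a. if l = b then lkp p 0 * \<phi> (qv (ev b)) else 0)" using base by simp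
    also have "\<dots> = (\<Sum>l\<in>S a. lkp ((p \<star> ev b) l) 0 * \<phi> (qv (ev l)))"
      by (rule sum.cong) (auto simp: vec_apply ev_apply)
    finally show ?case .
  next
    case (add u v)
    then have "\<phi> (qv (u + v)) = \<phi> (qv u) + \<phi> (qv v)"
      using h(1)[of "qv u" "qv v"] by (simp add: free_simps)
    also have "\<dots> = (\<Sum>l\<in>S a. lkp (u l) 0 * \<phi> (qv (ev l)) + lkp (v l) 0 * \<phi> (qv (ev l)))"
      by (simp only: add sum.distrib)
    also have "\<dots> = (\<Sum>l\<in>S a. lkp ((u + v) l) 0 * \<phi> (qv (ev l)))"
      by (simp add: vec_apply lookup_add distrib_right)
    finally show ?case .
  }
qed

lemma cochain_ev:
  assumes phi: "\<phi> \<in> cochains R a j" and l: "l < length a" "a ! l \<noteq> j"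
  shows "\<phi> (qv (ev l)) = 0"
proof -
  have "qv (ev l) \<in> mpart (free_gmodule R a) (a ! l)"
    unfolding free_simps using VV_ev[of l "S a"] l(1) vcomp_ev[of w "nth a" l] by blast
  then have "\<phi> (qv (ev l)) \<in> mpart (gshift residue_module (- j)) (a ! l)"
    using phi by (auto simp: cochains_def graded_hom_def)
  then show ?thesis using l(2) by (simp add: gshift_def residue_module_def split: if_splits)
qed

text \<open>The dual basis, extended by 0 off the carrier as the cochains are.\<close>

definition cbase :: "int list \<Rightarrow> nat \<Rightarrow> (nat \<Rightarrow> 'k mpoly set) \<Rightarrow> 'k" where
  "cbase a l x = (if x \<in> carrier (free_gmodule R a) then augmentation (x l) else 0)"

lemma cbase_qv: "v \<in> VV (S a) \<Longrightarrow> cbase a l (qv v) = lkp (v l) 0"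
  by (simp add: cbase_def free_simps(1)) (simp add: qv_def q_aug)

lemma cbase_cochain: assumes "l < length a" shows "cbase a l \<in> cochains R a (a ! l)"
  unfolding cochains_def graded_hom_def
proof (intro CollectI conjI ballI allI impI)
  fix x y assume "x \<in> carrier (free_gmodule R a)" "y \<in> carrier (free_gmodule R a)"
  then obtain u v where "x = qv u" "y = qv v" "u \<in> VV (S a)" "v \<in> VV (S a)" by (auto simp: free_simps)
  then show "cbase a l (x \<oplus>\<^bsub>free_gmodule R a\<^esub> y) = cbase a l x \<oplus>\<^bsub>gshift residue_module (- (a ! l))\<^esub> cbase a l y"
    by (simp add: free_simps cbase_qv VV_add gshift_def residue_module_def vec_apply lookup_add)
next
  fix r x assume "r \<in> carrier R" "x \<in> carrier (free_gmodule R a)"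
  then obtain p u where "r = q p" "x = qv u" "u \<in> VV (S a)" by (auto simp: free_simps q_carrier)
  then show "cbase a l (r \<odot>\<^bsub>free_gmodule R a\<^esub> x) = r \<odot>\<^bsub>gshift residue_module (- (a ! l))\<^esub> cbase a l x"
    by (simp add: free_simps cbase_qv VV_smv gshift_def residue_module_def vec_apply lookup_mult_0 q_aug)
next
  fix j x assume "x \<in> mpart (free_gmodule R a) j"
  then obtain u where u: "x = qv u" "u \<in> VV (S a)" "vcomp w (nth a) j u = u" by (auto simp: free_simps)
  have "comp w (j - a ! l) (u l) = u l" using u(3) by (metis vcomp_def)
  then have "j \<noteq> a ! l \<Longrightarrow> lkp (u l) 0 = 0" using lookup_comp_0[of w "j - a ! l" "u l"] by simp
  then show "cbase a l x \<in> mpart (gshift residue_module (- (a ! l))) j"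
    using u by (auto simp: cbase_qv gshift_def residue_module_def)
qed (simp_all add: cbase_def gshift_def residue_module_def)

text \<open>Regularity depends only on which Betti numbers vanish, so it suffices to have a finite
  spanning family and one nonzero cochain in each degree that occurs.\<close>

lemma fun_dim_cochains: "fun_dim (cochains R a j) \<noteq> 0 \<longleftrightarrow> j \<in> set a"
proof -
  let ?T = "cbase a ` S a"
  have span: "\<phi> \<in> fun_span ?T" if phi: "\<phi> \<in> cochains R a j" for \<phi>
  proof -
    have "\<phi> = (\<Sum>l\<in>S a. (\<lambda>x. \<phi> (qv (ev l)) * cbase a l x))"
    proof
      fix x show "\<phi> x = (\<Sum>l\<in>S a. (\<lambda>x. \<phi> (qv (ev l)) * cbase a l x)) x"
      proof (cases "x \<in> carrier (free_gmodule R a)")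
        case True
        then obtain v where v: "x = qv v" "v \<in> VV (S a)" by (auto simp: free_simps)
        then show ?thesis by (simp add: sum_fun_apply cbase_qv cochain_expand[OF phi] mult.commute)
      next
        case False
        then show ?thesis using phi by (simp add: cochains_def sum_fun_apply cbase_def)
      qed
    qed
    also have "\<dots> \<in> fun_span ?T" by (rule fun_span_sum) (rule imageI)
    finally show ?thesis .
  qed
  have "cochains R a j \<subseteq> {0} \<longleftrightarrow> j \<notin> set a"
  proof
    assume sub: "cochains R a j \<subseteq> {0}"
    show "j \<notin> set a"
    proof
      assume "j \<in> set a"
      then obtain l where l: "l < length a" "a ! l = j" by (auto simp: in_set_conv_nth)
      then have "cbase a l = 0" using cbase_cochain[OF l(1)] sub by blast
      then have "cbase a l (qv (ev l)) = 0" by simp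
      then show False using cbase_qv[OF VV_ev[of l "S a"], of l] l(1) by (simp add: ev_apply)
    qed
  next
    assume j: "j \<notin> set a"
    show "cochains R a j \<subseteq> {0}"
    proof
      fix \<phi> assume phi: "\<phi> \<in> cochains R a j"
      have ev: "\<phi> (qv (ev l)) = 0" if "l < length a" for l
        using cochain_ev[OF phi that] j that by force
      have "\<phi> x = 0" for x
      proof (cases "x \<in> carrier (free_gmodule R a)")
        case True
        then obtain v where "x = qv v" "v \<in> VV (S a)" by (auto simp: free_simps)
        then show ?thesis using cochain_expand[OF phi] ev by simp
      next
        case False
        then show ?thesis using phi by (simp add: cochains_def)
      qed
      then show "\<phi> \<in> {0}" by (auto simp: fun_eq_iff)
    qed
  qed
  moreover have "cochains R a j \<subseteq> fun_span ?T" using span by (intro subsetI)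
  ultimately show ?thesis using fun_dim_eq_0_iff[of ?T "cochains R a j"] by simp
qed

text \<open>By minimality every cochain vanishes on boundaries, so all cochains are cocycles and all
  coboundaries are 0. The resolution produced is the one that \<open>SOME\<close> selects inside
  \<open>betti\<close>.\<close>

lemma betti_degrees:
  assumes "\<exists>a d \<epsilon>. minimal_resolution R M a d \<epsilon>"
  shows "\<exists>a d \<epsilon>. minimal_resolution R M a d \<epsilon> \<and> (\<forall>i j. betti R M i j \<noteq> 0 \<longleftrightarrow> j \<in> set (a i))"
proof -
  define t where "t = (SOME (a, d, \<epsilon>). minimal_resolution R M a d \<epsilon>)"
  obtain a d \<epsilon> where t: "t = (a, d, \<epsilon>)" by (cases t) auto
  have "case t of (a, d, \<epsilon>) \<Rightarrow> minimal_resolution R M a d \<epsilon>"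
    unfolding t_def
  proof (rule someI_ex[of "\<lambda>(a, d, \<epsilon>). minimal_resolution R M a d \<epsilon>"])
    from assms obtain a d \<epsilon> where "minimal_resolution R M a d \<epsilon>" by (elim exE)
    then show "\<exists>x. case x of (a, d, \<epsilon>) \<Rightarrow> minimal_resolution R M a d \<epsilon>"
      by (intro exI[of _ "(a, d, \<epsilon>)"]) simp
  qed
  then have M: "minimal_resolution R M a d \<epsilon>" by (simp add: t)
  have dz: "\<phi> (d i x) = 0" if phi: "\<phi> \<in> cochains R (a i) j" and x: "x \<in> carrier (free_gmodule R (a (Suc i)))" for \<phi> i j x
  proof -
    have "d i \<in> graded_hom R (free_gmodule R (a (Suc i))) (free_gmodule R (a i))"
      using M by (simp add: minimal_resolution_def graded_free_resolution_def Let_def)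
    then have "d i x \<in> carrier (free_gmodule R (a i))" using x by (auto simp: graded_hom_def)
    then obtain v where v: "d i x = qv v" "v \<in> VV (S (a i))" by (auto simp: free_simps)
    have "lkp (v l) 0 = 0" if "l < length (a i)" for l
    proof -
      have "d i x l \<in> irrelevant_ideal R" using M x that by (simp add: minimal_resolution_def)
      then have "v l \<in> mm" by (simp add: v(1) qv_def q_irr)
      then show ?thesis by (simp add: mm_def)
    qed
    then show ?thesis using cochain_expand[OF phi v(2)] v(1) by simp
  qed
  have "betti R M i j \<noteq> 0 \<longleftrightarrow> j \<in> set (a i)" for i j
  proof -
    have "cocycles R a d i j = cochains R (a i) j" using dz by (auto simp: cocycles_def)
    moreover have "coboundaries R a d i j \<subseteq> {0}"
    proof (cases i)
      case (Suc m)
      then show ?thesis using dz[of _ m j] by (auto simp: fun_eq_iff)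
    qed (simp add: zero_fun_def)
    then have "fun_dim (coboundaries R a d i j) = 0" by (rule fun_dim_subset_0)
    ultimately have "betti R M i j = fun_dim (cochains R (a i) j)"
      by (simp add: betti_def t_def[symmetric] t)
    then show ?thesis using fun_dim_cochains by simp
  qed
  with M show ?thesis by blast
qed

text \<open>Level 0 holds \<open>k\<close> and level \<open>Suc m\<close> holds F_m, so the
  \<open>n\<close>-th syzygy sits in level \<open>n\<close> as the image of \<open>DF n\<close> for
  every \<open>n\<close>, including 0; the difference is in the modulus
  \<open>zl mm n\<close>.\<close>

lemma syzygy_presentation:
  assumes W: "graded_module R W" and syz: "is_syzygy R (residue_module :: ('k mpoly set, 'k) gmodule) n W"
  shows "\<exists>BF gF DF om. resolves_k BF gF DF \<and>
    presents (zl mm n) (BF n) (gF n) {v \<in> VV (BF n). \<exists>u\<in>VV (BF (Suc n)). v - DF n u \<in> EV (zl mm n)} W om"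
proof -
  let ?k = "residue_module :: ('k mpoly set, 'k) gmodule"
  have res: "\<exists>DF. resolves_k (lvl {0} (\<lambda>i. S (a i))) (lvl (\<lambda>_. 0) (\<lambda>i. nth (a i))) DF \<and>
      (\<forall>i. \<forall>v\<in>VV (S (a (Suc i))). qv (DF (Suc i) v) = d i (qv v))"
    if M: "minimal_resolution R ?k a d \<epsilon>" for a d \<epsilon>
    using minimal_resolution_pres[OF presents_residue M] unfolding resolves_k_def by auto
  show ?thesis
  proof (cases n)
    case 0
    obtain a d \<epsilon> where M: "minimal_resolution R ?k a d \<epsilon>"
      using minimal_resolution_exists[OF presents_residue] by blast
    from res[OF M] obtain DF where DF: "resolves_k (lvl {0} (\<lambda>i. S (a i))) (lvl (\<lambda>_. 0) (\<lambda>i. nth (a i))) DF" by blast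
    then have "{v \<in> VV {0}. \<exists>u\<in>VV (S (a 0)). v - DF 0 u \<in> EV mm} = VV {0}" by (auto simp: resolves_k_def)
    moreover have "\<exists>om. presents mm {0} (\<lambda>_. 0) (VV {0}) W om"
      using syz 0 by (intro presents_iso[OF presents_residue W]) simp
    ultimately show ?thesis using DF 0
      by (intro exI[of _ "lvl {0} (\<lambda>i. S (a i))"] exI[of _ "lvl (\<lambda>_. 0) (\<lambda>i. nth (a i))"] exI[of _ DF])
        (simp add: zl_def)
  next
    case (Suc m)
    obtain a d \<epsilon> where M: "minimal_resolution R ?k a d \<epsilon>"
      and iso: "graded_iso R (restrict_gmodule (free_gmodule R (a m)) (d m ` carrier (free_gmodule R (a (Suc m))))) W"
      using syz Suc by auto
    from res[OF M] obtain DF where DF: "resolves_k (lvl {0} (\<lambda>i. S (a i))) (lvl (\<lambda>_. 0) (\<lambda>i. nth (a i))) DF"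
      "\<And>i v. v \<in> VV (S (a (Suc i))) \<Longrightarrow> qv (DF (Suc i) v) = d i (qv v)" by blast
    let ?Im = "d m ` carrier (free_gmodule R (a (Suc m)))"
    let ?K = "{v \<in> VV (S (a m)). \<exists>u\<in>VV (S (a (Suc m))). v - DF (Suc m) u \<in> EV J}"
    have pr: "pres mm (lvl {0} (\<lambda>i. S (a i))) (lvl (\<lambda>_. 0) (\<lambda>i. nth (a i))) DF" using DF(1) by (simp add: resolves_k_def)
    have L: "lmap w (S (a (Suc m))) (nth (a (Suc m))) (S (a m)) (nth (a m)) (DF (Suc m))"
      using presD(4)[OF pr, of "Suc m"] by simp
    have K: "v \<in> ?K \<longleftrightarrow> v \<in> VV (S (a m)) \<and> qv v \<in> ?Im" for v
      using DF(2)[of _ m] by (auto simp: free_simps qv_eq[symmetric])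
    have sub: "submod w (nth (a m)) ?K"
      unfolding submod_def
    proof (intro conjI ballI allI)
      note E = submod_J[of "nth (a m)"]
      have "0 - DF (Suc m) 0 = 0" by (simp add: lin_0[OF lmapD(1)[OF L]])
      then have "0 - DF (Suc m) 0 \<in> EV J" using submodD(1)[OF E] by (simp only:)
      then show "0 \<in> ?K" using VV_0 by blast
      fix x assume "x \<in> ?K"
      then obtain u where u: "x \<in> VV (S (a m))" "u \<in> VV (S (a (Suc m)))" "x - DF (Suc m) u \<in> EV J" by blast
      show "p \<star> x \<in> ?K" for p
      proof -
        have "p \<star> x - DF (Suc m) (p \<star> u) = p \<star> (x - DF (Suc m) u)"
          by (simp add: lin_smv[OF lmapD(1)[OF L]] smv_simps)
        then have "p \<star> x - DF (Suc m) (p \<star> u) \<in> EV J" using submodD(3)[OF E u(3)] by (simp only:)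
        then show ?thesis using VV_smv u by blast
      qed
      show "vcomp w (nth (a m)) j x \<in> ?K" for j
      proof -
        have "vcomp w (nth (a m)) j x - DF (Suc m) (vcomp w (nth (a (Suc m))) j u) =
            vcomp w (nth (a m)) j (x - DF (Suc m) u)"
          by (simp add: lmapD(3)[OF L u(2)] vcomp_simps)
        then have "vcomp w (nth (a m)) j x - DF (Suc m) (vcomp w (nth (a (Suc m))) j u) \<in> EV J"
          using submodD(4)[OF E u(3)] by (simp only:)
        then show ?thesis using VV_vcomp u by blast
      qed
      fix y assume "y \<in> ?K"
      then obtain v where v: "y \<in> VV (S (a m))" "v \<in> VV (S (a (Suc m)))" "y - DF (Suc m) v \<in> EV J" by blast
      have "x + y - DF (Suc m) (u + v) = (x - DF (Suc m) u) + (y - DF (Suc m) v)"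
        by (simp add: lin_add[OF lmapD(1)[OF L]])
      then have "x + y - DF (Suc m) (u + v) \<in> EV J" using submodD(2)[OF E u(3) v(3)] by (simp only:)
      then show "x + y \<in> ?K" using VV_add[OF u(1) v(1)] VV_add[OF u(2) v(2)] by blast
    qed
    have Im: "?Im \<subseteq> qv ` VV (S (a m))"
      using DF(2)[of _ m] lmapD(2)[OF L] by (auto simp: free_simps) (metis imageI)
    have "presents J (S (a m)) (nth (a m)) ?K (restrict_gmodule (free_gmodule R (a m)) ?Im) qv"
      unfolding presents_def
    proof (intro conjI ballI allI sub)
      show "EV J \<inter> VV (S (a m)) \<subseteq> ?K"
      proof
        fix v assume v: "v \<in> EV J \<inter> VV (S (a m))"
        have "v - DF (Suc m) 0 = v" by (simp add: lin_0[OF lmapD(1)[OF L]])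
        then have "v - DF (Suc m) 0 \<in> EV J" using v by simp
        then show "v \<in> ?K" using v VV_0 by blast
      qed
      show "carrier (restrict_gmodule (free_gmodule R (a m)) ?Im) = qv ` ?K"
      proof -
        have "?Im = qv ` ?K"
        proof (intro equalityI subsetI)
          fix x assume x: "x \<in> ?Im"
          then obtain v where "v \<in> VV (S (a m))" "x = qv v" using Im by blast
          then show "x \<in> qv ` ?K" using K[of v] x by blast
        next
          fix x assume "x \<in> qv ` ?K"
          then show "x \<in> ?Im" using K by blast
        qed
        then show ?thesis by (simp add: restrict_gmodule_def)
      qed
      show "mpart (restrict_gmodule (free_gmodule R (a m)) ?Im) j = qv ` {v \<in> ?K. vcomp w (nth (a m)) j v = v}" for j
        using K by (auto simp: restrict_gmodule_def free_simps(5))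
    qed (use J in \<open>auto simp: restrict_gmodule_def free_simps qv_eq\<close>)
    from presents_iso[OF this W iso] obtain om where "presents J (S (a m)) (nth (a m)) ?K W om" by blast
    then show ?thesis using DF(1) Suc
      by (intro exI[of _ "lvl {0} (\<lambda>i. S (a i))"] exI[of _ "lvl (\<lambda>_. 0) (\<lambda>i. nth (a i))"] exI[of _ DF] exI[of _ om])
        (simp add: zl_def)
  qed
qed

end

text \<open>Beyond the first \<open>e\<close> variables \<open>w\<close> is arbitrary, and
  \<open>w'\<close> replaces it by positive weights; homogeneity of polynomials in the first
  \<open>e\<close> variables is unaffected.\<close>

lemma qring_graded_quotient:
  fixes I :: "'k::field mpoly set" and w w' :: "nat \<Rightarrow> nat"
  assumes hq: "hquot w' J" and kr: "kr e \<subseteq> J" and I: "ideal I (mpoly_ring e)" and IJ: "I = {p. rho {..<e} p = p \<and> p \<in> J}"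
    and w': "\<And>i. i < e \<Longrightarrow> w' i = w i"
  shows "qring w' J e (graded_quotient e w I) (\<lambda>p. I +>\<^bsub>mpoly_ring e\<^esub> rho {..<e} p)"
proof -
  interpret hquot w' J by (rule hq)
  interpret I: ideal I "mpoly_ring e" by (rule I)
  let ?P = "mpoly_ring e :: 'k mpoly ring"
  let ?r = "rho {..<e} :: 'k mpoly \<Rightarrow> 'k mpoly"
  let ?R = "graded_quotient e w I"
  define q where "q p = I +>\<^bsub>?P\<^esub> ?r p" for p
  have ops: "x \<oplus>\<^bsub>?P\<^esub> y = x + y" "x \<otimes>\<^bsub>?P\<^esub> y = x * y" "\<one>\<^bsub>?P\<^esub> = 1" for x y :: "'k mpoly"
    by (simp_all add: mpoly_ring_def)
  have rr: "?r (?r p) = ?r p" for p by (simp only: rho_rho Int_absorb)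
  have rJ: "?r p \<in> J \<longleftrightarrow> p \<in> J" for p
  proof
    assume "?r p \<in> J"
    moreover have "p - ?r p \<in> J" using kr rho_diff_kr(2) by blast
    ultimately have "p - ?r p + ?r p \<in> J" by (intro hidealD(2)[OF J])
    then show "p \<in> J" by simp
  next
    assume "p \<in> J"
    moreover have "?r p - p \<in> J" using kr rho_diff_kr(1) by blast
    ultimately have "?r p - p + p \<in> J" by (intro hidealD(2)[OF J])
    then show "?r p \<in> J" by simp
  qed
  have rI: "?r p \<in> I \<longleftrightarrow> p \<in> J" for p using rJ[of p] by (simp add: IJ rr)
  have I0: "0 \<in> I" using hidealD(1)[OF J] by (simp add: IJ rho_simps)
  have Iadd: "h + h' \<in> I" if "h \<in> I" "h' \<in> I" for h h' using that hidealD(2)[OF J] by (simp add: IJ rho_simps)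
  have qset: "q p = (\<lambda>h. h + ?r p) ` I" for p
    by (auto simp: q_def a_r_coset_def r_coset_def mpoly_ring_def)
  have q_eq: "q p = q p' \<longleftrightarrow> p - p' \<in> J" for p p'
  proof
    assume "q p = q p'"
    moreover have "?r p \<in> q p" unfolding qset by (rule rev_image_eqI[OF I0]) simp
    ultimately obtain h where h: "h \<in> I" "?r p = h + ?r p'" unfolding qset by blast
    then have "?r (p - p') \<in> I" by (simp add: rho_simps)
    then show "p - p' \<in> J" by (simp add: rI)
  next
    have sub: "q p \<subseteq> q p'" if "p - p' \<in> J" for p p'
    proof
      fix x assume "x \<in> q p"
      then obtain h where h: "h \<in> I" "x = h + ?r p" unfolding qset by blast
      have "?r (p - p') \<in> I" using that by (simp add: rI)
      then have "h + ?r (p - p') \<in> I" by (rule Iadd[OF h(1)])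
      moreover have "x = h + ?r (p - p') + ?r p'" by (simp add: h(2) rho_simps)
      ultimately show "x \<in> q p'" unfolding qset by blast
    qed
    assume "p - p' \<in> J"
    moreover from this have "p' - p \<in> J" using hidealD(6)[OF J] by fastforce
    ultimately show "q p = q p'" using sub by blast
  qed
  have carr: "carrier ?P = range ?r" using rr by (auto simp: carrier_mpoly_ring) (metis rangeI)
  have q_carrier: "carrier ?R = range q"
    by (auto simp: graded_quotient_def Let_def FactRing_def A_RCOSETS_def' carr q_def image_iff rr)
  have q_add: "q p \<oplus>\<^bsub>?R\<^esub> q p' = q (p + p')" for p p'
  proof -
    have "q p \<oplus>\<^bsub>?R\<^esub> q p' = q p <+>\<^bsub>?P\<^esub> q p'" by (simp add: graded_quotient_def Let_def FactRing_def)
    also have "\<dots> = q (p + p')"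
      unfolding q_def rho_simps using I.a_rcos_sum[of "?r p" "?r p'"] by (simp add: carr ops)
    finally show ?thesis .
  qed
  have q_mult: "q p \<otimes>\<^bsub>?R\<^esub> q p' = q (p * p')" for p p'
  proof -
    have "q p \<otimes>\<^bsub>?R\<^esub> q p' = [mod I:] q p \<Otimes>\<^bsub>?P\<^esub> q p'" by (simp add: graded_quotient_def Let_def FactRing_def)
    also have "\<dots> = q (p * p')"
      unfolding q_def rho_mult using I.rcoset_mult_add[of "?r p" "?r p'"] by (simp add: carr ops)
    finally show ?thesis .
  qed
  have q_zero: "\<zero>\<^bsub>?R\<^esub> = q 0"
    unfolding qset by (simp add: graded_quotient_def Let_def FactRing_def rho_simps)
  have q_one: "\<one>\<^bsub>?R\<^esub> = q 1" by (simp add: graded_quotient_def Let_def FactRing_def q_def ops)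
  have q_part: "rpart ?R j = q ` {p. comp w' j p = p}" for j
  proof -
    have deg: "homogeneous w j p \<longleftrightarrow> comp w' j p = p" if "?r p = p" for p
    proof -
      have "monom_deg w m = monom_deg w' m" if "m \<in> mkeys p" for m
      proof -
        have "mkeys m \<subseteq> {..<e}" using \<open>?r p = p\<close> that by (simp add: rho_def pfilter_id_iff)
        then show ?thesis unfolding monom_deg_def using w' by (intro sum.cong) auto
      qed
      then show ?thesis by (auto simp: comp_id_iff homogeneous_def)
    qed
    have "rpart ?R j = {I +>\<^bsub>?P\<^esub> p | p. p \<in> carrier ?P \<and> homogeneous w j p}"
      by (simp add: graded_quotient_def Let_def)
    also have "\<dots> = q ` {p. comp w' j p = p}"
    proof (intro equalityI subsetI)
      fix x assume "x \<in> {I +>\<^bsub>?P\<^esub> p | p. p \<in> carrier ?P \<and> homogeneous w j p}"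
      then obtain p where "x = I +>\<^bsub>?P\<^esub> p" "?r p = p" "homogeneous w j p" by (auto simp: carrier_mpoly_ring)
      then show "x \<in> q ` {p. comp w' j p = p}" using deg[of p] by (intro image_eqI[of _ _ p]) (simp_all add: q_def)
    next
      fix x assume "x \<in> q ` {p. comp w' j p = p}"
      then obtain p where p: "x = q p" "comp w' j p = p" by blast
      then have "homogeneous w j (?r p)" using deg[OF rr[of p]] by (simp flip: rho_comp)
      then show "x \<in> {I +>\<^bsub>?P\<^esub> p | p. p \<in> carrier ?P \<and> homogeneous w j p}"
        using p(1) rr[of p] by (auto simp: q_def carrier_mpoly_ring)
    qed
    finally show ?thesis .
  qed
  have ring: "ring ?R"
  proof (rule ringI)
    show "abelian_group ?R"
    proof (rule abelian_groupI)
      fix x assume "x \<in> carrier ?R"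
      then obtain p where "x = q p" by (auto simp: q_carrier)
      then show "\<exists>y\<in>carrier ?R. y \<oplus>\<^bsub>?R\<^esub> x = \<zero>\<^bsub>?R\<^esub>"
        by (intro bexI[of _ "q (- p)"]) (auto simp: q_carrier q_add q_zero)
    qed (auto simp: q_carrier q_add q_zero algebra_simps)
    show "Group.monoid ?R"
      by (rule monoidI) (auto simp: q_carrier q_mult q_one algebra_simps)
  qed (auto simp: q_carrier q_add q_mult algebra_simps)
  interpret R: ring ?R by (rule ring)
  have qmm: "q p \<in> q ` mm \<longleftrightarrow> p \<in> mm" for p
  proof
    assume "q p \<in> q ` mm"
    then obtain p' where p': "p' \<in> mm" "p - p' \<in> J" by (auto simp: q_eq)
    then have "(p - p') + p' \<in> mm" using Jmm by (intro hidealD(2)[OF hideal_mm]) auto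
    then show "p \<in> mm" by simp
  qed simp
  have parts: "rpart ?R j \<subseteq> q ` mm" if "j \<in> {0<..}" for j
  proof -
    have "p \<in> mm" if "comp w' j p = p" for p :: "'k mpoly"
      using lookup_comp_0[of w' j p] that \<open>j \<in> {0<..}\<close> by (simp add: mm_def)
    then show ?thesis unfolding q_part by blast
  qed
  have "irrelevant_ideal ?R = q ` mm"
  proof
    have "ideal (q ` mm) ?R"
    proof (rule idealI[OF ring])
      show "subgroup (q ` mm) (add_monoid ?R)"
      proof (rule group.subgroupI[OF R.a_group])
        show "q ` mm \<subseteq> carrier (add_monoid ?R)" by (auto simp: q_carrier)
        show "q ` mm \<noteq> {}" using hidealD(1)[OF hideal_mm] by blast
        fix x assume "x \<in> q ` mm"
        then obtain p where p: "x = q p" "p \<in> mm" by blast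
        have "\<ominus>\<^bsub>?R\<^esub> x = q (- p)" using p(1) by (intro R.minus_equality) (auto simp: q_carrier q_add q_zero)
        moreover have "- p \<in> mm" by (rule hidealD(6)[OF hideal_mm p(2)])
        ultimately show "inv\<^bsub>add_monoid ?R\<^esub> x \<in> q ` mm" by (simp add: a_inv_def)
      next
        fix x y assume "x \<in> q ` mm" "y \<in> q ` mm"
        then obtain p p' where "x = q p" "p \<in> mm" "y = q p'" "p' \<in> mm" by blast
        then show "x \<otimes>\<^bsub>add_monoid ?R\<^esub> y \<in> q ` mm" using hidealD(2)[OF hideal_mm, of p p'] by (simp add: q_add)
      qed
      fix x y assume "x \<in> q ` mm" "y \<in> carrier ?R"
      then obtain p p' where "x = q p" "p \<in> mm" "y = q p'" by (auto simp: q_carrier)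
      then show "y \<otimes>\<^bsub>?R\<^esub> x \<in> q ` mm" "x \<otimes>\<^bsub>?R\<^esub> y \<in> q ` mm"
        using hidealD(3,4)[OF hideal_mm, of p p'] by (simp_all add: q_mult)
    qed
    then show "irrelevant_ideal ?R \<subseteq> q ` mm"
      unfolding irrelevant_ideal_def using parts by (intro R.genideal_minimal) auto
    have pc: "(\<Union>j\<in>{0<..}. rpart ?R j) \<subseteq> carrier ?R" by (auto simp: q_part q_carrier)
    interpret M: ideal "irrelevant_ideal ?R" ?R
      unfolding irrelevant_ideal_def by (rule R.genideal_ideal[OF pc])
    show "q ` mm \<subseteq> irrelevant_ideal ?R"
    proof
      fix x assume "x \<in> q ` mm"
      then obtain p where p: "x = q p" "p \<in> mm" by blast
      let ?A = "monom_deg w' ` mkeys p"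
      \<comment> \<open>Components of negative degree vanish, and so does the one of degree 0: as
        the weights are positive, it is the constant term of \<open>p\<close>, which is 0.\<close>
      have cmp: "q (comp w' j p) \<in> irrelevant_ideal ?R" for j
      proof (cases "j > 0")
        case True
        have "q (comp w' j p) \<in> rpart ?R j" unfolding q_part by (rule imageI) (simp add: comp_comp)
        then show ?thesis using R.genideal_self[OF pc] True by (auto simp: irrelevant_ideal_def)
      next
        case False
        have "comp w' j p = 0"
        proof (cases "j = 0")
          case True
          then show ?thesis using p(2) comp_0[of w' p] w by (simp add: mm_def)
        next
          case False
          have "monom_deg w' m \<ge> 0" for m by (auto simp: monom_deg_def intro: sum_nonneg)
          then show ?thesis using False \<open>\<not> j > 0\<close> by (auto simp: comp_def pfilter_eq_0_iff)
        qed
        then show ?thesis using M.zero_closed by (simp add: q_zero)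
      qed
      have "q (\<Sum>j\<in>A. comp w' j p) \<in> irrelevant_ideal ?R" if "finite A" for A
        using that
      proof (induction A)
        case (insert j A)
        then show ?case using M.a_closed[OF cmp[of j], of "q (\<Sum>j\<in>A. comp w' j p)"] by (simp add: q_add)
      qed (use M.zero_closed in \<open>simp add: q_zero\<close>)
      from this[of ?A] show "x \<in> irrelevant_ideal ?R" by (simp add: p(1) sum_comp)
    qed
  qed
  then have q_irr: "q p \<in> irrelevant_ideal ?R \<longleftrightarrow> p \<in> mm" for p using qmm by simp
  have q_aug: "augmentation (q p) = lkp p 0" for p
  proof -
    have "lkp x 0 = lkp p 0" if "x \<in> q p" for x
      using that Jmm by (auto simp: qset IJ lookup_add mm_def)
    moreover have "?r p \<in> q p" unfolding qset by (rule rev_image_eqI[OF I0]) simp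
    ultimately show ?thesis unfolding augmentation_def by (intro the_equality) auto
  qed
  have "qring w' J e ?R q"
    by unfold_locales (use kr q_carrier q_add q_mult q_zero q_eq q_part q_irr q_aug in auto)
  then show ?thesis by (simp add: q_def[abs_def])
qed

lemma tate_of_regular_sequence:
  fixes fs :: "'k::field mpoly list" and w w' :: "nat \<Rightarrow> nat"
  assumes w': "\<And>i. w' i \<ge> 1" "\<And>i. i < e \<Longrightarrow> w' i = w i"
    and hom: "\<forall>f\<in>set fs. \<exists>j. homogeneous w j f" and reg: "regular_sequence (mpoly_ring e) fs"
  shows "\<exists>a dg. tate e (length fs) w' (nth fs) a dg"
proof -
  let ?P = "mpoly_ring e :: 'k mpoly ring"
  let ?r = "rho {..<e} :: 'k mpoly \<Rightarrow> 'k mpoly"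
  have rr: "?r (?r p) = ?r p" for p by (simp only: rho_rho Int_absorb)
  have sub: "set fs \<subseteq> carrier ?P" and ne: "Idl\<^bsub>?P\<^esub> (set fs) \<noteq> carrier ?P"
    and nz: "\<And>i g. i < length fs \<Longrightarrow> g \<in> carrier ?P \<Longrightarrow> fs ! i \<otimes>\<^bsub>?P\<^esub> g \<in> Idl\<^bsub>?P\<^esub> (set (take i fs)) \<Longrightarrow>
       g \<in> Idl\<^bsub>?P\<^esub> (set (take i fs))"
    using reg by (auto simp: regular_sequence_def)
  have fr: "?r (fs ! j) = fs ! j" if "j < length fs" for j
    using subsetD[OF sub nth_mem[OF that]] by (simp add: carrier_mpoly_ring)
  have "\<exists>d. comp w' d (fs ! j) = fs ! j" if j: "j < length fs" for j
  proof -
    obtain d where d: "homogeneous w d (fs ! j)" using bspec[OF hom nth_mem[OF j]] by blast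
    have "monom_deg w m = monom_deg w' m" if "m \<in> mkeys (fs ! j)" for m
    proof -
      have "mkeys m \<subseteq> {..<e}" using fr[OF j] that by (simp add: rho_def pfilter_id_iff)
      then show ?thesis unfolding monom_deg_def using w' by (intro sum.cong) auto
    qed
    then have "homogeneous w' d (fs ! j)" using d by (simp add: homogeneous_def)
    then show ?thesis by (auto simp: comp_id_iff)
  qed
  then obtain dg where dg: "\<And>j. j < length fs \<Longrightarrow> comp w' (dg j) (fs ! j) = fs ! j" by metis
  \<comment> \<open>A homogeneous equation with nonzero constant term would be a unit, contrary to
    the properness required in \<open>regular_sequence\<close>.\<close>
  have mm: "lkp (fs ! j) 0 = 0" if j: "j < length fs" for j
  proof (rule ccontr)
    assume k: "lkp (fs ! j) 0 \<noteq> 0"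
    then have "dg j = 0" using lookup_comp_0[of w' "dg j" "fs ! j"] dg[OF j] by (simp split: if_splits)
    then have f: "fs ! j = sing 0 (lkp (fs ! j) 0)" using dg[OF j] comp_0[of w' "fs ! j"] w'(1) by simp
    have "p \<in> Idl\<^bsub>?P\<^esub> (set fs)" if p: "p \<in> carrier ?P" for p
    proof -
      have "fs ! j * sing 0 (1 / lkp (fs ! j) 0) = 1" by (subst f) (use k in \<open>simp add: mult_single\<close>)
      then have "p = fs ! j * (sing 0 (1 / lkp (fs ! j) 0) * p)" by (simp flip: mult.assoc)
      also have "\<dots> = (\<Sum>i<length fs. if i = j then fs ! j * (sing 0 (1 / lkp (fs ! j) 0) * p) else 0)" using j by simp
      also have "\<dots> = (\<Sum>i<length fs. fs ! i * (if i = j then sing 0 (1 / lkp (fs ! j) 0) * p else 0))"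
        by (rule sum.cong) auto
      finally have "\<exists>t. p = (\<Sum>i<length fs. fs ! i * t i)"
        by (rule exI[of _ "\<lambda>i. if i = j then sing 0 (1 / lkp (fs ! j) 0) * p else 0"])
      then show ?thesis using genideal_mpoly_ring[OF sub order_refl] p by (simp add: carrier_mpoly_ring)
    qed
    moreover have "Idl\<^bsub>?P\<^esub> (set fs) \<subseteq> carrier ?P"
      using genideal_mpoly_ring[OF sub order_refl] by (auto simp: carrier_mpoly_ring)
    ultimately show False using ne by blast
  qed
  \<comment> \<open>An expansion along the variables becomes homogeneous when each coefficient is
    replaced by its component of the right degree.\<close>
  have "\<exists>a. fs ! j = (\<Sum>i<e. xv i * a i) \<and> (\<forall>i<e. comp w' (dg j - int (w' i)) (a i) = a i)" if j: "j < length fs" for j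
  proof -
    obtain p' where p': "?r (fs ! j) = rho {e..<e} (fs ! j) + (\<Sum>i<e. xv i * p' i)"
      using rho_decompose[OF order_refl] by blast
    then have "fs ! j = (\<Sum>i<e. xv i * p' i)" using fr[OF j] mm[OF j] by (simp add: rho_empty)
    then have "comp w' (dg j) (fs ! j) = (\<Sum>i<e. comp w' (dg j) (xv i * p' i))" by (simp add: comp_simps)
    also have "\<dots> = (\<Sum>i<e. xv i * comp w' (dg j - int (w' i)) (p' i))"
      by (simp only: mult.commute[of "xv _"] comp_mult'[OF comp_xv])
    finally show ?thesis using dg[OF j]
      by (intro exI[of _ "\<lambda>i. comp w' (dg j - int (w' i)) (p' i)"]) (simp add: comp_comp)
  qed
  then obtain a where a: "\<And>j. j < length fs \<Longrightarrow> fs ! j = (\<Sum>i<e. xv i * a j i)"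
    "\<And>j i. j < length fs \<Longrightarrow> i < e \<Longrightarrow> comp w' (dg j - int (w' i)) (a j i) = a j i" by metis
  have "tate e (length fs) w' (nth fs) a dg"
  proof (unfold_locales, fact w'(1), fact fr, fact a(1), fact a(2))
    fix s p t assume s: "s < length fs" and eq: "?r (fs ! s * p) = (\<Sum>j<s. fs ! j * t j)"
    note G = genideal_mpoly_ring[OF sub less_imp_le[OF s]]
    have "fs ! s * ?r p = (\<Sum>j<s. fs ! j * t j)" using eq fr[OF s] by (simp add: rho_mult)
    moreover have "?r (fs ! s * ?r p) = fs ! s * ?r p" using fr[OF s] by (simp add: rho_mult rr)
    ultimately have "fs ! s \<otimes>\<^bsub>?P\<^esub> ?r p \<in> Idl\<^bsub>?P\<^esub> (set (take s fs))"
      unfolding G by (auto simp: mpoly_ring_def)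
    then have "?r p \<in> Idl\<^bsub>?P\<^esub> (set (take s fs))" using nz[OF s, of "?r p"] by (simp add: carrier_mpoly_ring rr)
    then show "\<exists>t. ?r p = (\<Sum>j<s. fs ! j * t j)" unfolding G by blast
  qed
  then show ?thesis by blast
qed

text \<open>Internal minus homological degree takes the values \<open>j + m * (d - 2)\<close>, which
  are unbounded in \<open>m\<close>.\<close>

lemma regularity_infinite:
  assumes "\<And>m :: nat. betti R M (2 * m) (j + int m * d) \<noteq> 0" and d: "d > 2"
  shows "regularity R M = \<infinity>"
proof (rule ereal_top)
  fix B :: real
  obtain m :: nat where m: "B - real_of_int j \<le> real m" using real_arch_simple by blast
  have "int m * 1 \<le> int m * (d - 2)" using d by (intro mult_left_mono) auto
  then have "real m \<le> real_of_int (int m * (d - 2))" by (metis mult.right_neutral of_int_le_iff of_int_of_nat_eq)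
  then have "B \<le> real_of_int (j + int m * d - int (2 * m))" using m by (simp add: algebra_simps)
  also have "ereal (real_of_int (j + int m * d - int (2 * m))) \<le> regularity R M"
    unfolding regularity_def by (rule Sup_upper) (use assms(1) in blast)
  finally show "ereal B \<le> regularity R M" by simp
qed

theorem corollary2p3:
  fixes e n :: nat
    and w :: "nat \<Rightarrow> nat"
    and I :: "'k::field mpoly set"
    and W :: "('k mpoly set, 'm) gmodule"
    and N :: "'m set"
  assumes weights: "\<And>i. i < e \<Longrightarrow> 1 \<le> w i"
    and homogeneous: "homogeneous_ideal e w I"
    and proper: "I \<noteq> carrier (mpoly_ring e)"
    and ci: "complete_intersection e w I"
    and reg_k: "regularity (graded_quotient e w I) (residue_module :: ('k mpoly set, 'k) gmodule) = \<infinity>"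
    and syzygy: "is_syzygy (graded_quotient e w I) (residue_module :: ('k mpoly set, 'k) gmodule) n W"
    and summand: "graded_direct_summand (graded_quotient e w I) W N"
    and nonzero: "N \<noteq> {\<zero>\<^bsub>W\<^esub>}"
  shows "regularity (graded_quotient e w I) (restrict_gmodule W N) = \<infinity>"
proof -
  \<comment> \<open>Outside the variables of the ring the weights are arbitrary; the value 1 makes
    them positive everywhere.\<close>
  define w' where "w' i = (if i < e then w i else 1)" for i
  have w': "w' i \<ge> 1" "i < e \<Longrightarrow> w' i = w i" for i using weights by (auto simp: w'_def)
  let ?P = "mpoly_ring e :: 'k mpoly ring"
  obtain fs where fs: "\<forall>f\<in>set fs. \<exists>j. homogeneous w j f" "regular_sequence ?P fs" "I = Idl\<^bsub>?P\<^esub> (set fs)"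
    using ci by (auto simp: complete_intersection_def)
  obtain a dg where tate: "tate e (length fs) w' (nth fs) a dg"
    using tate_of_regular_sequence[OF w' fs(1,2)] by blast
  interpret T: tate e "length fs" w' "nth fs" a dg by (rule tate)
  define J where "J = T.JJ (length fs)"
  have hq: "hquot w' J" unfolding J_def by (rule T.hquot_axioms)
  have IJ: "I = {p. rho {..<e} p = p \<and> p \<in> J}"
    using genideal_mpoly_ring[of fs e "length fs"] fs(2,3) by (auto simp: J_def T.JJ_def regular_sequence_def)
  have ideal: "ideal I ?P" using homogeneous by (simp add: homogeneous_ideal_def)
  define R where "R = graded_quotient e w I"
  define q where "q = (\<lambda>p. I +>\<^bsub>?P\<^esub> rho {..<e} p)"
  have "qring w' J e R q"
    unfolding R_def q_def
    by (rule qring_graded_quotient[OF hq _ ideal IJ w'(2)]) (use T.kr_JJ in \<open>auto simp: J_def\<close>)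
  then interpret Q: qring w' J e R q .
  let ?k = "residue_module :: ('k mpoly set, 'k) gmodule"
  let ?N = "restrict_gmodule W N"
  have W: "graded_module R W" using syzygy by (cases n) (auto simp: R_def)
  obtain BF gF DF om where F: "Q.resolves_k BF gF DF" and
    PW: "Q.presents (Q.zl mm n) (BF n) (gF n) {v \<in> VV (BF n). \<exists>u\<in>VV (BF (Suc n)). v - DF n u \<in> EV (Q.zl mm n)} W om"
    using Q.syzygy_presentation[OF W syzygy[folded R_def]] by blast
  define Z where "Z = Q.zl mm n"
  define KW where "KW = {v \<in> VV (BF n). \<exists>u\<in>VV (BF (Suc n)). v - DF n u \<in> EV Z}"
  note PW = PW[folded Z_def, folded KW_def]
  obtain N' where N: "graded_submodule R W N" and N': "graded_submodule R W N'" and int: "N \<inter> N' = {\<zero>\<^bsub>W\<^esub>}"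
    and sum: "N <+>\<^bsub>W\<^esub> N' = carrier W"
    using summand by (auto simp: graded_direct_summand_def R_def)
  \<comment> \<open>Preimages of the two summands in level \<open>n\<close>; through them the
    decomposition of \<open>W\<close> becomes the hypotheses of
    \<open>resolves_summand\<close>.\<close>
  define K where "K = {v \<in> KW. om v \<in> N}"
  define K' where "K' = {v \<in> KW. om v \<in> N'}"
  have PN: "Q.presents Z (BF n) (gF n) K ?N om" unfolding K_def by (rule Q.presents_summand[OF PW W N])
  have PN': "Q.presents Z (BF n) (gF n) K' (restrict_gmodule W N') om" unfolding K'_def by (rule Q.presents_summand[OF PW W N'])
  note pW = Q.presentsD[OF PW] and pN = Q.presentsD[OF PN] and pN' = Q.presentsD[OF PN']
  obtain b d \<epsilon> where M: "minimal_resolution R ?N b d \<epsilon>" and deg: "\<And>i j. betti R ?N i j \<noteq> 0 \<longleftrightarrow> j \<in> set (b i)"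
    using Q.betti_degrees[OF Q.minimal_resolution_exists[OF PN]] by blast
  let ?B = "Q.lvl (BF n) (\<lambda>i. {..<length (b i)})" and ?g = "Q.lvl (gF n) (\<lambda>i. nth (b i))"
  obtain DG where G: "Q.pres Z ?B ?g DG" "Q.minim ?B DG" "\<And>v. v \<in> VV {..<length (b 0)} \<Longrightarrow> DG 0 v \<in> K"
    "\<And>v. v \<in> K \<Longrightarrow> \<exists>u\<in>VV {..<length (b 0)}. v - DG 0 u \<in> EV Z"
    using Q.minimal_resolution_pres[OF PN M] by blast
  have EZ: "submod w' (gF n) (EV Z)" by (rule submod_EV[OF pN(4)])
  have carrN: "N = om ` K" "N' = om ` K'" using pN(7) pN'(7) by (simp_all add: restrict_gmodule_def)
  have Fp: "Q.pres mm BF gF DF" using F by (simp add: Q.resolves_k_def)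
  have rs: "Q.resolves_summand Z (BF n) (gF n) (BF (Suc n)) (DF n) K K' ?B ?g DG"
    unfolding Q.resolves_summand_def
  proof (intro conjI ballI)
    fix u :: "nat \<Rightarrow> 'k mpoly" assume u: "u \<in> VV (BF (Suc n))"
    have "DF n u - DF n u \<in> EV Z" using submodD(1)[OF EZ] by (simp only: diff_self)
    then have DW: "DF n u \<in> KW" unfolding KW_def using Q.presD(6)[OF Fp u] u by blast
    then have "om (DF n u) \<in> N <+>\<^bsub>W\<^esub> N'" using pW(7) sum by blast
    then obtain y y' where y: "y \<in> K" "y' \<in> K'" "om (DF n u) = om y \<oplus>\<^bsub>W\<^esub> om y'"
      unfolding carrN set_add_def set_mult_def by auto
    have yW: "y \<in> KW" "y' \<in> KW" using y(1,2) by (auto simp: K_def K'_def)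
    have "om (DF n u) = om (y + y')" using y(3) pW(8)[OF yW] by simp
    then have e: "DF n u - (y + y') \<in> EV Z"
      using Q.presents_eq[OF PW DW submodD(2)[OF pW(1) yW]] by simp
    have "DF n u - (y + y') \<in> VV (BF n)" using submodD(6)[OF pW(1) DW submodD(2)[OF pW(1) yW]] pW(2) by blast
    then have "DF n u - (y + y') \<in> K'" using e pN'(6) by blast
    from submodD(2)[OF pN'(1) this y(2)] have "DF n u - y \<in> K'" by simp
    then show "\<exists>y\<in>K. DF n u - y \<in> K'" using y(1) by blast
  next
    fix y :: "nat \<Rightarrow> 'k mpoly" assume y: "y \<in> K \<inter> K'"
    then have "om y = \<zero>\<^bsub>W\<^esub>" using int by (auto simp: K_def K'_def)
    then show "y \<in> EV Z" using y pW(10)[of y] by (auto simp: K_def)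
  qed (use G pN(1) pN'(1,6) in \<open>auto simp: K_def KW_def\<close>)
  have "(\<exists>dd>2. \<forall>i l. l \<in> ?B (Suc i) \<longrightarrow> (\<exists>l'\<in>?B (Suc (Suc (Suc i))). ?g (Suc (Suc (Suc i))) l' = ?g (Suc i) l + dd)) \<or>
    (\<exists>C. \<forall>(BF :: nat \<Rightarrow> nat set) gF DF i l. Q.resolves_k BF gF DF \<longrightarrow> l \<in> BF (Suc i) \<longrightarrow> gF (Suc i) l - int i \<le> C)"
    using T.betti_alternative[folded J_def]
  proof (elim disjE)
    assume "\<exists>d>2. \<forall>n BF gF DF K K' BG gG DG i b. Q.resolves_k BF gF DF \<longrightarrow>
      Q.resolves_summand (Q.zl mm n) (BF n) (gF n) (BF (Suc n)) (DF n) K K' BG gG DG \<longrightarrow> b \<in> BG (Suc i) \<longrightarrow>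
      (\<exists>b'\<in>BG (Suc (Suc (Suc i))). gG (Suc (Suc (Suc i))) b' = gG (Suc i) b + d)"
    then obtain dd where "dd > 2" and h: "\<And>n BF gF DF K K' BG gG DG i b. Q.resolves_k BF gF DF \<Longrightarrow>
      Q.resolves_summand (Q.zl mm n) (BF n) (gF n) (BF (Suc n)) (DF n) K K' BG gG DG \<Longrightarrow> b \<in> BG (Suc i) \<Longrightarrow>
      \<exists>b'\<in>BG (Suc (Suc (Suc i))). gG (Suc (Suc (Suc i))) b' = gG (Suc i) b + dd" by blast
    then show ?thesis using h[OF F rs[unfolded Z_def]] by blast
  qed blast
  then consider (shift) dd where "dd > 2" "\<And>i l. l \<in> ?B (Suc i) \<Longrightarrow> \<exists>l'\<in>?B (Suc (Suc (Suc i))). ?g (Suc (Suc (Suc i))) l' = ?g (Suc i) l + dd"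
    | (bounded) C where "\<And>(BF :: nat \<Rightarrow> nat set) gF DF i l. Q.resolves_k BF gF DF \<Longrightarrow> l \<in> BF (Suc i) \<Longrightarrow> gF (Suc i) l - int i \<le> C"
    by blast
  then show ?thesis
  proof cases
    case shift
    \<comment> \<open>A nonzero summand has a generator, from which the repeated shift by 2 in
      homological degree starts.\<close>
    have "b 0 \<noteq> []"
    proof
      assume b0: "b 0 = []"
      have "om v = \<zero>\<^bsub>W\<^esub>" if v: "v \<in> K" for v
      proof -
        obtain u where u: "u \<in> VV {..<length (b 0)}" "v - DG 0 u \<in> EV Z" using G(4)[OF v] by blast
        have "u = 0" using u(1) b0 by (auto simp: VV_def fun_eq_iff)
        then have "DG 0 u = 0" using lin_0[OF Q.presD(5)[OF G(1), of 0]] by (simp only:)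
        then have "v \<in> EV Z" using u(2) by simp
        then show ?thesis using pW(10)[of v] v by (simp add: K_def)
      qed
      then have "N \<subseteq> {\<zero>\<^bsub>W\<^esub>}" unfolding carrN by blast
      moreover have "\<zero>\<^bsub>W\<^esub> \<in> N" using int by blast
      ultimately show False using nonzero by blast
    qed
    then obtain j where j: "j \<in> set (b 0)" by (cases "b 0") auto
    have "j + int m * dd \<in> set (b (2 * m))" for m :: nat
    proof (induction m)
      case (Suc m)
      then obtain l where l: "l < length (b (2 * m))" "b (2 * m) ! l = j + int m * dd" by (auto simp: in_set_conv_nth)
      \<comment> \<open>Level \<open>Suc i\<close> is F_i, so the shift from level
        \<open>Suc (2 * m)\<close> leads from \<open>b (2 * m)\<close> to
        \<open>b (2 * m + 2)\<close>.\<close>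
      then obtain l' where "l' < length (b (Suc (Suc (2 * m))))" "b (Suc (Suc (2 * m))) ! l' = b (2 * m) ! l + dd"
        using shift(2)[of l "2 * m"] by auto
      then have "b (2 * m) ! l + dd \<in> set (b (2 * Suc m))" by (auto simp: in_set_conv_nth)
      then show ?case using l(2) by (simp add: algebra_simps)
    qed (use j in simp)
    then show ?thesis unfolding R_def[symmetric] using shift(1) deg by (intro regularity_infinite[of _ _ j dd]) auto
  next
    \<comment> \<open>One constant then bounds internal minus homological degree for all generators
      in a minimal resolution of \<open>k\<close>, against \<open>reg_k\<close>.\<close>
    case bounded
    obtain b d \<epsilon> where M: "minimal_resolution R ?k b d \<epsilon>" and deg: "\<And>i j. betti R ?k i j \<noteq> 0 \<longleftrightarrow> j \<in> set (b i)"
      using Q.betti_degrees[OF Q.minimal_resolution_exists[OF Q.presents_residue]] by blast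
    obtain DG where G: "Q.resolves_k (Q.lvl {0} (\<lambda>i. {..<length (b i)})) (Q.lvl (\<lambda>_. 0) (\<lambda>i. nth (b i))) DG"
      using Q.minimal_resolution_pres[OF Q.presents_residue M] unfolding Q.resolves_k_def by auto
    have "real_of_int (j - int i) \<le> real_of_int C" if nz: "betti R ?k i j \<noteq> 0" for i j
    proof -
      obtain l where "l < length (b i)" "b i ! l = j" using iffD1[OF deg nz] unfolding in_set_conv_nth by blast
      then have "j - int i \<le> C" using bounded[OF G, of l i] by simp
      then show ?thesis by simp
    qed
    then have "regularity R ?k \<le> ereal (real_of_int C)" unfolding regularity_def by (intro Sup_least) auto
    then show ?thesis using reg_k by (simp add: R_def)
  qed
qed

end
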